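(* Let $\mathbb{F}_q$ be a finite field with $q$ elements and let $X$ be a smooth projective (geometrically irreducible) curve defined over $\mathbb{F}_q$. Let $G_1, G_2 \subset \mathrm{Aut}_{\mathbb{F}_q}(X)$ be different finite subgroups with $|G_1|=|G_2|$, and let $Q, Q' \in X(\overline{\mathbb{F}}_q)$. Assume that the following four conditions are satisfied: (a) $X/G_i \cong \mathbb{P}^1$ for $i=1,2$; (b) $G_1 \cap G_2 = \{1\}$; (c) $\sum_{\sigma \in G_1} \sigma(Q) = \sum_{\tau \in G_2} \tau(Q)$ as divisors over $\overline{\mathbb{F}}_q$, and this divisor, denoted by $D$, is defined over $\mathbb{F}_q$; (d) $Q' \in X(\mathbb{F}_q)$, $Q' \notin \mathrm{supp}(D)$, and the cardinality $\#S$ of the orbit $S := \langle G_1, G_2 \rangle \cdot Q'$ is at least $|G_1|+1$. Then the following hold. (1) The evaluation map $$\Phi: \mathcal{L}(D) \rightarrow \bigoplus_{R \in S} \mathbb{F}_q \cdot R, \qquad f \mapsto (f(R))_{R \in S}$$ is injective, and the minimum distance of the code $\Phi(\mathcal{L}(D))$ is at least $\#S - |G_1|$. (2) There exists an injective group homomorphism $$\langle G_1, G_2 \rangle \hookrightarrow \mathrm{Aut}(\Phi(\mathcal{L}(D))).$$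
   Context: $\overline{\mathbb{F}}_q$ is an algebraic closure of $\mathbb{F}_q$, $X(\mathbb{F}_q)$ is the set of $\mathbb{F}_q$-rational points of $X$, and $\mathrm{Aut}_{\mathbb{F}_q}(X)$ is the group of automorphisms of $X$ defined over $\mathbb{F}_q$. $\langle G_1, G_2\rangle$ is the subgroup of $\mathrm{Aut}_{\mathbb{F}_q}(X)$ generated by $G_1$ and $G_2$. $X/G_i$ is the quotient curve of $X$ by $G_i$. For a divisor $D$ on $X$ defined over $\mathbb{F}_q$, $\mathcal{L}(D) = \{ f \in \mathbb{F}_q(X)\setminus\{0\} : (f) + D \ge 0\} \cup \{0\}$ is the associated Riemann–Roch space over $\mathbb{F}_q$, where $\mathbb{F}_q(X)$ is the function field of $X$ over $\mathbb{F}_q$. $\bigoplus_{R \in S} \mathbb{F}_q \cdot R$ is the $\mathbb{F}_q$-vector space of dimension $\#S$ with coordinates indexed by the points of $S$. A code is a linear subspace $C$ of this space; its minimum distance is the minimum number of nonzero coordinates of a nonzero element of $C$. $\mathrm{Aut}(C)$ is the (permutation) automorphism group of $C$: the group of permutations of the coordinate index set $S$ whose induced action on $\bigoplus_{R \in S} \mathbb{F}_q \cdot R$ maps $C$ to itself. *)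

theory Defs
  imports
    "HOL-Analysis.Cartesian_Space"
    "HOL-Library.Numeral_Type"
    "HOL-Library.Poly_Mapping"
    "HOL-Algebra.Bij"
    "HOL-Algebra.Generated_Groups"
    "HOL-Algebra.Generated_Fields"
    "HOL-Algebra.Finite_Extensions"
    "HOL-Algebra.Algebraic_Closure_Type"
begin

no_notation fps_nth (infixl \<open>$\<close> 75)

text \<open>
  Varieties are taken in the classical sense: subsets of projective space over an algebraically
  closed field \<open>K\<close> (the type \<open>'a\<close>), together with a subfield \<open>k\<close> of \<open>K\<close> (a set) over which
  things may be defined.  In the application \<open>K\<close> is the type \<open>'k alg_closure\<close> for a finite field
  \<open>'k\<close>, and \<open>k\<close> is the following copy of \<open>'k\<close> inside it.
\<close>

abbreviation Fq :: "'k::field alg_closure set" where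
  "Fq \<equiv> range to_ac"


section \<open>Projective space and forms\<close>

text \<open>The index type \<open>'n\<close> of the homogeneous coordinates has \<open>n + 1\<close> elements for
  \<open>n\<close>-dimensional projective space; in particular \<open>('a, 2) proj\<close> is the projective line.\<close>

quotient_type (overloaded) ('a, 'n) proj = "('a::field)^('n::finite)" /
  partial: "\<lambda>v w. v \<noteq> 0 \<and> (\<exists>c. c \<noteq> 0 \<and> w = c *s v)"
proof (rule part_equivpI)
  show "\<exists>v::'a^'n. v \<noteq> 0 \<and> (\<exists>c. c \<noteq> 0 \<and> v = c *s v)"
    by (rule exI[of _ "vec 1"]) (auto simp: vec_eq_iff intro!: exI[of _ 1])
  show "symp (\<lambda>v w::'a^'n. v \<noteq> 0 \<and> (\<exists>c. c \<noteq> 0 \<and> w = c *s v))"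
  proof (rule sympI, elim conjE exE, intro conjI)
    fix v w :: "'a^'n" and c
    assume *: "v \<noteq> 0" "c \<noteq> 0" "w = c *s v"
    then show "w \<noteq> 0" by simp
    from * show "\<exists>c. c \<noteq> 0 \<and> v = c *s w"
      by (intro exI[of _ "inverse c"]) (simp add: vector_smult_assoc)
  qed
  show "transp (\<lambda>v w::'a^'n. v \<noteq> 0 \<and> (\<exists>c. c \<noteq> 0 \<and> w = c *s v))"
  proof (rule transpI, elim conjE exE, intro conjI)
    fix u v w :: "'a^'n" and c d
    assume *: "u \<noteq> 0" "c \<noteq> 0" "v = c *s u" "d \<noteq> 0" "w = d *s v"
    then show "u \<noteq> 0" by simp
    from * show "\<exists>c. c \<noteq> 0 \<and> w = c *s u"
      by (intro exI[of _ "d * c"]) (simp add: vector_smult_assoc)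
  qed
qed

type_synonym ('a, 'n) mpoly = "('n \<Rightarrow>\<^sub>0 nat) \<Rightarrow>\<^sub>0 'a"

definition mpoly_eval :: "('a::field, 'n::finite) mpoly \<Rightarrow> 'a^'n \<Rightarrow> 'a" where
  "mpoly_eval F v =
     (\<Sum>m\<in>Poly_Mapping.keys F. Poly_Mapping.lookup F m * (\<Prod>i\<in>UNIV. (v $ i) ^ Poly_Mapping.lookup m i))"

definition mpoly_pderiv :: "'n::finite \<Rightarrow> ('a::field, 'n) mpoly \<Rightarrow> ('a, 'n) mpoly" where
  "mpoly_pderiv i F =
     (\<Sum>m\<in>Poly_Mapping.keys F. Poly_Mapping.single (m - Poly_Mapping.single i 1)
        (of_nat (Poly_Mapping.lookup m i) * Poly_Mapping.lookup F m))"

definition homogeneous :: "nat \<Rightarrow> ('a::field, 'n::finite) mpoly \<Rightarrow> bool" where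
  "homogeneous d F \<longleftrightarrow> (\<forall>m\<in>Poly_Mapping.keys F. (\<Sum>i\<in>UNIV. Poly_Mapping.lookup m i) = d)"

definition coeffs_in :: "'a set \<Rightarrow> ('a::field, 'n::finite) mpoly \<Rightarrow> bool" where
  "coeffs_in k F \<longleftrightarrow> (\<forall>m. Poly_Mapping.lookup F m \<in> k)"

text \<open>The value of a form at a point depends on the chosen representative.  Below it only matters
  whether it vanishes, or quotients of values of forms of equal degree occur.\<close>

definition eval_at :: "('a::field, 'n::finite) mpoly \<Rightarrow> ('a, 'n) proj \<Rightarrow> 'a" where
  "eval_at F P = mpoly_eval F (rep_proj P)"


section \<open>The Zariski topology\<close>

definition zariski_closed :: "('a::field, 'n::finite) proj set \<Rightarrow> bool" where
  "zariski_closed Z \<longleftrightarrow>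
     (\<exists>T. (\<forall>F\<in>T. \<exists>d. homogeneous d F) \<and> Z = {P. \<forall>F\<in>T. eval_at F P = 0})"

definition zariski_openin :: "('a::field, 'n::finite) proj set \<Rightarrow> ('a, 'n) proj set \<Rightarrow> bool" where
  "zariski_openin V U \<longleftrightarrow> (\<exists>Z. zariski_closed Z \<and> U = V - Z)"

definition zariski_irreducible :: "('a::field, 'n::finite) proj set \<Rightarrow> bool" where
  "zariski_irreducible V \<longleftrightarrow> V \<noteq> {} \<and>
     (\<forall>A B. zariski_closed A \<longrightarrow> zariski_closed B \<longrightarrow> V \<subseteq> A \<union> B \<longrightarrow> V \<subseteq> A \<or> V \<subseteq> B)"

definition vanishing_forms :: "('a::field, 'n::finite) proj set \<Rightarrow> ('a, 'n) mpoly set" where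
  "vanishing_forms V = {F. (\<exists>d. homogeneous d F) \<and> (\<forall>P\<in>V. eval_at F P = 0)}"

interpretation gen_ideal: Modules.module "(*) :: 'r::comm_ring_1 \<Rightarrow> 'r \<Rightarrow> 'r"
  by standard (simp_all add: algebra_simps)

text \<open>The homogeneous ideal of \<open>V\<close> is generated by polynomials with coefficients in \<open>k\<close>.\<close>

definition defined_over :: "'a set \<Rightarrow> ('a::field, 'n::finite) proj set \<Rightarrow> bool" where
  "defined_over k V \<longleftrightarrow>
     vanishing_forms V \<subseteq> gen_ideal.span {F \<in> vanishing_forms V. coeffs_in k F}"

definition rational_points :: "'a set \<Rightarrow> ('a::field, 'n::finite) proj set \<Rightarrow> ('a, 'n) proj set" where
  "rational_points k V = {P\<in>V. \<exists>v. v \<noteq> 0 \<and> P = abs_proj v \<and> (\<forall>i. v $ i \<in> k)}"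


section \<open>The function field\<close>

text \<open>A rational function is a class of fractions \<open>g/h\<close> of forms of equal degree, where \<open>h\<close> does not
  vanish identically on \<open>V\<close>, and \<open>g/h = g'/h'\<close> iff \<open>g h' - g' h\<close> vanishes on \<open>V\<close>.\<close>

type_synonym ('a, 'n) ratfun = "(('a, 'n) mpoly \<times> ('a, 'n) mpoly) set"

definition form_fractions ::
    "('a::field, 'n::finite) proj set \<Rightarrow> (('a, 'n) mpoly \<times> ('a, 'n) mpoly) set" where
  "form_fractions V =
     {(g, h). (\<exists>d. homogeneous d g \<and> homogeneous d h) \<and> h \<notin> vanishing_forms V}"

definition fraction_rel ::
    "('a::field, 'n::finite) proj set \<Rightarrow>
     ((('a, 'n) mpoly \<times> ('a, 'n) mpoly) \<times> (('a, 'n) mpoly \<times> ('a, 'n) mpoly)) set" where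
  "fraction_rel V = {((g, h), (g', h')). (g, h) \<in> form_fractions V \<and> (g', h') \<in> form_fractions V \<and>
     g * h' - g' * h \<in> vanishing_forms V}"

definition function_field :: "('a::field, 'n::finite) proj set \<Rightarrow> ('a, 'n) ratfun ring" where
  "function_field V =
    \<lparr>carrier = form_fractions V // fraction_rel V,
     monoid.mult = (\<lambda>a b. \<Union>(g, h)\<in>a. \<Union>(g', h')\<in>b. fraction_rel V `` {(g * g', h * h')}),
     one = fraction_rel V `` {(1, 1)},
     zero = fraction_rel V `` {(0, 1)},
     add = (\<lambda>a b. \<Union>(g, h)\<in>a. \<Union>(g', h')\<in>b. fraction_rel V `` {(g * h' + g' * h, h * h')})\<rparr>"

definition constant_functions :: "('a::field, 'n::finite) proj set \<Rightarrow> ('a, 'n) ratfun set" where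
  "constant_functions V = {fraction_rel V `` {(Poly_Mapping.single 0 c, 1)} | c. True}"

text \<open>The field \<open>k(V)\<close>, as a subset of \<open>K(V)\<close>.\<close>

definition function_field_over ::
    "'a set \<Rightarrow> ('a::field, 'n::finite) proj set \<Rightarrow> ('a, 'n) ratfun set" where
  "function_field_over k V =
     {f \<in> carrier (function_field V). \<exists>(g, h)\<in>f. coeffs_in k g \<and> coeffs_in k h}"

definition local_ring ::
    "('a::field, 'n::finite) proj set \<Rightarrow> ('a, 'n) proj \<Rightarrow> ('a, 'n) ratfun set" where
  "local_ring V P = {f \<in> carrier (function_field V). \<exists>(g, h)\<in>f. eval_at h P \<noteq> 0}"

definition ratfun_value :: "('a::field, 'n::finite) ratfun \<Rightarrow> ('a, 'n) proj \<Rightarrow> 'a" where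
  "ratfun_value f P = (THE c. \<exists>(g, h)\<in>f. eval_at h P \<noteq> 0 \<and> c = eval_at g P / eval_at h P)"

definition max_ideal ::
    "('a::field, 'n::finite) proj set \<Rightarrow> ('a, 'n) proj \<Rightarrow> ('a, 'n) ratfun set" where
  "max_ideal V P = {f \<in> local_ring V P. ratfun_value f P = 0}"

definition uniformizer ::
    "('a::field, 'n::finite) proj set \<Rightarrow> ('a, 'n) proj \<Rightarrow> ('a, 'n) ratfun \<Rightarrow> bool" where
  "uniformizer V P t \<longleftrightarrow> t \<in> max_ideal V P \<and>
     max_ideal V P = {t \<otimes>\<^bsub>function_field V\<^esub> u | u. u \<in> local_ring V P}"

text \<open>Order of a nonzero rational function at a point of a smooth curve: the exponent \<open>n\<close> in
  \<open>f = u t^n\<close> with \<open>t\<close> a uniformizer and \<open>u\<close> a unit of the local ring.\<close>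

definition ord_at ::
    "('a::field, 'n::finite) proj set \<Rightarrow> ('a, 'n) proj \<Rightarrow> ('a, 'n) ratfun \<Rightarrow> int" where
  "ord_at V P f = (THE n. \<exists>t u. uniformizer V P t \<and> u \<in> local_ring V P - max_ideal V P \<and>
     f = u \<otimes>\<^bsub>function_field V\<^esub> (t [^]\<^bsub>function_field V\<^esub> n))"


section \<open>Smooth projective curves\<close>

text \<open>Transcendence degree one: some singleton is a transcendence basis of \<open>K(V)\<close> over \<open>K\<close>.\<close>

definition dimension_one :: "('a::field, 'n::finite) proj set \<Rightarrow> bool" where
  "dimension_one V \<longleftrightarrow> (\<exists>t\<in>carrier (function_field V).
     ring.transcendental (function_field V) (constant_functions V) t \<and>
     (\<forall>f\<in>carrier (function_field V).
        \<not> ring.transcendental (function_field V)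
            (generate_field (function_field V) (insert t (constant_functions V))) f))"

text \<open>Jacobian criterion: the gradients of the equations span a space of dimension \<open>n - 1\<close>, where
  \<open>n + 1 = CARD('n)\<close>.\<close>

definition smooth_curve_at :: "('a::field, 'n::finite) proj set \<Rightarrow> ('a, 'n) proj \<Rightarrow> bool" where
  "smooth_curve_at V P \<longleftrightarrow>
     vec.dim {\<chi> i. eval_at (mpoly_pderiv i F) P | F. F \<in> vanishing_forms V} + 2 = CARD('n)"

text \<open>Irreducibility refers to the points over \<open>K\<close>, so it is geometric irreducibility.\<close>

definition smooth_projective_curve :: "'a set \<Rightarrow> ('a::field, 'n::finite) proj set \<Rightarrow> bool" where
  "smooth_projective_curve k V \<longleftrightarrow>
     zariski_closed V \<and> zariski_irreducible V \<and> dimension_one V \<and>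
     (\<forall>P\<in>V. smooth_curve_at V P) \<and> defined_over k V"


section \<open>Morphisms, automorphisms and quotients\<close>

definition is_morphism ::
    "'a set \<Rightarrow> ('a::field, 'n::finite) proj set \<Rightarrow> ('a, 'm::finite) proj set \<Rightarrow>
     (('a, 'n) proj \<Rightarrow> ('a, 'm) proj) \<Rightarrow> bool" where
  "is_morphism k V Y \<phi> \<longleftrightarrow> \<phi> ` V \<subseteq> Y \<and>
     (\<forall>P\<in>V. \<exists>U (F :: 'm \<Rightarrow> ('a, 'n) mpoly) d. zariski_openin V U \<and> P \<in> U \<and>
        (\<forall>j. homogeneous d (F j) \<and> coeffs_in k (F j)) \<and>
        (\<forall>R\<in>U. (\<chi> j. eval_at (F j) R) \<noteq> 0 \<and> \<phi> R = abs_proj (\<chi> j. eval_at (F j) R)))"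

text \<open>Automorphisms are extensional functions on \<open>V\<close>, so that distinct elements of the group are
  distinct maps on \<open>V\<close>.\<close>

definition aut_group ::
    "'a set \<Rightarrow> ('a::field, 'n::finite) proj set \<Rightarrow> (('a, 'n) proj \<Rightarrow> ('a, 'n) proj) monoid" where
  "aut_group k V = (BijGroup V)
     \<lparr>carrier := {\<phi> \<in> Bij V. is_morphism k V V \<phi> \<and> is_morphism k V V (inv_into V \<phi>)}\<rparr>"

definition regular_on ::
    "('a::field, 'n::finite) proj set \<Rightarrow> ('a, 'n) proj set \<Rightarrow> (('a, 'n) proj \<Rightarrow> 'a) \<Rightarrow> bool" where
  "regular_on V U f \<longleftrightarrow> (\<forall>P\<in>U. \<exists>W g h d. zariski_openin V W \<and> P \<in> W \<and> W \<subseteq> U \<and>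
     homogeneous d g \<and> homogeneous d h \<and>
     (\<forall>R\<in>W. eval_at h R \<noteq> 0 \<and> f R = eval_at g R / eval_at h R))"

text \<open>\<open>Y\<close> with the \<open>k\<close>-morphism \<open>\<pi>\<close> is the quotient variety \<open>V/G\<close>: \<open>\<pi>\<close> identifies \<open>Y\<close> with the
  orbit space (as a set and as a topological space), and the regular functions on an open
  \<open>B \<subseteq> Y\<close> are exactly the \<open>G\<close>-invariant regular functions on its preimage.  (As the fibres
  are the orbits, the invariant functions on the preimage are those of the form \<open>g \<circ> \<pi>\<close>.)\<close>

definition is_quotient_by ::
    "'a set \<Rightarrow> ('a::field, 'n::finite) proj set \<Rightarrow> (('a, 'n) proj \<Rightarrow> ('a, 'n) proj) set \<Rightarrow>
     ('a, 'm::finite) proj set \<Rightarrow> (('a, 'n) proj \<Rightarrow> ('a, 'm) proj) \<Rightarrow> bool" where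
  "is_quotient_by k V G Y \<pi> \<longleftrightarrow>
     is_morphism k V Y \<pi> \<and> \<pi> ` V = Y \<and>
     (\<forall>P\<in>V. \<forall>R\<in>V. \<pi> P = \<pi> R \<longleftrightarrow> (\<exists>\<sigma>\<in>G. R = \<sigma> P)) \<and>
     (\<forall>B\<subseteq>Y. zariski_openin Y B \<longleftrightarrow> zariski_openin V {P\<in>V. \<pi> P \<in> B}) \<and>
     (\<forall>B. zariski_openin Y B \<longrightarrow>
        (\<forall>g. regular_on Y B g \<longleftrightarrow> regular_on V {P\<in>V. \<pi> P \<in> B} (g \<circ> \<pi>)))"

text \<open>\<open>V/G\<close> is determined up to isomorphism over \<open>k\<close>, so \<open>V/G\<close> is isomorphic to the projective
  line iff the line itself, with a suitable map, is a quotient of \<open>V\<close> by \<open>G\<close>.\<close>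

definition quotient_iso_P1 ::
    "'a set \<Rightarrow> ('a::field, 'n::finite) proj set \<Rightarrow> (('a, 'n) proj \<Rightarrow> ('a, 'n) proj) set \<Rightarrow> bool" where
  "quotient_iso_P1 k V G \<longleftrightarrow> (\<exists>\<pi>. is_quotient_by k V G (UNIV :: ('a, 2) proj set) \<pi>)"


section \<open>Divisors and Riemann--Roch spaces\<close>

text \<open>Divisors are elements \<open>D :: ('a, 'n) proj \<Rightarrow>\<^sub>0 int\<close> of the free abelian group on points;
  \<^const>\<open>frag_of\<close> gives the point \<open>P\<close> as a divisor.\<close>

definition galois_group :: "'a::field set \<Rightarrow> ('a \<Rightarrow> 'a) set" where
  "galois_group k = {s. bij s \<and> (\<forall>x y. s (x + y) = s x + s y) \<and> (\<forall>x y. s (x * y) = s x * s y) \<and>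
     (\<forall>x\<in>k. s x = x)}"

definition galois_act :: "('a \<Rightarrow> 'a) \<Rightarrow> ('a::field, 'n::finite) proj \<Rightarrow> ('a, 'n) proj" where
  "galois_act s P = abs_proj (\<chi> i. s (rep_proj P $ i))"

definition divisor_defined_over :: "'a set \<Rightarrow> (('a::field, 'n::finite) proj \<Rightarrow>\<^sub>0 int) \<Rightarrow> bool" where
  "divisor_defined_over k D \<longleftrightarrow> (\<forall>s\<in>galois_group k. \<forall>P.
     Poly_Mapping.lookup D (galois_act s P) = Poly_Mapping.lookup D P)"

definition riemann_roch_space ::
    "'a set \<Rightarrow> ('a::field, 'n::finite) proj set \<Rightarrow> (('a, 'n) proj \<Rightarrow>\<^sub>0 int) \<Rightarrow> ('a, 'n) ratfun set" where
  "riemann_roch_space k V D =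
     {f \<in> function_field_over k V - {\<zero>\<^bsub>function_field V\<^esub>}.
        \<forall>P\<in>V. ord_at V P f + Poly_Mapping.lookup D P \<ge> 0} \<union> {\<zero>\<^bsub>function_field V\<^esub>}"


section \<open>Codes\<close>

text \<open>Words with coordinates indexed by \<open>S\<close> and entries in \<open>k\<close> are the elements of
  \<open>S \<rightarrow>\<^sub>E k\<close>.\<close>

definition evaluation_map ::
    "('a::field, 'n::finite) proj set \<Rightarrow> ('a, 'n) ratfun \<Rightarrow> ('a, 'n) proj \<Rightarrow> 'a" where
  "evaluation_map S f = (\<lambda>R\<in>S. ratfun_value f R)"

definition linear_code :: "'a::field set \<Rightarrow> 'i set \<Rightarrow> ('i \<Rightarrow> 'a) set \<Rightarrow> bool" where
  "linear_code k S C \<longleftrightarrow> C \<subseteq> S \<rightarrow>\<^sub>E k \<and> (\<lambda>R\<in>S. 0) \<in> C \<and>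
     (\<forall>c\<in>C. \<forall>c'\<in>C. (\<lambda>R\<in>S. c R + c' R) \<in> C) \<and> (\<forall>a\<in>k. \<forall>c\<in>C. (\<lambda>R\<in>S. a * c R) \<in> C)"

definition min_distance :: "'i set \<Rightarrow> ('i \<Rightarrow> 'a::field) set \<Rightarrow> nat" where
  "min_distance S C = (LEAST d. \<exists>c\<in>C. c \<noteq> (\<lambda>R\<in>S. 0) \<and> d = card {R\<in>S. c R \<noteq> 0})"

definition permute_word :: "'i set \<Rightarrow> ('i \<Rightarrow> 'i) \<Rightarrow> ('i \<Rightarrow> 'a) \<Rightarrow> 'i \<Rightarrow> 'a" where
  "permute_word S p c = (\<lambda>R\<in>S. c (inv_into S p R))"

definition code_aut_group :: "'i set \<Rightarrow> ('i \<Rightarrow> 'a) set \<Rightarrow> ('i \<Rightarrow> 'i) monoid" where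
  "code_aut_group S C = (BijGroup S)\<lparr>carrier := {p \<in> Bij S. permute_word S p ` C = C}\<rparr>"

end

theory Submission
  imports Defs
begin

text \<open>
  Let \<open>\<pi>\<^sub>i\<close> be the quotient map by \<open>G\<^sub>i\<close>.  Since \<open>D\<close> is rational, the Frobenius image of \<open>Q\<close> lies in the
  \<open>G\<^sub>i\<close>-orbit of \<open>Q\<close>, so \<open>\<pi>\<^sub>i Q\<close> is a rational point of the line, and a coordinate of the line with its
  pole there pulls back to some \<open>f\<^sub>i\<close> in \<open>L(D)\<close> that separates the \<open>G\<^sub>i\<close>-orbits.  The divisor \<open>D\<close> is invariant
  under \<open>G\<^sub>1\<close> and \<open>G\<^sub>2\<close>, hence under the group \<open>H\<close> they generate, so \<open>H\<close> acts on \<open>L(D)\<close> and permutes the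
  coordinates of the code.

  A nonzero \<open>f\<close> in \<open>L(D)\<close> has at most \<open>deg D = card G\<^sub>1 < card S\<close> zeros, which gives (1).  If \<open>\<sigma>\<close> and \<open>\<tau>\<close>
  in \<open>H\<close> agree on \<open>S\<close>, then \<open>f\<^sub>i \<circ> \<sigma>\<close> and \<open>f\<^sub>i \<circ> \<tau>\<close> in \<open>L(D)\<close> agree on \<open>S\<close> and are equal by (1), so for
  almost all points \<open>R\<close> the points \<open>\<sigma> R\<close> and \<open>\<tau> R\<close> lie in one \<open>G\<^sub>i\<close>-orbit.  As \<open>G\<^sub>i\<close> is finite,
  \<open>\<sigma> \<tau>\<^sup>-\<^sup>1\<close> agrees at infinitely many points with some element of \<open>G\<^sub>i\<close> and thus lies in
  \<open>G\<^sub>1 \<inter> G\<^sub>2\<close>, which is trivial.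
\<close>

text \<open>The weight lies in the bound on the zeros. It is obtained by counting dimensions: if
  everywhere regular functions are constant, then more than deg E + 1 functions with poles bounded
  by E are linearly dependent, and a function with too many zeros would produce too many independent
  ones. That regular functions are constant is inherited from the line, because the product of the
  \<open>G1\<close>-conjugates of f - c descends along the quotient map.

  The function f_i lies in L(D) because its pole at a point P of the orbit of Q has order at most
  that of the stabilizer of P, which is the number of \<sigma> in G_i with \<sigma> Q = P, the
  coefficient of D at P.

  Automorphisms over \<open>Fq\<close> commute with Frobenius, so S consists of rational points and
  the code has entries in \<open>Fq\<close>.

  Rational functions are classes of fractions of forms and orders are definite descriptions. Both
  are traded for statements about functions on points up to generic equality: the Jacobian criterion
  gives a uniformizer at each point, and dimension one gives polynomial relations between two
  functions.\<close>

section \<open>Polynomials and forms\<close>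

text \<open>As a simplification rule this left-associates products and loops with \<open>mult_ac\<close>.\<close>

declare gen_ideal.scale_scale [simp del]

abbreviation Cst :: "'a::field \<Rightarrow> ('a, 'n::finite) mpoly" where
  "Cst c \<equiv> Poly_Mapping.single 0 c"

definition Var :: "'n::finite \<Rightarrow> ('a::field, 'n) mpoly" where
  "Var i = Poly_Mapping.single (Poly_Mapping.single i 1) 1"

definition monom_val :: "('n::finite \<Rightarrow>\<^sub>0 nat) \<Rightarrow> 'a::field^'n \<Rightarrow> 'a" where
  "monom_val m v = (\<Prod>i\<in>UNIV. (v $ i) ^ Poly_Mapping.lookup m i)"

abbreviation monom_deg :: "('n::finite \<Rightarrow>\<^sub>0 nat) \<Rightarrow> nat" where
  "monom_deg m \<equiv> (\<Sum>i\<in>UNIV. Poly_Mapping.lookup m i)"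

lemma monom_val_add: "monom_val (m + m') v = monom_val m v * monom_val m' v"
  by (simp add: monom_val_def lookup_add power_add prod.distrib)

lemma monom_val_0 [simp]: "monom_val 0 v = 1"
  by (simp add: monom_val_def)

lemma monom_val_single: "monom_val (Poly_Mapping.single i e) v = (v $ i) ^ e"
proof -
  have "monom_val (Poly_Mapping.single i e) v = (\<Prod>j\<in>UNIV. if j = i then (v $ j) ^ e else 1)"
    unfolding monom_val_def by (rule prod.cong) (auto simp: lookup_single when_def)
  then show ?thesis by simp
qed

lemma monom_val_scale: "monom_val m (c *s v) = c ^ monom_deg m * monom_val m v"
  by (simp add: monom_val_def power_mult_distrib prod.distrib power_sum)

lemma monom_deg_add: "monom_deg (m + m') = monom_deg m + monom_deg m'"
  by (simp add: lookup_add sum.distrib)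

lemma monom_deg_single: "monom_deg (Poly_Mapping.single i e) = e"
proof -
  have "monom_deg (Poly_Mapping.single i e) = (\<Sum>j\<in>UNIV. if j = i then e else 0)"
    by (rule sum.cong) (auto simp: lookup_single when_def)
  then show ?thesis by simp
qed

lemma mpoly_eval_eq: "mpoly_eval F v =
    (\<Sum>m\<in>Poly_Mapping.keys F. Poly_Mapping.lookup F m * monom_val m v)"
  unfolding mpoly_eval_def monom_val_def ..

lemma mpoly_eval_single [simp]: "mpoly_eval (Poly_Mapping.single m c) v = c * monom_val m v"
  by (simp add: mpoly_eval_eq)

lemma mpoly_eval_Var [simp]: "mpoly_eval (Var i) v = v $ i"
  by (simp only: Var_def mpoly_eval_single monom_val_single power_one_right mult_1)

lemma mpoly_eval_0 [simp]: "mpoly_eval 0 v = 0"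
  by (simp add: mpoly_eval_eq)

lemma mpoly_eval_1 [simp]: "mpoly_eval 1 v = 1"
  by (simp flip: single_one)

lemma mpoly_eval_add [simp]: "mpoly_eval (F + G) v = mpoly_eval F v + mpoly_eval G v"
  unfolding mpoly_eval_eq by (rule setsum_keys_plus_distrib) (auto simp: algebra_simps)

lemma mpoly_eval_sum [simp]: "mpoly_eval (sum f A) v = (\<Sum>x\<in>A. mpoly_eval (f x) v)"
  by (induction A rule: infinite_finite_induct) auto

lemma mpoly_expand:
  "F = (\<Sum>m\<in>Poly_Mapping.keys F. Poly_Mapping.single m (Poly_Mapping.lookup F m))"
proof (rule poly_mapping_eqI)
  fix k
  have "Poly_Mapping.lookup (\<Sum>m\<in>Poly_Mapping.keys F. Poly_Mapping.single m (Poly_Mapping.lookup F m)) k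
      = (\<Sum>m\<in>Poly_Mapping.keys F. if m = k then Poly_Mapping.lookup F k else 0)"
    unfolding lookup_sum by (rule sum.cong) (auto simp: lookup_single when_def)
  also have "\<dots> = Poly_Mapping.lookup F k"
    by (simp add: in_keys_iff)
  finally show "Poly_Mapping.lookup F k = Poly_Mapping.lookup
    (\<Sum>m\<in>Poly_Mapping.keys F. Poly_Mapping.single m (Poly_Mapping.lookup F m)) k" by simp
qed

lemma mpoly_mult_expand: "F * G = (\<Sum>m\<in>Poly_Mapping.keys F. \<Sum>n\<in>Poly_Mapping.keys G.
    Poly_Mapping.single (m + n) (Poly_Mapping.lookup F m * Poly_Mapping.lookup G n))"
proof -
  have "F * G = (\<Sum>m\<in>Poly_Mapping.keys F. Poly_Mapping.single m (Poly_Mapping.lookup F m)) *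
      (\<Sum>n\<in>Poly_Mapping.keys G. Poly_Mapping.single n (Poly_Mapping.lookup G n))"
    using mpoly_expand by metis
  then show ?thesis by (simp add: sum_product mult_single)
qed

lemma mpoly_eval_mult [simp]: "mpoly_eval (F * G) v = mpoly_eval F v * mpoly_eval G v"
proof -
  have "mpoly_eval (F * G) v = (\<Sum>m\<in>Poly_Mapping.keys F. \<Sum>n\<in>Poly_Mapping.keys G.
      (Poly_Mapping.lookup F m * monom_val m v) * (Poly_Mapping.lookup G n * monom_val n v))"
    by (subst mpoly_mult_expand) (simp only: mpoly_eval_sum mpoly_eval_single monom_val_add mult_ac)
  then show ?thesis
    by (simp only: mpoly_eval_eq[of F] mpoly_eval_eq[of G] sum_product)
qed

lemma mpoly_eval_uminus [simp]: "mpoly_eval (- F) v = - mpoly_eval F v"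
  using mpoly_eval_add[of F "-F" v] by (simp add: eq_neg_iff_add_eq_0 add.commute)

lemma mpoly_eval_diff [simp]: "mpoly_eval (F - G) v = mpoly_eval F v - mpoly_eval G v"
  using mpoly_eval_add[of F "-G" v] by simp

lemma mpoly_eval_power [simp]: "mpoly_eval (F ^ n) v = mpoly_eval F v ^ n"
  by (induction n) auto

lemma mpoly_eval_prod [simp]: "mpoly_eval (prod f A) v = (\<Prod>x\<in>A. mpoly_eval (f x) v)"
  by (induction A rule: infinite_finite_induct) auto

lemma homogeneous_iff:
  "homogeneous d F \<longleftrightarrow> (\<forall>m. Poly_Mapping.lookup F m \<noteq> 0 \<longrightarrow> monom_deg m = d)"
  by (auto simp: homogeneous_def in_keys_iff)

lemma homogeneous_0 [simp, intro]: "homogeneous d 0"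
  by (simp add: homogeneous_iff)

lemma homogeneous_single: "monom_deg m = d \<Longrightarrow> homogeneous d (Poly_Mapping.single m c)"
  by (auto simp: homogeneous_iff lookup_single when_def)

lemma homogeneous_Cst [simp, intro]: "homogeneous 0 (Cst c)"
  by (rule homogeneous_single) simp

lemma homogeneous_1 [simp, intro]: "homogeneous 0 1"
  unfolding single_one[symmetric] by (rule homogeneous_Cst)

lemma homogeneous_Var [simp, intro]: "homogeneous (Suc 0) (Var i)"
  unfolding Var_def by (rule homogeneous_single) (simp only: monom_deg_single One_nat_def)

lemma homogeneous_add [intro]: "homogeneous d F \<Longrightarrow> homogeneous d G \<Longrightarrow> homogeneous d (F + G)"
  unfolding homogeneous_iff lookup_add by (metis add.right_neutral)

lemma homogeneous_diff [intro]: "homogeneous d F \<Longrightarrow> homogeneous d G \<Longrightarrow> homogeneous d (F - G)"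
  unfolding homogeneous_iff lookup_minus by (metis diff_zero)

lemma homogeneous_sum [intro]:
  "(\<And>x. x \<in> A \<Longrightarrow> homogeneous d (f x)) \<Longrightarrow> homogeneous d (sum f A)"
  by (induction A rule: infinite_finite_induct) auto

lemma homogeneous_mult [intro]:
  "homogeneous d F \<Longrightarrow> homogeneous e G \<Longrightarrow> homogeneous (d + e) (F * G)"
  unfolding mpoly_mult_expand[of F G]
  by (intro homogeneous_sum homogeneous_single) (auto simp: homogeneous_def monom_deg_add)

lemma homogeneous_power [intro]: "homogeneous d F \<Longrightarrow> homogeneous (n * d) (F ^ n)"
  by (induction n) auto

lemma homogeneous_prod [intro]:
  "(\<And>x. x \<in> A \<Longrightarrow> homogeneous (d x) (f x)) \<Longrightarrow> homogeneous (sum d A) (prod f A)"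
  by (induction A rule: infinite_finite_induct) auto

lemma mpoly_eval_scale:
  "homogeneous d F \<Longrightarrow> mpoly_eval F (c *s v) = c ^ d * mpoly_eval F v"
  unfolding mpoly_eval_eq sum_distrib_left
  by (rule sum.cong) (auto simp: monom_val_scale homogeneous_def)

text \<open>A monomial of positive degree is a variable times a monomial of degree one less, and a
  form is the sum of its monomials. The degree is an argument of \<open>P\<close> because the
  expansions proved by this rule mention it.\<close>

lemma form_induct [consumes 1, case_names zero const var add]:
  assumes F: "homogeneous d F"
    and zero: "\<And>d. P d 0"
    and const: "\<And>c. P 0 (Cst c)"
    and var: "\<And>d F i. homogeneous d F \<Longrightarrow> P d F \<Longrightarrow> P (Suc d) (Var i * F)"
    and add: "\<And>d F G. homogeneous d F \<Longrightarrow> homogeneous d G \<Longrightarrow> P d F \<Longrightarrow> P d G \<Longrightarrow> P d (F + G)"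
  shows "P d F"
proof -
  have single: "P d (Poly_Mapping.single m c)" if "monom_deg m = d" for m c d
    using that
  proof (induction d arbitrary: m)
    case 0
    then have "m = 0" by (intro poly_mapping_eqI) simp
    then show ?case using const by simp
  next
    case (Suc d)
    then obtain i where i: "Poly_Mapping.lookup m i \<noteq> 0"
      by (metis (no_types, lifting) nat.distinct(1) sum.neutral)
    define m' where "m' = m - Poly_Mapping.single i 1"
    have m: "m = Poly_Mapping.single i 1 + m'"
      using i by (intro poly_mapping_eqI) (auto simp: m'_def lookup_add lookup_minus lookup_single when_def)
    have "monom_deg m' = d"
      using Suc.prems unfolding m monom_deg_add monom_deg_single by simp
    moreover have "Poly_Mapping.single m c = Var i * Poly_Mapping.single m' c"
      by (simp add: m mult_single Var_def)
    ultimately show ?case using Suc.IH[of m'] var[of d "Poly_Mapping.single m' c" i] homogeneous_single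
      by metis
  qed
  \<comment> \<open>Homogeneity of the partial sums is carried along, since \<open>add\<close> asks
    for it on both summands.\<close>
  have "homogeneous d (\<Sum>m\<in>A. Poly_Mapping.single m (Poly_Mapping.lookup F m)) \<and>
      P d (\<Sum>m\<in>A. Poly_Mapping.single m (Poly_Mapping.lookup F m))"
    if "A \<subseteq> Poly_Mapping.keys F" "finite A" for A
    using that(2,1)
  proof (induction rule: finite_induct)
    case empty
    then show ?case using zero by simp
  next
    case (insert x A)
    then have x: "monom_deg x = d" using F by (auto simp: homogeneous_def)
    from insert show ?case
      using single[OF x] homogeneous_single[OF x] by (auto intro!: add)
  qed
  from this[of "Poly_Mapping.keys F"] show ?thesis
    using mpoly_expand[of F] by simp
qed

subsection \<open>Linear forms, substitution and coefficients\<close>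

definition lin_form :: "'a::field^'n \<Rightarrow> ('a, 'n::finite) mpoly" where
  "lin_form u = (\<Sum>i\<in>UNIV. Cst (u $ i) * Var i)"

lemma mpoly_eval_lin_form [simp]: "mpoly_eval (lin_form u) v = (\<Sum>i\<in>UNIV. u $ i * v $ i)"
  by (simp add: lin_form_def)

lemma homogeneous_lin_form [simp, intro]: "homogeneous (Suc 0) (lin_form u)"
  unfolding lin_form_def
proof (rule homogeneous_sum)
  fix i show "homogeneous (Suc 0) (Cst (u $ i) * Var i)"
    using homogeneous_mult[OF homogeneous_Cst homogeneous_Var, of "u $ i" i] by simp
qed

definition mpoly_subst :: "('m::finite \<Rightarrow> ('a::field, 'n::finite) mpoly) \<Rightarrow> ('a, 'm) mpoly \<Rightarrow> ('a, 'n) mpoly" where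
  "mpoly_subst A F = (\<Sum>m\<in>Poly_Mapping.keys F.
     Cst (Poly_Mapping.lookup F m) * (\<Prod>i\<in>UNIV. A i ^ Poly_Mapping.lookup m i))"

lemma mpoly_eval_subst [simp]:
  "mpoly_eval (mpoly_subst A F) v = mpoly_eval F (\<chi> i. mpoly_eval (A i) v)"
  by (simp add: mpoly_subst_def mpoly_eval_eq[of F] monom_val_def)

lemma homogeneous_subst:
  assumes "\<And>i. homogeneous e (A i)" "homogeneous d F"
  shows "homogeneous (d * e) (mpoly_subst A F)"
  unfolding mpoly_subst_def
proof (rule homogeneous_sum)
  fix m assume "m \<in> Poly_Mapping.keys F"
  then have "d * e = 0 + (\<Sum>i\<in>UNIV. Poly_Mapping.lookup m i * e)"
    using assms(2) by (auto simp: homogeneous_def simp flip: sum_distrib_right)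
  then show "homogeneous (d * e)
     (Cst (Poly_Mapping.lookup F m) * (\<Prod>i\<in>UNIV. A i ^ Poly_Mapping.lookup m i))"
    using assms(1) by (simp only:) (intro homogeneous_mult homogeneous_Cst homogeneous_prod homogeneous_power)
qed

section \<open>Forms with coefficients in a subring, and conjugate forms\<close>

definition subring_set :: "'a::ring_1 set \<Rightarrow> bool" where
  "subring_set k \<longleftrightarrow> 0 \<in> k \<and> 1 \<in> k \<and> (\<forall>x\<in>k. \<forall>y\<in>k. x + y \<in> k \<and> x * y \<in> k) \<and> (\<forall>x\<in>k. - x \<in> k)"

lemma subring_set_sum: "subring_set k \<Longrightarrow> (\<And>x. x \<in> A \<Longrightarrow> f x \<in> k) \<Longrightarrow> sum f A \<in> k"
  by (induction A rule: infinite_finite_induct) (auto simp: subring_set_def)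

lemma subring_set_diff: "subring_set k \<Longrightarrow> x \<in> k \<Longrightarrow> y \<in> k \<Longrightarrow> x - y \<in> k"
  unfolding subring_set_def by (metis diff_conv_add_uminus)

lemma coeffs_in_single: "subring_set k \<Longrightarrow> c \<in> k \<Longrightarrow> coeffs_in k (Poly_Mapping.single m c)"
  by (auto simp: coeffs_in_def lookup_single when_def subring_set_def)

lemma coeffs_in_1: "subring_set k \<Longrightarrow> coeffs_in k 1"
  unfolding single_one[symmetric] by (rule coeffs_in_single) (auto simp: subring_set_def)

lemma coeffs_in_sum:
  "subring_set k \<Longrightarrow> (\<And>x. x \<in> A \<Longrightarrow> coeffs_in k (f x)) \<Longrightarrow> coeffs_in k (sum f A)"
  unfolding coeffs_in_def by (simp add: lookup_sum subring_set_sum)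

lemma coeffs_in_add: "subring_set k \<Longrightarrow> coeffs_in k F \<Longrightarrow> coeffs_in k G \<Longrightarrow> coeffs_in k (F + G)"
  by (simp add: coeffs_in_def lookup_add subring_set_def)

lemma coeffs_in_diff: "subring_set k \<Longrightarrow> coeffs_in k F \<Longrightarrow> coeffs_in k G \<Longrightarrow> coeffs_in k (F - G)"
  by (simp add: coeffs_in_def lookup_minus subring_set_diff)

lemma coeffs_in_mult: "subring_set k \<Longrightarrow> coeffs_in k F \<Longrightarrow> coeffs_in k G \<Longrightarrow> coeffs_in k (F * G)"
  unfolding mpoly_mult_expand[of F G]
  by (intro coeffs_in_sum coeffs_in_single) (auto simp: coeffs_in_def subring_set_def)

lemma coeffs_in_power: "subring_set k \<Longrightarrow> coeffs_in k F \<Longrightarrow> coeffs_in k (F ^ n)"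
  by (induction n) (auto simp: coeffs_in_mult coeffs_in_1)

lemma coeffs_in_prod:
  "subring_set k \<Longrightarrow> (\<And>x. x \<in> A \<Longrightarrow> coeffs_in k (f x)) \<Longrightarrow> coeffs_in k (prod f A)"
  by (induction A rule: infinite_finite_induct) (auto simp: coeffs_in_mult coeffs_in_1)

lemma coeffs_in_subst: "subring_set k \<Longrightarrow> (\<And>i. coeffs_in k (A i)) \<Longrightarrow> coeffs_in k F \<Longrightarrow>
    coeffs_in k (mpoly_subst A F)"
  unfolding mpoly_subst_def
  by (intro coeffs_in_sum coeffs_in_mult coeffs_in_prod coeffs_in_power coeffs_in_single)
    (auto simp: coeffs_in_def)

text \<open>The conjugate form, whose value at the conjugate of v is the conjugate of the value of F
  at v. With the Frobenius map it carries equations and fractions from P to its Frobenius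
  image.\<close>

definition map_coeffs :: "('a \<Rightarrow> 'a) \<Rightarrow> ('a::field, 'n::finite) mpoly \<Rightarrow> ('a, 'n) mpoly" where
  "map_coeffs s F = (\<Sum>m\<in>Poly_Mapping.keys F. Poly_Mapping.single m (s (Poly_Mapping.lookup F m)))"

lemma homogeneous_map_coeffs: "homogeneous d F \<Longrightarrow> homogeneous d (map_coeffs s F)"
  unfolding map_coeffs_def by (intro homogeneous_sum homogeneous_single) (simp add: homogeneous_def)

lemma map_coeffs_fixed:
  assumes "\<And>x. x \<in> k \<Longrightarrow> s x = x" "coeffs_in k F"
  shows "map_coeffs s F = F"
  using assms mpoly_expand[of F] unfolding map_coeffs_def coeffs_in_def by simp

lemma mpoly_eval_map_coeffs:
  fixes s :: "'a::field \<Rightarrow> 'a"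
  assumes add: "\<And>x y. s (x + y) = s x + s y" and mult: "\<And>x y. s (x * y) = s x * s y"
    and one: "s 1 = 1" and zero: "s 0 = 0"
  shows "mpoly_eval (map_coeffs s F) (\<chi> i. s (v $ i)) = s (mpoly_eval F v)"
proof -
  have sum: "s (sum f A) = (\<Sum>x\<in>A. s (f x))" for f :: "'c \<Rightarrow> 'a" and A
    by (induction A rule: infinite_finite_induct) (auto simp: add zero)
  have prod: "s (prod f A) = (\<Prod>x\<in>A. s (f x))" for f :: "'c \<Rightarrow> 'a" and A
    by (induction A rule: infinite_finite_induct) (auto simp: mult one)
  have power: "s (x ^ n) = s x ^ n" for x n
    by (induction n) (auto simp: mult one)
  show ?thesis
    by (simp add: map_coeffs_def mpoly_eval_eq[of F] sum mult monom_val_def prod power)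
qed

subsection \<open>Taylor expansion of a form along a point\<close>

lemma mpoly_pderiv_single: "mpoly_pderiv i (Poly_Mapping.single m c) =
    Poly_Mapping.single (m - Poly_Mapping.single i 1) (of_nat (Poly_Mapping.lookup m i) * c)"
  by (simp add: mpoly_pderiv_def)

lemma mpoly_pderiv_add: "mpoly_pderiv i (F + G) = mpoly_pderiv i F + mpoly_pderiv i G"
  unfolding mpoly_pderiv_def
  by (rule setsum_keys_plus_distrib) (auto simp: distrib_left single_add)

lemma mpoly_pderiv_0 [simp]: "mpoly_pderiv i 0 = 0"
  by (simp add: mpoly_pderiv_def)

lemma mpoly_pderiv_sum: "mpoly_pderiv i (sum f A) = (\<Sum>x\<in>A. mpoly_pderiv i (f x))"
  by (induction A rule: infinite_finite_induct) (auto simp: mpoly_pderiv_add)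

text \<open>The Leibniz rule for a variable times F. Exponents are subtracted in the natural
  numbers, so a monomial without x_j keeps its exponents under the derivative, but its coefficient
  is then multiplied by 0.\<close>

lemma mpoly_eval_pderiv_Var_mult:
  "mpoly_eval (mpoly_pderiv j (Var i * F)) p =
     (if i = j then mpoly_eval F p else 0) + p $ i * mpoly_eval (mpoly_pderiv j F) p"
proof -
  have *: "mpoly_eval (mpoly_pderiv j (Var i * Poly_Mapping.single m c)) p =
     (if i = j then mpoly_eval (Poly_Mapping.single m c) p else 0) +
     p $ i * mpoly_eval (mpoly_pderiv j (Poly_Mapping.single m c)) p" for m c
  proof (cases "i = j")
    case True
    have 1: "Poly_Mapping.single j 1 + m - Poly_Mapping.single j 1 = m" by simp
    have 2: "p $ j * (of_nat (Poly_Mapping.lookup m j) * c * monom_val (m - Poly_Mapping.single j 1) p)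
        = of_nat (Poly_Mapping.lookup m j) * c * monom_val m p"
    proof (cases "Poly_Mapping.lookup m j = 0")
      case False
      then have "m = Poly_Mapping.single j 1 + (m - Poly_Mapping.single j 1)"
        by (intro poly_mapping_eqI) (auto simp: lookup_add lookup_minus lookup_single when_def)
      then have "monom_val m p = p $ j * monom_val (m - Poly_Mapping.single j 1) p"
        by (metis monom_val_add monom_val_single power_one_right)
      then show ?thesis by simp
    qed simp
    have 3: "Poly_Mapping.lookup (Poly_Mapping.single j 1 + m) j = Suc (Poly_Mapping.lookup m j)"
      by (simp add: lookup_add)
    have "mpoly_eval (mpoly_pderiv j (Var i * Poly_Mapping.single m c)) p =
        of_nat (Suc (Poly_Mapping.lookup m j)) * c * monom_val m p"
      by (simp only: True Var_def mult_single mpoly_pderiv_single 1 3 mult_1 mpoly_eval_single)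
    then show ?thesis using 2 True
      by (simp only: mpoly_pderiv_single mpoly_eval_single if_True) (simp add: distrib_right)
  next
    case False
    have "p $ i * (of_nat (Poly_Mapping.lookup m j) * c * monom_val (m - Poly_Mapping.single j 1) p)
        = of_nat (Poly_Mapping.lookup m j) * c * monom_val (Poly_Mapping.single i 1 + m - Poly_Mapping.single j 1) p"
    proof (cases "Poly_Mapping.lookup m j = 0")
      case nz: False
      have "Poly_Mapping.single i 1 + m - Poly_Mapping.single j 1 = Poly_Mapping.single i 1 + (m - Poly_Mapping.single j 1)"
        using False nz by (intro poly_mapping_eqI) (auto simp: lookup_add lookup_minus lookup_single when_def)
      then show ?thesis by (simp add: monom_val_add monom_val_single)
    qed simp
    moreover have "Poly_Mapping.lookup (Poly_Mapping.single i 1 + m) j = Poly_Mapping.lookup m j"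
      using False by (simp add: lookup_add lookup_single when_def)
    ultimately show ?thesis using False
      by (simp only: Var_def mult_single mpoly_pderiv_single mpoly_eval_single mult_1) simp
  qed
  have F: "F = (\<Sum>m\<in>Poly_Mapping.keys F. Poly_Mapping.single m (Poly_Mapping.lookup F m))" (is "_ = ?S")
    by (rule mpoly_expand)
  have "mpoly_eval (mpoly_pderiv j (Var i * ?S)) p =
     (if i = j then mpoly_eval ?S p else 0) + p $ i * mpoly_eval (mpoly_pderiv j ?S) p"
    unfolding sum_distrib_left mpoly_pderiv_sum mpoly_eval_sum *
    by (simp add: sum.distrib)
  then show ?thesis using F by metis
qed

text \<open>Each variable that is split off adds one copy of the value to the sum. The formula puts
  the gradients of vanishing forms into the hyperplane orthogonal to \<open>p\<close>, in every
  characteristic.\<close>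

lemma euler_formula:
  fixes F :: "('a::field, 'n::finite) mpoly"
  shows "homogeneous d F \<Longrightarrow>
    (\<Sum>i\<in>UNIV. p $ i * mpoly_eval (mpoly_pderiv i F) p) = of_nat d * mpoly_eval F p"
proof (induction d F rule: form_induct)
  case (const c)
  then show ?case by (simp add: mpoly_pderiv_single)
next
  case (var d F k)
  define D where "D i = mpoly_eval (mpoly_pderiv i F) p" for i
  have "(\<Sum>i\<in>UNIV. p $ i * mpoly_eval (mpoly_pderiv i (Var k * F)) p) =
    (\<Sum>i\<in>UNIV. (if i = k then p $ i * mpoly_eval F p else 0) + p $ k * (p $ i * D i))"
    unfolding mpoly_eval_pderiv_Var_mult D_def[symmetric]
    by (rule sum.cong[OF refl], simp only: distrib_left mult.left_commute, split if_split)
      (simp only: split: if_splits, simp)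
  also have "\<dots> = p $ k * mpoly_eval F p + p $ k * (\<Sum>i\<in>UNIV. p $ i * D i)"
    by (simp add: sum.distrib sum_distrib_left)
  finally have "(\<Sum>i\<in>UNIV. p $ i * mpoly_eval (mpoly_pderiv i (Var k * F)) p) =
      p $ k * mpoly_eval F p + p $ k * (\<Sum>i\<in>UNIV. p $ i * D i)" .
  moreover have "(\<Sum>i\<in>UNIV. p $ i * D i) = of_nat d * mpoly_eval F p"
    using var.IH by (simp only: D_def)
  moreover have "mpoly_eval (Var k * F) p = p $ k * mpoly_eval F p"
    by simp
  moreover have "x * y + x * (of_nat d * y) = of_nat (Suc d) * (x * y)" for x y :: 'a
    by (simp add: algebra_simps)
  ultimately show ?case by (simp only:)
next
  case (add d F G)
  then show ?case
    by (simp only: mpoly_pderiv_add mpoly_eval_add sum.distrib distrib_left)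
qed simp

text \<open>Expansion to first order in the chart where \<open>l\<close> is 1, kept homogeneous. F
  minus its value times a power of \<open>lin_form l\<close> lies in the ideal of the point, and the
  cofactor of the i-th generator has the i-th partial derivative as its value at \<open>p\<close>.
  The clause for d = 0 is there because the degree d - 1 is then truncated.\<close>

lemma taylor_form:
  fixes p :: "'a::field^'n::finite"
  assumes l: "mpoly_eval (lin_form l) p = 1" and F: "homogeneous d F"
  shows "\<exists>A. (\<forall>i. homogeneous (d - 1) (A i) \<and> (d = 0 \<longrightarrow> A i = 0) \<and>
      mpoly_eval (A i) p = mpoly_eval (mpoly_pderiv i F) p) \<and>
    F = Cst (mpoly_eval F p) * lin_form l ^ d +
      (\<Sum>i\<in>UNIV. (Var i - Cst (p $ i) * lin_form l) * A i)"
proof -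
  have aux: "x = y + z \<Longrightarrow> z = x - y" for x y z :: "('a, 'n) mpoly" by simp
  have aux2: "f = c * z ^ e + s \<Longrightarrow> x * f = y * c * z ^ Suc e + ((x - y * z) * f + y * (z * s))"
    for s f c z x y :: "('a, 'n) mpoly" and e :: nat
    by (simp add: algebra_simps)
  show ?thesis using F
proof (induction d F rule: form_induct)
  case (zero d)
  then show ?case by (intro exI[of _ "\<lambda>_. 0"]) auto
next
  case (const c)
  then show ?case by (intro exI[of _ "\<lambda>_. 0"]) (auto simp: mpoly_pderiv_single)
next
  case (var d F k)
  define c where "c = mpoly_eval F p"
  from var.IH obtain A where A: "\<And>i. homogeneous (d - 1) (A i)" "\<And>i. d = 0 \<Longrightarrow> A i = 0"
      "\<And>i. mpoly_eval (A i) p = mpoly_eval (mpoly_pderiv i F) p"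
    and F: "F = Cst c * lin_form l ^ d + (\<Sum>i\<in>UNIV. (Var i - Cst (p $ i) * lin_form l) * A i)"
    unfolding c_def by blast
  \<comment> \<open>Multiply the expansion of F by x_k = (x_k - p_k l) + p_k l; the first summand
    contributes F itself to the k-th cofactor.\<close>
  define B where "B i = (if i = k then F else 0) + Cst (p $ k) * (lin_form l * A i)" for i
  have B1: "homogeneous d (B i)" for i
  proof (cases "d = 0")
    case True
    then show ?thesis using var.hyps A(2) by (auto simp: B_def)
  next
    case False
    have "homogeneous (0 + (Suc 0 + (d - 1))) (Cst (p $ k) * (lin_form l * A i))"
      using A(1) by (intro homogeneous_mult) auto
    then show ?thesis using var.hyps False by (auto simp: B_def)
  qed
  have B2: "mpoly_eval (B i) p = mpoly_eval (mpoly_pderiv i (Var k * F)) p" for i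
    using l by (auto simp: B_def mpoly_eval_pderiv_Var_mult A(3))
  have S: "(\<Sum>i\<in>UNIV. (Var i - Cst (p $ i) * lin_form l) * B i) =
      (Var k - Cst (p $ k) * lin_form l) * F +
      Cst (p $ k) * (lin_form l * (\<Sum>i\<in>UNIV. (Var i - Cst (p $ i) * lin_form l) * A i))"
  proof -
    have "(\<Sum>i\<in>UNIV. (Var i - Cst (p $ i) * lin_form l) * B i) =
       (\<Sum>i\<in>UNIV. (if i = k then (Var i - Cst (p $ i) * lin_form l) * F else 0)) +
       (\<Sum>i\<in>UNIV. Cst (p $ k) * (lin_form l * ((Var i - Cst (p $ i) * lin_form l) * A i)))"
      unfolding sum.distrib[symmetric]
      by (rule sum.cong) (auto simp: B_def algebra_simps)
    then show ?thesis by (simp add: sum_distrib_left)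
  qed
  have c': "Cst (mpoly_eval (Var k * F) p) = Cst (p $ k) * Cst c"
    by (simp add: c_def mult_single)
  have "Var k * F = Cst (mpoly_eval (Var k * F) p) * lin_form l ^ Suc d +
      (\<Sum>i\<in>UNIV. (Var i - Cst (p $ i) * lin_form l) * B i)"
    unfolding S c' by (rule aux2[OF F])
  then show ?case
    by (intro exI[of _ B] conjI allI B2) (simp_all only: B1 diff_Suc_1 nat.distinct simp_thms)
next
  case (add d F G)
  from add.IH obtain A B where
    A: "\<And>i. homogeneous (d - 1) (A i)" "\<And>i. d = 0 \<Longrightarrow> A i = 0"
      "\<And>i. mpoly_eval (A i) p = mpoly_eval (mpoly_pderiv i F) p"
      "F = Cst (mpoly_eval F p) * lin_form l ^ d + (\<Sum>i\<in>UNIV. (Var i - Cst (p $ i) * lin_form l) * A i)"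
    and B: "\<And>i. homogeneous (d - 1) (B i)" "\<And>i. d = 0 \<Longrightarrow> B i = 0"
      "\<And>i. mpoly_eval (B i) p = mpoly_eval (mpoly_pderiv i G) p"
      "G = Cst (mpoly_eval G p) * lin_form l ^ d + (\<Sum>i\<in>UNIV. (Var i - Cst (p $ i) * lin_form l) * B i)"
    by blast
  have "(\<Sum>i\<in>UNIV. (Var i - Cst (p $ i) * lin_form l) * A i) = F - Cst (mpoly_eval F p) * lin_form l ^ d"
    "(\<Sum>i\<in>UNIV. (Var i - Cst (p $ i) * lin_form l) * B i) = G - Cst (mpoly_eval G p) * lin_form l ^ d"
    by (rule aux[OF A(4)], rule aux[OF B(4)])
  then have FG: "F + G = Cst (mpoly_eval (F + G) p) * lin_form l ^ d +
      (\<Sum>i\<in>UNIV. (Var i - Cst (p $ i) * lin_form l) * (A i + B i))"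
    by (simp add: single_add distrib_left distrib_right sum.distrib)
  show ?case
  proof (intro exI[of _ "\<lambda>i. A i + B i"] conjI allI impI)
    fix i
    show "homogeneous (d - 1) (A i + B i)" by (intro homogeneous_add A(1) B(1))
    show "mpoly_eval (A i + B i) p = mpoly_eval (mpoly_pderiv i (F + G)) p"
      by (simp only: mpoly_pderiv_add mpoly_eval_add A(3) B(3))
    assume "d = 0" then show "A i + B i = 0" using A(2) B(2) by simp
  qed (rule FG)
qed
qed

section \<open>Points of projective space\<close>

lemma rep_proj_nonzero [simp]: "rep_proj P \<noteq> 0"
  using Quotient3_rep_reflp[OF Quotient3_proj, of P] by auto

lemma abs_rep_proj [simp]: "abs_proj (rep_proj P) = P"
  by (rule Quotient3_abs_rep[OF Quotient3_proj])

lemma abs_proj_eq_iff: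
  assumes "v \<noteq> 0" "w \<noteq> 0"
  shows "abs_proj v = abs_proj w \<longleftrightarrow> (\<exists>c. c \<noteq> 0 \<and> w = c *s v)"
proof -
  have refl: "u \<noteq> 0 \<Longrightarrow> \<exists>c. c \<noteq> 0 \<and> u = c *s u" for u :: "'x::field^'y::finite"
    by (intro exI[of _ 1]) auto
  show ?thesis
    using Quotient3_rel[OF Quotient3_proj, of v w] refl[OF assms(1)] refl[OF assms(2)] assms by blast
qed

lemma rep_abs_proj:
  assumes "v \<noteq> 0"
  obtains c where "c \<noteq> 0" "rep_proj (abs_proj v) = c *s v"
  using abs_proj_eq_iff[OF assms rep_proj_nonzero[of "abs_proj v"]] by auto

lemma eval_at_abs:
  assumes "v \<noteq> 0"
  obtains c where "c \<noteq> 0" "\<And>d F. homogeneous d F \<Longrightarrow> eval_at F (abs_proj v) = c ^ d * mpoly_eval F v"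
proof -
  obtain c where c: "c \<noteq> 0" "rep_proj (abs_proj v) = c *s v"
    by (rule rep_abs_proj[OF assms])
  show ?thesis
    by (rule that[OF c(1)]) (simp add: eval_at_def c mpoly_eval_scale)
qed

lemma eval_at_simps [simp]:
  "eval_at 0 P = 0" "eval_at 1 P = 1" "eval_at (F + G) P = eval_at F P + eval_at G P"
  "eval_at (F - G) P = eval_at F P - eval_at G P" "eval_at (F * G) P = eval_at F P * eval_at G P"
  "eval_at (F ^ n) P = eval_at F P ^ n" "eval_at (Cst c) P = c"
  "eval_at (- F) P = - eval_at F P"
  "eval_at (Var i) P = rep_proj P $ i"
  "eval_at (sum f A) P = (\<Sum>x\<in>A. eval_at (f x) P)" "eval_at (prod f A) P = (\<Prod>x\<in>A. eval_at (f x) P)"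
  by (simp_all add: eval_at_def monom_val_single)

lemma zariski_closed_zero_set: "homogeneous d F \<Longrightarrow> zariski_closed {P. eval_at F P = 0}"
  unfolding zariski_closed_def by (intro exI[of _ "{F}"]) auto

section \<open>The generic filter and regular functions\<close>

text \<open>Rational functions on an irreducible \<open>V\<close> are handled as functions on points modulo equality
  on a nonempty open subset of \<open>V\<close>.\<close>

locale irreducible_variety =
  fixes V :: "('a::field, 'n::finite) proj set"
  assumes irreducible: "zariski_irreducible V"
begin

text \<open>The vanishing ideal of an irreducible set is prime: \<open>V\<close> is covered by the
  two zero sets, so one of them already contains it.\<close>

lemma form_mult_vanish:
  assumes "homogeneous d g" "homogeneous e h" "\<And>R. R \<in> V \<Longrightarrow> eval_at g R = 0 \<or> eval_at h R = 0"
  shows "(\<forall>R\<in>V. eval_at g R = 0) \<or> (\<forall>R\<in>V. eval_at h R = 0)"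
proof -
  have "V \<subseteq> {P. eval_at g P = 0} \<union> {P. eval_at h P = 0}"
    using assms(3) by auto
  then have "V \<subseteq> {P. eval_at g P = 0} \<or> V \<subseteq> {P. eval_at h P = 0}"
    using irreducible zariski_closed_zero_set[OF assms(1)] zariski_closed_zero_set[OF assms(2)]
    unfolding zariski_irreducible_def by blast
  then show ?thesis by auto
qed

text \<open>The base consists of the basic open sets cut out by forms that do not vanish identically
  on \<open>V\<close>. Irreducibility keeps the intersection of two of them nonempty, so this is a
  proper filter.\<close>

definition gen :: "('a, 'n) proj filter" where
  "gen = Abs_filter (\<lambda>Q. \<exists>h. (\<exists>d. homogeneous d h) \<and> (\<exists>R\<in>V. eval_at h R \<noteq> 0) \<and>
     (\<forall>R\<in>V. eval_at h R \<noteq> 0 \<longrightarrow> Q R))"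

lemma eventually_gen: "eventually Q gen \<longleftrightarrow> (\<exists>h. (\<exists>d. homogeneous d h) \<and>
    (\<exists>R\<in>V. eval_at h R \<noteq> 0) \<and> (\<forall>R\<in>V. eval_at h R \<noteq> 0 \<longrightarrow> Q R))"
  unfolding gen_def
proof (rule eventually_Abs_filter, rule is_filter.intro)
  show "\<exists>h. (\<exists>d. homogeneous d h) \<and> (\<exists>R\<in>V. eval_at h R \<noteq> 0) \<and>
      (\<forall>R\<in>V. eval_at h R \<noteq> 0 \<longrightarrow> True)"
    using irreducible by (intro exI[of _ 1]) (auto simp: zariski_irreducible_def)
next
  fix A B :: "('a, 'n) proj \<Rightarrow> bool"
  assume "\<exists>h. (\<exists>d. homogeneous d h) \<and> (\<exists>R\<in>V. eval_at h R \<noteq> 0) \<and> (\<forall>R\<in>V. eval_at h R \<noteq> 0 \<longrightarrow> A R)"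
    and "\<exists>h. (\<exists>d. homogeneous d h) \<and> (\<exists>R\<in>V. eval_at h R \<noteq> 0) \<and> (\<forall>R\<in>V. eval_at h R \<noteq> 0 \<longrightarrow> B R)"
  then obtain g h d e where gh: "homogeneous d g" "homogeneous e h" "\<exists>R\<in>V. eval_at g R \<noteq> 0"
      "\<exists>R\<in>V. eval_at h R \<noteq> 0" "\<forall>R\<in>V. eval_at g R \<noteq> 0 \<longrightarrow> A R" "\<forall>R\<in>V. eval_at h R \<noteq> 0 \<longrightarrow> B R"
    by blast
  then have "\<exists>R\<in>V. eval_at (g * h) R \<noteq> 0"
    using form_mult_vanish[of d g e h] by auto
  then show "\<exists>h. (\<exists>d. homogeneous d h) \<and> (\<exists>R\<in>V. eval_at h R \<noteq> 0) \<and>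
      (\<forall>R\<in>V. eval_at h R \<noteq> 0 \<longrightarrow> A R \<and> B R)"
    using gh homogeneous_mult[OF gh(1,2)] by (intro exI[of _ "g * h"]) auto
qed blast

lemma gen_not_bot [simp]: "gen \<noteq> bot"
  unfolding trivial_limit_def eventually_gen by blast

lemma eventually_gen_in: "\<forall>\<^sub>F R in gen. R \<in> V"
  unfolding eventually_gen using irreducible
  by (intro exI[of _ 1]) (auto simp: zariski_irreducible_def)

lemma eventually_form_nonzero:
  "homogeneous d h \<Longrightarrow> P \<in> V \<Longrightarrow> eval_at h P \<noteq> 0 \<Longrightarrow> \<forall>\<^sub>F R in gen. eval_at h R \<noteq> 0"
  unfolding eventually_gen by blast

lemma form_zero_if_eventually:
  assumes "homogeneous d h" "\<forall>\<^sub>F R in gen. eval_at h R = 0" "P \<in> V"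
  shows "eval_at h P = 0"
proof (rule ccontr)
  assume "eval_at h P \<noteq> 0"
  then have "\<forall>\<^sub>F R in gen. eval_at h R \<noteq> 0"
    using assms by (intro eventually_form_nonzero)
  with assms(2) have "\<forall>\<^sub>F R in gen. False" by eventually_elim simp
  then show False by simp
qed

text \<open>Regularity at P with value c. Only the generic behaviour of F matters, so F itself may
  take any value at P; hence the value is a separate argument.\<close>

definition regv :: "('a, 'n) proj \<Rightarrow> (('a, 'n) proj \<Rightarrow> 'a) \<Rightarrow> 'a \<Rightarrow> bool" where
  "regv P F c \<longleftrightarrow> (\<exists>d g h. homogeneous d g \<and> homogeneous d h \<and> eval_at h P \<noteq> 0 \<and>
     c = eval_at g P / eval_at h P \<and> (\<forall>\<^sub>F R in gen. F R = eval_at g R / eval_at h R))"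

definition rat :: "(('a, 'n) proj \<Rightarrow> 'a) \<Rightarrow> bool" where
  "rat F \<longleftrightarrow> (\<exists>P\<in>V. \<exists>c. regv P F c)"

lemma regvI:
  "homogeneous d g \<Longrightarrow> homogeneous d h \<Longrightarrow> eval_at h P \<noteq> 0 \<Longrightarrow>
   \<forall>\<^sub>F R in gen. F R = eval_at g R / eval_at h R \<Longrightarrow> c = eval_at g P / eval_at h P \<Longrightarrow> regv P F c"
  unfolding regv_def by blast

text \<open>After cross multiplication, the difference of the two fractions is a single form that
  vanishes generically, hence on all of \<open>V\<close> and in particular at P.\<close>

lemma regv_unique:
  assumes P: "P \<in> V" and "regv P F c" "regv P G e" and FG: "\<forall>\<^sub>F R in gen. F R = G R"
  shows "c = e"
proof -
  obtain d g h where 1: "homogeneous d g" "homogeneous d h" "eval_at h P \<noteq> 0"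
     "c = eval_at g P / eval_at h P" "\<forall>\<^sub>F R in gen. F R = eval_at g R / eval_at h R"
    using assms(2) unfolding regv_def by blast
  obtain d' g' h' where 2: "homogeneous d' g'" "homogeneous d' h'" "eval_at h' P \<noteq> 0"
     "e = eval_at g' P / eval_at h' P" "\<forall>\<^sub>F R in gen. G R = eval_at g' R / eval_at h' R"
    using assms(3) unfolding regv_def by blast
  have hom: "homogeneous (d + d') (g * h' - g' * h)"
    using homogeneous_mult[OF 1(1) 2(2)] homogeneous_mult[OF 2(1) 1(2)]
    by (auto simp: add.commute)
  have "\<forall>\<^sub>F R in gen. eval_at (g * h' - g' * h) R = 0"
    using 1(5) 2(5) FG eventually_form_nonzero[OF 1(2) P 1(3)] eventually_form_nonzero[OF 2(2) P 2(3)]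
    by eventually_elim (simp add: field_simps)
  from form_zero_if_eventually[OF hom this P] show ?thesis
    using 1(3,4) 2(3,4) by (simp add: frac_eq_eq)
qed

lemma regv_cong:
  assumes "regv P F c" "\<forall>\<^sub>F R in gen. F R = G R"
  shows "regv P G c"
proof -
  obtain d g h where 1: "homogeneous d g" "homogeneous d h" "eval_at h P \<noteq> 0"
     "c = eval_at g P / eval_at h P" "\<forall>\<^sub>F R in gen. F R = eval_at g R / eval_at h R"
    using assms(1) unfolding regv_def by blast
  have "\<forall>\<^sub>F R in gen. G R = eval_at g R / eval_at h R"
    using 1(5) assms(2) by eventually_elim simp
  with 1 show ?thesis unfolding regv_def by blast
qed

lemma regv_const [simp, intro]: "regv P (\<lambda>_. c) c"
  by (rule regvI[of 0 "Cst c" 1]) auto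

lemma regv_add:
  assumes "P \<in> V" "regv P F a" "regv P G b"
  shows "regv P (\<lambda>R. F R + G R) (a + b)"
proof -
  obtain d g h where 1: "homogeneous d g" "homogeneous d h" "eval_at h P \<noteq> 0"
     "a = eval_at g P / eval_at h P" "\<forall>\<^sub>F R in gen. F R = eval_at g R / eval_at h R"
    using assms(2) unfolding regv_def by blast
  obtain d' g' h' where 2: "homogeneous d' g'" "homogeneous d' h'" "eval_at h' P \<noteq> 0"
     "b = eval_at g' P / eval_at h' P" "\<forall>\<^sub>F R in gen. G R = eval_at g' R / eval_at h' R"
    using assms(3) unfolding regv_def by blast
  show ?thesis
  proof (rule regvI)
    show "homogeneous (d + d') (g * h' + g' * h)"
      using homogeneous_mult[OF 1(1) 2(2)] homogeneous_mult[OF 2(1) 1(2)]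
      by (auto simp: add.commute)
    show "homogeneous (d + d') (h * h')" using 1 2 by auto
    show "\<forall>\<^sub>F R in gen. F R + G R = eval_at (g * h' + g' * h) R / eval_at (h * h') R"
      using 1(5) 2(5) eventually_form_nonzero[OF 1(2) assms(1) 1(3)]
        eventually_form_nonzero[OF 2(2) assms(1) 2(3)]
      by eventually_elim (simp add: field_simps)
  qed (use 1 2 in \<open>auto simp: field_simps\<close>)
qed

lemma regv_mult:
  assumes "P \<in> V" "regv P F a" "regv P G b"
  shows "regv P (\<lambda>R. F R * G R) (a * b)"
proof -
  obtain d g h where 1: "homogeneous d g" "homogeneous d h" "eval_at h P \<noteq> 0"
     "a = eval_at g P / eval_at h P" "\<forall>\<^sub>F R in gen. F R = eval_at g R / eval_at h R"
    using assms(2) unfolding regv_def by blast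
  obtain d' g' h' where 2: "homogeneous d' g'" "homogeneous d' h'" "eval_at h' P \<noteq> 0"
     "b = eval_at g' P / eval_at h' P" "\<forall>\<^sub>F R in gen. G R = eval_at g' R / eval_at h' R"
    using assms(3) unfolding regv_def by blast
  show ?thesis
  proof (rule regvI)
    show "homogeneous (d + d') (g * g')" "homogeneous (d + d') (h * h')" using 1 2 by auto
    show "\<forall>\<^sub>F R in gen. F R * G R = eval_at (g * g') R / eval_at (h * h') R"
      using 1(5) 2(5) by eventually_elim simp
  qed (use 1 2 in auto)
qed

lemma regv_inverse:
  assumes "P \<in> V" "regv P F a" "a \<noteq> 0"
  shows "regv P (\<lambda>R. inverse (F R)) (inverse a)"
proof -
  obtain d g h where 1: "homogeneous d g" "homogeneous d h" "eval_at h P \<noteq> 0"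
     "a = eval_at g P / eval_at h P" "\<forall>\<^sub>F R in gen. F R = eval_at g R / eval_at h R"
    using assms(2) unfolding regv_def by blast
  have "\<forall>\<^sub>F R in gen. inverse (F R) = eval_at h R / eval_at g R"
    using 1(5) by eventually_elim simp
  with 1 assms(3) show ?thesis by (intro regvI[of d h g]) auto
qed

lemma regv_uminus: "P \<in> V \<Longrightarrow> regv P F a \<Longrightarrow> regv P (\<lambda>R. - F R) (- a)"
  using regv_mult[OF _ regv_const[of P "- 1"]] by simp

lemma regv_diff: "P \<in> V \<Longrightarrow> regv P F a \<Longrightarrow> regv P G b \<Longrightarrow> regv P (\<lambda>R. F R - G R) (a - b)"
  using regv_add[OF _ _ regv_uminus] by simp

lemma regv_divide:
  "P \<in> V \<Longrightarrow> regv P F a \<Longrightarrow> regv P G b \<Longrightarrow> b \<noteq> 0 \<Longrightarrow> regv P (\<lambda>R. F R / G R) (a / b)"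
  using regv_mult[OF _ _ regv_inverse] by (simp add: field_class.field_divide_inverse)

lemma regv_sum: "P \<in> V \<Longrightarrow> (\<And>i. i \<in> I \<Longrightarrow> regv P (F i) (c i)) \<Longrightarrow>
    regv P (\<lambda>R. \<Sum>i\<in>I. F i R) (\<Sum>i\<in>I. c i)"
  by (induction I rule: infinite_finite_induct) (auto intro: regv_add)

lemma regv_prod: "P \<in> V \<Longrightarrow> (\<And>i. i \<in> I \<Longrightarrow> regv P (F i) (c i)) \<Longrightarrow>
    regv P (\<lambda>R. \<Prod>i\<in>I. F i R) (\<Prod>i\<in>I. c i)"
  by (induction I rule: infinite_finite_induct) (auto intro: regv_mult)

lemma regv_power: "P \<in> V \<Longrightarrow> regv P F c \<Longrightarrow> regv P (\<lambda>R. F R ^ n) (c ^ n)"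
  by (induction n) (auto intro: regv_mult)

lemma regv_poly: "P \<in> V \<Longrightarrow> regv P F c \<Longrightarrow> regv P (\<lambda>R. poly p (F R)) (poly p c)"
  by (induction p) (auto intro: regv_mult regv_add)

lemma regv_poly2: "P \<in> V \<Longrightarrow> regv P F c \<Longrightarrow> regv P G e \<Longrightarrow>
    regv P (\<lambda>R. poly (map_poly (\<lambda>q. poly q (F R)) p) (G R)) (poly (map_poly (\<lambda>q. poly q c) p) e)"
proof (induction p)
  case (pCons q p)
  then show ?case by (simp add: map_poly_pCons) (intro regv_add regv_mult regv_poly)
qed auto

lemma ratI:
  assumes "homogeneous d g" "homogeneous d h" "P \<in> V" "eval_at h P \<noteq> 0"
    "\<forall>\<^sub>F R in gen. F R = eval_at g R / eval_at h R"
  shows "rat F"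
  using assms unfolding rat_def regv_def by blast

lemma rat_eventually_regv:
  assumes "rat F"
  shows "\<forall>\<^sub>F P in gen. P \<in> V \<and> regv P F (F P)"
proof -
  obtain P d g h where 1: "P \<in> V" "homogeneous d g" "homogeneous d h" "eval_at h P \<noteq> 0"
     "\<forall>\<^sub>F R in gen. F R = eval_at g R / eval_at h R"
    using assms unfolding rat_def regv_def by blast
  show ?thesis
    using eventually_gen_in 1(5) eventually_form_nonzero[OF 1(3,1,4)]
    by eventually_elim (use 1 in \<open>auto intro: regvI\<close>)
qed

lemma ratE:
  assumes "rat F"
  obtains d g h P where "homogeneous d g" "homogeneous d h" "P \<in> V" "eval_at h P \<noteq> 0"
    "\<forall>\<^sub>F R in gen. F R = eval_at g R / eval_at h R"
  using assms unfolding rat_def regv_def by blast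

lemma rat_const [simp, intro]: "rat (\<lambda>_. c)"
  using irreducible regv_const unfolding rat_def zariski_irreducible_def by blast

text \<open>Two rational functions are regular at a common point, since both properties hold
  generically and \<open>gen\<close> is proper; one such point suffices for
  \<open>rat H\<close>.\<close>

lemma rat_mono:
  assumes "rat F" "rat G" "\<And>P a b. P \<in> V \<Longrightarrow> regv P F a \<Longrightarrow> regv P G b \<Longrightarrow> \<exists>c. regv P H c"
  shows "rat H"
proof -
  have "\<forall>\<^sub>F P in gen. P \<in> V \<and> (\<exists>c. regv P H c)"
    using rat_eventually_regv[OF assms(1)] rat_eventually_regv[OF assms(2)]
    by eventually_elim (use assms(3) in blast)
  then show ?thesis
    using eventually_happens'[OF gen_not_bot] unfolding rat_def by blast
qed

lemma rat_diff: "rat F \<Longrightarrow> rat G \<Longrightarrow> rat (\<lambda>R. F R - G R)"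
  by (rule rat_mono[of F G]) (auto intro: regv_diff)

lemma rat_mult: "rat F \<Longrightarrow> rat G \<Longrightarrow> rat (\<lambda>R. F R * G R)"
  by (rule rat_mono[of F G]) (auto intro: regv_mult)

lemma rat_uminus: "rat F \<Longrightarrow> rat (\<lambda>R. - F R)"
  by (rule rat_mono[of F F]) (auto intro: regv_uminus)

lemma rat_power: "rat F \<Longrightarrow> rat (\<lambda>R. F R ^ n)"
  by (induction n) (auto intro: rat_mult)

lemma rat_cong: "rat F \<Longrightarrow> \<forall>\<^sub>F R in gen. F R = G R \<Longrightarrow> rat G"
  unfolding rat_def using regv_cong by blast

text \<open>The numerator either vanishes on all of \<open>V\<close> or is generically nonzero. This
  dichotomy is what makes the function field a field.\<close>

lemma rat_zero_or_nonzero: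
  assumes "rat F"
  shows "(\<forall>\<^sub>F R in gen. F R = 0) \<or> (\<forall>\<^sub>F R in gen. F R \<noteq> 0)"
proof -
  obtain d g h P where 1: "homogeneous d g" "homogeneous d h" "P \<in> V" "eval_at h P \<noteq> 0"
    "\<forall>\<^sub>F R in gen. F R = eval_at g R / eval_at h R" by (rule ratE[OF assms])
  show ?thesis
  proof (cases "\<exists>R\<in>V. eval_at g R \<noteq> 0")
    case True
    then obtain R where R: "R \<in> V" "eval_at g R \<noteq> 0" by blast
    have "\<forall>\<^sub>F R in gen. F R \<noteq> 0"
      using 1(5) eventually_form_nonzero[OF 1(2,3,4)] eventually_form_nonzero[OF 1(1) R]
      by eventually_elim auto
    then show ?thesis ..
  next
    case False
    have "\<forall>\<^sub>F R in gen. F R = 0"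
      using 1(5) eventually_gen_in by eventually_elim (use False in auto)
    then show ?thesis ..
  qed
qed

lemma rat_inverse: "rat F \<Longrightarrow> rat (\<lambda>R. inverse (F R))"
proof -
  assume F: "rat F"
  consider "\<forall>\<^sub>F R in gen. F R = 0" | "\<forall>\<^sub>F R in gen. F R \<noteq> 0"
    using rat_zero_or_nonzero[OF F] by blast
  then show ?thesis
  proof cases
    case 1
    then have "\<forall>\<^sub>F R in gen. 0 = inverse (F R)" by eventually_elim simp
    then show ?thesis by (rule rat_cong[OF rat_const])
  next
    case 2
    have "\<forall>\<^sub>F R in gen. R \<in> V \<and> regv R F (F R) \<and> F R \<noteq> 0"
      using 2 rat_eventually_regv[OF F] by eventually_elim auto
    then show ?thesis
      using eventually_happens'[OF gen_not_bot] regv_inverse unfolding rat_def by blast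
  qed
qed

lemma regv_rat: "P \<in> V \<Longrightarrow> regv P F c \<Longrightarrow> rat F"
  unfolding rat_def by blast

end

section \<open>The function field\<close>

context irreducible_variety begin

abbreviation FF :: "('a, 'n) ratfun ring" where
  "FF \<equiv> function_field V"

text \<open>An arbitrary representative of the class is chosen. Different representatives need only
  agree where both denominators are nonzero, so facts about \<open>fn\<close> are stated under
  \<open>gen\<close>.\<close>

definition fn :: "('a, 'n) ratfun \<Rightarrow> ('a, 'n) proj \<Rightarrow> 'a" where
  "fn f = (let (g, h) = (SOME x. x \<in> f) in (\<lambda>R. eval_at g R / eval_at h R))"

lemma form_fractions_iff: "(g, h) \<in> form_fractions V \<longleftrightarrow>
    (\<exists>d. homogeneous d g \<and> homogeneous d h) \<and> (\<exists>R\<in>V. eval_at h R \<noteq> 0)"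
  unfolding form_fractions_def vanishing_forms_def by auto

text \<open>Both denominators are generically nonzero, so the cross-multiplied relation amounts to
  generic equality of the quotients, for which transitivity is immediate.\<close>

lemma fraction_rel_iff: "((g, h), (g', h')) \<in> fraction_rel V \<longleftrightarrow>
    (g, h) \<in> form_fractions V \<and> (g', h') \<in> form_fractions V \<and>
    (\<forall>\<^sub>F R in gen. eval_at g R / eval_at h R = eval_at g' R / eval_at h' R)"
proof -
  have "g * h' - g' * h \<in> vanishing_forms V \<longleftrightarrow>
      (\<forall>\<^sub>F R in gen. eval_at g R / eval_at h R = eval_at g' R / eval_at h' R)"
    if 1: "(g, h) \<in> form_fractions V" "(g', h') \<in> form_fractions V"
  proof -
    from that obtain d d' R R' where 1: "homogeneous d g" "homogeneous d h" "R \<in> V" "eval_at h R \<noteq> 0"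
      and 2: "homogeneous d' g'" "homogeneous d' h'" "R' \<in> V" "eval_at h' R' \<noteq> 0"
      unfolding form_fractions_iff by blast
    have hom: "homogeneous (d + d') (g * h' - g' * h)"
      using homogeneous_mult[OF 1(1) 2(2)] homogeneous_mult[OF 2(1) 1(2)]
      by (auto simp: add.commute)
    have nz: "\<forall>\<^sub>F R in gen. eval_at h R \<noteq> 0 \<and> eval_at h' R \<noteq> 0"
      using eventually_form_nonzero[OF 1(2,3,4)] eventually_form_nonzero[OF 2(2,3,4)]
      by eventually_elim simp
    have "(\<forall>R\<in>V. eval_at (g * h' - g' * h) R = 0) \<longleftrightarrow> (\<forall>\<^sub>F R in gen. eval_at (g * h' - g' * h) R = 0)"
    proof
      assume "\<forall>R\<in>V. eval_at (g * h' - g' * h) R = 0"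
      then show "\<forall>\<^sub>F R in gen. eval_at (g * h' - g' * h) R = 0"
        by (intro eventually_mono[OF eventually_gen_in]) simp
    next
      assume "\<forall>\<^sub>F R in gen. eval_at (g * h' - g' * h) R = 0"
      from form_zero_if_eventually[OF hom this]
      show "\<forall>R\<in>V. eval_at (g * h' - g' * h) R = 0" by blast
    qed
    also have "\<dots> \<longleftrightarrow> (\<forall>\<^sub>F R in gen. eval_at g R / eval_at h R = eval_at g' R / eval_at h' R)"
      by (rule eventually_subst) (use nz in \<open>eventually_elim, simp add: field_simps\<close>)
    finally have *: "(\<forall>R\<in>V. eval_at (g * h' - g' * h) R = 0) \<longleftrightarrow>
      (\<forall>\<^sub>F R in gen. eval_at g R / eval_at h R = eval_at g' R / eval_at h' R)" .
    have "(\<exists>d. homogeneous d (g * h' - g' * h)) = True" using hom by blast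
    then show ?thesis unfolding vanishing_forms_def mem_Collect_eq * by (simp only: simp_thms)
  qed
  then show ?thesis unfolding fraction_rel_def by (simp only: mem_Collect_eq case_prod_conv) blast
qed

lemma equiv_fraction_rel: "equiv (form_fractions V) (fraction_rel V)"
proof (rule equivI)
  show "fraction_rel V \<subseteq> form_fractions V \<times> form_fractions V"
    unfolding fraction_rel_def by auto
  show "refl_on (form_fractions V) (fraction_rel V)"
    by (rule refl_onI) (auto simp: fraction_rel_iff)
  show "sym (fraction_rel V)"
    by (rule symI) (auto simp: fraction_rel_iff eq_commute)
  show "trans (fraction_rel V)"
  proof (rule transI)
    fix x y z assume xyz: "(x, y) \<in> fraction_rel V" "(y, z) \<in> fraction_rel V"
    obtain a b c d e f where "x = (a, b)" "y = (c, d)" "z = (e, f)" by (cases x, cases y, cases z)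
    then show "(x, z) \<in> fraction_rel V"
      using xyz by (auto simp: fraction_rel_iff elim: eventually_elim2)
  qed
qed

abbreviation cls :: "('a, 'n) mpoly \<Rightarrow> ('a, 'n) mpoly \<Rightarrow> ('a, 'n) ratfun" where
  "cls g h \<equiv> fraction_rel V `` {(g, h)}"

lemma carrier_FF: "carrier FF = form_fractions V // fraction_rel V"
  unfolding function_field_def by (simp only: partial_object.select_convs)

lemma cls_in_carrier: "(g, h) \<in> form_fractions V \<Longrightarrow> cls g h \<in> carrier FF"
  unfolding carrier_FF by (rule quotientI)

lemma in_cls: "(g, h) \<in> form_fractions V \<Longrightarrow> (g, h) \<in> cls g h"
  using equiv_class_self[OF equiv_fraction_rel] .

lemma carrier_memD:
  assumes "f \<in> carrier FF" "(g, h) \<in> f"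
  shows "(g, h) \<in> form_fractions V" "f = cls g h"
proof -
  obtain x where x: "x \<in> form_fractions V" "f = fraction_rel V `` {x}"
    using assms(1) unfolding carrier_FF by (rule quotientE)
  then have "(x, (g, h)) \<in> fraction_rel V" using assms(2) by auto
  then show "(g, h) \<in> form_fractions V" "f = cls g h"
    using x equiv_class_eq[OF equiv_fraction_rel, of x "(g, h)"] by (auto simp: fraction_rel_def)
qed

lemma carrier_nonempty:
  assumes "f \<in> carrier FF"
  obtains g h where "(g, h) \<in> f"
proof -
  obtain x where x: "x \<in> form_fractions V" "f = fraction_rel V `` {x}"
    using assms(1) unfolding carrier_FF by (rule quotientE)
  then have "x \<in> f" using equiv_class_self[OF equiv_fraction_rel] by blast
  then show ?thesis using that by (cases x) auto
qed

lemma cls_eq_iff: "(g, h) \<in> form_fractions V \<Longrightarrow> (g', h') \<in> form_fractions V \<Longrightarrow>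
    cls g h = cls g' h' \<longleftrightarrow> (\<forall>\<^sub>F R in gen. eval_at g R / eval_at h R = eval_at g' R / eval_at h' R)"
  using eq_equiv_class_iff[OF equiv_fraction_rel, of "(g, h)" "(g', h')"] by (simp add: fraction_rel_iff)

lemma fn_eq:
  assumes "f \<in> carrier FF" "(g, h) \<in> f"
  shows "\<forall>\<^sub>F R in gen. fn f R = eval_at g R / eval_at h R"
proof -
  obtain g' h' where gh: "(SOME x. x \<in> f) = (g', h')" by (cases "SOME x. x \<in> f")
  then have in': "(g', h') \<in> f" using assms(2) someI[of "\<lambda>x. x \<in> f" "(g, h)"] by simp
  have "cls g' h' = cls g h"
    using carrier_memD(2)[OF assms(1) in'] carrier_memD(2)[OF assms] by simp
  then have "\<forall>\<^sub>F R in gen. eval_at g' R / eval_at h' R = eval_at g R / eval_at h R"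
    using cls_eq_iff[OF carrier_memD(1)[OF assms(1) in'] carrier_memD(1)[OF assms]] by blast
  then show ?thesis by (simp add: fn_def gh)
qed

lemma fn_cls: "(g, h) \<in> form_fractions V \<Longrightarrow> \<forall>\<^sub>F R in gen. fn (cls g h) R = eval_at g R / eval_at h R"
  using fn_eq[OF cls_in_carrier in_cls] .

text \<open>Together with \<open>fn_surj\<close> this identifies the function field with the
  rational functions modulo generic equality, so that identities in \<open>FF\<close> can be checked
  on values.\<close>

lemma fn_inj:
  assumes "f \<in> carrier FF" "f' \<in> carrier FF" "\<forall>\<^sub>F R in gen. fn f R = fn f' R"
  shows "f = f'"
proof -
  obtain g h where g: "(g, h) \<in> f" by (rule carrier_nonempty[OF assms(1)])
  obtain g' h' where g': "(g', h') \<in> f'" by (rule carrier_nonempty[OF assms(2)])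
  note gh = g g'
  have "\<forall>\<^sub>F R in gen. eval_at g R / eval_at h R = eval_at g' R / eval_at h' R"
    using assms(3) fn_eq[OF assms(1) gh(1)] fn_eq[OF assms(2) gh(2)] by eventually_elim simp
  then have "cls g h = cls g' h'"
    using cls_eq_iff[OF carrier_memD(1)[OF assms(1) gh(1)] carrier_memD(1)[OF assms(2) gh(2)]] by blast
  then show ?thesis
    using carrier_memD(2)[OF assms(1) gh(1)] carrier_memD(2)[OF assms(2) gh(2)] by simp
qed

lemma fn_rat: "f \<in> carrier FF \<Longrightarrow> rat (fn f)"
proof -
  assume f: "f \<in> carrier FF"
  obtain g h where gh: "(g, h) \<in> f" by (rule carrier_nonempty[OF f])
  then show ?thesis
    using carrier_memD[OF f gh] fn_eq[OF f gh] by (auto simp: form_fractions_iff intro: ratI)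
qed

lemma fn_surj:
  assumes "rat F"
  obtains f where "f \<in> carrier FF" "\<forall>\<^sub>F R in gen. fn f R = F R"
proof -
  obtain d g h P where 1: "homogeneous d g" "homogeneous d h" "P \<in> V" "eval_at h P \<noteq> 0"
    "\<forall>\<^sub>F R in gen. F R = eval_at g R / eval_at h R" by (rule ratE[OF assms])
  then have gh: "(g, h) \<in> form_fractions V" by (auto simp: form_fractions_iff)
  have "\<forall>\<^sub>F R in gen. fn (cls g h) R = F R"
    using 1(5) fn_cls[OF gh] by eventually_elim simp
  then show ?thesis using that cls_in_carrier[OF gh] by blast
qed

lemma form_fractions_mult: "(g, h) \<in> form_fractions V \<Longrightarrow> (g', h') \<in> form_fractions V \<Longrightarrow>
   (g * g', h * h') \<in> form_fractions V \<and> (g * h' + g' * h, h * h') \<in> form_fractions V"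
proof -
  assume "(g, h) \<in> form_fractions V" "(g', h') \<in> form_fractions V"
  then obtain d d' R R' where 1: "homogeneous d g" "homogeneous d h" "R \<in> V" "eval_at h R \<noteq> 0"
      and 2: "homogeneous d' g'" "homogeneous d' h'" "R' \<in> V" "eval_at h' R' \<noteq> 0"
      unfolding form_fractions_iff by blast
  have "homogeneous (d + d') (g * g')" "homogeneous (d + d') (h * h')"
     "homogeneous (d + d') (g * h' + g' * h)"
    using homogeneous_mult[OF 1(1) 2(2)] homogeneous_mult[OF 2(1) 1(2)]
      homogeneous_mult[OF 1(1) 2(1)] homogeneous_mult[OF 1(2) 2(2)]
    by (auto simp: add.commute[of d' d])
  moreover have "\<exists>R\<in>V. eval_at (h * h') R \<noteq> 0"
    using form_mult_vanish[OF 1(2) 2(2)] 1 2 by auto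
  ultimately show ?thesis unfolding form_fractions_iff by blast
qed

text \<open>The ring operations are unions over all pairs of representatives. All the united classes
  coincide, so any one pair computes the result.\<close>

lemma UN_pair_const:
  assumes "(g, h) \<in> f" "(g', h') \<in> f'" "\<And>a b a' b'. (a, b) \<in> f \<Longrightarrow> (a', b') \<in> f' \<Longrightarrow> T a b a' b' = U"
  shows "(\<Union>(a, b)\<in>f. \<Union>(a', b')\<in>f'. T a b a' b') = U"
proof -
  have "(\<Union>(a, b)\<in>f. \<Union>(a', b')\<in>f'. T a b a' b') = (\<Union>x\<in>f. \<Union>y\<in>f'. U)"
    by (intro SUP_cong refl) (auto simp: assms(3) split: prod.split)
  also have "\<dots> = U" using assms(1,2) by blast
  finally show ?thesis .
qed

lemma mult_FF:
  assumes "f \<in> carrier FF" "f' \<in> carrier FF" "(g, h) \<in> f" "(g', h') \<in> f'"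
  shows "f \<otimes>\<^bsub>FF\<^esub> f' = cls (g * g') (h * h')"
proof -
  have ev: "\<forall>\<^sub>F R in gen. eval_at (a * a') R / eval_at (b * b') R = fn f R * fn f' R"
    if ab: "(a, b) \<in> f" "(a', b') \<in> f'" for a b a' b'
    using fn_eq[OF assms(1) ab(1)] fn_eq[OF assms(2) ab(2)] by eventually_elim simp
  have *: "cls (a * a') (b * b') = cls (g * g') (h * h')" if "(a, b) \<in> f" "(a', b') \<in> f'" for a b a' b'
  proof (subst cls_eq_iff)
    show "\<forall>\<^sub>F R in gen. eval_at (a * a') R / eval_at (b * b') R = eval_at (g * g') R / eval_at (h * h') R"
      using ev[OF that] ev[OF assms(3,4)] by eventually_elim simp
  qed (simp_all only: form_fractions_mult[OF carrier_memD(1)[OF assms(1) that(1)] carrier_memD(1)[OF assms(2) that(2)]]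
      form_fractions_mult[OF carrier_memD(1)[OF assms(1,3)] carrier_memD(1)[OF assms(2,4)]])
  have "f \<otimes>\<^bsub>FF\<^esub> f' = (\<Union>(a, b)\<in>f. \<Union>(a', b')\<in>f'. cls (a * a') (b * b'))"
    unfolding function_field_def by (simp only: monoid.select_convs ring.select_convs)
  also have "\<dots> = cls (g * g') (h * h')"
    using assms(3,4) by (rule UN_pair_const) (rule *)
  finally show ?thesis .
qed

lemma add_FF:
  assumes "f \<in> carrier FF" "f' \<in> carrier FF" "(g, h) \<in> f" "(g', h') \<in> f'"
  shows "f \<oplus>\<^bsub>FF\<^esub> f' = cls (g * h' + g' * h) (h * h')"
proof -
  have ev: "\<forall>\<^sub>F R in gen. eval_at (a * b' + a' * b) R / eval_at (b * b') R = fn f R + fn f' R"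
    if ab: "(a, b) \<in> f" "(a', b') \<in> f'" for a b a' b'
  proof -
    obtain d d' R R' where 1: "homogeneous d b" "R \<in> V" "eval_at b R \<noteq> 0"
      and 2: "homogeneous d' b'" "R' \<in> V" "eval_at b' R' \<noteq> 0"
      using carrier_memD(1)[OF assms(1) ab(1)] carrier_memD(1)[OF assms(2) ab(2)]
      unfolding form_fractions_iff by blast
    show ?thesis
      using fn_eq[OF assms(1) ab(1)] fn_eq[OF assms(2) ab(2)]
        eventually_form_nonzero[OF 1] eventually_form_nonzero[OF 2]
      by eventually_elim (simp add: add_frac_eq)
  qed
  have *: "cls (a * b' + a' * b) (b * b') = cls (g * h' + g' * h) (h * h')"
    if "(a, b) \<in> f" "(a', b') \<in> f'" for a b a' b'
  proof (subst cls_eq_iff)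
    show "\<forall>\<^sub>F R in gen. eval_at (a * b' + a' * b) R / eval_at (b * b') R =
        eval_at (g * h' + g' * h) R / eval_at (h * h') R"
      using ev[OF that] ev[OF assms(3,4)] by eventually_elim simp
  qed (simp_all only: form_fractions_mult[OF carrier_memD(1)[OF assms(1) that(1)] carrier_memD(1)[OF assms(2) that(2)]]
      form_fractions_mult[OF carrier_memD(1)[OF assms(1,3)] carrier_memD(1)[OF assms(2,4)]])
  have "f \<oplus>\<^bsub>FF\<^esub> f' = (\<Union>(a, b)\<in>f. \<Union>(a', b')\<in>f'. cls (a * b' + a' * b) (b * b'))"
    unfolding function_field_def by (simp only: monoid.select_convs ring.select_convs)
  also have "\<dots> = cls (g * h' + g' * h) (h * h')"
    using assms(3,4) by (rule UN_pair_const) (rule *)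
  finally show ?thesis .
qed

lemma FF_closed:
  assumes "f \<in> carrier FF" "f' \<in> carrier FF"
  shows "f \<otimes>\<^bsub>FF\<^esub> f' \<in> carrier FF" "f \<oplus>\<^bsub>FF\<^esub> f' \<in> carrier FF"
    and fn_mult: "\<forall>\<^sub>F R in gen. fn (f \<otimes>\<^bsub>FF\<^esub> f') R = fn f R * fn f' R"
    and fn_add: "\<forall>\<^sub>F R in gen. fn (f \<oplus>\<^bsub>FF\<^esub> f') R = fn f R + fn f' R"
proof -
  obtain g h where g: "(g, h) \<in> f" by (rule carrier_nonempty[OF assms(1)])
  obtain g' h' where g': "(g', h') \<in> f'" by (rule carrier_nonempty[OF assms(2)])
  note gh = g g'
  have ff: "(g, h) \<in> form_fractions V" "(g', h') \<in> form_fractions V"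
    by (rule carrier_memD(1)[OF assms(1) gh(1)], rule carrier_memD(1)[OF assms(2) gh(2)])
  have ff': "(g * g', h * h') \<in> form_fractions V" "(g * h' + g' * h, h * h') \<in> form_fractions V"
    using form_fractions_mult[OF ff] by auto
  show "f \<otimes>\<^bsub>FF\<^esub> f' \<in> carrier FF" "f \<oplus>\<^bsub>FF\<^esub> f' \<in> carrier FF"
    unfolding mult_FF[OF assms gh] add_FF[OF assms gh] using ff' by (auto intro: cls_in_carrier)
  show "\<forall>\<^sub>F R in gen. fn (f \<otimes>\<^bsub>FF\<^esub> f') R = fn f R * fn f' R"
    unfolding mult_FF[OF assms gh]
    using fn_cls[OF ff'(1)] fn_eq[OF assms(1) gh(1)] fn_eq[OF assms(2) gh(2)] by eventually_elim simp
  obtain d d' R R' where 1: "homogeneous d h" "R \<in> V" "eval_at h R \<noteq> 0"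
    and 2: "homogeneous d' h'" "R' \<in> V" "eval_at h' R' \<noteq> 0"
    using ff unfolding form_fractions_iff by blast
  show "\<forall>\<^sub>F R in gen. fn (f \<oplus>\<^bsub>FF\<^esub> f') R = fn f R + fn f' R"
    unfolding add_FF[OF assms gh]
    using fn_cls[OF ff'(2)] fn_eq[OF assms(1) gh(1)] fn_eq[OF assms(2) gh(2)]
      eventually_form_nonzero[OF 1] eventually_form_nonzero[OF 2]
    by eventually_elim (simp add: add_frac_eq)
qed

lemma const_form_fraction: "(Cst c, 1) \<in> form_fractions V"
  using irreducible unfolding form_fractions_iff by (auto simp: zariski_irreducible_def intro!: exI[of _ 0])

definition cnst :: "'a \<Rightarrow> ('a, 'n) ratfun" where
  "cnst c = cls (Cst c) 1"

lemma cnst_carrier [simp, intro]: "cnst c \<in> carrier FF"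
  unfolding cnst_def by (rule cls_in_carrier[OF const_form_fraction])

lemma fn_cnst: "\<forall>\<^sub>F R in gen. fn (cnst c) R = c"
  unfolding cnst_def using fn_cls[OF const_form_fraction[of c]] by simp

lemma one_FF: "\<one>\<^bsub>FF\<^esub> = cnst 1" and zero_FF: "\<zero>\<^bsub>FF\<^esub> = cnst 0"
  unfolding function_field_def cnst_def single_one single_zero
  by (simp_all only: monoid.select_convs ring.select_convs)

lemma fn_eqI:
  assumes "f \<in> carrier FF" "f' \<in> carrier FF" "\<forall>\<^sub>F R in gen. fn f R = F R" "\<forall>\<^sub>F R in gen. fn f' R = F R"
  shows "f = f'"
  by (rule fn_inj[OF assms(1,2)]) (use assms(3,4) in \<open>eventually_elim, simp\<close>)

sublocale FF: Ring.field "FF"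
proof -
  note cl = FF_closed
  have "cring FF"
  proof (rule cringI)
    show "abelian_group FF"
    proof (rule abelian_groupI)
      fix x y z assume x: "x \<in> carrier FF" and y: "y \<in> carrier FF" and z: "z \<in> carrier FF"
      show "x \<oplus>\<^bsub>FF\<^esub> y \<in> carrier FF" using x y by (rule cl)
      show "x \<oplus>\<^bsub>FF\<^esub> y \<oplus>\<^bsub>FF\<^esub> z = x \<oplus>\<^bsub>FF\<^esub> (y \<oplus>\<^bsub>FF\<^esub> z)"
      proof (rule fn_inj)
        show "\<forall>\<^sub>F R in gen. fn (x \<oplus>\<^bsub>FF\<^esub> y \<oplus>\<^bsub>FF\<^esub> z) R = fn (x \<oplus>\<^bsub>FF\<^esub> (y \<oplus>\<^bsub>FF\<^esub> z)) R"
          using fn_add[OF cl(2)[OF x y] z] fn_add[OF x y] fn_add[OF x cl(2)[OF y z]] fn_add[OF y z]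
          by eventually_elim (simp add: add.assoc)
      qed (use x y z cl in auto)
      show "x \<oplus>\<^bsub>FF\<^esub> y = y \<oplus>\<^bsub>FF\<^esub> x"
      proof (rule fn_inj)
        show "\<forall>\<^sub>F R in gen. fn (x \<oplus>\<^bsub>FF\<^esub> y) R = fn (y \<oplus>\<^bsub>FF\<^esub> x) R"
          using fn_add[OF x y] fn_add[OF y x] by eventually_elim (simp add: add.commute)
      qed (use x y cl in auto)
      show "\<zero>\<^bsub>FF\<^esub> \<oplus>\<^bsub>FF\<^esub> x = x"
      proof (rule fn_inj)
        show "\<forall>\<^sub>F R in gen. fn (\<zero>\<^bsub>FF\<^esub> \<oplus>\<^bsub>FF\<^esub> x) R = fn x R"
          using fn_add[OF cnst_carrier[of 0] x] fn_cnst[of 0] unfolding zero_FF by eventually_elim simp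
      qed (use x cl in \<open>auto simp: zero_FF\<close>)
      obtain y where y: "y \<in> carrier FF" "\<forall>\<^sub>F R in gen. fn y R = - fn x R"
        by (rule fn_surj[OF rat_uminus[OF fn_rat[OF x]]])
      have "y \<oplus>\<^bsub>FF\<^esub> x = \<zero>\<^bsub>FF\<^esub>"
      proof (rule fn_inj)
        show "\<forall>\<^sub>F R in gen. fn (y \<oplus>\<^bsub>FF\<^esub> x) R = fn \<zero>\<^bsub>FF\<^esub> R"
          using fn_add[OF y(1) x] y(2) fn_cnst[of 0] unfolding zero_FF by eventually_elim simp
      qed (use x y cl in \<open>auto simp: zero_FF\<close>)
      then show "\<exists>y\<in>carrier FF. y \<oplus>\<^bsub>FF\<^esub> x = \<zero>\<^bsub>FF\<^esub>" using y(1) by blast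
    qed (simp add: zero_FF)
    show "comm_monoid FF"
    proof (rule comm_monoidI)
      fix x y z assume x: "x \<in> carrier FF" and y: "y \<in> carrier FF" and z: "z \<in> carrier FF"
      show "x \<otimes>\<^bsub>FF\<^esub> y \<in> carrier FF" using x y by (rule cl)
      show "x \<otimes>\<^bsub>FF\<^esub> y \<otimes>\<^bsub>FF\<^esub> z = x \<otimes>\<^bsub>FF\<^esub> (y \<otimes>\<^bsub>FF\<^esub> z)"
      proof (rule fn_inj)
        show "\<forall>\<^sub>F R in gen. fn (x \<otimes>\<^bsub>FF\<^esub> y \<otimes>\<^bsub>FF\<^esub> z) R = fn (x \<otimes>\<^bsub>FF\<^esub> (y \<otimes>\<^bsub>FF\<^esub> z)) R"
          using fn_mult[OF cl(1)[OF x y] z] fn_mult[OF x y] fn_mult[OF x cl(1)[OF y z]] fn_mult[OF y z]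
          by eventually_elim (simp add: mult.assoc)
      qed (use x y z cl in auto)
      show "x \<otimes>\<^bsub>FF\<^esub> y = y \<otimes>\<^bsub>FF\<^esub> x"
      proof (rule fn_inj)
        show "\<forall>\<^sub>F R in gen. fn (x \<otimes>\<^bsub>FF\<^esub> y) R = fn (y \<otimes>\<^bsub>FF\<^esub> x) R"
          using fn_mult[OF x y] fn_mult[OF y x] by eventually_elim (simp add: mult.commute)
      qed (use x y cl in auto)
      show "\<one>\<^bsub>FF\<^esub> \<otimes>\<^bsub>FF\<^esub> x = x"
      proof (rule fn_inj)
        show "\<forall>\<^sub>F R in gen. fn (\<one>\<^bsub>FF\<^esub> \<otimes>\<^bsub>FF\<^esub> x) R = fn x R"
          using fn_mult[OF cnst_carrier[of 1] x] fn_cnst[of 1] unfolding one_FF by eventually_elim simp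
      qed (use x cl in \<open>auto simp: one_FF\<close>)
    qed (simp add: one_FF)
    fix x y z assume x: "x \<in> carrier FF" and y: "y \<in> carrier FF" and z: "z \<in> carrier FF"
    show "(x \<oplus>\<^bsub>FF\<^esub> y) \<otimes>\<^bsub>FF\<^esub> z = x \<otimes>\<^bsub>FF\<^esub> z \<oplus>\<^bsub>FF\<^esub> y \<otimes>\<^bsub>FF\<^esub> z"
    proof (rule fn_inj)
      show "\<forall>\<^sub>F R in gen. fn ((x \<oplus>\<^bsub>FF\<^esub> y) \<otimes>\<^bsub>FF\<^esub> z) R = fn (x \<otimes>\<^bsub>FF\<^esub> z \<oplus>\<^bsub>FF\<^esub> y \<otimes>\<^bsub>FF\<^esub> z) R"
        using fn_mult[OF cl(2)[OF x y] z] fn_add[OF x y] fn_add[OF cl(1)[OF x z] cl(1)[OF y z]]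
          fn_mult[OF x z] fn_mult[OF y z]
        by eventually_elim (simp add: distrib_right)
    qed (use x y z cl in auto)
  qed
  then show "Ring.field FF"
  proof (rule cring.cring_fieldI2)
    show "\<zero>\<^bsub>FF\<^esub> \<noteq> \<one>\<^bsub>FF\<^esub>"
    proof
      assume "\<zero>\<^bsub>FF\<^esub> = \<one>\<^bsub>FF\<^esub>"
      then have "cnst 0 = cnst 1" by (simp add: one_FF zero_FF)
      then have "\<forall>\<^sub>F R in gen. fn (cnst 1) R = 0" using fn_cnst[of 0] by simp
      then have "\<forall>\<^sub>F R in gen. False"
        using fn_cnst[of 1] by eventually_elim simp
      then show False by simp
    qed
    fix a assume a: "a \<in> carrier FF" "a \<noteq> \<zero>\<^bsub>FF\<^esub>"
    have "\<not> (\<forall>\<^sub>F R in gen. fn a R = 0)"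
      using fn_eqI[OF a(1) cnst_carrier[of 0], of "\<lambda>_. 0"] fn_cnst[of 0] a(2) by (auto simp: zero_FF)
    then have nz: "\<forall>\<^sub>F R in gen. fn a R \<noteq> 0"
      using rat_zero_or_nonzero[OF fn_rat[OF a(1)]] by blast
    obtain b where b: "b \<in> carrier FF" "\<forall>\<^sub>F R in gen. fn b R = inverse (fn a R)"
      by (rule fn_surj[OF rat_inverse[OF fn_rat[OF a(1)]]])
    have "a \<otimes>\<^bsub>FF\<^esub> b = \<one>\<^bsub>FF\<^esub>"
    proof (rule fn_inj)
      show "\<forall>\<^sub>F R in gen. fn (a \<otimes>\<^bsub>FF\<^esub> b) R = fn \<one>\<^bsub>FF\<^esub> R"
        using fn_mult[OF a(1) b(1)] b(2) nz fn_cnst[of 1] unfolding one_FF by eventually_elim simp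
    qed (use a b cl in \<open>auto simp: one_FF\<close>)
    then show "\<exists>b\<in>carrier FF. a \<otimes>\<^bsub>FF\<^esub> b = \<one>\<^bsub>FF\<^esub>" using b(1) by blast
  qed
qed

lemma fn_one: "\<forall>\<^sub>F R in gen. fn \<one>\<^bsub>FF\<^esub> R = 1" and fn_zero: "\<forall>\<^sub>F R in gen. fn \<zero>\<^bsub>FF\<^esub> R = 0"
  unfolding one_FF zero_FF by (rule fn_cnst)+

lemma fn_zero_iff: "f \<in> carrier FF \<Longrightarrow> f = \<zero>\<^bsub>FF\<^esub> \<longleftrightarrow> (\<forall>\<^sub>F R in gen. fn f R = 0)"
  using fn_zero zero_FF cnst_carrier[of 0] fn_eqI[of f "\<zero>\<^bsub>FF\<^esub>" "\<lambda>_. 0"] by metis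

lemma fn_nonzero: "f \<in> carrier FF \<Longrightarrow> f \<noteq> \<zero>\<^bsub>FF\<^esub> \<Longrightarrow> (\<forall>\<^sub>F R in gen. fn f R \<noteq> 0)"
  using fn_zero_iff rat_zero_or_nonzero[OF fn_rat] by blast

lemma fn_a_inv:
  assumes f: "f \<in> carrier FF"
  shows "\<forall>\<^sub>F R in gen. fn (\<ominus>\<^bsub>FF\<^esub> f) R = - fn f R"
proof -
  have "\<forall>\<^sub>F R in gen. fn f R + fn (\<ominus>\<^bsub>FF\<^esub> f) R = 0"
    using fn_add[OF f FF.a_inv_closed[OF f], unfolded FF.r_neg[OF f]] fn_zero by eventually_elim simp
  then show ?thesis by eventually_elim (simp add: eq_neg_iff_add_eq_0 add.commute)
qed

lemma fn_inv:
  assumes f: "f \<in> carrier FF" "f \<noteq> \<zero>\<^bsub>FF\<^esub>"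
  shows "inv\<^bsub>FF\<^esub> f \<in> carrier FF" "\<forall>\<^sub>F R in gen. fn (inv\<^bsub>FF\<^esub> f) R = inverse (fn f R)"
proof -
  have u: "f \<in> Units FF" using f FF.field_Units by blast
  then show i: "inv\<^bsub>FF\<^esub> f \<in> carrier FF" by simp
  have "\<forall>\<^sub>F R in gen. fn f R * fn (inv\<^bsub>FF\<^esub> f) R = 1"
    using fn_mult[OF f(1) i, unfolded FF.Units_r_inv[OF u]] fn_one by eventually_elim simp
  then show "\<forall>\<^sub>F R in gen. fn (inv\<^bsub>FF\<^esub> f) R = inverse (fn f R)"
    by eventually_elim (metis inverse_unique)
qed

lemma fn_pow:
  assumes f: "f \<in> carrier FF"
  shows "\<forall>\<^sub>F R in gen. fn (f [^]\<^bsub>FF\<^esub> (n::nat)) R = fn f R ^ n"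
proof (induction n)
  case 0
  then show ?case using fn_one by simp
next
  case (Suc n)
  show ?case
    using Suc fn_mult[OF FF.nat_pow_closed[OF f, of n] f] unfolding FF.nat_pow_Suc
    by eventually_elim (simp add: mult.commute)
qed

lemma fn_int_pow:
  assumes f: "f \<in> carrier FF" "f \<noteq> \<zero>\<^bsub>FF\<^esub>"
  shows "f [^]\<^bsub>FF\<^esub> (n::int) \<in> carrier FF" "\<forall>\<^sub>F R in gen. fn (f [^]\<^bsub>FF\<^esub> n) R = fn f R powi n"
proof -
  have nz: "f [^]\<^bsub>FF\<^esub> m \<noteq> \<zero>\<^bsub>FF\<^esub>" for m :: nat
  proof
    assume "f [^]\<^bsub>FF\<^esub> m = \<zero>\<^bsub>FF\<^esub>"
    then have "\<forall>\<^sub>F R in gen. fn (f [^]\<^bsub>FF\<^esub> m) R = 0" using fn_zero by simp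
    then have "\<forall>\<^sub>F R in gen. False"
      using fn_pow[OF f(1), of m] fn_nonzero[OF f] by eventually_elim simp
    then show False by simp
  qed
  show "f [^]\<^bsub>FF\<^esub> n \<in> carrier FF"
    using FF.nat_pow_closed[OF f(1)] fn_inv(1)[OF FF.nat_pow_closed[OF f(1)] nz]
    unfolding int_pow_def2 by (split if_split) blast
  show "\<forall>\<^sub>F R in gen. fn (f [^]\<^bsub>FF\<^esub> n) R = fn f R powi n"
  proof (cases "n < 0")
    case True
    then have eq: "f [^]\<^bsub>FF\<^esub> n = inv\<^bsub>FF\<^esub> (f [^]\<^bsub>FF\<^esub> nat (- n))"
      unfolding int_pow_def2 by (rule if_P)
    show ?thesis
      unfolding eq using fn_inv(2)[OF FF.nat_pow_closed[OF f(1)] nz, of "nat (- n)"]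
        fn_pow[OF f(1), of "nat (- n)"]
      by eventually_elim (use True in \<open>simp add: power_int_def power_inverse\<close>)
  next
    case False
    then have eq: "f [^]\<^bsub>FF\<^esub> n = f [^]\<^bsub>FF\<^esub> nat n"
      unfolding int_pow_def2 by (rule if_not_P)
    show ?thesis unfolding eq using fn_pow[OF f(1), of "nat n"]
      by eventually_elim (use False in \<open>simp add: power_int_def\<close>)
  qed
qed

section \<open>Local rings and values of rational functions at points\<close>

lemma local_ring_iff:
  assumes "P \<in> V"
  shows "f \<in> local_ring V P \<longleftrightarrow> f \<in> carrier FF \<and> (\<exists>c. regv P (fn f) c)"
proof
  assume "f \<in> local_ring V P"
  then obtain g h where f: "f \<in> carrier FF" "(g, h) \<in> f" "eval_at h P \<noteq> 0"
    unfolding local_ring_def by auto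
  then show "f \<in> carrier FF \<and> (\<exists>c. regv P (fn f) c)"
    using carrier_memD(1)[OF f(1,2)] fn_eq[OF f(1,2)] by (auto simp: form_fractions_iff intro: regvI)
next
  assume "f \<in> carrier FF \<and> (\<exists>c. regv P (fn f) c)"
  then obtain d g h where f: "f \<in> carrier FF" and 1: "homogeneous d g" "homogeneous d h" "eval_at h P \<noteq> 0"
     "\<forall>\<^sub>F R in gen. fn f R = eval_at g R / eval_at h R"
    unfolding regv_def by blast
  have gh: "(g, h) \<in> form_fractions V" using 1 assms by (auto simp: form_fractions_iff)
  have "f = cls g h"
    using f cls_in_carrier[OF gh] 1(4) fn_cls[OF gh] by (rule fn_eqI)
  then show "f \<in> local_ring V P" using f 1(3) in_cls[OF gh] unfolding local_ring_def by auto
qed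

text \<open>\<open>ratfun_value\<close> is a definite description; by \<open>regv_unique\<close>
  every representative whose denominator is nonzero at P yields the same c.\<close>

lemma ratfun_value_eq:
  assumes "P \<in> V" "f \<in> carrier FF" "regv P (fn f) c"
  shows "ratfun_value f P = c"
  unfolding ratfun_value_def
proof (rule the_equality)
  have val: "c = eval_at g P / eval_at h P" if "(g, h) \<in> f" "eval_at h P \<noteq> 0" for g h
  proof -
    have "regv P (fn f) (eval_at g P / eval_at h P)"
      using carrier_memD(1)[OF assms(2) that(1)] fn_eq[OF assms(2) that(1)] that(2)
      by (auto simp: form_fractions_iff intro: regvI)
    then show ?thesis using regv_unique[OF assms(1,3)] by simp
  qed
  have "f \<in> local_ring V P"
    unfolding local_ring_iff[OF assms(1)] using assms(2,3) by blast
  then obtain g h where "(g, h) \<in> f" "eval_at h P \<noteq> 0"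
    unfolding local_ring_def by blast
  then show "\<exists>(g, h)\<in>f. eval_at h P \<noteq> 0 \<and> c = eval_at g P / eval_at h P"
    using val by blast
  fix e assume "\<exists>(g, h)\<in>f. eval_at h P \<noteq> 0 \<and> e = eval_at g P / eval_at h P"
  then show "e = c" using val by blast
qed

end

section \<open>Algebraic dependence in the function field\<close>

text \<open>Transitivity through the tower E, E(t), E(t, f) with E = K(y): both steps are finite, so
  every element at the top is algebraic over E. It lets y take over from t as a transcendence
  basis.\<close>

lemma (in Ring.field) algebraic_exchange:
  assumes K: "K \<subseteq> carrier R" and t: "t \<in> carrier R" and y: "y \<in> carrier R" and f: "f \<in> carrier R"
    and t_alg: "(algebraic over (generate_field R (insert y K))) t"
    and f_alg: "(algebraic over (generate_field R (insert t K))) f"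
  shows "(algebraic over (generate_field R (insert y K))) f"
proof -
  let ?E = "generate_field R (insert y K)"
  have E: "subfield ?E R" using K y by (intro generate_field_is_subfield) auto
  let ?L = "simple_extension ?E t"
  have L: "subfield ?L R" using simple_extension_is_subfield[OF E t] t_alg by blast
  have EL: "?E \<subseteq> ?L" using simple_extension_incl[OF subfieldE(3)[OF E] t] .
  have tL: "t \<in> ?L" using simple_extension_mem[OF subfieldE(1)[OF E] t] .
  have "K \<subseteq> ?E" by (auto intro: generate_field.incl)
  then have "generate_field R (insert t K) \<subseteq> ?L"
    using K t EL tL by (intro generate_field_min_subfield1[OF _ L]) auto
  then have fL: "(algebraic over ?L) f" using f_alg by (rule algebraic_mono)
  have 1: "finite_dimension ?E ?L"
    using finite_dimension_simple_extension[OF E t] t_alg by blast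
  have 2: "finite_dimension ?L (simple_extension ?L f)"
    using finite_dimension_simple_extension[OF L f] fL by blast
  have "finite_dimension ?E (simple_extension ?L f)"
    by (rule telescopic_base_dim(1)[OF E L 1 2])
  then show ?thesis
    using finite_dimension_imp_algebraic[OF E simple_extension_is_subring[OF subfieldE(1)[OF L] f]]
      simple_extension_mem[OF subfieldE(1)[OF L] f] by blast
qed

text \<open>A polynomial in two variables, with y the outer one. Relations in this form have no
  denominators and can be evaluated at single points.\<close>

definition poly2 :: "'a::comm_ring_1 poly poly \<Rightarrow> 'a \<Rightarrow> 'a \<Rightarrow> 'a" where
  "poly2 p x y = poly (map_poly (\<lambda>q. poly q x) p) y"

lemma poly2_0 [simp]: "poly2 0 x y = 0"
  by (simp add: poly2_def)

lemma poly2_pCons [simp]: "poly2 (pCons q p) x y = poly q x + y * poly2 p x y"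
  by (simp add: poly2_def map_poly_pCons)

lemma poly2_add: "poly2 (p + q) x y = poly2 p x y + poly2 q x y"
  by (induction p q rule: poly_induct2) (auto simp: algebra_simps)

lemma poly2_smult: "poly2 (Polynomial.smult c p) x y = poly c x * poly2 p x y"
  by (induction p) (auto simp: algebra_simps)

lemma poly2_monom: "poly2 (Polynomial.monom c n) x y = poly c x * y ^ n"
  by (induction n) (auto simp: Polynomial.monom_0 Polynomial.monom_Suc)

lemma poly2_altdef:
  assumes "\<And>i. i \<ge> N \<Longrightarrow> Polynomial.coeff p i = 0"
  shows "poly2 p x y = (\<Sum>i<N. poly (Polynomial.coeff p i) x * y ^ i)"
  using assms
proof (induction p arbitrary: N)
  case (pCons q p)
  show ?case
  proof (cases N)
    case 0
    then have "pCons q p = 0" using pCons.prems by (intro poly_eqI) simp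
    then show ?thesis using pCons.hyps by simp
  next
    case (Suc M)
    have "Polynomial.coeff p i = 0" if "i \<ge> M" for i
      using pCons.prems[of "Suc i"] that Suc by simp
    from pCons.IH[OF this] show ?thesis
      by (simp add: Suc sum.lessThan_Suc_shift sum_distrib_left mult_ac del: sum.lessThan_Suc)
  qed
qed simp

context irreducible_variety begin

lemma cnst_eqI: "f \<in> carrier FF \<Longrightarrow> \<forall>\<^sub>F R in gen. fn f R = c \<Longrightarrow> f = cnst c"
  by (rule fn_eqI[OF _ cnst_carrier _ fn_cnst])

lemma constant_functions_eq: "constant_functions V = range cnst"
  unfolding constant_functions_def cnst_def by auto

lemma subfield_constants: "subfield (range cnst) FF"
proof (rule FF.subfieldI')
  show "subring (range cnst) FF"
  proof (rule FF.subringI)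
    show "range cnst \<subseteq> carrier FF" by auto
    show "\<one>\<^bsub>FF\<^esub> \<in> range cnst" unfolding one_FF by simp
    fix x y assume "x \<in> range cnst" "y \<in> range cnst"
    then obtain a b where xy: "x = cnst a" "y = cnst b" by blast
    have "\<ominus>\<^bsub>FF\<^esub> x = cnst (- a)"
    proof (rule cnst_eqI)
      show "\<forall>\<^sub>F R in gen. fn (\<ominus>\<^bsub>FF\<^esub> x) R = - a"
        unfolding xy using fn_a_inv[OF cnst_carrier[of a]] fn_cnst[of a] by eventually_elim simp
    qed (simp add: xy)
    then show "\<ominus>\<^bsub>FF\<^esub> x \<in> range cnst" by simp
    have "x \<otimes>\<^bsub>FF\<^esub> y = cnst (a * b)"
    proof (rule cnst_eqI)
      show "\<forall>\<^sub>F R in gen. fn (x \<otimes>\<^bsub>FF\<^esub> y) R = a * b"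
        unfolding xy using fn_mult[OF cnst_carrier[of a] cnst_carrier[of b]] fn_cnst[of a] fn_cnst[of b]
        by eventually_elim simp
    qed (simp add: xy)
    then show "x \<otimes>\<^bsub>FF\<^esub> y \<in> range cnst" by simp
    have "x \<oplus>\<^bsub>FF\<^esub> y = cnst (a + b)"
    proof (rule cnst_eqI)
      show "\<forall>\<^sub>F R in gen. fn (x \<oplus>\<^bsub>FF\<^esub> y) R = a + b"
        unfolding xy using fn_add[OF cnst_carrier[of a] cnst_carrier[of b]] fn_cnst[of a] fn_cnst[of b]
        by eventually_elim simp
    qed (simp add: xy)
    then show "x \<oplus>\<^bsub>FF\<^esub> y \<in> range cnst" by simp
  qed
  fix x assume "x \<in> range cnst - {\<zero>\<^bsub>FF\<^esub>}"
  then obtain a where x: "x = cnst a" "x \<noteq> \<zero>\<^bsub>FF\<^esub>" by blast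
  have xc: "x \<in> carrier FF" by (simp add: x)
  have "inv\<^bsub>FF\<^esub> x = cnst (inverse a)"
  proof (rule cnst_eqI)
    show "\<forall>\<^sub>F R in gen. fn (inv\<^bsub>FF\<^esub> x) R = inverse a"
      using fn_inv(2)[OF xc x(2)] fn_cnst[of a] unfolding x(1) by eventually_elim simp
  qed (rule fn_inv(1)[OF xc x(2)])
  then show "inv\<^bsub>FF\<^esub> x \<in> range cnst" by simp
qed

text \<open>Fractions of polynomials in z contain z and the constants and are closed under the field
  operations; this form is what clearing denominators needs.\<close>

lemma generate_field_as_quotient:
  assumes z: "z \<in> carrier FF" and w: "w \<in> generate_field FF (insert z (range cnst))"
  shows "\<exists>p q. (\<forall>\<^sub>F R in gen. poly q (fn z R) \<noteq> 0) \<and> (\<forall>\<^sub>F R in gen. fn w R = poly p (fn z R) / poly q (fn z R))"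
  using w
proof (induction rule: generate_field.induct)
  case one
  show ?case by (intro exI[of _ 1]) (use fn_one in simp)
next
  case (incl h)
  then consider "h = z" | c where "h = cnst c" by blast
  then show ?case
  proof cases
    case 1
    then show ?thesis by (intro exI[of _ "[:0, 1:]"] exI[of _ 1]) simp
  next
    case 2
    then show ?thesis using fn_cnst[of c] by (intro exI[of _ "[:c:]"] exI[of _ 1]) simp
  qed
next
  case (a_inv h)
  then obtain p q where pq: "\<forall>\<^sub>F R in gen. poly q (fn z R) \<noteq> 0"
    "\<forall>\<^sub>F R in gen. fn h R = poly p (fn z R) / poly q (fn z R)" by blast
  have h: "h \<in> carrier FF" using FF.generate_field_in_carrier[OF _ a_inv.hyps] z by auto
  have "\<forall>\<^sub>F R in gen. fn (\<ominus>\<^bsub>FF\<^esub> h) R = poly (- p) (fn z R) / poly q (fn z R)"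
    using fn_a_inv[OF h] pq(2) by eventually_elim simp
  with pq(1) show ?case by blast
next
  case (m_inv h)
  then obtain p q where pq: "\<forall>\<^sub>F R in gen. poly q (fn z R) \<noteq> 0"
    "\<forall>\<^sub>F R in gen. fn h R = poly p (fn z R) / poly q (fn z R)" by blast
  have h: "h \<in> carrier FF" using FF.generate_field_in_carrier[OF _ m_inv.hyps(1)] z by auto
  have 1: "\<forall>\<^sub>F R in gen. poly p (fn z R) \<noteq> 0"
    using fn_nonzero[OF h m_inv.hyps(2)] pq(2) by eventually_elim auto
  have 2: "\<forall>\<^sub>F R in gen. fn (inv\<^bsub>FF\<^esub> h) R = poly q (fn z R) / poly p (fn z R)"
    using fn_inv(2)[OF h m_inv.hyps(2)] pq(2) by eventually_elim simp
  from 1 2 show ?case by blast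
next
  case (eng_add h1 h2)
  then obtain p q p' q' where pq: "\<forall>\<^sub>F R in gen. poly q (fn z R) \<noteq> 0"
    "\<forall>\<^sub>F R in gen. fn h1 R = poly p (fn z R) / poly q (fn z R)"
    "\<forall>\<^sub>F R in gen. poly q' (fn z R) \<noteq> 0"
    "\<forall>\<^sub>F R in gen. fn h2 R = poly p' (fn z R) / poly q' (fn z R)" by blast
  have h: "h1 \<in> carrier FF" "h2 \<in> carrier FF"
    using FF.generate_field_in_carrier[OF _ eng_add.hyps(1)] FF.generate_field_in_carrier[OF _ eng_add.hyps(2)] z
    by auto
  have 1: "\<forall>\<^sub>F R in gen. poly (q * q') (fn z R) \<noteq> 0"
    using pq(1,3) by eventually_elim simp
  have 2: "\<forall>\<^sub>F R in gen. fn (h1 \<oplus>\<^bsub>FF\<^esub> h2) R = poly (p * q' + p' * q) (fn z R) / poly (q * q') (fn z R)"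
    using fn_add[OF h] pq by eventually_elim (simp add: add_frac_eq)
  from 1 2 show ?case by blast
next
  case (eng_mult h1 h2)
  then obtain p q p' q' where pq: "\<forall>\<^sub>F R in gen. poly q (fn z R) \<noteq> 0"
    "\<forall>\<^sub>F R in gen. fn h1 R = poly p (fn z R) / poly q (fn z R)"
    "\<forall>\<^sub>F R in gen. poly q' (fn z R) \<noteq> 0"
    "\<forall>\<^sub>F R in gen. fn h2 R = poly p' (fn z R) / poly q' (fn z R)" by blast
  have h: "h1 \<in> carrier FF" "h2 \<in> carrier FF"
    using FF.generate_field_in_carrier[OF _ eng_mult.hyps(1)] FF.generate_field_in_carrier[OF _ eng_mult.hyps(2)] z
    by auto
  have 1: "\<forall>\<^sub>F R in gen. poly (q * q') (fn z R) \<noteq> 0"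
    using pq(1,3) by eventually_elim simp
  have 2: "\<forall>\<^sub>F R in gen. fn (h1 \<otimes>\<^bsub>FF\<^esub> h2) R = poly (p * p') (fn z R) / poly (q * q') (fn z R)"
    using fn_mult[OF h] pq by eventually_elim simp
  from 1 2 show ?case by blast
qed

text \<open>A polynomial over K(z) is a list with the leading coefficient first. Clearing
  denominators one head at a time gives \<open>P\<close>, with common denominator \<open>s\<close>.
  The polynomial of the tail has no coefficient from the length of the tail on, so a new leading
  term cannot cancel; this keeps \<open>P\<close> nonzero.\<close>

lemma list_eval_as_poly2:
  assumes z: "z \<in> carrier FF" and x: "x \<in> carrier FF"
    and "set l \<subseteq> generate_field FF (insert z (range cnst))"
  shows "\<exists>P s. (\<forall>\<^sub>F R in gen. poly s (fn z R) \<noteq> 0) \<and>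
     (\<forall>\<^sub>F R in gen. poly2 P (fn z R) (fn x R) = poly s (fn z R) * fn (FF.eval l x) R) \<and>
     (\<forall>i\<ge>length l. Polynomial.coeff P i = 0) \<and>
     (l \<noteq> [] \<longrightarrow> hd l \<noteq> \<zero>\<^bsub>FF\<^esub> \<longrightarrow> P \<noteq> 0)"
  using assms(3)
proof (induction l)
  case Nil
  have "\<forall>\<^sub>F R in gen. poly2 0 (fn z R) (fn x R) = poly 1 (fn z R) * fn (FF.eval [] x) R"
    using fn_zero by eventually_elim simp
  then show ?case by (intro exI[of _ 0] exI[of _ 1]) simp
next
  case (Cons a l)
  let ?E = "generate_field FF (insert z (range cnst))"
  have Ec: "?E \<subseteq> carrier FF" using z by (intro FF.generate_field_incl) auto
  from Cons obtain P s where P: "\<forall>\<^sub>F R in gen. poly s (fn z R) \<noteq> 0"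
     "\<forall>\<^sub>F R in gen. poly2 P (fn z R) (fn x R) = poly s (fn z R) * fn (FF.eval l x) R"
     "\<forall>i\<ge>length l. Polynomial.coeff P i = 0" by auto
  have aE: "a \<in> ?E" and lE: "set l \<subseteq> carrier FF" using Cons.prems Ec by auto
  then have a: "a \<in> carrier FF" using Ec by blast
  obtain p q where pq: "\<forall>\<^sub>F R in gen. poly q (fn z R) \<noteq> 0"
    "\<forall>\<^sub>F R in gen. fn a R = poly p (fn z R) / poly q (fn z R)"
    using generate_field_as_quotient[OF z aE] by blast
  define P' where "P' = Polynomial.monom (p * s) (length l) + Polynomial.smult q P"
  have 1: "\<forall>\<^sub>F R in gen. poly (q * s) (fn z R) \<noteq> 0"
    using P(1) pq(1) by eventually_elim simp
  have xl: "x [^]\<^bsub>FF\<^esub> length l \<in> carrier FF" using x by simp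
  have el: "FF.eval l x \<in> carrier FF" using FF.eval_in_carrier[OF lE x] .
  have ev: "FF.eval (a # l) x = a \<otimes>\<^bsub>FF\<^esub> x [^]\<^bsub>FF\<^esub> length l \<oplus>\<^bsub>FF\<^esub> FF.eval l x" by simp
  have 2: "\<forall>\<^sub>F R in gen. poly2 P' (fn z R) (fn x R) = poly (q * s) (fn z R) * fn (FF.eval (a # l) x) R"
    unfolding ev
    using fn_add[OF FF.m_closed[OF a xl] el] fn_mult[OF a xl] fn_pow[OF x, of "length l"] P(2) pq
  proof eventually_elim
    case (elim R)
    have "fn (a \<otimes>\<^bsub>FF\<^esub> x [^]\<^bsub>FF\<^esub> length l \<oplus>\<^bsub>FF\<^esub> FF.eval l x) R =
        poly p (fn z R) / poly q (fn z R) * fn x R ^ length l + fn (FF.eval l x) R"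
      using elim by simp
    moreover have "poly2 P' (fn z R) (fn x R) =
        poly p (fn z R) * poly s (fn z R) * fn x R ^ length l + poly q (fn z R) * (poly s (fn z R) * fn (FF.eval l x) R)"
      using elim by (simp add: P'_def poly2_add poly2_monom poly2_smult)
    ultimately show ?case using elim by (simp add: distrib_left)
  qed
  have 3: "\<forall>i\<ge>length (a # l). Polynomial.coeff P' i = 0"
    using P(3) by (auto simp: P'_def)
  have 4: "P' \<noteq> 0" if "a \<noteq> \<zero>\<^bsub>FF\<^esub>"
  proof
    assume "P' = 0"
    then have "Polynomial.coeff P' (length l) = 0" by simp
    then have "p * s = 0" using P(3) by (simp add: P'_def)
    have "\<forall>\<^sub>F R in gen. poly (p * s) (fn z R) \<noteq> 0"
      using fn_nonzero[OF a that] pq(2) P(1) by eventually_elim auto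
    then have "\<forall>\<^sub>F R in gen. False" unfolding \<open>p * s = 0\<close> by simp
    then show False by simp
  qed
  show ?case
    using 1 2 3 4 by (intro exI[of _ P'] exI[of _ "q * s"]) simp
qed

lemma algebraic_imp_poly2:
  assumes z: "z \<in> carrier FF" and x: "x \<in> carrier FF"
    and alg: "(FF.algebraic over (generate_field FF (insert z (range cnst)))) x"
  shows "\<exists>P. P \<noteq> 0 \<and> (\<forall>\<^sub>F R in gen. poly2 P (fn z R) (fn x R) = 0)"
proof -
  let ?E = "generate_field FF (insert z (range cnst))"
  have E: "subfield ?E FF" using z by (intro FF.generate_field_is_subfield) auto
  obtain l where l: "l \<in> carrier (?E[X]\<^bsub>FF\<^esub>)" "l \<noteq> []" "FF.eval l x = \<zero>\<^bsub>FF\<^esub>"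
    by (rule FF.algebraicE[OF subfieldE(1)[OF E] x alg])
  have l': "set l \<subseteq> ?E" "hd l \<noteq> \<zero>\<^bsub>FF\<^esub>"
    using l(1,2) unfolding univ_poly_def polynomial_def by auto
  obtain P s where P: "\<forall>\<^sub>F R in gen. poly2 P (fn z R) (fn x R) = poly s (fn z R) * fn (FF.eval l x) R" "P \<noteq> 0"
    using list_eval_as_poly2[OF z x l'(1)] l(2) l'(2) by blast
  have "\<forall>\<^sub>F R in gen. poly2 P (fn z R) (fn x R) = 0"
    using P(1) fn_zero unfolding l(3) by eventually_elim simp
  with P(2) show ?thesis by blast
qed

lemma poly_in_generate_field:
  assumes y: "y \<in> carrier FF"
  shows "\<exists>w\<in>generate_field FF (insert y (range cnst)). \<forall>\<^sub>F R in gen. fn w R = poly r (fn y R)"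
proof (induction r)
  case 0
  have "cnst 0 \<in> generate_field FF (insert y (range cnst))" by (rule generate_field.incl) simp
  then show ?case using fn_cnst[of 0] by (intro bexI[of _ "cnst 0"]) simp_all
next
  case (pCons c r)
  let ?E = "generate_field FF (insert y (range cnst))"
  have Ec: "?E \<subseteq> carrier FF" using y by (intro FF.generate_field_incl) auto
  obtain w where w: "w \<in> ?E" "\<forall>\<^sub>F R in gen. fn w R = poly r (fn y R)" using pCons.IH by blast
  have c: "cnst c \<in> ?E" and yE: "y \<in> ?E" by (auto intro: generate_field.incl)
  have wc: "w \<in> carrier FF" using w(1) Ec by blast
  have 1: "cnst c \<oplus>\<^bsub>FF\<^esub> y \<otimes>\<^bsub>FF\<^esub> w \<in> ?E"
    using c yE w(1) by (intro generate_field.eng_add generate_field.eng_mult)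
  have "\<forall>\<^sub>F R in gen. fn (cnst c \<oplus>\<^bsub>FF\<^esub> y \<otimes>\<^bsub>FF\<^esub> w) R = poly (pCons c r) (fn y R)"
    using fn_add[OF cnst_carrier[of c] FF.m_closed[OF y wc]] fn_mult[OF y wc] fn_cnst[of c] w(2)
    by eventually_elim simp
  with 1 show ?case by blast
qed

lemma fn_eval_map:
  assumes x: "x \<in> carrier FF" and w: "\<And>j. w j \<in> carrier FF"
  shows "\<forall>\<^sub>F R in gen. fn (FF.eval (map w (rev [0..<N])) x) R = (\<Sum>j<N. fn (w j) R * fn x R ^ j)"
proof (induction N)
  case 0
  show ?case using fn_zero by simp
next
  case (Suc N)
  have xl: "x [^]\<^bsub>FF\<^esub> N \<in> carrier FF" using x by simp
  have el: "FF.eval (map w (rev [0..<N])) x \<in> carrier FF"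
    using w by (intro FF.eval_in_carrier x) auto
  have ev: "FF.eval (map w (rev [0..<Suc N])) x = w N \<otimes>\<^bsub>FF\<^esub> x [^]\<^bsub>FF\<^esub> N \<oplus>\<^bsub>FF\<^esub> FF.eval (map w (rev [0..<N])) x"
    by simp
  show ?case unfolding ev
    using fn_add[OF FF.m_closed[OF w[of N] xl] el] fn_mult[OF w[of N] xl] fn_pow[OF x, of N] Suc
    by eventually_elim simp
qed

text \<open>The relation is read as a polynomial in t whose coefficients are polynomials in y. As y
  is transcendental, these coefficients do not all vanish.\<close>

lemma poly2_imp_algebraic:
  assumes t: "t \<in> carrier FF" and y: "y \<in> carrier FF"
    and P: "P \<noteq> 0" "\<forall>\<^sub>F R in gen. poly2 P (fn t R) (fn y R) = 0"
    and transc: "\<And>q. \<forall>\<^sub>F R in gen. poly q (fn y R) = 0 \<Longrightarrow> q = 0"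
  shows "(FF.algebraic over (generate_field FF (insert y (range cnst)))) t"
proof -
  let ?E = "generate_field FF (insert y (range cnst))"
  have E: "subfield ?E FF" using y by (intro FF.generate_field_is_subfield) auto
  have Ec: "?E \<subseteq> carrier FF" using subfieldE(3)[OF E] .
  define M where "M = Suc (Polynomial.degree P)"
  \<comment> \<open>A strict bound on the degrees in t of all coefficients, so that every sum over
    powers of t has the same range.\<close>
  define N where "N = Suc (Max ((\<lambda>i. Polynomial.degree (Polynomial.coeff P i)) ` {..<M}))"
  have N: "Polynomial.coeff (Polynomial.coeff P i) j = 0" if "j \<ge> N" for i j
  proof (cases "i < M")
    case True
    have "Polynomial.degree (Polynomial.coeff P i) \<le> Max ((\<lambda>i. Polynomial.degree (Polynomial.coeff P i)) ` {..<M})"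
      using True by (intro Max_ge) auto
    then show ?thesis using that by (intro coeff_eq_0) (simp add: N_def)
  next
    case False
    then have "Polynomial.coeff P i = 0" by (intro coeff_eq_0) (simp add: M_def)
    then show ?thesis by simp
  qed
  \<comment> \<open>The coefficient of t^j, a polynomial in y: the coefficient table of
    \<open>P\<close> transposed.\<close>
  define r where "r j = (\<Sum>i<M. Polynomial.monom (Polynomial.coeff (Polynomial.coeff P i) j) i)" for j
  have r_coeff: "Polynomial.coeff (r j) i = Polynomial.coeff (Polynomial.coeff P i) j" for i j
  proof -
    have "Polynomial.coeff (r j) i = (\<Sum>i'<M. if i' = i then Polynomial.coeff (Polynomial.coeff P i) j else 0)"
      unfolding r_def Polynomial.coeff_sum by (rule sum.cong) auto
    then show ?thesis by (auto simp: M_def coeff_eq_0)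
  qed
  have "\<forall>j. \<exists>w. w \<in> ?E \<and> (\<forall>\<^sub>F R in gen. fn w R = poly (r j) (fn y R))"
    using poly_in_generate_field[OF y] by blast
  then obtain w where w: "\<And>j. w j \<in> ?E" "\<And>j. \<forall>\<^sub>F R in gen. fn (w j) R = poly (r j) (fn y R)"
    unfolding choice_iff by blast
  have wc: "w j \<in> carrier FF" for j using w(1) Ec by blast
  have r_poly: "poly (r j) c = (\<Sum>i<M. Polynomial.coeff (Polynomial.coeff P i) j * c ^ i)" for j c
    unfolding r_def by (simp add: poly_sum poly_monom)
  have swap: "(\<Sum>j<N. poly (r j) b * a ^ j) = poly2 P a b" for a b
  proof -
    have "poly2 P a b = (\<Sum>i<M. poly (Polynomial.coeff P i) a * b ^ i)"
      by (rule poly2_altdef) (simp add: M_def coeff_eq_0)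
    also have "\<dots> = (\<Sum>i<M. (\<Sum>j<N. Polynomial.coeff (Polynomial.coeff P i) j * a ^ j) * b ^ i)"
    proof (rule sum.cong[OF refl])
      fix i assume i: "i \<in> {..<M}"
      have "poly (Polynomial.coeff P i) a = (\<Sum>j\<le>Polynomial.degree (Polynomial.coeff P i). Polynomial.coeff (Polynomial.coeff P i) j * a ^ j)"
        by (rule poly_altdef)
      also have "\<dots> = (\<Sum>j<N. Polynomial.coeff (Polynomial.coeff P i) j * a ^ j)"
      proof (rule sum.mono_neutral_left)
        have "Polynomial.degree (Polynomial.coeff P i) \<le> Max ((\<lambda>i. Polynomial.degree (Polynomial.coeff P i)) ` {..<M})"
          using i by (intro Max_ge) auto
        then show "{..Polynomial.degree (Polynomial.coeff P i)} \<subseteq> {..<N}"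
          by (auto simp: N_def)
      qed (auto simp: coeff_eq_0)
      finally show "poly (Polynomial.coeff P i) a * b ^ i = (\<Sum>j<N. Polynomial.coeff (Polynomial.coeff P i) j * a ^ j) * b ^ i"
        by simp
    qed
    also have "\<dots> = (\<Sum>j<N. poly (r j) b * a ^ j)"
      unfolding r_poly sum_distrib_right
      by (subst sum.swap) (intro sum.cong refl, simp add: mult_ac)
    finally show ?thesis by simp
  qed
  \<comment> \<open>Lists have the leading coefficient first, hence \<open>rev\<close>; leading
    entries may be zero, hence the later \<open>normalize\<close>.\<close>
  define L where "L = map w (rev [0..<N])"
  have LE: "set L \<subseteq> ?E" using w(1) by (auto simp: L_def)
  have Lc: "set L \<subseteq> carrier FF" using LE Ec by blast
  have all: "\<forall>\<^sub>F R in gen. \<forall>j\<in>{..<N}. fn (w j) R = poly (r j) (fn y R)"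
    using w(2) by (subst eventually_ball_finite_distrib) auto
  have "\<forall>\<^sub>F R in gen. fn (FF.eval L t) R = 0"
    using fn_eval_map[OF t, where w = w and N = N, OF wc] all P(2) unfolding L_def
    by eventually_elim (simp add: swap)
  then have "FF.eval L t = \<zero>\<^bsub>FF\<^esub>"
    using fn_zero_iff[OF FF.eval_in_carrier[OF Lc t]] by blast
  then have ev: "FF.eval (FF.normalize L) t = \<zero>\<^bsub>FF\<^esub>"
    using FF.eval_normalize[OF Lc t] by simp
  have nonempty: "FF.normalize L \<noteq> []"
  proof
    assume empty: "FF.normalize L = []"
    have nl: "FF.normalize l = [] \<Longrightarrow> set l \<subseteq> {\<zero>\<^bsub>FF\<^esub>}" for l
      by (induction l) (auto split: if_splits)
    have L0: "set L \<subseteq> {\<zero>\<^bsub>FF\<^esub>}" by (rule nl[OF empty])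
    have r0: "r j = 0" for j
    proof (cases "j < N")
      case True
      then have "w j \<in> set L" by (simp add: L_def)
      then have "w j = \<zero>\<^bsub>FF\<^esub>" using L0 by blast
      then have "\<forall>\<^sub>F R in gen. fn (w j) R = 0" using fn_zero by simp
      then have "\<forall>\<^sub>F R in gen. poly (r j) (fn y R) = 0"
        using w(2)[of j] by eventually_elim simp
      then show ?thesis by (rule transc)
    next
      case False
      then show ?thesis by (intro poly_eqI) (simp add: r_coeff N)
    qed
    have "P = 0"
    proof (rule poly_eqI, rule poly_eqI)
      fix i j show "Polynomial.coeff (Polynomial.coeff P i) j = Polynomial.coeff (Polynomial.coeff 0 i) j"
        using r_coeff[of j i] r0[of j] by simp
    qed
    with P(1) show False by blast
  qed
  have "FF.normalize L \<in> carrier (?E[X]\<^bsub>FF\<^esub>)"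
    using FF.normalize_gives_polynomial[OF LE] unfolding univ_poly_def by simp
  from FF.algebraicI[OF this nonempty ev] show ?thesis .
qed

text \<open>While the constant term in F is zero, a factor F can be divided out because F is
  generically nonzero.\<close>

lemma poly2_cancel:
  assumes Y: "rat Y" and F: "rat F" "\<forall>\<^sub>F R in gen. F R \<noteq> 0"
  shows "P \<noteq> 0 \<Longrightarrow> \<forall>\<^sub>F R in gen. poly2 P (Y R) (F R) = 0 \<Longrightarrow>
     \<exists>Q. Polynomial.coeff Q 0 \<noteq> 0 \<and> (\<forall>\<^sub>F R in gen. poly2 Q (Y R) (F R) = 0)"
proof (induction P)
  case (pCons q P)
  show ?case
  proof (cases "q = 0")
    case True
    then have "P \<noteq> 0" using pCons.prems(1) by auto
    moreover have "\<forall>\<^sub>F R in gen. poly2 P (Y R) (F R) = 0"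
      using pCons.prems(2) F(2) by eventually_elim (simp add: True)
    ultimately show ?thesis by (rule pCons.IH)
  next
    case False
    then show ?thesis using pCons.prems(2) by (intro exI[of _ "pCons q P"]) simp
  qed
qed simp

text \<open>If Y is algebraic over the constants, its own equation serves, as a relation of degree 0
  in F. Otherwise Y can replace the transcendence basis by the exchange lemma. The nonzero constant
  term in F is the point: where F vanishes, it leaves a nontrivial equation for Y.\<close>

lemma dimension_one_algebraic_dependence:
  assumes dim: "dimension_one V" and Y: "rat Y" and F: "rat F" "\<not> (\<forall>\<^sub>F R in gen. F R = 0)"
  shows "\<exists>P. Polynomial.coeff P 0 \<noteq> 0 \<and> (\<forall>\<^sub>F R in gen. poly2 P (Y R) (F R) = 0)"
proof -
  have Fnz: "\<forall>\<^sub>F R in gen. F R \<noteq> 0" using rat_zero_or_nonzero[OF F(1)] F(2) by blast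
  show ?thesis
  proof (cases "\<exists>q. q \<noteq> 0 \<and> (\<forall>\<^sub>F R in gen. poly q (Y R) = 0)")
    case True
    then obtain q where "q \<noteq> 0" "\<forall>\<^sub>F R in gen. poly q (Y R) = 0" by blast
    then show ?thesis by (intro exI[of _ "[:q:]"]) simp
  next
    case False
    obtain y where y: "y \<in> carrier FF" "\<forall>\<^sub>F R in gen. fn y R = Y R" by (rule fn_surj[OF Y])
    obtain f where f: "f \<in> carrier FF" "\<forall>\<^sub>F R in gen. fn f R = F R" by (rule fn_surj[OF F(1)])
    have transc: "q = 0" if "\<forall>\<^sub>F R in gen. poly q (fn y R) = 0" for q
    proof -
      have "\<forall>\<^sub>F R in gen. poly q (Y R) = 0" using that y(2) by eventually_elim simp
      then show ?thesis using False by blast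
    qed
    obtain t where t: "t \<in> carrier FF" and alg: "\<And>g. g \<in> carrier FF \<Longrightarrow>
        (FF.algebraic over (generate_field FF (insert t (range cnst)))) g"
      using dim unfolding dimension_one_def over_def constant_functions_eq by blast
    obtain P where P: "P \<noteq> 0" "\<forall>\<^sub>F R in gen. poly2 P (fn t R) (fn y R) = 0"
      using algebraic_imp_poly2[OF t y(1) alg[OF y(1)]] by blast
    have t_alg: "(FF.algebraic over (generate_field FF (insert y (range cnst)))) t"
      by (rule poly2_imp_algebraic[OF t y(1) P transc])
    have "(FF.algebraic over (generate_field FF (insert y (range cnst)))) f"
      by (rule FF.algebraic_exchange[OF _ t y(1) f(1) t_alg alg[OF f(1)]]) auto
    then obtain Q where Q: "Q \<noteq> 0" "\<forall>\<^sub>F R in gen. poly2 Q (fn y R) (fn f R) = 0"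
      using algebraic_imp_poly2[OF y(1) f(1)] by blast
    have "\<forall>\<^sub>F R in gen. poly2 Q (Y R) (F R) = 0"
      using Q(2) y(2) f(2) by eventually_elim simp
    from poly2_cancel[OF Y F(1) Fnz Q(1) this] show ?thesis .
  qed
qed

lemma dimension_one_nonconstant:
  assumes dim: "dimension_one V"
  shows "\<exists>F. rat F \<and> (\<forall>c. \<not> (\<forall>\<^sub>F R in gen. F R = c))"
proof -
  obtain t where t: "t \<in> carrier FF" "FF.transcendental (range cnst) t"
    using dim unfolding dimension_one_def constant_functions_eq by blast
  have "\<not> (\<forall>\<^sub>F R in gen. fn t R = c)" for c
  proof
    assume "\<forall>\<^sub>F R in gen. fn t R = c"
    then have "t \<in> range cnst" using cnst_eqI[OF t(1)] by blast
    then show False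
      using FF.algebraic_self[OF subfieldE(1)[OF subfield_constants]] t(2) unfolding over_def by blast
  qed
  then show ?thesis using fn_rat[OF t(1)] by blast
qed

end

section \<open>Finiteness of zero sets on a curve\<close>

text \<open>Representatives of distinct points have a nonzero 2 by 2 minor; replacing the
  representative of P in it by variables gives the form.\<close>

lemma separating_linear_form:
  fixes P Q :: "('a::field, 'n::finite) proj"
  assumes "P \<noteq> Q"
  obtains h where "homogeneous 1 h" "eval_at h Q = 0" "eval_at h P \<noteq> 0"
proof -
  define p q where pq: "p = rep_proj P" "q = rep_proj Q"
  have "\<exists>i j. q $ i * p $ j \<noteq> q $ j * p $ i"
  proof (rule ccontr)
    assume "\<not> ?thesis"
    then have eq: "q $ i * p $ j = q $ j * p $ i" for i j by blast
    obtain i where i: "p $ i \<noteq> 0" unfolding pq by (metis rep_proj_nonzero vec_eq_iff zero_index)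
    define c where "c = q $ i / p $ i"
    have qc: "q = c *s p" using eq[of i] i by (simp add: vec_eq_iff c_def field_simps)
    then have "c \<noteq> 0" using rep_proj_nonzero[of Q] pq by auto
    then have "abs_proj p = abs_proj q" using qc abs_proj_eq_iff[of p q] pq by auto
    then show False using assms by (simp add: pq)
  qed
  then obtain i j where ij: "q $ i * p $ j \<noteq> q $ j * p $ i" by blast
  show ?thesis
  proof (rule that)
    show "homogeneous 1 (Cst (q $ i) * Var j - Cst (q $ j) * Var i)"
      using homogeneous_mult[OF homogeneous_Cst[of "q $ i"] homogeneous_Var[of j]]
        homogeneous_mult[OF homogeneous_Cst[of "q $ j"] homogeneous_Var[of i]]
      by (auto intro!: homogeneous_diff)
  qed (use ij in \<open>auto simp: pq mult.commute\<close>)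
qed

lemma separating_form:
  fixes P :: "('a::field, 'n::finite) proj"
  assumes "finite A" "P \<notin> A"
  obtains h where "homogeneous (card A) h" "\<And>Q. Q \<in> A \<Longrightarrow> eval_at h Q = 0" "eval_at h P \<noteq> 0"
proof -
  have "\<exists>h. homogeneous 1 h \<and> eval_at h Q = 0 \<and> eval_at h P \<noteq> 0" if "Q \<in> A" for Q
  proof -
    have "P \<noteq> Q" using that assms(2) by blast
    then show ?thesis by (rule separating_linear_form) blast
  qed
  then have "\<forall>Q\<in>A. \<exists>h. homogeneous 1 h \<and> eval_at h Q = 0 \<and> eval_at h P \<noteq> 0" by blast
  from bchoice[OF this] obtain h where h: "\<And>Q. Q \<in> A \<Longrightarrow> homogeneous 1 (h Q)"
    "\<And>Q. Q \<in> A \<Longrightarrow> eval_at (h Q) Q = 0" "\<And>Q. Q \<in> A \<Longrightarrow> eval_at (h Q) P \<noteq> 0" by blast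
  show ?thesis
  proof (rule that[of "\<Prod>Q\<in>A. h Q"])
    show "homogeneous (card A) (\<Prod>Q\<in>A. h Q)"
      using homogeneous_prod[of A "\<lambda>_. 1" h] h(1) by simp
    show "eval_at (\<Prod>Q\<in>A. h Q) Q = 0" if "Q \<in> A" for Q
      using that assms(1) h(2)[OF that] by (auto simp: prod_zero_iff)
    show "eval_at (\<Prod>Q\<in>A. h Q) P \<noteq> 0" using assms(1) h(3) by (simp add: prod_zero_iff)
  qed
qed

lemma finite_vec_set:
  fixes A :: "'n::finite \<Rightarrow> 'a set"
  assumes "\<And>i. finite (A i)"
  shows "finite {v :: 'a^'n. \<forall>i. v $ i \<in> A i}"
proof -
  have "{v :: 'a^'n. \<forall>i. v $ i \<in> A i} \<subseteq> (\<lambda>f. \<chi> i. f i) ` (Pi\<^sub>E UNIV A)"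
  proof
    fix v :: "'a^'n" assume "v \<in> {v. \<forall>i. v $ i \<in> A i}"
    then show "v \<in> (\<lambda>f. \<chi> i. f i) ` (Pi\<^sub>E UNIV A)"
      by (intro image_eqI[of _ _ "\<lambda>i. v $ i"]) (auto simp: vec_eq_iff)
  qed
  moreover have "finite (Pi\<^sub>E (UNIV :: 'n set) A)" using assms by (intro finite_PiE) auto
  ultimately show ?thesis using finite_surj by blast
qed

lemma proj_eq_coord:
  fixes R :: "('a::field, 'n::finite) proj"
  assumes "rep_proj R $ i \<noteq> 0"
  shows "R = abs_proj (\<chi> j. rep_proj R $ j / rep_proj R $ i)"
proof -
  let ?v = "\<chi> j. rep_proj R $ j / rep_proj R $ i"
  have "?v \<noteq> 0" using assms by (auto simp: vec_eq_iff)
  moreover have "rep_proj R = (rep_proj R $ i) *s ?v" using assms by (simp add: vec_eq_iff)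
  ultimately have "abs_proj ?v = abs_proj (rep_proj R)"
    using assms abs_proj_eq_iff[of ?v "rep_proj R"] by auto
  then show ?thesis by simp
qed

section \<open>Curves, where generic means cofinite\<close>

locale curve = irreducible_variety V for V :: "('a::alg_closed_field, 'n::finite) proj set" +
  assumes dim: "dimension_one V"
begin

lemma regv_frac: "homogeneous d g \<Longrightarrow> homogeneous d h \<Longrightarrow> eval_at h R \<noteq> 0 \<Longrightarrow>
    regv R (\<lambda>R. eval_at g R / eval_at h R) (eval_at g R / eval_at h R)"
  by (rule regvI) auto

text \<open>On the chart where x_i is nonzero, g becomes a function F, and every coordinate Y_j =
  x_j / x_i satisfies a relation with F whose constant term is a nonzero polynomial in Y_j. At a
  zero of g that constant term must vanish, which leaves finitely many values for each
  coordinate.\<close>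

lemma finite_zeros_chart:
  assumes g: "homogeneous d g" "P \<in> V" "eval_at g P \<noteq> 0"
  shows "finite {R\<in>V. eval_at g R = 0 \<and> eval_at (Var i) R \<noteq> 0}"
proof (cases "\<exists>S\<in>V. eval_at (Var i) S \<noteq> 0")
  case False
  then have "{R\<in>V. eval_at g R = 0 \<and> eval_at (Var i) R \<noteq> 0} = {}" by blast
  then show ?thesis by (simp only: finite.emptyI)
next
  case True
  then obtain S where S: "S \<in> V" "eval_at (Var i) S \<noteq> 0" by blast
  have hd: "homogeneous d (Var i ^ d)" using homogeneous_power[OF homogeneous_Var, of d i] by simp
  define F where "F R = eval_at g R / eval_at (Var i ^ d) R" for R :: "('a, 'n) proj"
  define Y where "Y j R = eval_at (Var j) R / eval_at (Var i) R" for j and R :: "('a, 'n) proj"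
  have Sd: "eval_at (Var i ^ d) S \<noteq> 0" using S(2) by simp
  have F: "rat F" unfolding F_def by (rule ratI[OF g(1) hd S(1) Sd]) simp
  have Fnz: "\<not> (\<forall>\<^sub>F R in gen. F R = 0)"
  proof
    assume "\<forall>\<^sub>F R in gen. F R = 0"
    then have "\<forall>\<^sub>F R in gen. False"
      using eventually_form_nonzero[OF g] eventually_form_nonzero[OF homogeneous_Var S]
      by eventually_elim (simp add: F_def)
    then show False by simp
  qed
  have Y: "rat (Y j)" for j
    unfolding Y_def by (rule ratI[OF homogeneous_Var[of j] homogeneous_Var S]) simp
  have "\<forall>j. \<exists>p. Polynomial.coeff p 0 \<noteq> 0 \<and> (\<forall>\<^sub>F R in gen. poly2 p (Y j R) (F R) = 0)"
    using dimension_one_algebraic_dependence[OF dim Y F Fnz] by blast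
  from choice[OF this] obtain p where p: "\<And>j. Polynomial.coeff (p j) 0 \<noteq> 0"
    "\<And>j. \<forall>\<^sub>F R in gen. poly2 (p j) (Y j R) (F R) = 0" by blast
  define A where "A j = {x. poly (Polynomial.coeff (p j) 0) x = 0}" for j
  have A: "finite (A j)" for j unfolding A_def using p(1) by (rule poly_roots_finite)
  have *: "Y j R \<in> A j" if R: "R \<in> V" "eval_at g R = 0" "eval_at (Var i) R \<noteq> 0" for R j
  proof -
    have Rd: "eval_at (Var i ^ d) R \<noteq> 0" using R(3) by simp
    have 1: "regv R F 0" unfolding F_def using regv_frac[OF g(1) hd Rd] R(2) by simp
    have 2: "regv R (Y j) (Y j R)"
      unfolding Y_def by (rule regv_frac[OF homogeneous_Var homogeneous_Var R(3)])
    have "regv R (\<lambda>R. poly2 (p j) (Y j R) (F R)) (poly2 (p j) (Y j R) 0)"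
      unfolding poly2_def by (rule regv_poly2[OF R(1) 2 1])
    from regv_unique[OF R(1) this regv_const p(2)]
    have "poly2 (p j) (Y j R) 0 = 0" .
    then show ?thesis unfolding A_def by (cases "p j") auto
  qed
  have "{R\<in>V. eval_at g R = 0 \<and> eval_at (Var i) R \<noteq> 0} \<subseteq> abs_proj ` {v. \<forall>j. v $ j \<in> A j}"
  proof
    fix R assume "R \<in> {R\<in>V. eval_at g R = 0 \<and> eval_at (Var i) R \<noteq> 0}"
    then have R: "R \<in> V" "eval_at g R = 0" "eval_at (Var i) R \<noteq> 0" by auto
    show "R \<in> abs_proj ` {v. \<forall>j. v $ j \<in> A j}"
    proof (rule image_eqI)
      show "R = abs_proj (\<chi> j. rep_proj R $ j / rep_proj R $ i)"
        using R(3) by (intro proj_eq_coord) simp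
      show "(\<chi> j. rep_proj R $ j / rep_proj R $ i) \<in> {v. \<forall>j. v $ j \<in> A j}"
        using *[OF R] by (simp add: Y_def)
    qed
  qed
  then show ?thesis using finite_vec_set[of A] A finite_surj by blast
qed

lemma finite_zeros:
  assumes g: "homogeneous d g" "P \<in> V" "eval_at g P \<noteq> 0"
  shows "finite {R\<in>V. eval_at g R = 0}"
proof -
  have "{R\<in>V. eval_at g R = 0} \<subseteq> (\<Union>i. {R\<in>V. eval_at g R = 0 \<and> eval_at (Var i) R \<noteq> 0})"
  proof
    fix R assume R: "R \<in> {R\<in>V. eval_at g R = 0}"
    obtain i where "rep_proj R $ i \<noteq> 0" by (metis rep_proj_nonzero vec_eq_iff zero_index)
    then show "R \<in> (\<Union>i. {R\<in>V. eval_at g R = 0 \<and> eval_at (Var i) R \<noteq> 0})" using R by auto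
  qed
  then show ?thesis
    using finite_zeros_chart[OF g] by (elim finite_subset) (intro finite_UN_I, simp_all)
qed

lemma nonconstant_eventually_avoids:
  obtains F where "rat F" "\<And>c. \<forall>\<^sub>F R in gen. F R \<noteq> c"
proof -
  obtain F where F: "rat F" "\<And>c. \<not> (\<forall>\<^sub>F R in gen. F R = c)"
    using dimension_one_nonconstant[OF dim] by blast
  have "\<forall>\<^sub>F R in gen. F R \<noteq> c" for c
    using rat_zero_or_nonzero[OF rat_diff[OF F(1) rat_const[of c]]] F(2)[of c] by simp
  with F(1) show ?thesis by (rule that)
qed

lemma eventually_gen_neq: "\<forall>\<^sub>F R in gen. R \<noteq> P"
proof -
  obtain F where F: "rat F" "\<And>c. \<forall>\<^sub>F R in gen. F R \<noteq> c" by (rule nonconstant_eventually_avoids) blast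
  show ?thesis using F(2)[of "F P"] by eventually_elim auto
qed

text \<open>One direction is the finiteness of zero sets; for the other, single points are avoided
  generically by means of a nonconstant function. Finiteness is easier to transport along injective
  maps than nonvanishing of forms.\<close>

lemma eventually_gen_iff: "eventually Q gen \<longleftrightarrow> finite {R\<in>V. \<not> Q R}"
proof
  assume "eventually Q gen"
  then obtain h d P where h: "homogeneous d h" "P \<in> V" "eval_at h P \<noteq> 0"
    "\<forall>R\<in>V. eval_at h R \<noteq> 0 \<longrightarrow> Q R" unfolding eventually_gen by blast
  have "{R\<in>V. \<not> Q R} \<subseteq> {R\<in>V. eval_at h R = 0}" using h(4) by blast
  then show "finite {R\<in>V. \<not> Q R}" using finite_zeros[OF h(1-3)] finite_subset by blast
next
  assume fin: "finite {R\<in>V. \<not> Q R}"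
  have "\<forall>\<^sub>F R in gen. \<forall>P\<in>{R\<in>V. \<not> Q R}. R \<noteq> P"
    using fin eventually_gen_neq by (subst eventually_ball_finite_distrib) auto
  then show "eventually Q gen"
    using eventually_gen_in by eventually_elim blast
qed

lemma infinite_V: "infinite V"
proof
  assume "finite V"
  then have "finite {R\<in>V. \<not> False}" by simp
  then have "\<forall>\<^sub>F R in gen. False" unfolding eventually_gen_iff .
  then show False by simp
qed

text \<open>A nonempty open set misses only zeros of one form. Conversely, a finite set is cut out
  by products of linear forms, one product for each point to be avoided.\<close>

lemma zariski_openin_iff: "zariski_openin V U \<longleftrightarrow> U \<subseteq> V \<and> (U = {} \<or> finite (V - U))"
proof
  assume "zariski_openin V U"
  then obtain T where T: "\<And>F. F \<in> T \<Longrightarrow> \<exists>d. homogeneous d F" "U = V - {P. \<forall>F\<in>T. eval_at F P = 0}"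
    unfolding zariski_openin_def zariski_closed_def by blast
  show "U \<subseteq> V \<and> (U = {} \<or> finite (V - U))"
  proof (cases "U = {}")
    case False
    then obtain P F where P: "P \<in> V" "F \<in> T" "eval_at F P \<noteq> 0" using T(2) by blast
    obtain d where d: "homogeneous d F" using T(1)[OF P(2)] by blast
    have "V - U \<subseteq> {R\<in>V. eval_at F R = 0}" using T(2) P(2) by blast
    then show ?thesis using finite_zeros[OF d P(1,3)] finite_subset T(2) by blast
  qed simp
next
  assume U: "U \<subseteq> V \<and> (U = {} \<or> finite (V - U))"
  show "zariski_openin V U"
  proof (cases "U = {}")
    case True
    have "zariski_closed (UNIV :: ('a, 'n) proj set)"
      unfolding zariski_closed_def by (intro exI[of _ "{}"]) simp
    then show ?thesis unfolding zariski_openin_def True by blast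
  next
    case False
    then have fin: "finite (V - U)" using U by blast
    define T where "T = {F. (\<exists>d. homogeneous d F) \<and> (\<forall>Q\<in>V - U. eval_at F Q = 0)}"
    have T: "zariski_closed {P. \<forall>F\<in>T. eval_at F P = 0}"
      unfolding zariski_closed_def by (intro exI[of _ T]) (simp add: T_def)
    have "U = V - {P. \<forall>F\<in>T. eval_at F P = 0}"
    proof (intro equalityI subsetI)
      fix P assume P: "P \<in> U"
      then have "P \<notin> V - U" by blast
      then obtain h where "homogeneous (card (V - U)) h" "\<And>Q. Q \<in> V - U \<Longrightarrow> eval_at h Q = 0" "eval_at h P \<noteq> 0"
        using separating_form[OF fin] by blast
      then have "h \<in> T" "eval_at h P \<noteq> 0" unfolding T_def by blast+
      then show "P \<in> V - {P. \<forall>F\<in>T. eval_at F P = 0}" using P U by blast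
    next
      fix P assume "P \<in> V - {P. \<forall>F\<in>T. eval_at F P = 0}"
      then show "P \<in> U" unfolding T_def by blast
    qed
    then show ?thesis using T unfolding zariski_openin_def by blast
  qed
qed

end

section \<open>Local rings of smooth points\<close>

context curve begin

text \<open>Gaussian elimination over the local ring: 1 - a k k has value 1 at P, so the k-th
  equation can be solved for \<open>y k\<close> and substituted into the others. The new
  coefficients a' still vanish at P, which lets the induction continue.\<close>

lemma nakayama:
  assumes P: "P \<in> V" and "finite I"
    and "\<And>i. i \<in> I \<Longrightarrow> regv P (c i) (cv i)"
    and "\<And>i j. i \<in> I \<Longrightarrow> j \<in> I \<Longrightarrow> regv P (a i j) 0"
    and "\<And>i. i \<in> I \<Longrightarrow> \<forall>\<^sub>F R in gen. y i R = c i R * T R + (\<Sum>j\<in>I. a i j R * y j R)"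
  shows "\<forall>i\<in>I. \<exists>b e. regv P b e \<and> (\<forall>\<^sub>F R in gen. y i R = b R * T R)"
  using assms(2-)
proof (induction I arbitrary: c cv a rule: finite_induct)
  case (insert k I)
  have akk: "regv P (a k k) 0" by (rule insert.prems(2)) auto
  define u where "u R = inverse (1 - a k k R)" for R
  have u: "regv P u (inverse 1)"
    unfolding u_def using regv_inverse[OF P regv_diff[OF P regv_const[of P 1] akk]] by simp
  have nz: "\<forall>\<^sub>F R in gen. 1 - a k k R \<noteq> 0"
  proof -
    have r: "rat (\<lambda>R. 1 - a k k R)"
      by (intro rat_diff rat_const) (rule regv_rat[OF P akk])
    have "\<not> (\<forall>\<^sub>F R in gen. 1 - a k k R = 0)"
    proof
      assume "\<forall>\<^sub>F R in gen. 1 - a k k R = 0"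
      from regv_unique[OF P regv_diff[OF P regv_const[of P 1] akk] regv_const[of P 0] this]
      show False by simp
    qed
    then show ?thesis using rat_zero_or_nonzero[OF r] by blast
  qed
  have k: "\<forall>\<^sub>F R in gen. y k R = u R * c k R * T R + (\<Sum>j\<in>I. u R * a k j R * y j R)"
    using insert.prems(3)[of k, OF insertI1] nz
  proof eventually_elim
    case (elim R)
    have "(1 - a k k R) * y k R = c k R * T R + (\<Sum>j\<in>I. a k j R * y j R)"
      using elim(1) insert.hyps by (simp add: algebra_simps)
    then have "u R * ((1 - a k k R) * y k R) = u R * (c k R * T R + (\<Sum>j\<in>I. a k j R * y j R))"
      by simp
    moreover have "u R * ((1 - a k k R) * y k R) = y k R"
      using elim(2) by (simp add: u_def)
    ultimately show ?case by (simp add: distrib_left sum_distrib_left mult.assoc)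
  qed
  \<comment> \<open>Coefficients of the remaining equations after substituting the solved
    \<open>y k\<close>.\<close>
  define c' where "c' i R = c i R + a i k R * (u R * c k R)" for i R
  define a' where "a' i j R = a i j R + a i k R * (u R * a k j R)" for i j R
  have c': "regv P (c' i) (cv i + 0 * (inverse 1 * cv k))" if "i \<in> I" for i
    unfolding c'_def by (intro regv_add regv_mult P u insert.prems) (use that in auto)
  have a': "regv P (a' i j) 0" if "i \<in> I" "j \<in> I" for i j
  proof -
    have "regv P (a' i j) (0 + 0 * (inverse 1 * 0))"
      unfolding a'_def by (intro regv_add regv_mult P u insert.prems) (use that in auto)
    then show ?thesis by simp
  qed
  have eq: "\<forall>\<^sub>F R in gen. y i R = c' i R * T R + (\<Sum>j\<in>I. a' i j R * y j R)" if i: "i \<in> I" for i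
    using insert.prems(3)[of i, OF insertI2[OF i]] k
  proof eventually_elim
    case (elim R)
    have "y i R = c i R * T R + (a i k R * y k R + (\<Sum>j\<in>I. a i j R * y j R))"
      using elim(1) insert.hyps by simp
    also have "a i k R * y k R = a i k R * (u R * c k R * T R + (\<Sum>j\<in>I. u R * a k j R * y j R))"
      using elim(2) by simp
    also have "c i R * T R + (a i k R * (u R * c k R * T R + (\<Sum>j\<in>I. u R * a k j R * y j R)) + (\<Sum>j\<in>I. a i j R * y j R))
        = c' i R * T R + (\<Sum>j\<in>I. a' i j R * y j R)"
      by (simp add: c'_def a'_def algebra_simps sum.distrib sum_distrib_left)
    finally show ?case .
  qed
  have IH: "\<forall>i\<in>I. \<exists>b e. regv P b e \<and> (\<forall>\<^sub>F R in gen. y i R = b R * T R)"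
    by (rule insert.IH[OF c' a' eq])
  from bchoice[OF this] obtain b where b1: "\<forall>i\<in>I. \<exists>e. regv P (b i) e \<and> (\<forall>\<^sub>F R in gen. y i R = b i R * T R)"
    by blast
  from bchoice[OF this] obtain e where b: "\<And>i. i \<in> I \<Longrightarrow> regv P (b i) (e i)"
      "\<And>i. i \<in> I \<Longrightarrow> \<forall>\<^sub>F R in gen. y i R = b i R * T R" by blast
  have all: "\<forall>\<^sub>F R in gen. \<forall>i\<in>I. y i R = b i R * T R"
    using insert.hyps(1) b(2) by (subst eventually_ball_finite_distrib) auto
  have 1: "regv P (\<lambda>R. u R * c k R + (\<Sum>j\<in>I. u R * a k j R * b j R))
      (inverse 1 * cv k + (\<Sum>j\<in>I. inverse 1 * 0 * e j))"
    by (intro regv_add regv_mult regv_sum P u insert.prems b) auto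
  have 2: "\<forall>\<^sub>F R in gen. y k R = (u R * c k R + (\<Sum>j\<in>I. u R * a k j R * b j R)) * T R"
    using k all
  proof eventually_elim
    case (elim R)
    have "(\<Sum>j\<in>I. u R * a k j R * y j R) = (\<Sum>j\<in>I. u R * a k j R * b j R * T R)"
      by (rule sum.cong) (use elim(2) in auto)
    then show ?case using elim(1) by (simp add: distrib_right sum_distrib_right)
  qed
  show ?case using IH 1 2 by blast
qed simp

text \<open>T generates the maximal ideal of the local ring at P, stated for functions on
  points.\<close>

definition unif :: "('a, 'n) proj \<Rightarrow> (('a, 'n) proj \<Rightarrow> 'a) \<Rightarrow> bool" where
  "unif P T \<longleftrightarrow> regv P T 0 \<and> (\<forall>F. regv P F 0 \<longrightarrow> (\<exists>b c. regv P b c \<and> (\<forall>\<^sub>F R in gen. F R = b R * T R)))"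

text \<open>The relations \<open>w\<close> between the generators \<open>y i = x i / l - p i\<close> of the maximal ideal \<open>m\<close> modulo
  \<open>m y\<close> form a subspace.  It contains the gradients of the equations (by Taylor expansion) and \<open>l\<close>, so
  the Jacobian criterion makes it a hyperplane, and \<open>m\<close> is principal by Nakayama's lemma.\<close>

lemma uniformizer_linear:
  assumes P: "P \<in> V" and smooth: "smooth_curve_at V P" and l: "eval_at (lin_form l) P = 1"
  shows "\<exists>u. unif P (\<lambda>R. eval_at (lin_form u) R / eval_at (lin_form l) R)"
proof -
  define p where "p = rep_proj P"
  define L where "L R = eval_at (lin_form l) R" for R :: "('a, 'n) proj"
  have lp: "mpoly_eval (lin_form l) p = 1" using l by (simp add: eval_at_def p_def)
  have Lp: "L P = 1" using l by (simp add: L_def)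
  have l_nz: "eval_at (lin_form l) P \<noteq> 0" using l by simp
  have Lnz: "\<forall>\<^sub>F R in gen. L R \<noteq> 0"
    unfolding L_def by (rule eventually_form_nonzero[OF homogeneous_lin_form P l_nz])
  have hLd: "homogeneous d (lin_form l ^ d)" for d
    using homogeneous_power[OF homogeneous_lin_form, of d l] by simp
  define y where "y i R = eval_at (Var i) R / L R - p $ i" for i R
  have y: "regv P (y i) 0" for i
  proof -
    have "regv P (\<lambda>R. eval_at (Var i) R / L R) (eval_at (Var i) P / L P)"
      unfolding L_def by (rule regv_frac[OF homogeneous_Var homogeneous_lin_form l_nz])
    from regv_diff[OF P this regv_const[of P "p $ i"]] show ?thesis
      unfolding y_def by (simp add: Lp p_def)
  qed
  \<comment> \<open>Divided by a power of L, the expansion expresses any form through the functions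
    \<open>y i\<close>, with coefficients regular at P and values the partial derivatives.\<close>
  have taylor: "\<exists>a. (\<forall>i. regv P (a i) (mpoly_eval (mpoly_pderiv i G) p)) \<and>
      (\<forall>\<^sub>F R in gen. eval_at G R / L R ^ d = mpoly_eval G p + (\<Sum>i\<in>UNIV. a i R * y i R))"
    if G: "homogeneous d G" for d G
  proof -
    obtain A where A: "\<And>i. homogeneous (d - 1) (A i)" "\<And>i. d = 0 \<Longrightarrow> A i = 0"
        "\<And>i. mpoly_eval (A i) p = mpoly_eval (mpoly_pderiv i G) p"
        "G = Cst (mpoly_eval G p) * lin_form l ^ d +
           (\<Sum>i\<in>UNIV. (Var i - Cst (p $ i) * lin_form l) * A i)"
      using taylor_form[OF lp G] by blast
    define a where "a i R = eval_at (A i * lin_form l) R / eval_at (lin_form l ^ d) R" for i and R :: "('a, 'n) proj"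
    have hA: "homogeneous d (A i * lin_form l)" for i
    proof (cases "d = 0")
      case True
      then show ?thesis using A(2) by simp
    next
      case False
      have "homogeneous (d - 1 + Suc 0) (A i * lin_form l)"
        by (intro homogeneous_mult A(1) homogeneous_lin_form)
      then show ?thesis using False by simp
    qed
    have a1: "regv P (a i) (mpoly_eval (mpoly_pderiv i G) p)" for i
    proof -
      have "eval_at (lin_form l ^ d) P \<noteq> 0" using l by simp
      from regv_frac[OF hA hLd this] have "regv P (a i) (eval_at (A i * lin_form l) P / eval_at (lin_form l ^ d) P)"
        unfolding a_def .
      moreover have "eval_at (A i * lin_form l) P / eval_at (lin_form l ^ d) P = mpoly_eval (mpoly_pderiv i G) p"
        using l A(3)[of i] by (simp add: eval_at_def[of "A i"] p_def)
      ultimately show ?thesis by simp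
    qed
    have "\<forall>\<^sub>F R in gen. eval_at G R / L R ^ d = mpoly_eval G p + (\<Sum>i\<in>UNIV. a i R * y i R)"
      using Lnz
    proof eventually_elim
      case (elim R)
      have "eval_at G R = mpoly_eval G p * L R ^ d +
          (\<Sum>i\<in>UNIV. (eval_at (Var i) R - p $ i * L R) * eval_at (A i) R)"
        by (subst A(4)) (simp add: L_def)
      then have "eval_at G R / L R ^ d = mpoly_eval G p +
          (\<Sum>i\<in>UNIV. (eval_at (Var i) R - p $ i * L R) * eval_at (A i) R / L R ^ d)"
        using elim by (simp add: add_divide_distrib sum_divide_distrib)
      also have "(\<Sum>i\<in>UNIV. (eval_at (Var i) R - p $ i * L R) * eval_at (A i) R / L R ^ d) =
         (\<Sum>i\<in>UNIV. a i R * y i R)"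
      proof (rule sum.cong[OF refl])
        fix i
        have "a i R * y i R = eval_at (A i) R * L R / L R ^ d * ((eval_at (Var i) R - p $ i * L R) / L R)"
          using elim by (simp add: a_def y_def L_def[symmetric] diff_divide_distrib)
        then show "(eval_at (Var i) R - p $ i * L R) * eval_at (A i) R / L R ^ d = a i R * y i R"
          using elim by simp
      qed
      finally show ?case .
    qed
    then show ?thesis using a1 by blast
  qed
  define Rel where "Rel = {w. \<exists>a. (\<forall>i. regv P (a i) (w $ i)) \<and> (\<forall>\<^sub>F R in gen. (\<Sum>i\<in>UNIV. a i R * y i R) = 0)}"
  define W where "W = {\<chi> i. eval_at (mpoly_pderiv i F) P | F. F \<in> vanishing_forms V}"
  have sub: "vec.subspace Rel"
  proof (rule vec.subspaceI)
    show "0 \<in> Rel" unfolding Rel_def by (auto intro!: exI[of _ "\<lambda>_ _. 0"])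
    fix v w assume "v \<in> Rel" "w \<in> Rel"
    then obtain a b where a: "\<And>i. regv P (a i) (v $ i)" "\<forall>\<^sub>F R in gen. (\<Sum>i\<in>UNIV. a i R * y i R) = 0"
      and b: "\<And>i. regv P (b i) (w $ i)" "\<forall>\<^sub>F R in gen. (\<Sum>i\<in>UNIV. b i R * y i R) = 0"
      unfolding Rel_def by blast
    have 1: "regv P (\<lambda>R. a i R + b i R) ((v + w) $ i)" for i
      using regv_add[OF P a(1)[of i] b(1)[of i]] by simp
    have 2: "\<forall>\<^sub>F R in gen. (\<Sum>i\<in>UNIV. (a i R + b i R) * y i R) = 0"
      using a(2) b(2) by eventually_elim (simp add: distrib_right sum.distrib)
    show "v + w \<in> Rel" unfolding Rel_def mem_Collect_eq
      by (rule exI[of _ "\<lambda>i R. a i R + b i R"]) (intro conjI allI 1 2)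
  next
    fix c v assume "v \<in> Rel"
    then obtain a where a: "\<And>i. regv P (a i) (v $ i)" "\<forall>\<^sub>F R in gen. (\<Sum>i\<in>UNIV. a i R * y i R) = 0"
      unfolding Rel_def by blast
    have 1: "regv P (\<lambda>R. c * a i R) ((c *s v) $ i)" for i
      using regv_mult[OF P regv_const[of P c] a(1)[of i]] by simp
    have 2: "\<forall>\<^sub>F R in gen. (\<Sum>i\<in>UNIV. (c * a i R) * y i R) = 0"
      using a(2) by eventually_elim (simp add: mult.assoc sum_distrib_left[symmetric])
    show "c *s v \<in> Rel" unfolding Rel_def mem_Collect_eq
      by (rule exI[of _ "\<lambda>i R. c * a i R"]) (intro conjI allI 1 2)
  qed
  have W_Rel: "W \<subseteq> Rel"
  proof
    fix w assume "w \<in> W"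
    then obtain F d where F: "w = (\<chi> i. eval_at (mpoly_pderiv i F) P)" "homogeneous d F"
      "\<And>R. R \<in> V \<Longrightarrow> eval_at F R = 0" unfolding W_def vanishing_forms_def by blast
    obtain a where a: "\<And>i. regv P (a i) (mpoly_eval (mpoly_pderiv i F) p)"
      "\<forall>\<^sub>F R in gen. eval_at F R / L R ^ d = mpoly_eval F p + (\<Sum>i\<in>UNIV. a i R * y i R)"
      using taylor[OF F(2)] by blast
    have 0: "mpoly_eval F p = 0" using F(3)[OF P] by (simp add: eval_at_def p_def)
    have 1: "regv P (a i) (w $ i)" for i using a(1)[of i] by (simp add: F(1) eval_at_def p_def)
    have 2: "\<forall>\<^sub>F R in gen. (\<Sum>i\<in>UNIV. a i R * y i R) = 0"
      using a(2) eventually_gen_in by eventually_elim (simp add: F(3) 0)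
    show "w \<in> Rel" unfolding Rel_def mem_Collect_eq using 1 2 by blast
  qed
  have l_Rel: "l \<in> Rel"
  proof -
    have "\<forall>\<^sub>F R in gen. (\<Sum>i\<in>UNIV. l $ i * y i R) = 0"
      using Lnz
    proof eventually_elim
      case (elim R)
      have "(\<Sum>i\<in>UNIV. l $ i * y i R) = (\<Sum>i\<in>UNIV. l $ i * rep_proj R $ i) / L R - (\<Sum>i\<in>UNIV. l $ i * p $ i)"
        by (simp add: y_def right_diff_distrib sum_subtractf sum_divide_distrib)
      also have "(\<Sum>i\<in>UNIV. l $ i * rep_proj R $ i) = L R" by (simp add: L_def eval_at_def)
      also have "(\<Sum>i\<in>UNIV. l $ i * p $ i) = 1" using lp by simp
      finally show ?case using elim by simp
    qed
    then show ?thesis unfolding Rel_def by (auto intro!: exI[of _ "\<lambda>i _. l $ i"])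
  qed
  have l_span: "l \<notin> vec.span W"
  proof
    assume "l \<in> vec.span W"
    \<comment> \<open>By Euler's formula every gradient of a vanishing form is orthogonal to p,
      whereas \<open>l\<close> pairs with p to 1.\<close>
    have "vec.subspace {w. (\<Sum>i\<in>UNIV. w $ i * p $ i) = 0}"
      by (rule vec.subspaceI) (auto simp: distrib_right sum.distrib mult.assoc simp flip: sum_distrib_left)
    moreover have "W \<subseteq> {w. (\<Sum>i\<in>UNIV. w $ i * p $ i) = 0}"
    proof
      fix w assume "w \<in> W"
      then obtain F d where F: "w = (\<chi> i. eval_at (mpoly_pderiv i F) P)" "homogeneous d F"
        "\<And>R. R \<in> V \<Longrightarrow> eval_at F R = 0" unfolding W_def vanishing_forms_def by blast
      have "(\<Sum>i\<in>UNIV. w $ i * p $ i) = (\<Sum>i\<in>UNIV. p $ i * mpoly_eval (mpoly_pderiv i F) p)"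
        by (rule sum.cong) (auto simp: F(1) eval_at_def p_def)
      also have "\<dots> = of_nat d * mpoly_eval F p" by (rule euler_formula[OF F(2)])
      also have "\<dots> = 0" using F(3)[OF P] by (simp add: eval_at_def p_def)
      finally show "w \<in> {w. (\<Sum>i\<in>UNIV. w $ i * p $ i) = 0}" by simp
    qed
    ultimately have "vec.span W \<subseteq> {w. (\<Sum>i\<in>UNIV. w $ i * p $ i) = 0}"
      by (intro vec.span_minimal)
    then have "(\<Sum>i\<in>UNIV. l $ i * p $ i) = 0" using \<open>l \<in> vec.span W\<close> by blast
    then show False using lp by simp
  qed
  have dimW: "vec.dim W + 2 = CARD('n)" using smooth unfolding smooth_curve_at_def W_def .
  have dim1: "vec.dim (insert l W) = vec.dim W + 1"
    using l_span by (simp add: vec.dim_insert)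
  have "vec.span (insert l W) \<noteq> UNIV"
  proof
    assume "vec.span (insert l W) = UNIV"
    then have "vec.dim (insert l W) = CARD('n)"
      using vec.dim_span[of "insert l W"] vec_dim_card[where 'a = 'a and 'n = 'n] by simp
    then show False using dim1 dimW by simp
  qed
  then obtain u where u: "u \<notin> vec.span (insert l W)" by blast
  have dim2: "vec.dim (insert u (insert l W)) = CARD('n)"
    using u dim1 dimW by (simp add: vec.dim_insert)
  have span2: "vec.span (insert u (insert l W)) = UNIV"
    using vec.dim_eq_full[of "insert u (insert l W)"] dim2 vec_dim_card[where 'a = 'a and 'n = 'n]
    unfolding vec.dim_UNIV vec.dimension_def by simp
  have S_Rel: "vec.span (insert l W) \<subseteq> Rel"
    using W_Rel l_Rel sub by (intro vec.span_minimal) auto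
  \<comment> \<open>\<open>Rel\<close> contains a hyperplane that misses u, so modulo
    \<open>Rel\<close> every unit vector is a multiple of u; the combination of the
    \<open>y j\<close> with coefficients u is the candidate generator.\<close>
  have "\<forall>i. \<exists>c. axis i 1 - c *s u \<in> Rel"
    using span2 vec.span_breakdown_eq[of _ u "insert l W"] S_Rel by blast
  from choice[OF this] obtain c where c: "\<And>i. axis i 1 - c i *s u \<in> Rel" by blast
  define w where "w i = axis i 1 - c i *s u" for i
  have "\<forall>i. \<exists>a. (\<forall>j. regv P (a j) (w i $ j)) \<and> (\<forall>\<^sub>F R in gen. (\<Sum>j\<in>UNIV. a j R * y j R) = 0)"
    using c unfolding Rel_def w_def by blast
  from choice[OF this] obtain a where a: "\<And>i j. regv P (a i j) (w i $ j)"
    "\<And>i. \<forall>\<^sub>F R in gen. (\<Sum>j\<in>UNIV. a i j R * y j R) = 0" by blast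
  define T where "T R = (\<Sum>j\<in>UNIV. u $ j * y j R)" for R
  \<comment> \<open>A relation with coefficients a differs from the one with constant coefficients w
    by these functions, which vanish at P as \<open>nakayama\<close> requires.\<close>
  define \<alpha> where "\<alpha> i j R = w i $ j - a i j R" for i j R
  have \<alpha>: "regv P (\<alpha> i j) 0" for i j
    using regv_diff[OF P regv_const[of P "w i $ j"] a(1)[of i j]] unfolding \<alpha>_def by simp
  have rel: "\<forall>\<^sub>F R in gen. y i R = c i * T R + (\<Sum>j\<in>UNIV. \<alpha> i j R * y j R)" for i
    using a(2)[of i]
  proof eventually_elim
    case (elim R)
    have "(\<Sum>j\<in>UNIV. \<alpha> i j R * y j R) = (\<Sum>j\<in>UNIV. w i $ j * y j R)"
      using elim by (simp add: \<alpha>_def left_diff_distrib sum_subtractf)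
    also have "\<dots> = (\<Sum>j\<in>UNIV. (if j = i then y j R else 0) - c i * (u $ j * y j R))"
      by (rule sum.cong) (auto simp: w_def axis_def left_diff_distrib mult.assoc)
    also have "\<dots> = y i R - c i * T R"
      by (simp add: sum_subtractf sum_distrib_left T_def)
    finally show ?case by simp
  qed
  have "\<forall>i\<in>UNIV. \<exists>b e. regv P b e \<and> (\<forall>\<^sub>F R in gen. y i R = b R * T R)"
    by (rule nakayama[where c = "\<lambda>i _. c i" and cv = c and a = \<alpha>])
      (rule P finite_class.finite_UNIV regv_const \<alpha> rel)+
  then have "\<forall>i. \<exists>b. \<exists>e. regv P b e \<and> (\<forall>\<^sub>F R in gen. y i R = b R * T R)" by blast
  from choice[OF this] obtain b where "\<forall>i. \<exists>e. regv P (b i) e \<and> (\<forall>\<^sub>F R in gen. y i R = b i R * T R)" by blast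
  from choice[OF this] obtain e where b: "\<And>i. regv P (b i) (e i)" "\<And>i. \<forall>\<^sub>F R in gen. y i R = b i R * T R"
    by blast
  have allb: "\<forall>\<^sub>F R in gen. \<forall>i\<in>UNIV. y i R = b i R * T R"
    using b(2) by (subst eventually_ball_finite_distrib) auto
  \<comment> \<open>The constants subtracted in the \<open>y j\<close> are absorbed into a multiple
    of \<open>l\<close>, which makes T a quotient of two linear forms.\<close>
  define u' where "u' = u - (\<Sum>j\<in>UNIV. u $ j * p $ j) *s l"
  have T_eq: "\<forall>\<^sub>F R in gen. T R = eval_at (lin_form u') R / eval_at (lin_form l) R"
    using Lnz
  proof eventually_elim
    case (elim R)
    have 1: "(\<Sum>i\<in>UNIV. l $ i * rep_proj R $ i) = L R" by (simp add: L_def eval_at_def)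
    have "eval_at (lin_form u') R = (\<Sum>i\<in>UNIV. u $ i * rep_proj R $ i) -
        (\<Sum>j\<in>UNIV. u $ j * p $ j) * (\<Sum>i\<in>UNIV. l $ i * rep_proj R $ i)"
      by (simp add: eval_at_def u'_def left_diff_distrib sum_subtractf sum_distrib_left mult.assoc)
    then have "eval_at (lin_form u') R / L R = (\<Sum>i\<in>UNIV. u $ i * rep_proj R $ i) / L R - (\<Sum>j\<in>UNIV. u $ j * p $ j)"
      unfolding 1 using elim by (simp add: diff_divide_distrib)
    also have "\<dots> = T R"
      by (simp add: T_def y_def right_diff_distrib sum_subtractf sum_divide_distrib)
    finally show ?case by (simp add: L_def)
  qed
  have T0: "regv P T 0"
  proof -
    have "regv P T (\<Sum>j\<in>UNIV. u $ j * 0)"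
      unfolding T_def by (intro regv_sum regv_mult P y regv_const)
    then show ?thesis by simp
  qed
  have princ: "\<exists>b c. regv P b c \<and> (\<forall>\<^sub>F R in gen. F R = b R * T R)" if F: "regv P F 0" for F
  proof -
    obtain d g h where gh: "homogeneous d g" "homogeneous d h" "eval_at h P \<noteq> 0"
      "0 = eval_at g P / eval_at h P" "\<forall>\<^sub>F R in gen. F R = eval_at g R / eval_at h R"
      using F unfolding regv_def by blast
    obtain a where a: "\<And>i. regv P (a i) (mpoly_eval (mpoly_pderiv i g) p)"
      "\<forall>\<^sub>F R in gen. eval_at g R / L R ^ d = mpoly_eval g p + (\<Sum>i\<in>UNIV. a i R * y i R)"
      using taylor[OF gh(1)] by blast
    have g0: "mpoly_eval g p = 0" using gh(3,4) by (simp add: eval_at_def p_def)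
    define B where "B R = (\<Sum>i\<in>UNIV. a i R * b i R) * (eval_at (lin_form l ^ d) R / eval_at h R)" for R
    have "regv P B ((\<Sum>i\<in>UNIV. mpoly_eval (mpoly_pderiv i g) p * e i) * (eval_at (lin_form l ^ d) P / eval_at h P))"
      unfolding B_def by (intro regv_mult regv_sum P a(1) b(1) regv_frac[OF hLd gh(2,3)])
    moreover have "\<forall>\<^sub>F R in gen. F R = B R * T R"
      using gh(5) a(2) allb Lnz
    proof eventually_elim
      case (elim R)
      have "eval_at g R / L R ^ d = (\<Sum>i\<in>UNIV. a i R * b i R) * T R"
        unfolding sum_distrib_right elim(2) g0 using elim(3) by (simp add: mult.assoc)
      then have "eval_at g R = (\<Sum>i\<in>UNIV. a i R * b i R) * T R * L R ^ d"
        using elim(4) by (simp add: divide_eq_eq)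
      then show ?case unfolding elim(1) B_def by (simp add: L_def)
    qed
    ultimately show ?thesis by blast
  qed
  have "unif P (\<lambda>R. eval_at (lin_form u') R / eval_at (lin_form l) R)"
    unfolding unif_def
  proof (intro conjI allI impI)
    show "regv P (\<lambda>R. eval_at (lin_form u') R / eval_at (lin_form l) R) 0"
      by (rule regv_cong[OF T0 T_eq])
    fix F assume "regv P F 0"
    then obtain b c where bc: "regv P b c" "\<forall>\<^sub>F R in gen. F R = b R * T R" using princ by blast
    have "\<forall>\<^sub>F R in gen. F R = b R * (eval_at (lin_form u') R / eval_at (lin_form l) R)"
      using bc(2) T_eq by eventually_elim simp
    with bc(1) show "\<exists>b c. regv P b c \<and> (\<forall>\<^sub>F R in gen. F R = b R * (eval_at (lin_form u') R / eval_at (lin_form l) R))"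
      by blast
  qed
  then show ?thesis by blast
qed

end

section \<open>Orders of rational functions\<close>

context curve begin

lemma regv_powi:
  assumes "P \<in> V" "regv P F c" "c \<noteq> 0"
  shows "regv P (\<lambda>R. F R powi n) (c powi n)"
proof (cases "n \<ge> 0")
  case True
  then show ?thesis using regv_power[OF assms(1,2), of "nat n"] by (simp add: power_int_def)
next
  case False
  then show ?thesis using regv_power[OF assms(1) regv_inverse[OF assms], of "nat (- n)"]
    by (simp add: power_int_def)
qed

text \<open>If T were generically 0, the maximal ideal at P would be 0 and every function regular at
  P constant. Then all quotients of forms would be constant, but some rational function is
  not.\<close>

lemma unif_nonzero:
  assumes P: "P \<in> V" and T: "unif P T"
  shows "\<forall>\<^sub>F R in gen. T R \<noteq> 0"
proof (rule ccontr)
  assume "\<not> ?thesis"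
  moreover have "regv P T 0" using T unfolding unif_def by blast
  ultimately have T0: "\<forall>\<^sub>F R in gen. T R = 0"
    using rat_zero_or_nonzero[OF regv_rat[OF P]] by blast
  have const: "\<forall>\<^sub>F R in gen. F R = c" if F: "regv P F c" for F c
  proof -
    have "regv P (\<lambda>R. F R - c) 0" using regv_diff[OF P F regv_const[of P c]] by simp
    then obtain b where "\<forall>\<^sub>F R in gen. F R - c = b R * T R" using T unfolding unif_def by blast
    then show ?thesis using T0 by eventually_elim simp
  qed
  obtain F where F: "rat F" "\<And>c. \<forall>\<^sub>F R in gen. F R \<noteq> c" by (rule nonconstant_eventually_avoids) blast
  obtain d g h Q where gh: "homogeneous d g" "homogeneous d h" "Q \<in> V" "eval_at h Q \<noteq> 0"
    "\<forall>\<^sub>F R in gen. F R = eval_at g R / eval_at h R" by (rule ratE[OF F(1)])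
  obtain i where i: "eval_at (Var i) P \<noteq> 0" by (metis rep_proj_nonzero vec_eq_iff zero_index eval_at_simps(9))
  have hd: "homogeneous d (Var i ^ d)" using homogeneous_power[OF homogeneous_Var, of d i] by simp
  have id: "eval_at (Var i ^ d) P \<noteq> 0" using i by simp
  have 1: "\<forall>\<^sub>F R in gen. eval_at g R / eval_at (Var i ^ d) R = eval_at g P / eval_at (Var i ^ d) P"
    by (rule const[OF regv_frac[OF gh(1) hd id]])
  have 2: "\<forall>\<^sub>F R in gen. eval_at h R / eval_at (Var i ^ d) R = eval_at h P / eval_at (Var i ^ d) P"
    by (rule const[OF regv_frac[OF gh(2) hd id]])
  define c1 where "c1 = eval_at g P / eval_at (Var i ^ d) P"
  define c2 where "c2 = eval_at h P / eval_at (Var i ^ d) P"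
  have "\<forall>\<^sub>F R in gen. F R = c1 / c2"
    using 1[folded c1_def] 2[folded c2_def] gh(5) eventually_form_nonzero[OF hd P id]
  proof eventually_elim
    case (elim R)
    have "eval_at g R / eval_at h R = (eval_at g R / eval_at (Var i ^ d) R) / (eval_at h R / eval_at (Var i ^ d) R)"
      using elim(4) by simp
    then show ?case unfolding elim(1,2) elim(3) .
  qed
  then have "\<forall>\<^sub>F R in gen. False" using F(2)[of "c1 / c2"] by eventually_elim simp
  then show False by simp
qed

text \<open>A polynomial relation between \<open>F\<close> and \<open>T\<close> whose constant term in \<open>F\<close> is a nonzero polynomial
  in \<open>T\<close> exhibits \<open>F\<close> as a divisor of a power of \<open>T\<close>; this replaces Krull's intersection theorem.\<close>

lemma divides_power_of_unif:
  assumes P: "P \<in> V" and T: "unif P T" and F: "regv P F c" "\<not> (\<forall>\<^sub>F R in gen. F R = 0)"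
  shows "\<exists>k b e. regv P b e \<and> (\<forall>\<^sub>F R in gen. F R * b R = T R ^ k)"
proof -
  have T0: "regv P T 0" using T unfolding unif_def by blast
  obtain p where p: "Polynomial.coeff p 0 \<noteq> 0" "\<forall>\<^sub>F R in gen. poly2 p (T R) (F R) = 0"
    using dimension_one_algebraic_dependence[OF dim regv_rat[OF P T0] regv_rat[OF P F(1)] F(2)] by blast
  obtain q p' where qp: "p = pCons q p'" by (cases p)
  then have q: "q \<noteq> 0" using p(1) by simp
  \<comment> \<open>q = X^k r with r(0) nonzero, so r(T) is a unit at P and the relation can be
    solved for T^k.\<close>
  obtain r where r: "q = [:- 0, 1:] ^ Polynomial.order 0 q * r" "\<not> [:- 0, 1:] dvd r"
    using order_decomp[OF q, of 0] by blast
  define k where "k = Polynomial.order 0 q"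
  have r0: "poly r 0 \<noteq> 0" using r(2) poly_eq_0_iff_dvd[of r 0] by simp
  have qk: "poly q x = x ^ k * poly r x" for x
    by (subst r(1)) (simp add: k_def poly_power)
  define b where "b R = - poly2 p' (T R) (F R) / poly r (T R)" for R
  have rT: "regv P (\<lambda>R. poly r (T R)) (poly r 0)" by (rule regv_poly[OF P T0])
  have b: "regv P b (- poly2 p' 0 c / poly r 0)"
    unfolding b_def poly2_def
    by (intro regv_divide regv_uminus regv_poly2 P T0 F(1) rT r0)
  have rnz: "\<forall>\<^sub>F R in gen. poly r (T R) \<noteq> 0"
  proof -
    have "\<not> (\<forall>\<^sub>F R in gen. poly r (T R) = 0)"
      using regv_unique[OF P rT regv_const[of P 0]] r0 by blast
    then show ?thesis using rat_zero_or_nonzero[OF regv_rat[OF P rT]] by blast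
  qed
  have "\<forall>\<^sub>F R in gen. F R * b R = T R ^ k"
    using p(2) rnz
  proof eventually_elim
    case (elim R)
    have "T R ^ k * poly r (T R) = - (F R * poly2 p' (T R) (F R))"
      using elim(1) unfolding qp by (simp add: qk eq_neg_iff_add_eq_0)
    then show ?case using elim(2) by (simp add: b_def field_simps)
  qed
  with b show ?thesis by blast
qed

text \<open>If F vanishes at P it is divisible by T, and cancelling T lowers the exponent k. So k
  limits how often this can happen before a unit is reached.\<close>

lemma unif_decomp_nat:
  assumes P: "P \<in> V" and T: "unif P T"
  shows "regv P F c \<Longrightarrow> regv P b e \<Longrightarrow> \<forall>\<^sub>F R in gen. F R * b R = T R ^ k \<Longrightarrow>
    \<exists>n U u. regv P U u \<and> u \<noteq> 0 \<and> (\<forall>\<^sub>F R in gen. F R = U R * T R ^ n)"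
proof (induction k arbitrary: F c)
  case 0
  have "c * e = 1"
    using regv_unique[OF P regv_mult[OF P 0(1,2)] regv_const[of P 1]] 0(3) by simp
  then have "c \<noteq> 0" by auto
  then show ?case using 0(1) by (intro exI[of _ 0] exI[of _ F] exI[of _ c]) simp
next
  case (Suc k)
  show ?case
  proof (cases "c = 0")
    case False
    then show ?thesis using Suc.prems(1) by (intro exI[of _ 0] exI[of _ F] exI[of _ c]) simp
  next
    case True
    then obtain F' c' where F': "regv P F' c'" "\<forall>\<^sub>F R in gen. F R = F' R * T R"
      using T Suc.prems(1) unfolding unif_def by blast
    have "\<forall>\<^sub>F R in gen. F' R * b R = T R ^ k"
      using F'(2) Suc.prems(3) unif_nonzero[OF P T] by eventually_elim auto
    from Suc.IH[OF F'(1) Suc.prems(2) this] obtain n U u where U: "regv P U u" "u \<noteq> 0"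
      "\<forall>\<^sub>F R in gen. F' R = U R * T R ^ n" by blast
    have "\<forall>\<^sub>F R in gen. F R = U R * T R ^ Suc n"
      using F'(2) U(3) by eventually_elim simp
    with U show ?thesis by blast
  qed
qed

lemma unif_decomp:
  assumes P: "P \<in> V" and T: "unif P T" and F: "rat F" "\<not> (\<forall>\<^sub>F R in gen. F R = 0)"
  shows "\<exists>(n::int) U u. regv P U u \<and> u \<noteq> 0 \<and> (\<forall>\<^sub>F R in gen. F R = U R * T R powi n)"
proof -
  obtain d g h Q where gh: "homogeneous d g" "homogeneous d h" "Q \<in> V" "eval_at h Q \<noteq> 0"
    "\<forall>\<^sub>F R in gen. F R = eval_at g R / eval_at h R" by (rule ratE[OF F(1)])
  obtain i where i: "eval_at (Var i) P \<noteq> 0" by (metis rep_proj_nonzero vec_eq_iff zero_index eval_at_simps(9))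
  \<comment> \<open>A form of the common degree d that does not vanish at P; dividing by it turns
    numerator and denominator into functions regular at P.\<close>
  define l :: "('a, 'n) mpoly" where "l = Var i ^ d"
  have hd: "homogeneous d l" using homogeneous_power[OF homogeneous_Var, of d i] by (simp add: l_def)
  have id: "eval_at l P \<noteq> 0" using i by (simp add: l_def)
  have lnz: "\<forall>\<^sub>F R in gen. eval_at l R \<noteq> 0" by (rule eventually_form_nonzero[OF hd P id])
  define G where "G R = eval_at g R / eval_at l R" for R
  define H where "H R = eval_at h R / eval_at l R" for R
  have G: "regv P G (eval_at g P / eval_at l P)" unfolding G_def by (rule regv_frac[OF gh(1) hd id])
  have H: "regv P H (eval_at h P / eval_at l P)" unfolding H_def by (rule regv_frac[OF gh(2) hd id])
  have FGH: "\<forall>\<^sub>F R in gen. F R = G R / H R"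
    using gh(5) lnz by eventually_elim (simp add: G_def H_def)
  have Gnz: "\<not> (\<forall>\<^sub>F R in gen. G R = 0)"
  proof
    assume "\<forall>\<^sub>F R in gen. G R = 0"
    then have "\<forall>\<^sub>F R in gen. F R = 0" using FGH by eventually_elim simp
    then show False using F(2) by blast
  qed
  have Hnz: "\<not> (\<forall>\<^sub>F R in gen. H R = 0)"
  proof
    assume "\<forall>\<^sub>F R in gen. H R = 0"
    then have "\<forall>\<^sub>F R in gen. F R = 0" using FGH by eventually_elim simp
    then show False using F(2) by blast
  qed
  obtain n U u where U: "regv P U u" "u \<noteq> 0" "\<forall>\<^sub>F R in gen. G R = U R * T R ^ n"
    using divides_power_of_unif[OF P T G Gnz] unif_decomp_nat[OF P T G] by blast
  obtain m W w where W: "regv P W w" "w \<noteq> 0" "\<forall>\<^sub>F R in gen. H R = W R * T R ^ m"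
    using divides_power_of_unif[OF P T H Hnz] unif_decomp_nat[OF P T H] by blast
  have "\<forall>\<^sub>F R in gen. F R = U R / W R * T R powi (int n - int m)"
    using FGH U(3) W(3) unif_nonzero[OF P T]
    by eventually_elim (simp add: power_int_diff)
  moreover have "regv P (\<lambda>R. U R / W R) (u / w)" by (rule regv_divide[OF P U(1) W(1,2)])
  moreover have "u / w \<noteq> 0" using U(2) W(2) by simp
  ultimately show ?thesis by blast
qed

lemma unif_unit_quotient:
  assumes P: "P \<in> V" and T: "unif P T" and T': "unif P T'"
  shows "\<exists>b c. regv P b c \<and> c \<noteq> 0 \<and> (\<forall>\<^sub>F R in gen. T' R = b R * T R)"
proof -
  obtain b c where b: "regv P b c" "\<forall>\<^sub>F R in gen. T' R = b R * T R"
    using T T' unfolding unif_def by blast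
  obtain b' c' where b': "regv P b' c'" "\<forall>\<^sub>F R in gen. T R = b' R * T' R"
    using T T' unfolding unif_def by blast
  have "\<forall>\<^sub>F R in gen. b R * b' R = 1"
    using b(2) b'(2) unif_nonzero[OF P T]
  proof eventually_elim
    case (elim R)
    have "T R = b' R * (b R * T R)" using elim by simp
    then have "(b R * b' R) * T R = 1 * T R" by (simp add: mult_ac)
    then show ?case using elim(3) by (metis mult_right_cancel)
  qed
  from regv_unique[OF P regv_mult[OF P b(1) b'(1)] regv_const[of P 1] this]
  have "c \<noteq> 0" by auto
  with b show ?thesis by blast
qed

text \<open>If m exceeded n, then W would be a regular multiple of a positive power of T and vanish
  at P. With U regular and W a unit, the lemma gives both the uniqueness of the order and, with m =
  0, a bound on the order from regularity.\<close>

lemma unif_exponent_le: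
  assumes P: "P \<in> V" and T: "unif P T" and T': "unif P T'"
    and U: "regv P U u" and W: "regv P W w" "w \<noteq> 0"
    and eq: "\<forall>\<^sub>F R in gen. W R * T R powi n = U R * T' R powi (m::int)"
  shows "m \<le> n"
proof (rule ccontr)
  assume "\<not> m \<le> n"
  define k where "k = nat (m - n)"
  have m: "m = n + int k" and k: "k > 0" using \<open>\<not> m \<le> n\<close> by (auto simp: k_def)
  obtain b c where b: "regv P b c" "c \<noteq> 0" "\<forall>\<^sub>F R in gen. T' R = b R * T R"
    using unif_unit_quotient[OF P T T'] by blast
  have "\<forall>\<^sub>F R in gen. W R = U R * b R powi m * T R ^ k"
    using eq b(3) unif_nonzero[OF P T]
  proof eventually_elim
    case (elim R)
    have "T' R powi m = b R powi m * (T R powi n * T R ^ k)"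
      using elim(3) by (simp add: elim(2) power_int_mult_distrib m power_int_add)
    then have "W R * T R powi n = (U R * b R powi m * T R ^ k) * T R powi n"
      using elim(1) by (simp add: mult_ac)
    moreover have "T R powi n \<noteq> 0" using elim(3) by simp
    ultimately show ?case by (metis mult_right_cancel)
  qed
  moreover have "regv P (\<lambda>R. U R * b R powi m * T R ^ k) (u * c powi m * 0 ^ k)"
    using T unfolding unif_def by (intro regv_mult regv_powi regv_power P U b(1,2)) blast
  ultimately have "w = u * c powi m * 0 ^ k" using regv_unique[OF P W(1)] by blast
  then show False using W(2) k by simp
qed

section \<open>Comparison with uniformizers and orders in the function field\<close>

lemma max_ideal_iff:
  assumes P: "P \<in> V"
  shows "f \<in> max_ideal V P \<longleftrightarrow> f \<in> carrier FF \<and> regv P (fn f) 0"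
proof
  assume "f \<in> max_ideal V P"
  then have f: "f \<in> local_ring V P" "ratfun_value f P = 0" unfolding max_ideal_def by auto
  then obtain c where c: "f \<in> carrier FF" "regv P (fn f) c" using local_ring_iff[OF P] by blast
  then show "f \<in> carrier FF \<and> regv P (fn f) 0" using ratfun_value_eq[OF P c] f(2) by simp
next
  assume f: "f \<in> carrier FF \<and> regv P (fn f) 0"
  then have "f \<in> local_ring V P" using local_ring_iff[OF P] by blast
  then show "f \<in> max_ideal V P" using ratfun_value_eq[OF P] f unfolding max_ideal_def by blast
qed

lemma uniformizer_iff:
  assumes P: "P \<in> V"
  shows "uniformizer V P t \<longleftrightarrow> t \<in> carrier FF \<and> unif P (fn t)"
proof
  assume t: "uniformizer V P t"
  then have tm: "t \<in> max_ideal V P"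
    and eq: "max_ideal V P = {t \<otimes>\<^bsub>FF\<^esub> u | u. u \<in> local_ring V P}" unfolding uniformizer_def by auto
  have tc: "t \<in> carrier FF" "regv P (fn t) 0" using tm max_ideal_iff[OF P] by auto
  have "\<exists>b c. regv P b c \<and> (\<forall>\<^sub>F R in gen. F R = b R * fn t R)" if F: "regv P F 0" for F
  proof -
    obtain f where f: "f \<in> carrier FF" "\<forall>\<^sub>F R in gen. fn f R = F R" by (rule fn_surj[OF regv_rat[OF P F]])
    have f2: "\<forall>\<^sub>F R in gen. F R = fn f R" using f(2) by eventually_elim simp
    have "f \<in> max_ideal V P" unfolding max_ideal_iff[OF P] using f(1) regv_cong[OF F f2] by blast
    then obtain u where u: "u \<in> local_ring V P" "f = t \<otimes>\<^bsub>FF\<^esub> u" using eq by blast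
    then obtain c where c: "u \<in> carrier FF" "regv P (fn u) c" using local_ring_iff[OF P] by blast
    have "\<forall>\<^sub>F R in gen. F R = fn u R * fn t R"
      using f2 fn_mult[OF tc(1) c(1)] unfolding u(2) by eventually_elim (simp add: mult.commute)
    with c(2) show ?thesis by blast
  qed
  then show "t \<in> carrier FF \<and> unif P (fn t)" using tc unfolding unif_def by blast
next
  assume t: "t \<in> carrier FF \<and> unif P (fn t)"
  then have t0: "t \<in> carrier FF" "regv P (fn t) 0" unfolding unif_def by auto
  have "max_ideal V P = {t \<otimes>\<^bsub>FF\<^esub> u | u. u \<in> local_ring V P}"
  proof (intro equalityI subsetI)
    fix f assume "f \<in> max_ideal V P"
    then have f: "f \<in> carrier FF" "regv P (fn f) 0" using max_ideal_iff[OF P] by auto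
    then obtain b c where b: "regv P b c" "\<forall>\<^sub>F R in gen. fn f R = b R * fn t R" using t unfolding unif_def by blast
    obtain u where u: "u \<in> carrier FF" "\<forall>\<^sub>F R in gen. fn u R = b R" by (rule fn_surj[OF regv_rat[OF P b(1)]])
    have u2: "\<forall>\<^sub>F R in gen. b R = fn u R" using u(2) by eventually_elim simp
    have ul: "u \<in> local_ring V P" unfolding local_ring_iff[OF P] using u(1) regv_cong[OF b(1) u2] by blast
    have "f = t \<otimes>\<^bsub>FF\<^esub> u"
    proof (rule fn_inj)
      show "\<forall>\<^sub>F R in gen. fn f R = fn (t \<otimes>\<^bsub>FF\<^esub> u) R"
        using b(2) u(2) fn_mult[OF t0(1) u(1)] by eventually_elim (simp add: mult.commute)
    qed (use f t0 u FF_closed in auto)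
    then show "f \<in> {t \<otimes>\<^bsub>FF\<^esub> u | u. u \<in> local_ring V P}" using ul by blast
  next
    fix f assume "f \<in> {t \<otimes>\<^bsub>FF\<^esub> u | u. u \<in> local_ring V P}"
    then obtain u c where u: "f = t \<otimes>\<^bsub>FF\<^esub> u" "u \<in> carrier FF" "regv P (fn u) c"
      using local_ring_iff[OF P] by blast
    have m: "\<forall>\<^sub>F R in gen. fn t R * fn u R = fn f R"
      unfolding u(1) using fn_mult[OF t0(1) u(2)] by eventually_elim simp
    have "regv P (fn f) (0 * c)" by (rule regv_cong[OF regv_mult[OF P t0(2) u(3)] m])
    then show "f \<in> max_ideal V P"
      unfolding max_ideal_iff[OF P] using FF_closed(1)[OF t0(1) u(2)] u(1) by simp
  qed
  then show "uniformizer V P t" unfolding uniformizer_def using max_ideal_iff[OF P] t0 by blast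
qed

text \<open>A pole of order at most k at P. The test runs over all functions vanishing at P instead
  of one chosen uniformizer, which makes invariance under automorphisms visible.\<close>

definition pole_le :: "('a, 'n) proj \<Rightarrow> nat \<Rightarrow> (('a, 'n) proj \<Rightarrow> 'a) \<Rightarrow> bool" where
  "pole_le P k F \<longleftrightarrow> (\<forall>s. regv P s 0 \<longrightarrow> (\<exists>c. regv P (\<lambda>R. s R ^ k * F R) c))"

lemma pole_le_unif:
  assumes P: "P \<in> V" and T: "unif P T"
  shows "pole_le P k F \<longleftrightarrow> (\<exists>c. regv P (\<lambda>R. T R ^ k * F R) c)"
proof
  assume "pole_le P k F"
  then show "\<exists>c. regv P (\<lambda>R. T R ^ k * F R) c" using T unfolding pole_le_def unif_def by blast
next
  assume "\<exists>c. regv P (\<lambda>R. T R ^ k * F R) c"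
  then obtain c where c: "regv P (\<lambda>R. T R ^ k * F R) c" by blast
  show "pole_le P k F" unfolding pole_le_def
  proof (intro allI impI)
    fix s assume "regv P s 0"
    then obtain b e where b: "regv P b e" "\<forall>\<^sub>F R in gen. s R = b R * T R" using T unfolding unif_def by blast
    have "\<forall>\<^sub>F R in gen. b R ^ k * (T R ^ k * F R) = s R ^ k * F R"
      using b(2) by eventually_elim (simp add: power_mult_distrib)
    from regv_cong[OF regv_mult[OF P regv_power[OF P b(1)] c] this]
    show "\<exists>c. regv P (\<lambda>R. s R ^ k * F R) c" by blast
  qed
qed

lemma unif_exists:
  assumes P: "P \<in> V" and smooth: "smooth_curve_at V P"
  obtains T where "unif P T"
proof -
  obtain i where i: "rep_proj P $ i \<noteq> 0" by (metis rep_proj_nonzero vec_eq_iff zero_index)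
  have "eval_at (lin_form (axis i (inverse (rep_proj P $ i)))) P
      = (\<Sum>j\<in>UNIV. if j = i then inverse (rep_proj P $ i) * rep_proj P $ i else 0)"
    unfolding eval_at_def mpoly_eval_lin_form by (rule sum.cong) (auto simp: axis_def)
  then have "eval_at (lin_form (axis i (inverse (rep_proj P $ i)))) P = 1" using i by simp
  then show ?thesis using uniformizer_linear[OF P smooth] that by blast
qed

text \<open>\<open>ord_at\<close> is a definite description, so the decomposition into a unit and a
  power of a uniformizer has to exist and to determine the exponent, whatever uniformizer is taken.
  After that the order can be forgotten in favour of \<open>pole_le\<close>.\<close>

lemma ord_at_ge_iff:
  assumes P: "P \<in> V" and smooth: "smooth_curve_at V P" and f: "f \<in> carrier FF" "f \<noteq> \<zero>\<^bsub>FF\<^esub>"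
  shows "ord_at V P f + int k \<ge> 0 \<longleftrightarrow> pole_le P k (fn f)"
proof -
  obtain T where T: "unif P T" by (rule unif_exists[OF P smooth])
  have fnz: "\<not> (\<forall>\<^sub>F R in gen. fn f R = 0)" using fn_zero_iff[OF f(1)] f(2) by blast
  obtain n U u where U: "regv P U u" "u \<noteq> 0" "\<forall>\<^sub>F R in gen. fn f R = U R * T R powi n"
    using unif_decomp[OF P T fn_rat[OF f(1)] fnz] by blast
  have "ord_at V P f = n"
    unfolding ord_at_def
  proof (rule the_equality)
    obtain t where t: "t \<in> carrier FF" "\<forall>\<^sub>F R in gen. fn t R = T R"
      using fn_surj[OF regv_rat[OF P]] T unfolding unif_def by blast
    obtain v where v: "v \<in> carrier FF" "\<forall>\<^sub>F R in gen. fn v R = U R"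
      using fn_surj[OF regv_rat[OF P U(1)]] by blast
    have t2: "\<forall>\<^sub>F R in gen. T R = fn t R" using t(2) by eventually_elim simp
    have v2: "\<forall>\<^sub>F R in gen. U R = fn v R" using v(2) by eventually_elim simp
    have "unif P (fn t)" unfolding unif_def
    proof (intro conjI allI impI)
      show "regv P (fn t) 0" using regv_cong[OF _ t2] T unfolding unif_def by blast
      fix F assume "regv P F 0"
      then obtain b c where "regv P b c" "\<forall>\<^sub>F R in gen. F R = b R * T R" using T unfolding unif_def by blast
      moreover from this(2) t2 have "\<forall>\<^sub>F R in gen. F R = b R * fn t R" by eventually_elim simp
      ultimately show "\<exists>b c. regv P b c \<and> (\<forall>\<^sub>F R in gen. F R = b R * fn t R)" by blast
    qed
    then have tu: "uniformizer V P t" using uniformizer_iff[OF P] t(1) by blast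
    have vU: "regv P (fn v) u" by (rule regv_cong[OF U(1) v2])
    have vl: "v \<in> local_ring V P - max_ideal V P"
      using vU v(1) U(2) regv_unique[OF P vU, of "fn v" 0] local_ring_iff[OF P] max_ideal_iff[OF P] by auto
    have tnz: "t \<noteq> \<zero>\<^bsub>FF\<^esub>"
    proof
      assume "t = \<zero>\<^bsub>FF\<^esub>"
      then have "\<forall>\<^sub>F R in gen. fn t R = 0" using fn_zero by simp
      then have "\<forall>\<^sub>F R in gen. False" using t(2) unif_nonzero[OF P T] by eventually_elim simp
      then show False by simp
    qed
    have "f = v \<otimes>\<^bsub>FF\<^esub> (t [^]\<^bsub>FF\<^esub> n)"
    proof (rule fn_inj)
      show "\<forall>\<^sub>F R in gen. fn f R = fn (v \<otimes>\<^bsub>FF\<^esub> (t [^]\<^bsub>FF\<^esub> n)) R"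
        using U(3) v(2) t(2) fn_mult[OF v(1) fn_int_pow(1)[OF t(1) tnz, of n]] fn_int_pow(2)[OF t(1) tnz, of n]
        by eventually_elim simp
      show "v \<otimes>\<^bsub>FF\<^esub> (t [^]\<^bsub>FF\<^esub> n) \<in> carrier FF" by (rule FF_closed(1)[OF v(1) fn_int_pow(1)[OF t(1) tnz]])
    qed (rule f(1))
    with tu vl show "\<exists>t u. uniformizer V P t \<and> u \<in> local_ring V P - max_ideal V P \<and> f = u \<otimes>\<^bsub>FF\<^esub> (t [^]\<^bsub>FF\<^esub> n)"
      by blast
  next
    fix m :: int
    assume "\<exists>t u. uniformizer V P t \<and> u \<in> local_ring V P - max_ideal V P \<and> f = u \<otimes>\<^bsub>FF\<^esub> (t [^]\<^bsub>FF\<^esub> m)"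
    then obtain t v where tv: "uniformizer V P t" "v \<in> local_ring V P" "v \<notin> max_ideal V P"
      "f = v \<otimes>\<^bsub>FF\<^esub> (t [^]\<^bsub>FF\<^esub> m)" by blast
    have t: "t \<in> carrier FF" "unif P (fn t)" using uniformizer_iff[OF P] tv(1) by auto
    obtain w where w: "v \<in> carrier FF" "regv P (fn v) w" using local_ring_iff[OF P] tv(2) by blast
    have wnz: "w \<noteq> 0" using w tv(3) max_ideal_iff[OF P] by auto
    have tnz: "t \<noteq> \<zero>\<^bsub>FF\<^esub>"
    proof
      assume "t = \<zero>\<^bsub>FF\<^esub>"
      then have "\<forall>\<^sub>F R in gen. fn t R = 0" using fn_zero by simp
      then have "\<forall>\<^sub>F R in gen. False" using unif_nonzero[OF P t(2)] by eventually_elim simp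
      then show False by simp
    qed
    have fe: "\<forall>\<^sub>F R in gen. fn f R = fn v R * fn t R powi m"
      unfolding tv(4) using fn_mult[OF w(1) fn_int_pow(1)[OF t(1) tnz, of m]] fn_int_pow(2)[OF t(1) tnz, of m]
      by eventually_elim simp
    have e1: "\<forall>\<^sub>F R in gen. U R * T R powi n = fn v R * fn t R powi m"
      using fe U(3) by eventually_elim simp
    have e2: "\<forall>\<^sub>F R in gen. fn v R * fn t R powi m = U R * T R powi n"
      using fe U(3) by eventually_elim simp
    show "m = n"
      using unif_exponent_le[OF P T t(2) w(2) U(1,2) e1] unif_exponent_le[OF P t(2) T U(1) w(2) wnz e2] by simp
  qed
  moreover have "n + int k \<ge> 0 \<longleftrightarrow> pole_le P k (fn f)"
    unfolding pole_le_unif[OF P T]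
  proof
    assume "n + int k \<ge> 0"
    then obtain m where m: "n + int k = int m" by (metis nonneg_int_cases)
    have 1: "regv P (\<lambda>R. U R * T R ^ m) (u * 0 ^ m)"
      using T unfolding unif_def by (intro regv_mult regv_power P U(1)) blast
    have 2: "\<forall>\<^sub>F R in gen. U R * T R ^ m = T R ^ k * fn f R"
      using U(3) unif_nonzero[OF P T]
    proof eventually_elim
      case (elim R)
      have "T R ^ m = T R powi (n + int k)" unfolding m by simp
      also have "\<dots> = T R powi n * T R ^ k" using elim(2) by (simp add: power_int_add)
      finally show ?case using elim(1) by (simp add: mult_ac)
    qed
    show "\<exists>c. regv P (\<lambda>R. T R ^ k * fn f R) c" using regv_cong[OF 1 2] by blast
  next
    assume "\<exists>c. regv P (\<lambda>R. T R ^ k * fn f R) c"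
    then obtain c where c: "regv P (\<lambda>R. T R ^ k * fn f R) c" by blast
    have "\<forall>\<^sub>F R in gen. U R * T R powi (n + int k) = (T R ^ k * fn f R) * T R powi 0"
      using U(3) unif_nonzero[OF P T] by eventually_elim (simp add: power_int_add mult_ac)
    from unif_exponent_le[OF P T T c U(1,2) this] show "n + int k \<ge> 0" .
  qed
  ultimately show ?thesis by simp
qed

lemma pole_le_0: "P \<in> V \<Longrightarrow> pole_le P 0 F \<longleftrightarrow> (\<exists>c. regv P F c)"
  unfolding pole_le_def using regv_const[of P 0] by auto

end

section \<open>Zeros and poles\<close>

locale smooth_curve = curve V for V :: "('a::alg_closed_field, 'n::finite) proj set" +
  assumes smooth: "\<And>P. P \<in> V \<Longrightarrow> smooth_curve_at V P"
begin

lemma pole_le_cong: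
  assumes "pole_le P k F" "\<forall>\<^sub>F R in gen. F R = G R"
  shows "pole_le P k G"
  unfolding pole_le_def
proof (intro allI impI)
  fix s assume "regv P s 0"
  then obtain c where c: "regv P (\<lambda>R. s R ^ k * F R) c" using assms(1) unfolding pole_le_def by blast
  have "\<forall>\<^sub>F R in gen. s R ^ k * F R = s R ^ k * G R" using assms(2) by eventually_elim simp
  from regv_cong[OF c this] show "\<exists>c. regv P (\<lambda>R. s R ^ k * G R) c" by blast
qed

lemma pole_le_regv: "P \<in> V \<Longrightarrow> regv P F c \<Longrightarrow> pole_le P k F"
  unfolding pole_le_def using regv_mult regv_power by blast

lemma pole_le_add:
  assumes P: "P \<in> V" and "pole_le P k F" "pole_le P k G"
  shows "pole_le P k (\<lambda>R. F R + G R)"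
  unfolding pole_le_def
proof (intro allI impI)
  fix s assume s: "regv P s 0"
  obtain c e where "regv P (\<lambda>R. s R ^ k * F R) c" "regv P (\<lambda>R. s R ^ k * G R) e"
    using assms(2,3) s unfolding pole_le_def by blast
  from regv_add[OF P this] show "\<exists>c. regv P (\<lambda>R. s R ^ k * (F R + G R)) c"
    by (auto simp: distrib_left)
qed

lemma pole_le_mult:
  assumes P: "P \<in> V" and "pole_le P k F" "pole_le P m G"
  shows "pole_le P (k + m) (\<lambda>R. F R * G R)"
  unfolding pole_le_def
proof (intro allI impI)
  fix s assume s: "regv P s 0"
  obtain c e where ce: "regv P (\<lambda>R. s R ^ k * F R) c" "regv P (\<lambda>R. s R ^ m * G R) e"
    using assms(2,3) s unfolding pole_le_def by blast
  have "(\<lambda>R. s R ^ k * F R * (s R ^ m * G R)) = (\<lambda>R. s R ^ (k + m) * (F R * G R))"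
    by (simp add: fun_eq_iff power_add mult_ac)
  then show "\<exists>c. regv P (\<lambda>R. s R ^ (k + m) * (F R * G R)) c"
    using regv_mult[OF P ce] by auto
qed

lemma pole_le_mono: "P \<in> V \<Longrightarrow> pole_le P k F \<Longrightarrow> k \<le> m \<Longrightarrow> pole_le P m F"
  using pole_le_mult[of P k F "m - k" "\<lambda>_. 1"] pole_le_regv[OF _ regv_const] by simp

lemma pole_le_cmult: "P \<in> V \<Longrightarrow> pole_le P k F \<Longrightarrow> pole_le P k (\<lambda>R. c * F R)"
  using pole_le_mult[of P 0 "\<lambda>_. c" k F] pole_le_regv[OF _ regv_const] by simp

lemma pole_le_diff: "P \<in> V \<Longrightarrow> pole_le P k F \<Longrightarrow> pole_le P k G \<Longrightarrow> pole_le P k (\<lambda>R. F R - G R)"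
  using pole_le_add[OF _ _ pole_le_cmult[where c = "- 1"]] by simp

lemma pole_le_power: "P \<in> V \<Longrightarrow> pole_le P k F \<Longrightarrow> pole_le P (j * k) (\<lambda>R. F R ^ j)"
proof (induction j)
  case 0
  then show ?case using pole_le_regv[OF _ regv_const] by simp
next
  case (Suc j)
  then show ?case using pole_le_mult[of P k F "j * k" "\<lambda>R. F R ^ j"] by simp
qed

lemma pole_le_exists:
  assumes P: "P \<in> V" and F: "rat F"
  shows "\<exists>k. pole_le P k F"
proof (cases "\<forall>\<^sub>F R in gen. F R = 0")
  case True
  then have "\<forall>\<^sub>F R in gen. 0 = F R" by eventually_elim simp
  from regv_cong[OF regv_const this] show ?thesis using pole_le_regv[OF P] by blast
next
  case False
  obtain T where T: "unif P T" by (rule unif_exists[OF P smooth[OF P]])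
  obtain n U u where U: "regv P U u" "u \<noteq> 0" "\<forall>\<^sub>F R in gen. F R = U R * T R powi n"
    using unif_decomp[OF P T F False] by blast
  define k where "k = nat (- n)"
  have e: "\<forall>\<^sub>F R in gen. U R * T R ^ nat (n + int k) = T R ^ k * F R"
    using U(3) unif_nonzero[OF P T]
  proof eventually_elim
    case (elim R)
    have "n + int k \<ge> 0" by (simp add: k_def)
    then have "T R ^ nat (n + int k) = T R powi (n + int k)" by (simp add: power_int_def)
    also have "\<dots> = T R powi n * T R ^ k" using elim(2) by (simp add: power_int_add)
    finally show ?case using elim(1) by (simp add: mult_ac)
  qed
  have "regv P (\<lambda>R. U R * T R ^ nat (n + int k)) (u * 0 ^ nat (n + int k))"
    using T unfolding unif_def by (intro regv_mult regv_power P U(1)) blast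
  from regv_cong[OF this e] show ?thesis unfolding pole_le_unif[OF P T, symmetric, THEN ex_cong1]
    using pole_le_unif[OF P T] by blast
qed

text \<open>A positive bound is needed at most at the finitely many points where F is not regular
  with its own value.\<close>

lemma pole_divisor_exists:
  assumes F: "rat F"
  shows "\<exists>E :: ('a, 'n) proj \<Rightarrow> nat. finite {P. E P \<noteq> 0} \<and> {P. E P \<noteq> 0} \<subseteq> V \<and> (\<forall>P\<in>V. pole_le P (E P) F)"
proof -
  have "\<forall>P\<in>V. \<exists>k. pole_le P k F" using pole_le_exists[OF _ F] by blast
  from bchoice[OF this] obtain k where k: "\<And>P. P \<in> V \<Longrightarrow> pole_le P (k P) F" by blast
  define B where "B = {P\<in>V. \<not> (P \<in> V \<and> regv P F (F P))}"
  have B: "finite B" using rat_eventually_regv[OF F] unfolding eventually_gen_iff B_def .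
  define E where "E P = (if P \<in> B then k P else 0)" for P
  have "{P. E P \<noteq> 0} \<subseteq> B" by (auto simp: E_def)
  moreover have "B \<subseteq> V" by (auto simp: B_def)
  moreover have "pole_le P (E P) F" if "P \<in> V" for P
  proof (cases "P \<in> B")
    case True
    then show ?thesis using k[OF that] by (simp add: E_def)
  next
    case False
    then have "regv P F (F P)" using that by (simp add: B_def)
    then show ?thesis by (rule pole_le_regv[OF that])
  qed
  ultimately show ?thesis using B by (intro exI[of _ E]) (auto intro: finite_subset)
qed

text \<open>If the coefficient of the highest allowed pole term vanishes, T divides the remaining
  function and the pole order drops by one.\<close>

lemma pole_le_lower:
  assumes P: "P \<in> V" and T: "unif P T" and F: "regv P (\<lambda>R. T R ^ Suc a * F R) 0"
  shows "pole_le P a F"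
proof -
  obtain b c where b: "regv P b c" "\<forall>\<^sub>F R in gen. T R ^ Suc a * F R = b R * T R"
    using F T unfolding unif_def by blast
  have "\<forall>\<^sub>F R in gen. b R = T R ^ a * F R"
    using b(2) unif_nonzero[OF P T] by eventually_elim (simp add: mult_ac)
  from regv_cong[OF b(1) this] show ?thesis using pole_le_unif[OF P T] by blast
qed

text \<open>Global sections of the structure sheaf are constant. It is carried as a hypothesis until
  the line supplies it in \<open>quotient_regular_constant\<close>.\<close>

definition only_constants_regular :: bool where
  "only_constants_regular \<longleftrightarrow> (\<forall>F. rat F \<longrightarrow> (\<forall>P\<in>V. \<exists>c. regv P F c) \<longrightarrow> (\<exists>c. \<forall>\<^sub>F R in gen. F R = c))"

text \<open>The bound deg A + 1 on the dimension of L(A). Lowering A by one point imposes one linear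
  condition, the vanishing of the leading coefficient at that point; for A = 0 only constants
  remain.\<close>

lemma linearly_dependent:
  fixes A :: "('a, 'n) proj \<Rightarrow> nat"
  assumes const: only_constants_regular
  shows "finite {P. A P \<noteq> 0} \<Longrightarrow> {P. A P \<noteq> 0} \<subseteq> V \<Longrightarrow> (\<Sum>P | A P \<noteq> 0. A P) = d \<Longrightarrow>
    finite I \<Longrightarrow> card I > d + 1 \<Longrightarrow> (\<And>i. i \<in> I \<Longrightarrow> rat (f i)) \<Longrightarrow>
    (\<And>i P. i \<in> I \<Longrightarrow> P \<in> V \<Longrightarrow> pole_le P (A P) (f i)) \<Longrightarrow>
    \<exists>c. (\<exists>i\<in>I. c i \<noteq> 0) \<and> (\<forall>\<^sub>F R in gen. (\<Sum>i\<in>I. c i * f i R) = 0)"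
proof (induction d arbitrary: A I f)
  case 0
  then have A0: "A P = 0" for P by auto
  have "\<exists>a. \<forall>\<^sub>F R in gen. f i R = a" if "i \<in> I" for i
  proof -
    have "\<forall>P\<in>V. \<exists>c. regv P (f i) c"
      using 0(7)[OF that] pole_le_0 unfolding A0 by blast
    then show ?thesis using const 0(6)[OF that] unfolding only_constants_regular_def by blast
  qed
  then have "\<forall>i\<in>I. \<exists>a. \<forall>\<^sub>F R in gen. f i R = a" by blast
  from bchoice[OF this] obtain a where a: "\<And>i. i \<in> I \<Longrightarrow> \<forall>\<^sub>F R in gen. f i R = a i" by blast
  have all: "\<forall>\<^sub>F R in gen. \<forall>i\<in>I. f i R = a i"
    using 0(4) a by (subst eventually_ball_finite_distrib) auto
  have sum: "\<forall>\<^sub>F R in gen. (\<Sum>i\<in>I. c i * f i R) = (\<Sum>i\<in>I. c i * a i)" for c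
    using all by eventually_elim (intro sum.cong, auto)
  have "card I > 1" using 0(5) by simp
  then obtain i j where ij: "i \<in> I" "j \<in> I" "i \<noteq> j"
    by (metis card_le_Suc0_iff_eq 0(4) not_less One_nat_def)
  show ?case
  proof (cases "a i = 0")
    case True
    define c where "c k = (if k = i then 1 else 0 :: 'a)" for k
    have "(\<Sum>k\<in>I. c k * a k) = (\<Sum>k\<in>I. if k = i then a k else 0)" by (rule sum.cong) (auto simp: c_def)
    also have "\<dots> = 0" using 0(4) ij True by simp
    finally have "\<forall>\<^sub>F R in gen. (\<Sum>i\<in>I. c i * f i R) = 0" using sum[of c] by simp
    then show ?thesis using ij(1) by (intro exI[of _ c]) (auto simp: c_def)
  next
    case False
    define c where "c k = (if k = i then a j else if k = j then - a i else 0)" for k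
    have "(\<Sum>k\<in>I. c k * a k) = (\<Sum>k\<in>{i, j}. c k * a k)"
      by (rule sum.mono_neutral_right) (use 0(4) ij in \<open>auto simp: c_def\<close>)
    also have "\<dots> = 0" using ij(3) by (simp add: c_def)
    finally have "\<forall>\<^sub>F R in gen. (\<Sum>i\<in>I. c i * f i R) = 0" using sum[of c] by simp
    then show ?thesis using ij False by (intro exI[of _ c]) (auto simp: c_def intro!: bexI[of _ j])
  qed
next
  case (Suc d)
  have "{P. A P \<noteq> 0} \<noteq> {}"
  proof
    assume empty: "{P. A P \<noteq> 0} = {}"
    show False using Suc.prems(3) unfolding empty by simp
  qed
  then obtain P where P: "A P \<noteq> 0" by blast
  then have PV: "P \<in> V" using Suc.prems(2) by blast
  obtain b where b: "A P = Suc b" using P not0_implies_Suc by blast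
  define A' where "A' = A(P := b)"
  have A'sub: "{Q. A' Q \<noteq> 0} \<subseteq> {Q. A Q \<noteq> 0}" by (auto simp: A'_def b)
  have A'1: "finite {Q. A' Q \<noteq> 0}" "{Q. A' Q \<noteq> 0} \<subseteq> V"
    using A'sub Suc.prems(1,2) finite_subset by blast+
  have "(\<Sum>Q | A' Q \<noteq> 0. A' Q) = (\<Sum>Q | A Q \<noteq> 0. A' Q)"
    by (rule sum.mono_neutral_left) (use A'sub Suc.prems(1) in auto)
  also have "\<dots> = b + (\<Sum>Q\<in>{Q. A Q \<noteq> 0} - {P}. A' Q)"
    using Suc.prems(1) P by (subst sum.remove[of _ P]) (auto simp: A'_def)
  also have "(\<Sum>Q\<in>{Q. A Q \<noteq> 0} - {P}. A' Q) = (\<Sum>Q\<in>{Q. A Q \<noteq> 0} - {P}. A Q)"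
    by (rule sum.cong) (auto simp: A'_def)
  also have "Suc (b + \<dots>) = (\<Sum>Q | A Q \<noteq> 0. A Q)"
    using Suc.prems(1) P by (subst (2) sum.remove[of _ P]) (auto simp: b)
  finally have A'2: "(\<Sum>Q | A' Q \<noteq> 0. A' Q) = d" using Suc.prems(3) by simp
  obtain T where T: "unif P T" by (rule unif_exists[OF PV smooth[OF PV]])
  have "\<forall>i\<in>I. \<exists>v. regv P (\<lambda>R. T R ^ Suc b * f i R) v"
  proof
    fix i assume i: "i \<in> I"
    show "\<exists>v. regv P (\<lambda>R. T R ^ Suc b * f i R) v"
      using Suc.prems(7)[OF i PV] unfolding b pole_le_unif[OF PV T] .
  qed
  from bchoice[OF this] obtain v where v: "\<And>i. i \<in> I \<Longrightarrow> regv P (\<lambda>R. T R ^ Suc b * f i R) (v i)" by blast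
  show ?case
  proof (cases "\<forall>i\<in>I. v i = 0")
    case True
    have pole: "pole_le Q (A' Q) (f i)" if "i \<in> I" "Q \<in> V" for i Q
    proof (cases "Q = P")
      case True
      then show ?thesis using pole_le_lower[OF PV T] v[OF that(1)] \<open>\<forall>i\<in>I. v i = 0\<close> that(1)
        by (simp add: A'_def)
    next
      case False
      then show ?thesis using Suc.prems(7)[OF that] by (simp add: A'_def)
    qed
    show ?thesis
      by (rule Suc.IH[OF A'1 A'2 Suc.prems(4) _ Suc.prems(6) pole]) (use Suc.prems(5) in auto)
  next
    case False
    then obtain k where k: "k \<in> I" "v k \<noteq> 0" by blast
    \<comment> \<open>Subtracting a multiple of \<open>f k\<close> kills the leading coefficient at
      P, so these functions satisfy the smaller pole bound.\<close>
    define g where "g i R = f i R - v i / v k * f k R" for i R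
    have grat: "rat (g i)" if "i \<in> I - {k}" for i
      unfolding g_def using that k(1) by (intro rat_diff rat_mult rat_const Suc.prems(6)) auto
    have pole: "pole_le Q (A' Q) (g i)" if i: "i \<in> I - {k}" and Q: "Q \<in> V" for i Q
    proof (cases "Q = P")
      case True
      have iI: "i \<in> I" using i by blast
      have "regv P (\<lambda>R. T R ^ Suc b * f i R - v i / v k * (T R ^ Suc b * f k R)) (v i - v i / v k * v k)"
        by (intro regv_diff regv_mult regv_const PV v iI k(1))
      then have "regv P (\<lambda>R. T R ^ Suc b * g i R) 0"
        using k(2) by (simp add: g_def right_diff_distrib mult_ac)
      from pole_le_lower[OF PV T this] show ?thesis by (simp add: A'_def True)
    next
      case False
      have "pole_le Q (A Q) (g i)" unfolding g_def
        using i k(1) by (intro pole_le_diff pole_le_cmult Q Suc.prems(7)) auto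
      then show ?thesis using False by (simp add: A'_def)
    qed
    have card: "card (I - {k}) > d + 1" using Suc.prems(4,5) k(1) by (simp add: card_Diff_singleton)
    have finI: "finite (I - {k})" using Suc.prems(4) by blast
    have "\<exists>c. (\<exists>i\<in>I - {k}. c i \<noteq> 0) \<and> (\<forall>\<^sub>F R in gen. (\<Sum>i\<in>I - {k}. c i * g i R) = 0)"
      by (rule Suc.IH[OF A'1 A'2 finI card grat pole])
    then obtain c where c: "\<exists>i\<in>I - {k}. c i \<noteq> 0" "\<forall>\<^sub>F R in gen. (\<Sum>i\<in>I - {k}. c i * g i R) = 0"
      by (elim exE conjE)
    \<comment> \<open>Undoing the substitution collects all subtracted multiples in the coefficient
      of \<open>f k\<close>; the other coefficients are unchanged.\<close>
    define c' where "c' i = (if i = k then - (\<Sum>j\<in>I - {k}. c j * (v j / v k)) else c i)" for i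
    have "\<forall>\<^sub>F R in gen. (\<Sum>i\<in>I. c' i * f i R) = 0"
      using c(2)
    proof eventually_elim
      case (elim R)
      have "(\<Sum>i\<in>I. c' i * f i R) = c' k * f k R + (\<Sum>i\<in>I - {k}. c' i * f i R)"
        using Suc.prems(4) k(1) by (rule sum.remove)
      also have "(\<Sum>i\<in>I - {k}. c' i * f i R) = (\<Sum>i\<in>I - {k}. c i * f i R)"
        by (rule sum.cong) (auto simp: c'_def)
      also have "c' k * f k R = - (\<Sum>i\<in>I - {k}. c i * (v i / v k) * f k R)"
        by (simp add: c'_def sum_distrib_right)
      also have "- (\<Sum>i\<in>I - {k}. c i * (v i / v k) * f k R) + (\<Sum>i\<in>I - {k}. c i * f i R) = (\<Sum>i\<in>I - {k}. c i * g i R)"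
        by (simp add: g_def right_diff_distrib sum_subtractf mult.assoc)
      finally show ?case using elim by simp
    qed
    moreover have "\<exists>i\<in>I. c' i \<noteq> 0" using c(1) by (auto simp: c'_def)
    ultimately show ?thesis by (intro exI[of _ c'] conjI)
  qed
qed

lemma sum_shift_zero:
  fixes S :: "nat \<Rightarrow> 'b::comm_ring_1"
  assumes "\<And>j. j < j0 \<Longrightarrow> S j = 0"
  shows "(\<Sum>j\<le>j0 + r. S j * x ^ j) = x ^ j0 * (\<Sum>j\<le>r. S (j0 + j) * x ^ j)"
proof (induction r)
  case 0
  have "(\<Sum>j\<le>j0. S j * x ^ j) = (\<Sum>j\<in>{j0}. S j * x ^ j)"
    by (rule sum.mono_neutral_right) (use assms in auto)
  then show ?case by (simp add: mult.commute)
next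
  case (Suc r)
  then show ?case by (simp add: distrib_left power_add mult_ac)
qed

text \<open>The form \<open>g P\<close> vanishes on Z except at P. In the common denominator, the
  sum of these forms, exactly one term survives at each point of Z, so the quotients take the values
  1 and 0 as required.\<close>

lemma separating_functions:
  assumes Z: "finite Z"
  obtains w where "\<And>P Q. P \<in> Z \<Longrightarrow> Q \<in> Z \<Longrightarrow> regv Q (w P) (if P = Q then 1 else 0)"
proof -
  have "\<forall>P\<in>Z. \<exists>h. homogeneous (card Z - 1) h \<and> (\<forall>Q\<in>Z - {P}. eval_at h Q = 0) \<and> eval_at h P \<noteq> 0"
  proof
    fix P assume P: "P \<in> Z"
    have fin: "finite (Z - {P})" "P \<notin> Z - {P}" using Z by auto
    obtain h where h: "homogeneous (card (Z - {P})) h" "\<And>Q. Q \<in> Z - {P} \<Longrightarrow> eval_at h Q = 0" "eval_at h P \<noteq> 0"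
      by (rule separating_form[OF fin]) blast
    have cd: "card (Z - {P}) = card Z - 1" using P Z by (simp add: card_Diff_singleton)
    show "\<exists>h. homogeneous (card Z - 1) h \<and> (\<forall>Q\<in>Z - {P}. eval_at h Q = 0) \<and> eval_at h P \<noteq> 0"
      using h unfolding cd by blast
  qed
  from bchoice[OF this] obtain g where g: "\<And>P. P \<in> Z \<Longrightarrow> homogeneous (card Z - 1) (g P)"
    "\<And>P Q. P \<in> Z \<Longrightarrow> Q \<in> Z \<Longrightarrow> Q \<noteq> P \<Longrightarrow> eval_at (g P) Q = 0" "\<And>P. P \<in> Z \<Longrightarrow> eval_at (g P) P \<noteq> 0"
    by blast
  define h where "h = (\<Sum>P\<in>Z. g P)"
  have hh: "homogeneous (card Z - 1) h" unfolding h_def using g(1) by (rule homogeneous_sum)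
  have hval: "eval_at h P = eval_at (g P) P" if "P \<in> Z" for P
  proof -
    have "eval_at h P = (\<Sum>Q\<in>Z. if Q = P then eval_at (g P) P else 0)"
      unfolding h_def eval_at_simps using g(2) that by (intro sum.cong) auto
    then show ?thesis using that Z by simp
  qed
  have hnz: "eval_at h P \<noteq> 0" if "P \<in> Z" for P using hval[OF that] g(3)[OF that] by simp
  define w where "w P R = eval_at (g P) R / eval_at h R" for P R
  have w: "regv Q (w P) (if P = Q then 1 else 0)" if "P \<in> Z" "Q \<in> Z" for P Q
  proof -
    have "regv Q (w P) (eval_at (g P) Q / eval_at h Q)"
      unfolding w_def by (rule regv_frac[OF g(1)[OF that(1)] hh hnz[OF that(2)]])
    then show ?thesis using hval[OF that(2)] g(2)[OF that] g(3)[OF that(1)] by (auto split: if_splits)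
  qed
  show ?thesis by (rule that[OF w])
qed

text \<open>With functions \<open>w P\<close> separating the zeros \<open>P\<close> of \<open>F\<close>, the products \<open>w P * F^j\<close> are linearly
  independent.  For \<open>j \<le> m\<close> their number grows like \<open>m * card Z\<close>, while their poles allow at most
  about \<open>m * d\<close> independent functions.\<close>

lemma zeros_le_degree:
  fixes A :: "('a, 'n) proj \<Rightarrow> nat"
  assumes const: only_constants_regular
    and A: "finite {P. A P \<noteq> 0}" "{P. A P \<noteq> 0} \<subseteq> V" "(\<Sum>P | A P \<noteq> 0. A P) = d"
    and F: "rat F" "\<And>P. P \<in> V \<Longrightarrow> pole_le P (A P) F" "\<not> (\<forall>\<^sub>F R in gen. F R = 0)"
    and Z: "finite Z" "Z \<subseteq> V" "\<And>P. P \<in> Z \<Longrightarrow> regv P F 0"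
  shows "card Z \<le> d"
proof (rule ccontr)
  assume "\<not> card Z \<le> d"
  then have N: "card Z \<ge> d + 1" by simp
  obtain w where w: "\<And>P Q. P \<in> Z \<Longrightarrow> Q \<in> Z \<Longrightarrow> regv Q (w P) (if P = Q then 1 else 0)"
    by (rule separating_functions[OF Z(1)]) blast
  have wrat: "rat (w P)" if "P \<in> Z" for P using regv_rat[OF _ w[OF that that]] Z(2) that by blast
  have "\<forall>P\<in>Z. \<exists>E :: ('a, 'n) proj \<Rightarrow> nat. finite {Q. E Q \<noteq> 0} \<and> {Q. E Q \<noteq> 0} \<subseteq> V \<and> (\<forall>Q\<in>V. pole_le Q (E Q) (w P))"
    using pole_divisor_exists[OF wrat] by blast
  from bchoice[OF this] obtain E :: "('a, 'n) proj \<Rightarrow> ('a, 'n) proj \<Rightarrow> nat" where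
    E: "\<And>P. P \<in> Z \<Longrightarrow> finite {Q. E P Q \<noteq> 0}" "\<And>P. P \<in> Z \<Longrightarrow> {Q. E P Q \<noteq> 0} \<subseteq> V"
      "\<And>P Q. P \<in> Z \<Longrightarrow> Q \<in> V \<Longrightarrow> pole_le Q (E P Q) (w P)" by blast
  \<comment> \<open>One pole divisor that bounds all the functions \<open>w P\<close> at
    once.\<close>
  define E' where "E' Q = (\<Sum>P\<in>Z. E P Q)" for Q
  have E'nz: "{Q. E' Q \<noteq> 0} = (\<Union>P\<in>Z. {Q. E P Q \<noteq> 0})" using Z(1) by (auto simp: E'_def)
  have E'1: "finite {Q. E' Q \<noteq> 0}" "{Q. E' Q \<noteq> 0} \<subseteq> V" unfolding E'nz using Z(1) E(1,2) by auto
  have E'2: "pole_le Q (E' Q) (w P)" if "P \<in> Z" "Q \<in> V" for P Q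
    using that Z(1) unfolding E'_def by (intro pole_le_mono[OF _ E(3)] member_le_sum) auto
  define e where "e = (\<Sum>Q | E' Q \<noteq> 0. E' Q)"
  \<comment> \<open>Large enough for the count: (d + 1)(m + 1) exceeds e + m d + 1 because d + m
    exceeds e.\<close>
  define m where "m = e + 1"
  define B where "B Q = E' Q + m * A Q" for Q
  have B1: "finite {Q. B Q \<noteq> 0}" "{Q. B Q \<noteq> 0} \<subseteq> V"
  proof -
    have "{Q. B Q \<noteq> 0} \<subseteq> {Q. E' Q \<noteq> 0} \<union> {Q. A Q \<noteq> 0}" by (auto simp: B_def)
    then show "finite {Q. B Q \<noteq> 0}" "{Q. B Q \<noteq> 0} \<subseteq> V"
      using E'1 A(1,2) by (blast intro: finite_subset)+
  qed
  have B2: "(\<Sum>Q | B Q \<noteq> 0. B Q) = e + m * d"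
  proof -
    let ?X = "{Q. E' Q \<noteq> 0} \<union> {Q. A Q \<noteq> 0}"
    have X: "finite ?X" using E'1 A(1) by blast
    have "(\<Sum>Q | B Q \<noteq> 0. B Q) = (\<Sum>Q\<in>?X. B Q)"
      by (rule sum.mono_neutral_left) (use X in \<open>auto simp: B_def\<close>)
    also have "\<dots> = (\<Sum>Q\<in>?X. E' Q) + m * (\<Sum>Q\<in>?X. A Q)"
      by (simp add: B_def sum.distrib sum_distrib_left)
    also have "(\<Sum>Q\<in>?X. E' Q) = e" unfolding e_def
      by (rule sum.mono_neutral_right) (use X in auto)
    also have "(\<Sum>Q\<in>?X. A Q) = d" unfolding A(3)[symmetric]
      by (rule sum.mono_neutral_right) (use X in auto)
    finally show ?thesis .
  qed
  define I where "I = Z \<times> {..m}"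
  define f where "f i R = w (fst i) R * F R ^ snd i" for i R
  have I: "finite I" using Z(1) by (simp add: I_def)
  have "card I = card Z * (m + 1)" by (simp add: I_def card_cartesian_product)
  also have "\<dots> \<ge> (d + 1) * (m + 1)" using N by (intro mult_right_mono) auto
  finally have cardI: "card I > e + m * d + 1" by (simp add: m_def algebra_simps)
  have frat: "rat (f i)" if "i \<in> I" for i
    unfolding f_def using that by (intro rat_mult wrat rat_power F(1)) (auto simp: I_def)
  have fpole: "pole_le Q (B Q) (f i)" if i: "i \<in> I" and Q: "Q \<in> V" for i Q
  proof -
    have "pole_le Q (E' Q + snd i * A Q) (f i)"
      unfolding f_def using i by (intro pole_le_mult Q E'2 pole_le_power F(2)) (auto simp: I_def)
    moreover have "E' Q + snd i * A Q \<le> B Q" using i by (auto simp: I_def B_def)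
    ultimately show ?thesis by (rule pole_le_mono[OF Q])
  qed
  have "\<exists>c. (\<exists>i\<in>I. c i \<noteq> 0) \<and> (\<forall>\<^sub>F R in gen. (\<Sum>i\<in>I. c i * f i R) = 0)"
    by (rule linearly_dependent[OF const B1 B2 I cardI frat fpole])
  then obtain c where c: "\<exists>i\<in>I. c i \<noteq> 0" "\<forall>\<^sub>F R in gen. (\<Sum>i\<in>I. c i * f i R) = 0"
    by (elim exE conjE)
  \<comment> \<open>The lowest power of F in the relation. It is divided out, and at a zero Q of F
    the rest specializes to the single coefficient at (Q, j0).\<close>
  define j0 where "j0 = (LEAST j. \<exists>P\<in>Z. c (P, j) \<noteq> 0)"
  obtain P1 j1 where Pj: "P1 \<in> Z" "j1 \<le> m" "c (P1, j1) \<noteq> 0" using c(1) by (auto simp: I_def)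
  have j0: "\<exists>P\<in>Z. c (P, j0) \<noteq> 0" unfolding j0_def by (rule LeastI[of _ j1]) (use Pj in blast)
  have j0m: "j0 \<le> m" unfolding j0_def using Least_le[of "\<lambda>j. \<exists>P\<in>Z. c (P, j) \<noteq> 0" j1] Pj by force
  have below: "c (P, j) = 0" if "j < j0" "P \<in> Z" for P j
    using not_less_Least[of j "\<lambda>j. \<exists>P\<in>Z. c (P, j) \<noteq> 0"] that unfolding j0_def by blast
  obtain r where r: "m = j0 + r" using j0m le_Suc_ex by blast
  define S where "S j R = (\<Sum>P\<in>Z. c (P, j) * w P R)" for j R
  define G where "G R = (\<Sum>j\<le>r. S (j0 + j) R * F R ^ j)" for R
  have Fnz: "\<forall>\<^sub>F R in gen. F R \<noteq> 0" using rat_zero_or_nonzero[OF F(1)] F(3) by blast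
  have G0: "\<forall>\<^sub>F R in gen. G R = 0"
    using c(2) Fnz
  proof eventually_elim
    case (elim R)
    have "(\<Sum>i\<in>I. c i * f i R) = (\<Sum>P\<in>Z. \<Sum>j\<le>m. c (P, j) * (w P R * F R ^ j))"
      unfolding I_def by (simp add: sum.cartesian_product f_def case_prod_beta)
    also have "\<dots> = (\<Sum>j\<le>m. \<Sum>P\<in>Z. c (P, j) * (w P R * F R ^ j))" by (rule sum.swap)
    also have "\<dots> = (\<Sum>j\<le>m. S j R * F R ^ j)" by (simp add: S_def sum_distrib_right mult.assoc)
    also have "\<dots> = F R ^ j0 * G R"
      unfolding r G_def by (rule sum_shift_zero) (simp add: S_def below)
    finally show ?case using elim by simp
  qed
  obtain Q where Q: "Q \<in> Z" "c (Q, j0) \<noteq> 0" using j0 by blast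
  have QV: "Q \<in> V" using Q Z(2) by blast
  have Sv: "regv Q (S j) (c (Q, j))" for j
  proof -
    have "regv Q (S j) (\<Sum>P\<in>Z. c (P, j) * (if P = Q then 1 else 0))"
      unfolding S_def by (intro regv_sum regv_mult regv_const QV w Q(1))
    also have "(\<Sum>P\<in>Z. c (P, j) * (if P = Q then 1 else 0)) = (\<Sum>P\<in>Z. if P = Q then c (P, j) else 0)"
      by (rule sum.cong) auto
    also have "\<dots> = c (Q, j)" using Q(1) Z(1) by simp
    finally show ?thesis .
  qed
  have "regv Q G (\<Sum>j\<le>r. c (Q, j0 + j) * 0 ^ j)"
    unfolding G_def by (intro regv_sum regv_mult regv_power QV Sv Z(3) Q(1))
  from regv_unique[OF QV this regv_const[of Q 0] G0] have "(\<Sum>j\<le>r. c (Q, j0 + j) * 0 ^ j) = 0" .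
  moreover have "(\<Sum>j\<le>r. c (Q, j0 + j) * 0 ^ j) = (\<Sum>j\<in>{0}. c (Q, j0 + j) * 0 ^ j)"
    by (rule sum.mono_neutral_right) auto
  ultimately show False using Q(2) by simp
qed

end

section \<open>Regular functions on the projective line\<close>

definition affine_pt :: "'a::field \<Rightarrow> 'a^2" where
  "affine_pt x = (\<chi> i. if i = 1 then x else 1)"

definition infinite_pt :: "'a::field^2" where
  "infinite_pt = (\<chi> i. if i = 1 then 1 else 0)"

lemma two_neq_one: "(2::2) \<noteq> 1"
  by simp

lemma affine_pt_nonzero: "affine_pt x \<noteq> 0"
proof -
  have "affine_pt x $ 2 = 1" by (simp add: affine_pt_def)
  then show ?thesis by auto
qed

lemma infinite_pt_nonzero: "infinite_pt \<noteq> (0 :: 'a::field^2)"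
proof -
  have "infinite_pt $ 1 = (1 :: 'a)" by (simp add: infinite_pt_def)
  then show ?thesis by auto
qed

lemma proj_line_cases:
  fixes y :: "('a::field, 2) proj"
  obtains x where "y = abs_proj (affine_pt x)" | "y = abs_proj infinite_pt"
proof (cases "rep_proj y $ 2 = 0")
  case False
  have "(\<chi> j. rep_proj y $ j / rep_proj y $ 2) = affine_pt (rep_proj y $ 1 / rep_proj y $ 2)"
    using False by (auto simp: vec_eq_iff affine_pt_def) (metis exhaust_2)
  then show ?thesis using proj_eq_coord[OF False] that(1) by metis
next
  case True
  have nz: "rep_proj y $ 1 \<noteq> 0"
  proof
    assume "rep_proj y $ 1 = 0"
    then have "rep_proj y = 0" using True by (simp add: vec_eq_iff forall_2)
    then show False by simp
  qed
  have "rep_proj y = rep_proj y $ 1 *s infinite_pt"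
    using True by (simp add: vec_eq_iff infinite_pt_def forall_2)
  then have "abs_proj infinite_pt = abs_proj (rep_proj y)"
    using nz abs_proj_eq_iff[OF infinite_pt_nonzero rep_proj_nonzero[of y]] by blast
  then show ?thesis using that(2) by simp
qed

text \<open>The form in the affine coordinate, with the second homogeneous coordinate set to
  1.\<close>

definition dehom :: "('a::field, 2) mpoly \<Rightarrow> 'a poly" where
  "dehom F = (\<Sum>m\<in>Poly_Mapping.keys F. Polynomial.monom (Poly_Mapping.lookup F m) (Poly_Mapping.lookup m 1))"

lemma monom_val_2: "monom_val m (v :: 'a::field^2) = v $ 1 ^ Poly_Mapping.lookup m 1 * v $ 2 ^ Poly_Mapping.lookup m 2"
  unfolding monom_val_def UNIV_2 by (simp add: two_neq_one[symmetric])

lemma poly_dehom: "poly (dehom F) x = mpoly_eval F (affine_pt x)"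
  by (simp add: dehom_def poly_sum poly_monom mpoly_eval_eq monom_val_2 affine_pt_def)

lemma degree_dehom:
  assumes "homogeneous d F"
  shows "Polynomial.degree (dehom F) \<le> d"
  unfolding dehom_def
proof (rule degree_sum_le)
  fix m assume "m \<in> Poly_Mapping.keys F"
  then have "Poly_Mapping.lookup m 1 \<le> d" using assms by (auto simp: homogeneous_def sum_2)
  then show "Polynomial.degree (Polynomial.monom (Poly_Mapping.lookup F m) (Poly_Mapping.lookup m 1)) \<le> d"
    using degree_monom_le order_trans by blast
qed simp

text \<open>At the point at infinity only the pure power of the first coordinate survives. The
  coefficient is taken at the degree \<open>d\<close> of the form, which may exceed the degree of
  the polynomial.\<close>

lemma coeff_dehom:
  assumes "homogeneous d F"
  shows "Polynomial.coeff (dehom F) d = mpoly_eval F infinite_pt"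
  unfolding dehom_def mpoly_eval_eq Polynomial.coeff_sum
proof (rule sum.cong[OF refl])
  fix m assume "m \<in> Poly_Mapping.keys F"
  then have "Poly_Mapping.lookup m 1 + Poly_Mapping.lookup m 2 = d" using assms by (auto simp: homogeneous_def sum_2)
  then show "Polynomial.coeff (Polynomial.monom (Poly_Mapping.lookup F m) (Poly_Mapping.lookup m 1)) d =
      Poly_Mapping.lookup F m * monom_val m infinite_pt"
    by (auto simp: monom_val_2 infinite_pt_def)
qed

text \<open>Over a finite field, 1 plus the product of all X - a would be a nonconstant polynomial
  without roots.\<close>

lemma infinite_UNIV_alg_closed: "infinite (UNIV :: 'a::alg_closed_field set)"
proof
  assume fin: "finite (UNIV :: 'a set)"
  define p :: "'a poly" where "p = 1 + (\<Prod>a\<in>UNIV. [:- a, 1:])"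
  have "Polynomial.degree (\<Prod>a\<in>UNIV. [:- a, 1 :: 'a:]) = card (UNIV :: 'a set)"
    by (subst degree_prod_eq_sum_degree) auto
  moreover have "card (UNIV :: 'a set) > 0" using fin by (simp add: card_gt_0_iff)
  ultimately have "Polynomial.degree p > 0"
    unfolding p_def by (subst degree_add_eq_right) auto
  then obtain x where "poly p x = 0" using alg_closed_imp_poly_has_root by blast
  moreover have "poly (\<Prod>a\<in>UNIV. [:- a, 1 :: 'a:]) x = 0"
    using fin by (auto simp: poly_prod prod_zero_iff intro!: bexI[of _ x])
  ultimately show False by (simp add: p_def)
qed

lemma poly_eqI_cofinite:
  fixes p q r :: "'a::alg_closed_field poly"
  assumes "r \<noteq> 0" "\<And>x. poly r x \<noteq> 0 \<Longrightarrow> poly p x = poly q x"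
  shows "p = q"
proof (rule ccontr)
  assume "p \<noteq> q"
  then have "r * (p - q) \<noteq> 0" using assms(1) by simp
  then have "finite {x. poly (r * (p - q)) x = 0}" by (rule poly_roots_finite)
  moreover have "{x. poly (r * (p - q)) x = 0} = UNIV" using assms(2) by auto
  ultimately show False using infinite_UNIV_alg_closed by (metis (full_types))
qed

lemma eval_at_abs_ratio:
  assumes "v \<noteq> 0" "homogeneous d a" "homogeneous d b"
  shows "eval_at a (abs_proj v) / eval_at b (abs_proj v) = mpoly_eval a v / mpoly_eval b v"
proof -
  obtain c where c: "c \<noteq> 0" "\<And>d F. homogeneous d F \<Longrightarrow> eval_at F (abs_proj v) = c ^ d * mpoly_eval F v"
    by (rule eval_at_abs[OF assms(1)]) blast
  show ?thesis using c(1) by (simp add: c(2)[OF assms(2)] c(2)[OF assms(3)])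
qed

lemma eval_at_abs_zero:
  assumes "v \<noteq> 0" "homogeneous d a"
  shows "eval_at a (abs_proj v) = 0 \<longleftrightarrow> mpoly_eval a v = 0"
proof -
  obtain c where c: "c \<noteq> 0" "\<And>d F. homogeneous d F \<Longrightarrow> eval_at F (abs_proj v) = c ^ d * mpoly_eval F v"
    by (rule eval_at_abs[OF assms(1)]) blast
  show ?thesis using c(1) by (simp add: c(2)[OF assms(2)])
qed

lemma openin_basic:
  assumes "zariski_openin M U" "P \<in> U"
  obtains F d where "homogeneous d F" "eval_at F P \<noteq> 0" "\<And>R. R \<in> M \<Longrightarrow> eval_at F R \<noteq> 0 \<Longrightarrow> R \<in> U"
proof -
  obtain T where T: "\<And>F. F \<in> T \<Longrightarrow> \<exists>d. homogeneous d F" "U = M - {P. \<forall>F\<in>T. eval_at F P = 0}"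
    using assms(1) unfolding zariski_openin_def zariski_closed_def by blast
  then obtain F where F: "F \<in> T" "eval_at F P \<noteq> 0" using assms(2) by blast
  then obtain d where "homogeneous d F" using T(1) by blast
  then show ?thesis using that F T(2) by blast
qed

text \<open>Take a fraction p/q that represents g, with q of least degree. At a root of q, a local
  representation with nonvanishing denominator forces p to vanish too, so q could be shortened;
  hence q is constant. The chart at infinity then bounds the degree of p by 0.\<close>

lemma regular_on_proj_line_constant:
  fixes g :: "('a::alg_closed_field, 2) proj \<Rightarrow> 'a"
  assumes reg: "regular_on UNIV UNIV g"
  shows "\<exists>c. \<forall>y. g y = c"
proof -
  \<comment> \<open>\<open>r\<close> is the equation, in the affine coordinate, of the complement of
    a small neighbourhood of \<open>y\<close>; it is a nonzero polynomial also when \<open>y\<close>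
    is the point at infinity.\<close>
  have loc: "\<exists>a b d r. homogeneous d a \<and> homogeneous d b \<and> eval_at b y \<noteq> 0 \<and> g y = eval_at a y / eval_at b y \<and>
      r \<noteq> 0 \<and> (\<forall>x. poly r x \<noteq> 0 \<longrightarrow> poly (dehom b) x \<noteq> 0 \<and>
        g (abs_proj (affine_pt x)) = poly (dehom a) x / poly (dehom b) x)" for y
  proof -
    obtain W a b d where W: "zariski_openin UNIV W" "y \<in> W" "homogeneous d a" "homogeneous d b"
      "\<And>R. R \<in> W \<Longrightarrow> eval_at b R \<noteq> 0 \<and> g R = eval_at a R / eval_at b R"
      using reg unfolding regular_on_def by (metis UNIV_I)
    obtain F e where F: "homogeneous e F" "eval_at F y \<noteq> 0" "\<And>R. eval_at F R \<noteq> 0 \<Longrightarrow> R \<in> W"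
      using openin_basic[OF W(1,2)] by (metis UNIV_I)
    have r: "dehom F \<noteq> 0"
    proof (cases y rule: proj_line_cases)
      case (1 x)
      then have "poly (dehom F) x \<noteq> 0"
        using F(2) eval_at_abs_zero[OF affine_pt_nonzero F(1)] by (simp add: poly_dehom)
      then show ?thesis by auto
    next
      case 2
      then have "Polynomial.coeff (dehom F) e \<noteq> 0"
        using F(2) eval_at_abs_zero[OF infinite_pt_nonzero F(1)] by (simp add: coeff_dehom[OF F(1)])
      then show ?thesis by auto
    qed
    have "poly (dehom b) x \<noteq> 0 \<and> g (abs_proj (affine_pt x)) = poly (dehom a) x / poly (dehom b) x"
      if "poly (dehom F) x \<noteq> 0" for x
    proof -
      have "abs_proj (affine_pt x) \<in> W"
        using that eval_at_abs_zero[OF affine_pt_nonzero F(1)] by (intro F(3)) (simp add: poly_dehom)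
      from W(5)[OF this] show ?thesis
        using eval_at_abs_zero[OF affine_pt_nonzero W(4)] eval_at_abs_ratio[OF affine_pt_nonzero W(3,4)]
        by (simp add: poly_dehom)
    qed
    then show ?thesis using W(3,4) W(5)[OF W(2)] r by blast
  qed
  define y0 :: "('a, 2) proj" where "y0 = abs_proj infinite_pt"
  obtain a0 b0 d0' r0 where ab0: "homogeneous d0' a0" "homogeneous d0' b0" "r0 \<noteq> 0"
    "\<And>x. poly r0 x \<noteq> 0 \<Longrightarrow> poly (dehom b0) x \<noteq> 0 \<and> g (abs_proj (affine_pt x)) = poly (dehom a0) x / poly (dehom b0) x"
    using loc[of y0] by blast
  have agree: "dehom a * dehom b0 = dehom a0 * dehom b"
    if "r \<noteq> 0" "\<And>x. poly r x \<noteq> 0 \<Longrightarrow> poly (dehom b) x \<noteq> 0 \<and> g (abs_proj (affine_pt x)) = poly (dehom a) x / poly (dehom b) x"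
    for a b r
  proof (rule poly_eqI_cofinite[of "r * r0"])
    show "r * r0 \<noteq> 0" using that(1) ab0(3) by simp
    fix x assume "poly (r * r0) x \<noteq> 0"
    then have "poly r x \<noteq> 0" "poly r0 x \<noteq> 0" by auto
    from that(2)[OF this(1)] ab0(4)[OF this(2)]
    show "poly (dehom a * dehom b0) x = poly (dehom a0 * dehom b) x" by (auto simp: frac_eq_eq)
  qed
  have b0nz: "dehom b0 \<noteq> 0"
  proof
    assume "dehom b0 = 0"
    then have "poly r0 x = 0" for x using ab0(4)[of x] by auto
    then have "r0 = 0" using poly_all_0_iff_0 poly_eqI_cofinite[of 1 r0 0] by simp
    then show False using ab0(3) by blast
  qed
  \<comment> \<open>There is a fraction for g with denominator of degree n; taking the least n
    replaces reduction to lowest terms.\<close>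
  define D where "D n \<longleftrightarrow> (\<exists>p q. q \<noteq> 0 \<and> p * dehom b0 = dehom a0 * q \<and> Polynomial.degree q = n)" for n
  have Db0: "D (Polynomial.degree (dehom b0))" unfolding D_def using b0nz by blast
  have "D (LEAST n. D n)" by (rule LeastI[of D, OF Db0])
  then obtain p q where pq: "q \<noteq> 0" "p * dehom b0 = dehom a0 * q" "Polynomial.degree q = (LEAST n. D n)"
    unfolding D_def by (elim exE conjE)
  have min: "Polynomial.degree q \<le> m" if "D m" for m
    unfolding pq(3) using that by (rule Least_le[of D])
  have pB: "p * dehom b = dehom a * q"
    if "dehom a * dehom b0 = dehom a0 * dehom b" for a b
  proof -
    have "(p * dehom b) * dehom b0 = (p * dehom b0) * dehom b" by (simp add: mult_ac)
    also have "\<dots> = (dehom a0 * dehom b) * q" unfolding pq(2) by (simp add: mult_ac)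
    also have "\<dots> = (dehom a * q) * dehom b0" unfolding that[symmetric] by (simp add: mult_ac)
    finally show ?thesis using b0nz by simp
  qed
  have "Polynomial.degree q = 0"
  proof (rule ccontr)
    assume "Polynomial.degree q \<noteq> 0"
    then obtain x where x: "poly q x = 0" using alg_closed_imp_poly_has_root[of q] by auto
    obtain a b d r where ab: "homogeneous d b" "eval_at b (abs_proj (affine_pt x)) \<noteq> 0" "r \<noteq> 0"
      "\<And>x. poly r x \<noteq> 0 \<Longrightarrow> poly (dehom b) x \<noteq> 0 \<and> g (abs_proj (affine_pt x)) = poly (dehom a) x / poly (dehom b) x"
      using loc[of "abs_proj (affine_pt x)"] by blast
    have "poly (dehom b) x \<noteq> 0"
      using ab(2) eval_at_abs_zero[OF affine_pt_nonzero ab(1)] by (simp add: poly_dehom)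
    moreover have "poly (p * dehom b) x = poly (dehom a * q) x"
      using pB[OF agree[OF ab(3,4)]] by simp
    ultimately have "poly p x = 0" using x by simp
    then obtain p' where p': "p = [:- x, 1:] * p'" unfolding poly_eq_0_iff_dvd by (rule dvdE)
    obtain q' where q': "q = [:- x, 1:] * q'" using x unfolding poly_eq_0_iff_dvd by (rule dvdE)
    have q'nz: "q' \<noteq> 0" using pq(1) q' by auto
    have "[:- x, 1:] * (p' * dehom b0) = [:- x, 1:] * (dehom a0 * q')"
      using pq(2) unfolding p' q' by (simp only: mult_ac)
    then have "p' * dehom b0 = dehom a0 * q'" by (metis mult_left_cancel pCons_eq_0_iff one_neq_zero)
    then have "D (Polynomial.degree q')" unfolding D_def using q'nz by blast
    then have "Polynomial.degree q \<le> Polynomial.degree q'" by (rule min)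
    moreover have "Polynomial.degree ([:- x, 1:] * q') = Polynomial.degree [:- x, 1:] + Polynomial.degree q'"
      using q'nz by (intro degree_mult_eq) simp_all
    ultimately show False unfolding q' by simp
  qed
  then obtain k where k: "q = [:k:]" "k \<noteq> 0" using pq(1) by (metis degree_eq_zeroE pCons_0_0)
  have pdeg: "Polynomial.degree p = 0"
  proof -
    obtain a b d r where ab: "homogeneous d a" "homogeneous d b" "eval_at b (abs_proj infinite_pt) \<noteq> 0" "r \<noteq> 0"
      "\<And>x. poly r x \<noteq> 0 \<Longrightarrow> poly (dehom b) x \<noteq> 0 \<and> g (abs_proj (affine_pt x)) = poly (dehom a) x / poly (dehom b) x"
      using loc[of "abs_proj infinite_pt"] by blast
    \<comment> \<open>Nonvanishing at infinity gives the dehomogenized \<open>b\<close> full degree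
      d, while p times it is a multiple of the dehomogenized \<open>a\<close>, of degree at most
      d.\<close>
    have cd: "Polynomial.coeff (dehom b) d \<noteq> 0"
      using ab(3) eval_at_abs_zero[OF infinite_pt_nonzero ab(2)] by (simp add: coeff_dehom[OF ab(2)])
    then have bd: "Polynomial.degree (dehom b) \<ge> d" "dehom b \<noteq> 0" by (auto intro: le_degree)
    show ?thesis
    proof (cases "p = 0")
      case False
      have "Polynomial.degree (p * dehom b) = Polynomial.degree p + Polynomial.degree (dehom b)"
        using False bd(2) by (rule degree_mult_eq)
      moreover have "Polynomial.degree (p * dehom b) \<le> d"
      proof -
        have "p * dehom b = dehom a * q" by (rule pB[OF agree[OF ab(4,5)]])
        then have "p * dehom b = Polynomial.smult k (dehom a)" using k(1) by simp
        then show ?thesis using k(2) degree_dehom[OF ab(1)] by simp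
      qed
      ultimately show ?thesis using bd(1) by simp
    qed simp
  qed
  then obtain l where l: "p = [:l:]" by (metis degree_eq_zeroE)
  have "g y = l / k" for y
  proof -
    obtain a b d r where ab: "homogeneous d a" "homogeneous d b" "eval_at b y \<noteq> 0" "g y = eval_at a y / eval_at b y" "r \<noteq> 0"
      "\<And>x. poly r x \<noteq> 0 \<Longrightarrow> poly (dehom b) x \<noteq> 0 \<and> g (abs_proj (affine_pt x)) = poly (dehom a) x / poly (dehom b) x"
      using loc[of y] by blast
    have "p * dehom b = dehom a * q" by (rule pB[OF agree[OF ab(5,6)]])
    then have eq: "Polynomial.smult l (dehom b) = Polynomial.smult k (dehom a)"
      unfolding l k by simp
    show ?thesis
    proof (cases y rule: proj_line_cases)
      case (1 x)
      have "poly (Polynomial.smult l (dehom b)) x = poly (Polynomial.smult k (dehom a)) x" unfolding eq ..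
      then have e: "l * mpoly_eval b (affine_pt x) = k * mpoly_eval a (affine_pt x)" by (simp add: poly_dehom)
      have "mpoly_eval b (affine_pt x) \<noteq> 0"
        using ab(3) eval_at_abs_zero[OF affine_pt_nonzero ab(2)] 1 by simp
      moreover have "g y = mpoly_eval a (affine_pt x) / mpoly_eval b (affine_pt x)"
        unfolding ab(4) unfolding 1 by (rule eval_at_abs_ratio[OF affine_pt_nonzero ab(1,2)])
      ultimately show ?thesis using e k(2) by (simp add: frac_eq_eq mult.commute)
    next
      case 2
      have "Polynomial.coeff (Polynomial.smult l (dehom b)) d = Polynomial.coeff (Polynomial.smult k (dehom a)) d" unfolding eq ..
      then have e: "l * mpoly_eval b infinite_pt = k * mpoly_eval a infinite_pt"
        by (simp add: coeff_dehom[OF ab(1)] coeff_dehom[OF ab(2)])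
      have "mpoly_eval b infinite_pt \<noteq> 0"
        using ab(3) eval_at_abs_zero[OF infinite_pt_nonzero ab(2)] 2 by simp
      moreover have "g y = mpoly_eval a infinite_pt / mpoly_eval b infinite_pt"
        unfolding ab(4) unfolding 2 by (rule eval_at_abs_ratio[OF infinite_pt_nonzero ab(1,2)])
      ultimately show ?thesis using e k(2) by (simp add: frac_eq_eq mult.commute)
    qed
  qed
  then show ?thesis by blast
qed

section \<open>Morphisms and pullback of functions\<close>

lemma morphism_local:
  assumes "is_morphism k M Y \<phi>" "P \<in> M"
  obtains F d h e where "\<And>j. homogeneous d (F j)" "\<And>j. coeffs_in k (F j)" "homogeneous e h" "eval_at h P \<noteq> 0"
    "\<And>R. R \<in> M \<Longrightarrow> eval_at h R \<noteq> 0 \<Longrightarrow> (\<chi> j. eval_at (F j) R) \<noteq> 0 \<and> \<phi> R = abs_proj (\<chi> j. eval_at (F j) R)"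
proof -
  note ex = bspec[OF conjunct2[OF assms(1)[unfolded is_morphism_def]] assms(2)]
  obtain U F d where "zariski_openin M U \<and> P \<in> U \<and> (\<forall>j. homogeneous d (F j) \<and> coeffs_in k (F j)) \<and>
      (\<forall>R\<in>U. (\<chi> j. eval_at (F j) R) \<noteq> 0 \<and> \<phi> R = abs_proj (\<chi> j. eval_at (F j) R))"
    using ex by (elim exE)
  then have U: "zariski_openin M U" "P \<in> U" "\<And>j. homogeneous d (F j)" "\<And>j. coeffs_in k (F j)"
    "\<And>R. R \<in> U \<Longrightarrow> (\<chi> j. eval_at (F j) R) \<noteq> 0 \<and> \<phi> R = abs_proj (\<chi> j. eval_at (F j) R)"
    by simp_all
  obtain h e where h: "homogeneous e h" "eval_at h P \<noteq> 0" "\<And>R. R \<in> M \<Longrightarrow> eval_at h R \<noteq> 0 \<Longrightarrow> R \<in> U"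
    by (rule openin_basic[OF U(1,2)]) blast
  show ?thesis by (rule that[OF U(3,4) h(1,2) U(5)[OF h(3)]])
qed

lemma eval_at_subst: "eval_at (mpoly_subst F g) R = mpoly_eval g (\<chi> j. eval_at (F j) R)"
  by (simp add: eval_at_def)

context curve begin

text \<open>A morphism is locally given by forms over \<open>k\<close>, and substituting them into a
  fraction gives a fraction again. The coefficient claims are separate implications, so that the
  lemma serves fractions over \<open>k\<close> as well as over the whole field.\<close>

lemma morphism_pullback_forms:
  assumes phi: "is_morphism k V Y \<phi>" and k: "subring_set k" and P: "P \<in> V"
    and g: "homogeneous d g" and h: "homogeneous d h" and hP: "eval_at h (\<phi> P) \<noteq> 0"
  obtains e g' h' where "homogeneous e g'" "homogeneous e h'" "eval_at h' P \<noteq> 0"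
    "coeffs_in k g \<Longrightarrow> coeffs_in k g'" "coeffs_in k h \<Longrightarrow> coeffs_in k h'"
    "eval_at g (\<phi> P) / eval_at h (\<phi> P) = eval_at g' P / eval_at h' P"
    "\<forall>\<^sub>F R in gen. eval_at g (\<phi> R) / eval_at h (\<phi> R) = eval_at g' R / eval_at h' R"
proof -
  obtain F e b f where F: "\<And>j. homogeneous e (F j)" "\<And>j. coeffs_in k (F j)" "homogeneous f b" "eval_at b P \<noteq> 0"
    "\<And>R. R \<in> V \<Longrightarrow> eval_at b R \<noteq> 0 \<Longrightarrow> (\<chi> j. eval_at (F j) R) \<noteq> 0 \<and> \<phi> R = abs_proj (\<chi> j. eval_at (F j) R)"
    by (rule morphism_local[OF phi P]) blast
  have eq: "eval_at g (\<phi> R) / eval_at h (\<phi> R) = eval_at (mpoly_subst F g) R / eval_at (mpoly_subst F h) R"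
    if "R \<in> V" "eval_at b R \<noteq> 0" for R
    using F(5)[OF that] eval_at_abs_ratio[OF _ g h] by (simp add: eval_at_subst)
  have ev: "\<forall>\<^sub>F R in gen. eval_at g (\<phi> R) / eval_at h (\<phi> R) = eval_at (mpoly_subst F g) R / eval_at (mpoly_subst F h) R"
    using eventually_gen_in eventually_form_nonzero[OF F(3) P F(4)] by eventually_elim (rule eq)
  have nz: "eval_at (mpoly_subst F h) P \<noteq> 0"
    using F(5)[OF P F(4)] eval_at_abs_zero[OF _ h] hP by (auto simp: eval_at_subst)
  show ?thesis
  proof (rule that[of "d * e" "mpoly_subst F g" "mpoly_subst F h"])
    show "homogeneous (d * e) (mpoly_subst F g)" by (rule homogeneous_subst[OF _ g]) (rule F(1))
    show "homogeneous (d * e) (mpoly_subst F h)" by (rule homogeneous_subst[OF _ h]) (rule F(1))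
    show "coeffs_in k (mpoly_subst F g)" if "coeffs_in k g" by (rule coeffs_in_subst[OF k _ that]) (rule F(2))
    show "coeffs_in k (mpoly_subst F h)" if "coeffs_in k h" by (rule coeffs_in_subst[OF k _ that]) (rule F(2))
  qed (rule nz eq[OF P F(4)] ev)+
qed

lemma regv_morphism_frac:
  assumes phi: "is_morphism k V Y \<phi>" and k: "subring_set k" and P: "P \<in> V"
    and g: "homogeneous d g" and h: "homogeneous d h" and hP: "eval_at h (\<phi> P) \<noteq> 0"
  shows "regv P (\<lambda>R. eval_at g (\<phi> R) / eval_at h (\<phi> R)) (eval_at g (\<phi> P) / eval_at h (\<phi> P))"
proof -
  obtain e g' h' where *: "homogeneous e g'" "homogeneous e h'" "eval_at h' P \<noteq> 0"
    "eval_at g (\<phi> P) / eval_at h (\<phi> P) = eval_at g' P / eval_at h' P"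
    "\<forall>\<^sub>F R in gen. eval_at g (\<phi> R) / eval_at h (\<phi> R) = eval_at g' R / eval_at h' R"
    by (rule morphism_pullback_forms[OF phi k P g h hP]) blast
  show ?thesis by (rule regvI[OF *(1-3,5,4)])
qed

text \<open>Exceptional sets are finite, and an injective map pulls finite sets back to finite
  sets.\<close>

lemma eventually_gen_inj:
  assumes "inj_on \<phi> V" "\<phi> ` V \<subseteq> V" "\<forall>\<^sub>F R in gen. Q R"
  shows "\<forall>\<^sub>F R in gen. Q (\<phi> R)"
proof -
  have "finite {R\<in>V. \<not> Q R}" using assms(3) unfolding eventually_gen_iff .
  moreover have "\<phi> ` {R\<in>V. \<not> Q (\<phi> R)} \<subseteq> {R\<in>V. \<not> Q R}" using assms(2) by auto
  moreover have "inj_on \<phi> {R\<in>V. \<not> Q (\<phi> R)}" using assms(1) by (rule inj_on_subset) auto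
  ultimately show ?thesis unfolding eventually_gen_iff using finite_imageD finite_subset by blast
qed

lemma regv_pullback:
  assumes phi: "is_morphism k V V \<phi>" and k: "subring_set k" and inj: "inj_on \<phi> V" and P: "P \<in> V"
    and F: "regv (\<phi> P) F c"
  shows "regv P (\<lambda>R. F (\<phi> R)) c"
proof -
  have sub: "\<phi> ` V \<subseteq> V" using phi unfolding is_morphism_def by blast
  obtain d g h where 1: "homogeneous d g" "homogeneous d h" "eval_at h (\<phi> P) \<noteq> 0"
     "c = eval_at g (\<phi> P) / eval_at h (\<phi> P)" "\<forall>\<^sub>F R in gen. F R = eval_at g R / eval_at h R"
    using F unfolding regv_def by blast
  have "\<forall>\<^sub>F R in gen. F (\<phi> R) = eval_at g (\<phi> R) / eval_at h (\<phi> R)"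
    by (rule eventually_gen_inj[OF inj sub 1(5)])
  then have "\<forall>\<^sub>F R in gen. eval_at g (\<phi> R) / eval_at h (\<phi> R) = F (\<phi> R)" by eventually_elim simp
  from regv_cong[OF regv_morphism_frac[OF phi k P 1(1-3)] this] show ?thesis unfolding 1(4) .
qed

text \<open>\<open>regular_on\<close> asks for equality at every point of a neighbourhood,
  \<open>regv\<close> only for generic equality. When f is regular with its own value at all points
  of \<open>U\<close>, \<open>regv_unique\<close> upgrades generic equality to equality where the
  denominator is nonzero.\<close>

lemma regular_on_iff:
  assumes U: "zariski_openin V U"
  shows "regular_on V U f \<longleftrightarrow> (\<forall>P\<in>U. regv P f (f P))"
proof
  assume reg: "regular_on V U f"
  show "\<forall>P\<in>U. regv P f (f P)"
  proof
    fix P assume "P \<in> U"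
    then obtain W g h d where W: "zariski_openin V W" "P \<in> W" "homogeneous d g" "homogeneous d h"
      "\<And>R. R \<in> W \<Longrightarrow> eval_at h R \<noteq> 0 \<and> f R = eval_at g R / eval_at h R"
      using reg unfolding regular_on_def by blast
    have W2: "finite (V - W)" using W(1,2) unfolding zariski_openin_iff by blast
    have "{R\<in>V. \<not> (f R = eval_at g R / eval_at h R)} \<subseteq> V - W" using W(5) by blast
    then have "\<forall>\<^sub>F R in gen. f R = eval_at g R / eval_at h R"
      unfolding eventually_gen_iff using W2 by (rule finite_subset)
    then show "regv P f (f P)" using W by (intro regvI) auto
  qed
next
  assume reg: "\<forall>P\<in>U. regv P f (f P)"
  have UV: "U \<subseteq> V" using U unfolding zariski_openin_iff by blast
  show "regular_on V U f" unfolding regular_on_def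
  proof
    fix P assume P: "P \<in> U"
    then obtain d g h where gh: "homogeneous d g" "homogeneous d h" "eval_at h P \<noteq> 0"
      "\<forall>\<^sub>F R in gen. f R = eval_at g R / eval_at h R" using reg unfolding regv_def by blast
    define W where "W = {R\<in>U. eval_at h R \<noteq> 0}"
    have "finite (V - U)" using U P unfolding zariski_openin_iff by blast
    moreover have "finite {R\<in>V. eval_at h R = 0}" using finite_zeros[OF gh(2) _ gh(3)] P UV by blast
    moreover have "V - W \<subseteq> (V - U) \<union> {R\<in>V. eval_at h R = 0}" by (auto simp: W_def)
    ultimately have "finite (V - W)" using finite_subset finite_UnI by blast
    then have W: "zariski_openin V W" unfolding zariski_openin_iff using UV by (auto simp: W_def)
    have "eval_at h R \<noteq> 0 \<and> f R = eval_at g R / eval_at h R" if R: "R \<in> W" for R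
    proof -
      have hR: "R \<in> U" "eval_at h R \<noteq> 0" using R by (auto simp: W_def)
      have 1: "regv R f (f R)" using reg hR(1) by blast
      have 2: "regv R f (eval_at g R / eval_at h R)" by (rule regvI[OF gh(1,2) hR(2) gh(4) refl])
      have "f R = eval_at g R / eval_at h R" using regv_unique[OF _ 1 2] hR(1) UV by auto
      with hR(2) show ?thesis by blast
    qed
    moreover have "P \<in> W" using P gh(3) by (simp add: W_def)
    moreover have "W \<subseteq> U" by (auto simp: W_def)
    ultimately show "\<exists>W g h d. zariski_openin V W \<and> P \<in> W \<and> W \<subseteq> U \<and> homogeneous d g \<and> homogeneous d h \<and>
        (\<forall>R\<in>W. eval_at h R \<noteq> 0 \<and> f R = eval_at g R / eval_at h R)"
      using W gh(1,2) by blast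
  qed
qed

lemma openin_V: "zariski_openin V V"
  unfolding zariski_openin_iff by simp

end

section \<open>Automorphisms and quotients\<close>

lemma openin_form: "homogeneous d h \<Longrightarrow> zariski_openin M {R\<in>M. eval_at h R \<noteq> 0}"
  unfolding zariski_openin_def using zariski_closed_zero_set[of d h] by blast

text \<open>Automorphisms are restricted functions and inverses come from \<open>inv_into\<close>;
  this lemma disposes of their values off \<open>M\<close>.\<close>

lemma is_morphism_cong:
  assumes "is_morphism k M Y \<phi>" "\<And>P. P \<in> M \<Longrightarrow> \<phi> P = \<psi> P"
  shows "is_morphism k M Y \<psi>"
  unfolding is_morphism_def
proof (intro conjI ballI)
  show "\<psi> ` M \<subseteq> Y" using assms unfolding is_morphism_def by force
  fix P assume P: "P \<in> M"
  obtain F d h e where F: "\<And>j. homogeneous d (F j)" "\<And>j. coeffs_in k (F j)" "homogeneous e h" "eval_at h P \<noteq> 0"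
    "\<And>R. R \<in> M \<Longrightarrow> eval_at h R \<noteq> 0 \<Longrightarrow> (\<chi> j. eval_at (F j) R) \<noteq> 0 \<and> \<phi> R = abs_proj (\<chi> j. eval_at (F j) R)"
    by (rule morphism_local[OF assms(1) P]) blast
  show "\<exists>U F d. zariski_openin M U \<and> P \<in> U \<and> (\<forall>j. homogeneous d (F j) \<and> coeffs_in k (F j)) \<and>
      (\<forall>R\<in>U. (\<chi> j. eval_at (F j) R) \<noteq> 0 \<and> \<psi> R = abs_proj (\<chi> j. eval_at (F j) R))"
    by (intro exI[of _ "{R\<in>M. eval_at h R \<noteq> 0}"] exI[of _ F] exI[of _ d] conjI openin_form[OF F(3)])
      (use F P assms(2) in auto)
qed

lemma is_morphism_id:
  assumes k: "subring_set k"
  shows "is_morphism k M M (\<lambda>P. P)"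
  unfolding is_morphism_def
proof (intro conjI ballI)
  fix P :: "('a, 'b) proj" assume P: "P \<in> M"
  have one: "homogeneous 0 (1 :: ('a, 'b) mpoly)" by simp
  have rep: "(\<chi> j. eval_at (Var j) R) = rep_proj R" for R :: "('a, 'b) proj" by (simp add: vec_eq_iff)
  have cf: "coeffs_in k (Var j :: ('a, 'b) mpoly)" for j
    using k unfolding Var_def by (intro coeffs_in_single) (auto simp: subring_set_def)
  show "\<exists>U F d. zariski_openin M U \<and> P \<in> U \<and> (\<forall>j. homogeneous d (F j) \<and> coeffs_in k (F j)) \<and>
      (\<forall>R\<in>U. (\<chi> j. eval_at (F j) R) \<noteq> 0 \<and> R = abs_proj (\<chi> j. eval_at (F j) R))"
    by (intro exI[of _ "{R\<in>M. eval_at 1 R \<noteq> 0}"] exI[of _ Var] exI[of _ "Suc 0"] conjI openin_form[OF one])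
      (use P cf in \<open>auto simp: rep\<close>)
qed simp

lemma is_morphism_compose:
  assumes phi: "is_morphism k M Y \<phi>" and psi: "is_morphism k Y Z \<psi>" and k: "subring_set k"
  shows "is_morphism k M Z (\<lambda>P. \<psi> (\<phi> P))"
  unfolding is_morphism_def
proof (intro conjI ballI)
  show "(\<lambda>P. \<psi> (\<phi> P)) ` M \<subseteq> Z" using phi psi unfolding is_morphism_def by blast
  fix P assume P: "P \<in> M"
  then have pP: "\<phi> P \<in> Y" using phi unfolding is_morphism_def by blast
  obtain F d h e where F: "\<And>j. homogeneous d (F j)" "\<And>j. coeffs_in k (F j)" "homogeneous e h" "eval_at h P \<noteq> 0"
    "\<And>R. R \<in> M \<Longrightarrow> eval_at h R \<noteq> 0 \<Longrightarrow> (\<chi> j. eval_at (F j) R) \<noteq> 0 \<and> \<phi> R = abs_proj (\<chi> j. eval_at (F j) R)"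
    by (rule morphism_local[OF phi P]) blast
  obtain F' d' h' e' where F': "\<And>j. homogeneous d' (F' j)" "\<And>j. coeffs_in k (F' j)" "homogeneous e' h'" "eval_at h' (\<phi> P) \<noteq> 0"
    "\<And>R. R \<in> Y \<Longrightarrow> eval_at h' R \<noteq> 0 \<Longrightarrow> (\<chi> j. eval_at (F' j) R) \<noteq> 0 \<and> \<psi> R = abs_proj (\<chi> j. eval_at (F' j) R)"
    by (rule morphism_local[OF psi pP]) blast
  define b where "b = h * mpoly_subst F h'"
  define G where "G j = mpoly_subst F (F' j)" for j
  have b: "homogeneous (e + e' * d) b"
    unfolding b_def by (intro homogeneous_mult F(3) homogeneous_subst F(1) F'(3))
  have G: "homogeneous (d' * d) (G j)" "coeffs_in k (G j)" for j
    unfolding G_def by (intro homogeneous_subst F(1) F'(1), intro coeffs_in_subst k F(2) F'(2))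
  have bP: "eval_at b P \<noteq> 0"
    using F(4) F(5)[OF P F(4)] F'(4) eval_at_abs_zero[OF _ F'(3)] by (auto simp: b_def eval_at_subst)
  have loc: "(\<chi> j. eval_at (G j) R) \<noteq> 0 \<and> \<psi> (\<phi> R) = abs_proj (\<chi> j. eval_at (G j) R)"
    if R: "R \<in> M" "eval_at b R \<noteq> 0" for R
  proof -
    define v where "v = (\<chi> j. eval_at (F j) R)"
    have hR: "eval_at h R \<noteq> 0" "mpoly_eval h' v \<noteq> 0"
      using R(2) by (auto simp: b_def eval_at_subst v_def)
    have v: "v \<noteq> 0" "\<phi> R = abs_proj v" using F(5)[OF R(1) hR(1)] by (auto simp: v_def)
    have "\<phi> R \<in> Y" using phi R(1) unfolding is_morphism_def by blast
    moreover have "eval_at h' (\<phi> R) \<noteq> 0" using hR(2) eval_at_abs_zero[OF v(1) F'(3)] v(2) by simp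
    ultimately have psi_R: "(\<chi> j. eval_at (F' j) (\<phi> R)) \<noteq> 0" "\<psi> (\<phi> R) = abs_proj (\<chi> j. eval_at (F' j) (\<phi> R))"
      using F'(5) by blast+
    obtain c where c: "c \<noteq> 0" "\<And>d F. homogeneous d F \<Longrightarrow> eval_at F (abs_proj v) = c ^ d * mpoly_eval F v"
      by (rule eval_at_abs[OF v(1)]) blast
    \<comment> \<open>\<open>eval_at\<close> uses the chosen representative of \<phi> R, which
      differs from v by the scalar c. All components have the same degree d', so a common power of c
      factors out.\<close>
    have eq: "(\<chi> j. eval_at (F' j) (\<phi> R)) = c ^ d' *s (\<chi> j. eval_at (G j) R)"
      by (simp add: vec_eq_iff v(2) c(2)[OF F'(1)] G_def eval_at_subst v_def[symmetric])
    have nz: "(\<chi> j. eval_at (G j) R) \<noteq> 0" using psi_R(1) unfolding eq by auto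
    have "\<exists>a. a \<noteq> 0 \<and> (\<chi> j. eval_at (F' j) (\<phi> R)) = a *s (\<chi> j. eval_at (G j) R)"
      using eq c(1) by (intro exI[of _ "c ^ d'"]) simp
    then have "abs_proj (\<chi> j. eval_at (G j) R) = abs_proj (\<chi> j. eval_at (F' j) (\<phi> R))"
      using abs_proj_eq_iff[OF nz psi_R(1)] by blast
    then show ?thesis using nz psi_R(2) by simp
  qed
  show "\<exists>U F d. zariski_openin M U \<and> P \<in> U \<and> (\<forall>j. homogeneous d (F j) \<and> coeffs_in k (F j)) \<and>
      (\<forall>R\<in>U. (\<chi> j. eval_at (F j) R) \<noteq> 0 \<and> \<psi> (\<phi> R) = abs_proj (\<chi> j. eval_at (F j) R))"
    by (intro exI[of _ "{R\<in>M. eval_at b R \<noteq> 0}"] exI[of _ G] exI[of _ "d' * d"] conjI openin_form[OF b])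
      (use P bP G loc in auto)
qed

lemma carrier_aut_group: "carrier (aut_group k V) =
    {\<phi> \<in> Bij V. is_morphism k V V \<phi> \<and> is_morphism k V V (inv_into V \<phi>)}"
  by (simp add: aut_group_def)

lemma aut_group_mult: "\<phi> \<in> Bij V \<Longrightarrow> \<psi> \<in> Bij V \<Longrightarrow> \<phi> \<otimes>\<^bsub>aut_group k V\<^esub> \<psi> = compose V \<phi> \<psi>"
  by (simp add: aut_group_def BijGroup_def)

lemma aut_group_one: "\<one>\<^bsub>aut_group k V\<^esub> = (\<lambda>P\<in>V. P)"
  by (simp add: aut_group_def BijGroup_def)

lemma Bij_bij_betw: "f \<in> Bij S \<Longrightarrow> bij_betw f S S"
  by (simp add: Bij_def)

lemma group_aut_group:
  assumes k: "subring_set k"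
  shows "group (aut_group k V)"
proof -
  let ?A = "{\<phi> \<in> Bij V. is_morphism k V V \<phi> \<and> is_morphism k V V (inv_into V \<phi>)}"
  interpret B: group "BijGroup V" by (rule group_BijGroup)
  have "subgroup ?A (BijGroup V)"
  proof (rule B.subgroupI)
    show "?A \<subseteq> carrier (BijGroup V)" by (auto simp: BijGroup_def)
    have "(\<lambda>P\<in>V. P) \<in> ?A"
    proof -
      have "is_morphism k V V (\<lambda>P\<in>V. P)" by (rule is_morphism_cong[OF is_morphism_id[OF k]]) simp
      moreover have "is_morphism k V V (inv_into V (\<lambda>P\<in>V. P))"
      proof (rule is_morphism_cong[OF is_morphism_id[OF k]])
        fix P assume "P \<in> V"
        then show "P = inv_into V (\<lambda>P\<in>V. P) P"
          by (intro inv_into_f_eq[symmetric]) (auto simp: inj_on_def)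
      qed
      ultimately show ?thesis using id_Bij by blast
    qed
    then show "?A \<noteq> {}" by blast
  next
    fix \<phi> assume phi: "\<phi> \<in> ?A"
    then have bij: "bij_betw \<phi> V V" using Bij_bij_betw by blast
    have inv: "inv\<^bsub>BijGroup V\<^esub> \<phi> = (\<lambda>P\<in>V. inv_into V \<phi> P)" using phi by (intro inv_BijGroup) blast
    have "is_morphism k V V (inv_into V (\<lambda>P\<in>V. inv_into V \<phi> P))"
    proof (rule is_morphism_cong[of k V V \<phi>])
      fix P assume P: "P \<in> V"
      have "inj_on (\<lambda>P\<in>V. inv_into V \<phi> P) V"
        using bij_betw_inv_into[OF bij] by (auto simp: bij_betw_def inj_on_def)
      moreover have "\<phi> P \<in> V" using bij P by (auto simp: bij_betw_def)
      moreover have "(\<lambda>P\<in>V. inv_into V \<phi> P) (\<phi> P) = P"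
        using bij P calculation(2) by (simp add: bij_betw_def)
      ultimately show "\<phi> P = inv_into V (\<lambda>P\<in>V. inv_into V \<phi> P) P" by (metis inv_into_f_f)
    qed (use phi in blast)
    moreover have "is_morphism k V V (\<lambda>P\<in>V. inv_into V \<phi> P)"
      by (rule is_morphism_cong[of k V V "inv_into V \<phi>"]) (use phi in auto)
    ultimately show "inv\<^bsub>BijGroup V\<^esub> \<phi> \<in> ?A" unfolding inv using phi restrict_inv_into_Bij by blast
  next
    fix \<phi> \<psi> assume phi: "\<phi> \<in> ?A" and psi: "\<psi> \<in> ?A"
    have b1: "bij_betw \<phi> V V" and b2: "bij_betw \<psi> V V" using phi psi Bij_bij_betw by blast+
    have m: "\<phi> \<otimes>\<^bsub>BijGroup V\<^esub> \<psi> = compose V \<phi> \<psi>" using phi psi by (simp add: BijGroup_def)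
    have b3: "bij_betw (compose V \<phi> \<psi>) V V"
      using compose_Bij[of \<phi> V \<psi>] phi psi Bij_bij_betw by blast
    have 1: "is_morphism k V V (compose V \<phi> \<psi>)"
    proof (rule is_morphism_cong)
      show "is_morphism k V V (\<lambda>P. \<phi> (\<psi> P))"
        by (rule is_morphism_compose[OF _ _ k, of V V \<psi> V \<phi>]) (use phi psi in auto)
    qed (simp add: compose_def)
    have 2: "is_morphism k V V (inv_into V (compose V \<phi> \<psi>))"
    proof (rule is_morphism_cong)
      show "is_morphism k V V (\<lambda>P. inv_into V \<psi> (inv_into V \<phi> P))"
        by (rule is_morphism_compose[OF _ _ k, of V V "inv_into V \<phi>" V "inv_into V \<psi>"]) (use phi psi in auto)
      fix P assume P: "P \<in> V"
      let ?R = "inv_into V \<psi> (inv_into V \<phi> P)"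
      have i1: "inv_into V \<phi> P \<in> V" "\<phi> (inv_into V \<phi> P) = P"
        using b1 P by (auto simp: bij_betw_def inv_into_into f_inv_into_f)
      have i2: "?R \<in> V" "\<psi> ?R = inv_into V \<phi> P"
        using b2 i1(1) by (auto simp: bij_betw_def inv_into_into f_inv_into_f)
      have "compose V \<phi> \<psi> ?R = P" using i1 i2 by (simp add: compose_def)
      then show "?R = inv_into V (compose V \<phi> \<psi>) P"
        using b3 i2(1) by (metis bij_betw_def inv_into_f_f)
    qed
    show "\<phi> \<otimes>\<^bsub>BijGroup V\<^esub> \<psi> \<in> ?A" unfolding m using 1 2 compose_Bij phi psi by blast
  qed
  from B.subgroup_imp_group[OF this] show ?thesis unfolding aut_group_def .
qed

lemma quotient_regular_iff:
  assumes "is_quotient_by k V G Y \<pi>" "zariski_openin Y B"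
  shows "regular_on Y B g \<longleftrightarrow> regular_on V {P\<in>V. \<pi> P \<in> B} (g \<circ> \<pi>)"
  using conjunct2[OF conjunct2[OF conjunct2[OF conjunct2[OF assms(1)[unfolded is_quotient_by_def]]]]] assms(2)
  by blast

lemma quotient_openin_iff:
  assumes "is_quotient_by k V G UNIV \<pi>"
  shows "zariski_openin UNIV B \<longleftrightarrow> zariski_openin V {P\<in>V. \<pi> P \<in> B}"
  using conjunct1[OF conjunct2[OF conjunct2[OF conjunct2[OF assms(1)[unfolded is_quotient_by_def]]]]]
  by blast

lemma quotient_fibre:
  assumes "is_quotient_by k V G Y \<pi>" "P \<in> V" "R \<in> V"
  shows "\<pi> P = \<pi> R \<longleftrightarrow> (\<exists>\<sigma>\<in>G. R = \<sigma> P)"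
  using conjunct1[OF conjunct2[OF conjunct2[OF assms(1)[unfolded is_quotient_by_def]]]] assms(2,3)
  by blast

text \<open>Each fibre is one orbit, so any choice of a point in the fibre gives the same
  value.\<close>

lemma quotient_lift:
  assumes quot: "is_quotient_by k V G Y \<pi>" and inv: "\<And>\<sigma> R. \<sigma> \<in> G \<Longrightarrow> R \<in> V \<Longrightarrow> N (\<sigma> R) = N R"
  obtains g where "\<And>R. R \<in> V \<Longrightarrow> g (\<pi> R) = N R"
proof
  fix R assume R: "R \<in> V"
  define R' where "R' = (SOME R'. R' \<in> V \<and> \<pi> R' = \<pi> R)"
  have "R' \<in> V \<and> \<pi> R' = \<pi> R"
    unfolding R'_def by (rule someI[of _ R]) (use R in blast)
  then obtain \<sigma> where "\<sigma> \<in> G" "R' = \<sigma> R"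
    using quotient_fibre[OF quot R, of R'] by auto
  then have "N R' = N R" using inv R by simp
  then show "(\<lambda>y. N (SOME R. R \<in> V \<and> \<pi> R = y)) (\<pi> R) = N R" by (simp only: R'_def)
qed

lemma quotient_morphism: "is_quotient_by k V G Y \<pi> \<Longrightarrow> is_morphism k V Y \<pi>"
  unfolding is_quotient_by_def by (elim conjE)

section \<open>The automorphism group over \<open>k\<close> acting on points and functions\<close>

locale curve_over = smooth_curve V for V :: "('a::alg_closed_field, 'n::finite) proj set" +
  fixes k :: "'a set"
  assumes k: "subring_set k"
begin

abbreviation Aut where "Aut \<equiv> aut_group k V"

sublocale Aut: Group.group Aut
  by (rule group_aut_group[OF k])

lemma autD:
  assumes "\<sigma> \<in> carrier Aut"
  shows "\<sigma> \<in> Bij V" "is_morphism k V V \<sigma>" "inj_on \<sigma> V" "\<sigma> ` V = V"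
  using assms Bij_bij_betw[of \<sigma> V] unfolding carrier_aut_group bij_betw_def by auto

lemma aut_in: "\<sigma> \<in> carrier Aut \<Longrightarrow> P \<in> V \<Longrightarrow> \<sigma> P \<in> V"
  using autD(4) by blast

lemma aut_mult: "\<sigma> \<in> carrier Aut \<Longrightarrow> \<tau> \<in> carrier Aut \<Longrightarrow> P \<in> V \<Longrightarrow> (\<sigma> \<otimes>\<^bsub>Aut\<^esub> \<tau>) P = \<sigma> (\<tau> P)"
  by (simp add: aut_group_mult autD(1) compose_def)

lemma aut_one: "P \<in> V \<Longrightarrow> \<one>\<^bsub>Aut\<^esub> P = P"
  by (simp add: aut_group_one)

lemma aut_inv:
  assumes "\<sigma> \<in> carrier Aut" "P \<in> V"
  shows "(inv\<^bsub>Aut\<^esub> \<sigma>) (\<sigma> P) = P" "\<sigma> ((inv\<^bsub>Aut\<^esub> \<sigma>) P) = P"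
  using aut_mult[of "inv\<^bsub>Aut\<^esub> \<sigma>" \<sigma> P] aut_mult[of \<sigma> "inv\<^bsub>Aut\<^esub> \<sigma>" P] assms aut_one by auto

lemma aut_eqI:
  assumes "\<sigma> \<in> carrier Aut" "\<tau> \<in> carrier Aut" "\<And>P. P \<in> V \<Longrightarrow> \<sigma> P = \<tau> P"
  shows "\<sigma> = \<tau>"
  using Bij_imp_extensional[OF autD(1)[OF assms(1)]] Bij_imp_extensional[OF autD(1)[OF assms(2)]] assms(3)
  by (rule extensionalityI)

lemma regv_aut: "\<sigma> \<in> carrier Aut \<Longrightarrow> P \<in> V \<Longrightarrow> regv (\<sigma> P) F c \<Longrightarrow> regv P (\<lambda>R. F (\<sigma> R)) c"
  using regv_pullback[OF autD(2) k autD(3)] by blast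

lemma rat_aut: "\<sigma> \<in> carrier Aut \<Longrightarrow> rat F \<Longrightarrow> rat (\<lambda>R. F (\<sigma> R))"
proof -
  assume s: "\<sigma> \<in> carrier Aut" and F: "rat F"
  obtain Q c where Q: "Q \<in> V" "regv Q F c" using F unfolding rat_def by blast
  then obtain P where P: "P \<in> V" "Q = \<sigma> P" using autD(4)[OF s] by blast
  show ?thesis using regv_rat[OF P(1) regv_aut[OF s P(1)]] Q(2) P(2) by blast
qed

lemma eventually_aut: "\<sigma> \<in> carrier Aut \<Longrightarrow> \<forall>\<^sub>F R in gen. A R \<Longrightarrow> \<forall>\<^sub>F R in gen. A (\<sigma> R)"
  using eventually_gen_inj[OF autD(3)] autD(4) by blast

text \<open>A test function at P is moved to \<sigma> P by the inverse automorphism, tested there,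
  and moved back.\<close>

lemma pole_le_aut:
  assumes s: "\<sigma> \<in> carrier Aut" and P: "P \<in> V" and F: "pole_le (\<sigma> P) n F"
  shows "pole_le P n (\<lambda>R. F (\<sigma> R))"
  unfolding pole_le_def
proof (intro allI impI)
  fix t assume t: "regv P t 0"
  have si: "inv\<^bsub>Aut\<^esub> \<sigma> \<in> carrier Aut" using s by simp
  have "regv (\<sigma> P) (\<lambda>R. t ((inv\<^bsub>Aut\<^esub> \<sigma>) R)) 0"
    by (rule regv_aut[OF si aut_in[OF s P]]) (simp add: aut_inv[OF s P] t)
  then obtain c where c: "regv (\<sigma> P) (\<lambda>R. t ((inv\<^bsub>Aut\<^esub> \<sigma>) R) ^ n * F R) c"
    using F unfolding pole_le_def by blast
  have e: "\<forall>\<^sub>F R in gen. t ((inv\<^bsub>Aut\<^esub> \<sigma>) (\<sigma> R)) ^ n * F (\<sigma> R) = t R ^ n * F (\<sigma> R)"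
    using eventually_gen_in by eventually_elim (simp add: aut_inv[OF s])
  from regv_cong[OF regv_aut[OF s P c] e]
  show "\<exists>c. regv P (\<lambda>R. t R ^ n * F (\<sigma> R)) c" by blast
qed

text \<open>If \<open>\<sigma> P\<close> and \<open>\<tau> P\<close> differ, a linear form \<open>l\<close> that separates them and a form \<open>h\<close> vanishing at neither
  give the function \<open>l (\<sigma> R) / h (\<sigma> R) - l (\<tau> R) / h (\<tau> R)\<close>, which has infinitely many zeros but is nonzero at \<open>P\<close>.\<close>

lemma aut_eq_if_agree:
  assumes s: "\<sigma> \<in> carrier Aut" and t: "\<tau> \<in> carrier Aut" and inf: "infinite {R\<in>V. \<sigma> R = \<tau> R}"
  shows "\<sigma> = \<tau>"
proof (rule aut_eqI[OF s t])
  fix P assume P: "P \<in> V"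
  show "\<sigma> P = \<tau> P"
  proof (rule ccontr)
    assume neq: "\<sigma> P \<noteq> \<tau> P"
    obtain l where l: "homogeneous 1 l" "eval_at l (\<tau> P) = 0" "eval_at l (\<sigma> P) \<noteq> 0"
      by (rule separating_linear_form[OF neq])
    obtain l' where l': "homogeneous 1 l'" "eval_at l' (\<sigma> P) = 0" "eval_at l' (\<tau> P) \<noteq> 0"
      using separating_linear_form[of "\<tau> P" "\<sigma> P"] neq by metis
    define h where "h = l + l'"
    have h: "homogeneous 1 h" unfolding h_def using l(1) l'(1) by (rule homogeneous_add)
    have hs: "eval_at h (\<sigma> P) \<noteq> 0" "eval_at h (\<tau> P) \<noteq> 0" using l l' by (auto simp: h_def)
    have 1: "regv P (\<lambda>R. eval_at l (\<sigma> R) / eval_at h (\<sigma> R)) (eval_at l (\<sigma> P) / eval_at h (\<sigma> P))"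
      by (rule regv_morphism_frac[OF autD(2)[OF s] k P l(1) h hs(1)])
    have 2: "regv P (\<lambda>R. eval_at l (\<tau> R) / eval_at h (\<tau> R)) (eval_at l (\<tau> P) / eval_at h (\<tau> P))"
      by (rule regv_morphism_frac[OF autD(2)[OF t] k P l(1) h hs(2)])
    let ?D = "\<lambda>R. eval_at l (\<sigma> R) / eval_at h (\<sigma> R) - eval_at l (\<tau> R) / eval_at h (\<tau> R)"
    have D: "regv P ?D (eval_at l (\<sigma> P) / eval_at h (\<sigma> P) - eval_at l (\<tau> P) / eval_at h (\<tau> P))"
      by (rule regv_diff[OF P 1 2])
    have "\<not> (\<forall>\<^sub>F R in gen. ?D R \<noteq> 0)"
    proof
      assume "\<forall>\<^sub>F R in gen. ?D R \<noteq> 0"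
      then have "finite {R\<in>V. \<not> (?D R \<noteq> 0)}" unfolding eventually_gen_iff .
      moreover have "{R\<in>V. \<sigma> R = \<tau> R} \<subseteq> {R\<in>V. \<not> (?D R \<noteq> 0)}" by auto
      ultimately show False using inf finite_subset by blast
    qed
    then have "\<forall>\<^sub>F R in gen. ?D R = 0" using rat_zero_or_nonzero[OF regv_rat[OF P D]] by blast
    from regv_unique[OF P D regv_const[of P 0] this] show False using l hs by simp
  qed
qed

text \<open>Right translation by \<tau> permutes the factors.\<close>

lemma invariant_product:
  assumes G: "subgroup G Aut" and \<tau>: "\<tau> \<in> G" and R: "R \<in> V"
  shows "(\<Prod>\<sigma>\<in>G. f (\<sigma> (\<tau> R))) = (\<Prod>\<sigma>\<in>G. (f (\<sigma> R) :: 'b::comm_monoid_mult))"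
proof -
  have GA: "\<sigma> \<in> carrier Aut" if "\<sigma> \<in> G" for \<sigma> by (rule subgroup.mem_carrier[OF G that])
  have "bij_betw (\<lambda>\<sigma>. \<sigma> \<otimes>\<^bsub>Aut\<^esub> \<tau>) G G"
  proof (rule bij_betw_byWitness[where f' = "\<lambda>\<sigma>. \<sigma> \<otimes>\<^bsub>Aut\<^esub> inv\<^bsub>Aut\<^esub> \<tau>"])
    show "\<forall>\<sigma>\<in>G. \<sigma> \<otimes>\<^bsub>Aut\<^esub> \<tau> \<otimes>\<^bsub>Aut\<^esub> inv\<^bsub>Aut\<^esub> \<tau> = \<sigma>"
      using GA \<tau> by (auto simp: Aut.m_assoc)
    show "\<forall>\<sigma>\<in>G. \<sigma> \<otimes>\<^bsub>Aut\<^esub> inv\<^bsub>Aut\<^esub> \<tau> \<otimes>\<^bsub>Aut\<^esub> \<tau> = \<sigma>"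
      using GA \<tau> by (auto simp: Aut.m_assoc)
    show "(\<lambda>\<sigma>. \<sigma> \<otimes>\<^bsub>Aut\<^esub> \<tau>) ` G \<subseteq> G" "(\<lambda>\<sigma>. \<sigma> \<otimes>\<^bsub>Aut\<^esub> inv\<^bsub>Aut\<^esub> \<tau>) ` G \<subseteq> G"
      using G \<tau> by (auto intro: subgroup.m_closed subgroup.m_inv_closed)
  qed
  then have "(\<Prod>\<sigma>\<in>G. f ((\<sigma> \<otimes>\<^bsub>Aut\<^esub> \<tau>) R)) = (\<Prod>\<sigma>\<in>G. f (\<sigma> R))"
    by (rule prod.reindex_bij_betw)
  moreover have "(\<Prod>\<sigma>\<in>G. f ((\<sigma> \<otimes>\<^bsub>Aut\<^esub> \<tau>) R)) = (\<Prod>\<sigma>\<in>G. f (\<sigma> (\<tau> R)))"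
    by (rule prod.cong) (auto simp: aut_mult GA \<tau> R)
  ultimately show ?thesis by simp
qed

text \<open>With c = f P0, the product of all f \<circ> \<sigma> - c is invariant, descends to a
  regular function on the line and is therefore constant, with value 0 because of the factor of the
  identity at P0. As \<open>V\<close> is infinite and G finite, one factor has infinitely many zeros
  and so vanishes generically; translating back gives F = c.\<close>

lemma quotient_regular_constant:
  fixes \<pi> :: "('a, 'n) proj \<Rightarrow> ('a, 2) proj"
  assumes G: "subgroup G Aut" "finite G" and quot: "is_quotient_by k V G UNIV \<pi>"
  shows only_constants_regular
  unfolding only_constants_regular_def
proof (intro allI impI)
  fix F assume F: "rat F" "\<forall>P\<in>V. \<exists>c. regv P F c"
  have GA: "\<sigma> \<in> carrier Aut" if "\<sigma> \<in> G" for \<sigma> by (rule subgroup.mem_carrier[OF G(1) that])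
  \<comment> \<open>Descent works with values at all points, so F is replaced by the function of its
    regular values.\<close>
  from bchoice[OF F(2)] obtain f where f: "\<And>P. P \<in> V \<Longrightarrow> regv P F (f P)" by blast
  have Ff: "\<forall>\<^sub>F R in gen. F R = f R"
    using rat_eventually_regv[OF F(1)]
  proof eventually_elim
    case (elim R)
    then show ?case using regv_unique[of R F "F R" F "f R"] f[of R] by simp
  qed
  have ff: "regv P f (f P)" if "P \<in> V" for P using regv_cong[OF f[OF that] Ff] .
  obtain P0 where P0: "P0 \<in> V" using irreducible unfolding zariski_irreducible_def by blast
  define c where "c = f P0"
  define N where "N R = (\<Prod>\<sigma>\<in>G. f (\<sigma> R) - c)" for R
  have N: "regv P N (N P)" if P: "P \<in> V" for P
    unfolding N_def
  proof (rule regv_prod[OF P])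
    fix \<sigma> assume s: "\<sigma> \<in> G"
    have "regv P (\<lambda>R. f (\<sigma> R)) (f (\<sigma> P))"
      by (rule regv_aut[OF GA[OF s] P ff[OF aut_in[OF GA[OF s] P]]])
    then show "regv P (\<lambda>R. f (\<sigma> R) - c) (f (\<sigma> P) - c)" by (rule regv_diff[OF P _ regv_const])
  qed
  have N_inv: "N (\<tau> R) = N R" if "\<tau> \<in> G" "R \<in> V" for \<tau> R
    unfolding N_def by (rule invariant_product[OF G(1) that])
  obtain g where g: "\<And>R. R \<in> V \<Longrightarrow> g (\<pi> R) = N R"
    by (rule quotient_lift[OF quot N_inv]) (assumption, assumption, rule that)
  have "regular_on V V (g \<circ> \<pi>)"
    unfolding regular_on_iff[OF openin_V]
  proof
    fix P assume P: "P \<in> V"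
    have "\<forall>\<^sub>F R in gen. N R = (g \<circ> \<pi>) R" using eventually_gen_in by eventually_elim (simp add: g)
    moreover have "(g \<circ> \<pi>) P = N P" by (simp add: g[OF P])
    ultimately show "regv P (g \<circ> \<pi>) ((g \<circ> \<pi>) P)" using regv_cong[OF N[OF P]] by (simp only:)
  qed
  moreover have "{P\<in>V. \<pi> P \<in> (UNIV :: ('a, 2) proj set)} = V" by simp
  moreover have "zariski_openin (UNIV :: ('a, 2) proj set) UNIV"
    using openin_form[OF homogeneous_1, of "UNIV :: ('a, 2) proj set"] by simp
  ultimately have "regular_on UNIV UNIV g"
    using quotient_regular_iff[OF quot] by simp
  then obtain e where e: "\<And>y. g y = e" using regular_on_proj_line_constant by blast
  have "N P0 = 0"
  proof -
    have "\<one>\<^bsub>Aut\<^esub> \<in> G" using G(1) by (rule subgroup.one_closed)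
    moreover have "f (\<one>\<^bsub>Aut\<^esub> P0) - c = 0" using aut_one[OF P0] by (simp add: c_def)
    ultimately show ?thesis unfolding N_def using G(2) by (subst prod_zero_iff) auto
  qed
  then have N0: "N R = 0" if "R \<in> V" for R using g[OF that] g[OF P0] e by simp
  have "\<exists>\<sigma>\<in>G. infinite {R\<in>V. f (\<sigma> R) = c}"
  proof (rule ccontr)
    assume "\<not> ?thesis"
    then have "finite (\<Union>\<sigma>\<in>G. {R\<in>V. f (\<sigma> R) = c})" using G(2) by blast
    moreover have "V \<subseteq> (\<Union>\<sigma>\<in>G. {R\<in>V. f (\<sigma> R) = c})"
    proof
      fix R assume R: "R \<in> V"
      then have "(\<Prod>\<sigma>\<in>G. f (\<sigma> R) - c) = 0" using N0 unfolding N_def by blast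
      then have "\<exists>\<sigma>\<in>G. f (\<sigma> R) - c = 0" by (simp only: prod_zero_iff[OF G(2)])
      then obtain \<sigma> where "\<sigma> \<in> G" "f (\<sigma> R) - c = 0" ..
      then show "R \<in> (\<Union>\<sigma>\<in>G. {R\<in>V. f (\<sigma> R) = c})" using R by auto
    qed
    ultimately show False using infinite_V finite_subset by blast
  qed
  then obtain \<sigma> where \<sigma>: "\<sigma> \<in> G" "infinite {R\<in>V. f (\<sigma> R) = c}" by blast
  have r: "rat (\<lambda>R. f (\<sigma> R) - c)"
    by (rule rat_diff[OF rat_aut[OF GA[OF \<sigma>(1)] regv_rat[OF P0 ff[OF P0]]] rat_const])
  have "\<not> (\<forall>\<^sub>F R in gen. f (\<sigma> R) - c \<noteq> 0)"
  proof
    assume "\<forall>\<^sub>F R in gen. f (\<sigma> R) - c \<noteq> 0"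
    then have "finite {R\<in>V. f (\<sigma> R) = c}" unfolding eventually_gen_iff by simp
    then show False using \<sigma>(2) by blast
  qed
  then have "\<forall>\<^sub>F R in gen. f (\<sigma> R) - c = 0" using rat_zero_or_nonzero[OF r] by blast
  then have 1: "\<forall>\<^sub>F R in gen. f (\<sigma> ((inv\<^bsub>Aut\<^esub> \<sigma>) R)) - c = 0"
    by (rule eventually_aut[OF Aut.inv_closed[OF GA[OF \<sigma>(1)]]])
  have "\<forall>\<^sub>F R in gen. F R = c"
    using 1 Ff eventually_gen_in by eventually_elim (simp add: aut_inv[OF GA[OF \<sigma>(1)]])
  then show "\<exists>c. \<forall>\<^sub>F R in gen. F R = c" by blast
qed

end

section \<open>The coordinate function of a rational quotient\<close>

lemma proportional_2:
  fixes v w :: "'a::field^2"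
  assumes "v \<noteq> 0" "w \<noteq> 0" "w $ 1 * v $ 2 = w $ 2 * v $ 1"
  shows "\<exists>c. c \<noteq> 0 \<and> v = c *s w"
proof (cases "w $ 1 = 0")
  case False
  have eq: "v = (v $ 1 / w $ 1) *s w"
    using assms(3) False by (simp add: vec_eq_iff forall_2 field_simps)
  then have "v $ 1 / w $ 1 \<noteq> 0" using assms(1) by (metis vector_smult_lzero)
  then show ?thesis using eq by blast
next
  case True
  then have w2: "w $ 2 \<noteq> 0" using assms(2) by (auto simp: vec_eq_iff forall_2)
  have eq: "v = (v $ 2 / w $ 2) *s w"
    using assms(3) True w2 by (simp add: vec_eq_iff forall_2)
  then have "v $ 2 / w $ 2 \<noteq> 0" using assms(1) by (metis vector_smult_lzero)
  then show ?thesis using eq by blast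
qed

definition line_form :: "'a::field^2 \<Rightarrow> ('a, 2) mpoly" where
  "line_form w = Cst (w $ 1) * Var 2 - Cst (w $ 2) * Var 1"

text \<open>The numerator of \<open>line_coord\<close> must not vanish at \<open>w\<close>, or the
  pole there would be cancelled.\<close>

definition coord_form :: "'a::field^2 \<Rightarrow> ('a, 2) mpoly" where
  "coord_form w = (if w $ 1 \<noteq> 0 then Var 1 else Var 2)"

definition line_coord :: "'a::field^2 \<Rightarrow> ('a, 2) proj \<Rightarrow> 'a" where
  "line_coord w z = eval_at (coord_form w) z / eval_at (line_form w) z"

lemma homogeneous_line_form: "homogeneous 1 (line_form w)"
  using homogeneous_mult[OF homogeneous_Cst[of "w $ 1"] homogeneous_Var[of "2::2"]]
    homogeneous_mult[OF homogeneous_Cst[of "w $ 2"] homogeneous_Var[of "1::2"]]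
  unfolding line_form_def by (intro homogeneous_diff) simp_all

lemma homogeneous_coord_form: "homogeneous 1 (coord_form w)"
  unfolding coord_form_def by simp

lemma eval_at_line_form: "eval_at (line_form w) z = w $ 1 * rep_proj z $ 2 - w $ 2 * rep_proj z $ 1"
  by (simp add: line_form_def)

lemma line_form_zero_iff:
  assumes "w \<noteq> 0"
  shows "eval_at (line_form w) z = 0 \<longleftrightarrow> z = abs_proj w"
proof
  assume "eval_at (line_form w) z = 0"
  then have "w $ 1 * rep_proj z $ 2 = w $ 2 * rep_proj z $ 1" by (simp add: eval_at_line_form)
  then have "abs_proj w = abs_proj (rep_proj z)"
    using proportional_2[OF rep_proj_nonzero assms] abs_proj_eq_iff[OF assms rep_proj_nonzero[of z]] by blast
  then show "z = abs_proj w" by simp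
next
  assume "z = abs_proj w"
  then show "eval_at (line_form w) z = 0"
    using eval_at_abs_zero[OF assms homogeneous_line_form] by (simp add: line_form_def mult.commute)
qed

text \<open>After cross multiplication, equality of the coordinates becomes w_1 or w_2 times the 2
  by 2 minor of the two points.\<close>

lemma inj_line_coord:
  fixes w :: "'a::field^2"
  assumes w: "w \<noteq> 0"
  shows "inj_on (line_coord w) (UNIV - {abs_proj w})"
proof (rule inj_onI)
  fix y z assume "y \<in> UNIV - {abs_proj w}" "z \<in> UNIV - {abs_proj w}" and eq: "line_coord w y = line_coord w z"
  then have nz: "eval_at (line_form w) y \<noteq> 0" "eval_at (line_form w) z \<noteq> 0"
    using line_form_zero_iff[OF w] by auto
  define a where "a = rep_proj y"
  define b where "b = rep_proj z"
  define s where "s = w $ 1 * a $ 2 - w $ 2 * a $ 1"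
  define t where "t = w $ 1 * b $ 2 - w $ 2 * b $ 1"
  have st: "s \<noteq> 0" "t \<noteq> 0" using nz by (auto simp: eval_at_line_form s_def t_def a_def b_def)
  have ab0: "a \<noteq> 0" "b \<noteq> 0" by (auto simp: a_def b_def)
  have "a $ 1 * b $ 2 = a $ 2 * b $ 1"
  proof (cases "w $ 1 = 0")
    case False
    then have e: "a $ 1 * t = b $ 1 * s"
      using eq nz by (simp add: line_coord_def coord_form_def eval_at_line_form a_def b_def s_def t_def frac_eq_eq)
    have "w $ 1 * (a $ 1 * b $ 2) = a $ 1 * t + w $ 2 * a $ 1 * b $ 1" by (simp add: t_def algebra_simps)
    also have "\<dots> = w $ 1 * (a $ 2 * b $ 1)" unfolding e by (simp add: s_def algebra_simps)
    finally show ?thesis using False by simp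
  next
    case True
    then have e: "a $ 2 * t = b $ 2 * s"
      using eq nz by (simp add: line_coord_def coord_form_def eval_at_line_form a_def b_def s_def t_def frac_eq_eq)
    have w2: "w $ 2 \<noteq> 0" using True w by (auto simp: vec_eq_iff forall_2)
    have "w $ 2 * (a $ 2 * b $ 1) = - (a $ 2 * t)" using True by (simp add: t_def mult_ac)
    also have "\<dots> = w $ 2 * (a $ 1 * b $ 2)" unfolding e using True by (simp add: s_def mult_ac)
    finally show ?thesis using w2 by simp
  qed
  from proportional_2[OF ab0(2,1) this] have "abs_proj a = abs_proj b"
    using abs_proj_eq_iff[OF ab0] by blast
  then show "y = z" by (simp add: a_def b_def)
qed

text \<open>A factor theorem, read off from the first-order expansion at \<open>w\<close>: in two
  variables both generators of the ideal of the point are multiples of the one linear form that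
  vanishes there. The expansion uses a coordinate that is nonzero at \<open>w\<close>.\<close>

lemma binary_form_divisible:
  fixes a :: "('a::field, 2) mpoly"
  assumes w: "w \<noteq> 0" and a: "homogeneous d a" "mpoly_eval a w = 0"
  shows "\<exists>b. homogeneous (d - 1) b \<and> (d = 0 \<longrightarrow> b = 0) \<and> (\<forall>v. mpoly_eval a v = (w $ 1 * v $ 2 - w $ 2 * v $ 1) * mpoly_eval b v)"
proof -
  have one_two: "(1 :: 2) \<noteq> 2" using two_neq_one by metis
  obtain i :: 2 where i: "w $ i \<noteq> 0" using w by (auto simp: vec_eq_iff)
  define l where "l = axis i (inverse (w $ i))"
  have lv: "mpoly_eval (lin_form l) v = v $ i / w $ i" for v
  proof -
    have "mpoly_eval (lin_form l) v = (\<Sum>j\<in>UNIV. if j = i then inverse (w $ i) * v $ i else 0)"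
      unfolding mpoly_eval_lin_form by (rule sum.cong) (auto simp: l_def axis_def)
    then show ?thesis by (simp add: field_class.field_divide_inverse mult.commute)
  qed
  have l1: "mpoly_eval (lin_form l) w = 1" unfolding lv using i by simp
  obtain A where A: "\<And>j. homogeneous (d - 1) (A j)" "\<And>j. d = 0 \<Longrightarrow> A j = 0"
    "a = Cst (mpoly_eval a w) * lin_form l ^ d + (\<Sum>j\<in>UNIV. (Var j - Cst (w $ j) * lin_form l) * A j)"
    using taylor_form[OF l1 a(1)] by blast
  have ev: "mpoly_eval a v = (v $ 1 - w $ 1 * (v $ i / w $ i)) * mpoly_eval (A 1) v +
      (v $ 2 - w $ 2 * (v $ i / w $ i)) * mpoly_eval (A 2) v" for v
    by (subst A(3)) (simp add: a(2) sum_2 lv del: mpoly_eval_lin_form)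
  have sc: "homogeneous (d - 1) (Cst c * A j)" for c j
    using homogeneous_mult[OF homogeneous_Cst[of c] A(1)[of j]] by simp
  consider "i = 1" | "i = 2" using exhaust_2 by blast
  then show ?thesis
  proof cases
    case 1
    have "mpoly_eval a v = (w $ 1 * v $ 2 - w $ 2 * v $ 1) * mpoly_eval (Cst (inverse (w $ 1)) * A 2) v" for v
      using i unfolding ev 1 by (simp add: field_simps)
    then show ?thesis using sc A(2) by (intro exI[of _ "Cst (inverse (w $ 1)) * A 2"]) simp
  next
    case 2
    have "mpoly_eval a v = (w $ 1 * v $ 2 - w $ 2 * v $ 1) * mpoly_eval (Cst (- inverse (w $ 2)) * A 1) v" for v
      using i unfolding ev 2 by (simp add: field_simps)
    then show ?thesis using sc A(2) by (intro exI[of _ "Cst (- inverse (w $ 2)) * A 1"]) simp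
  qed
qed

section \<open>A uniformizer adapted to a finite set of points\<close>

context smooth_curve begin

lemma unif_times_unit:
  assumes P: "P \<in> V" and T: "unif P T" and U: "regv P U u" "u \<noteq> 0"
    and eq: "\<forall>\<^sub>F R in gen. T' R = U R * T R"
  shows "unif P T'"
  unfolding unif_def
proof (intro conjI allI impI)
  have T0: "regv P T 0" using T unfolding unif_def by blast
  have "\<forall>\<^sub>F R in gen. U R * T R = T' R" using eq by eventually_elim simp
  from regv_cong[OF regv_mult[OF P U(1) T0] this] show "regv P T' 0" by simp
  have Unz: "\<forall>\<^sub>F R in gen. U R \<noteq> 0"
  proof -
    have "\<not> (\<forall>\<^sub>F R in gen. U R = 0)"
      using regv_unique[OF P U(1) regv_const[of P 0]] U(2) by blast
    then show ?thesis using rat_zero_or_nonzero[OF regv_rat[OF P U(1)]] by blast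
  qed
  fix F assume "regv P F 0"
  then obtain b c where b: "regv P b c" "\<forall>\<^sub>F R in gen. F R = b R * T R" using T unfolding unif_def by blast
  have 1: "regv P (\<lambda>R. b R / U R) (c / u)" by (rule regv_divide[OF P b(1) U])
  have 2: "\<forall>\<^sub>F R in gen. F R = b R / U R * T' R"
    using b(2) eq Unz by eventually_elim simp
  show "\<exists>b c. regv P b c \<and> (\<forall>\<^sub>F R in gen. F R = b R * T' R)"
    by (intro exI conjI, rule 1, rule 2)
qed

text \<open>T0 is corrected by a function w with value 1 at P and 0 on A, to w^m T0 + (1 - w)^2. At
  P the second summand is a multiple of T0^2, so the result is a unit times T0; on A the power of w
  cancels the poles of T0 and the value is 1.\<close>

lemma unif_separated:
  assumes P: "P \<in> V" and A: "finite A" "A \<subseteq> V" "P \<notin> A"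
  obtains T where "unif P T" "\<And>q. q \<in> A \<Longrightarrow> \<exists>c. c \<noteq> 0 \<and> regv q T c"
proof -
  obtain T0 where T0: "unif P T0" by (rule unif_exists[OF P smooth[OF P]])
  have T00: "regv P T0 0" using T0 unfolding unif_def by blast
  have finZ: "finite (insert P A)" using A(1) by simp
  obtain W where W: "\<And>R Q. R \<in> insert P A \<Longrightarrow> Q \<in> insert P A \<Longrightarrow> regv Q (W R) (if R = Q then 1 else 0)"
    by (rule separating_functions[OF finZ]) blast
  define w where "w = W P"
  have wP: "regv P w 1" using W[of P P] by (simp add: w_def)
  have wq: "regv q w 0" if "q \<in> A" for q using W[of P q] that A(3) by (auto simp: w_def split: if_splits)
  have "\<forall>q\<in>A. \<exists>n. pole_le q n T0" using pole_le_exists[OF _ regv_rat[OF P T00]] A(2) by blast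
  from bchoice[OF this] obtain n where n: "\<And>q. q \<in> A \<Longrightarrow> pole_le q (n q) T0" by blast
  \<comment> \<open>The extra 1 leaves a spare factor w once the pole is cancelled, so the first
    summand vanishes at q.\<close>
  define m where "m = (\<Sum>q\<in>A. n q) + 1"
  have "regv P (\<lambda>R. 1 - w R) 0" using regv_diff[OF P regv_const[of P 1] wP] by simp
  then obtain b c where b: "regv P b c" "\<forall>\<^sub>F R in gen. 1 - w R = b R * T0 R" using T0 unfolding unif_def by blast
  define T where "T R = w R ^ m * T0 R + (1 - w R) ^ 2" for R
  have U: "regv P (\<lambda>R. w R ^ m + b R ^ 2 * T0 R) 1"
    using regv_add[OF P regv_power[OF P wP, of m] regv_mult[OF P regv_power[OF P b(1), of 2] T00]] by simp
  have eq: "\<forall>\<^sub>F R in gen. T R = (w R ^ m + b R ^ 2 * T0 R) * T0 R"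
    using b(2)
  proof eventually_elim
    case (elim R)
    show ?case unfolding T_def elim by (simp add: power2_eq_square algebra_simps)
  qed
  have 1: "unif P T" by (rule unif_times_unit[OF P T0 U _ eq]) simp
  have 2: "\<exists>c. c \<noteq> 0 \<and> regv q T c" if q: "q \<in> A" for q
  proof -
    have qV: "q \<in> V" using q A(2) by blast
    have "n q \<le> (\<Sum>q\<in>A. n q)" using q A(1) by (intro member_le_sum) auto
    then obtain j where j: "m = n q + Suc j" unfolding m_def by (metis add_Suc_right add.commute le_Suc_ex Suc_eq_plus1)
    obtain e where e: "regv q (\<lambda>R. w R ^ n q * T0 R) e" using n[OF q] wq[OF q] unfolding pole_le_def by blast
    have "regv q (\<lambda>R. w R ^ Suc j * (w R ^ n q * T0 R) + (1 - w R) ^ 2) (0 ^ Suc j * e + (1 - 0) ^ 2)"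
      by (intro regv_add regv_mult regv_power regv_diff regv_const qV wq q e)
    moreover have "(\<lambda>R. w R ^ Suc j * (w R ^ n q * T0 R) + (1 - w R) ^ 2) = T"
      unfolding T_def j by (simp add: fun_eq_iff power_add mult_ac)
    ultimately have "regv q T 1" by simp
    then show ?thesis by (intro exI[of _ 1]) simp
  qed
  show ?thesis by (rule that[OF 1 2])
qed

end

context curve_over begin

lemma quotient_eventually_avoids:
  assumes quot: "is_quotient_by k V G UNIV \<pi>" and G: "finite G" and P: "P \<in> V"
  shows "\<forall>\<^sub>F R in gen. \<pi> R \<noteq> \<pi> P"
proof -
  have "{R\<in>V. \<not> \<pi> R \<noteq> \<pi> P} \<subseteq> (\<lambda>\<sigma>. \<sigma> P) ` G"
  proof
    fix R assume "R \<in> {R\<in>V. \<not> \<pi> R \<noteq> \<pi> P}"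
    then have R: "R \<in> V" "\<pi> P = \<pi> R" by auto
    then obtain \<sigma> where "\<sigma> \<in> G" "R = \<sigma> P" using quotient_fibre[OF quot P R(1)] by blast
    then show "R \<in> (\<lambda>\<sigma>. \<sigma> P) ` G" by blast
  qed
  then show ?thesis unfolding eventually_gen_iff using G finite_subset by blast
qed

text \<open>For a uniformizer \<open>T\<close> at \<open>P\<close> that is a unit at the other points of the orbit, the product of the
  conjugates of \<open>T\<close> descends to a function on the line that vanishes at \<open>\<pi> P\<close>.  It is divisible by
  the local parameter there, and divides \<open>T^n\<close> with \<open>n\<close> the order of the stabilizer.\<close>

lemma quotient_pole:
  fixes \<pi> :: "('a, 'n) proj \<Rightarrow> ('a, 2) proj"
  assumes G: "subgroup G Aut" "finite G" and quot: "is_quotient_by k V G UNIV \<pi>"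
    and P: "P \<in> V" and w: "w \<noteq> 0" "\<pi> P = abs_proj w"
  shows "pole_le P (card {\<sigma>\<in>G. \<sigma> P = P}) (\<lambda>R. line_coord w (\<pi> R))"
proof -
  have GA: "\<sigma> \<in> carrier Aut" if "\<sigma> \<in> G" for \<sigma> by (rule subgroup.mem_carrier[OF G(1) that])
  have mor: "is_morphism k V UNIV \<pi>" by (rule quotient_morphism[OF quot])
  define A where "A = (\<lambda>\<sigma>. \<sigma> P) ` G - {P}"
  have A: "finite A" "A \<subseteq> V" "P \<notin> A" using G(2) aut_in[OF GA P] by (auto simp: A_def)
  obtain T where T: "unif P T" "\<And>q. q \<in> A \<Longrightarrow> \<exists>c. c \<noteq> 0 \<and> regv q T c"
    by (rule unif_separated[OF P A]) blast
  have T0: "regv P T 0" using T(1) unfolding unif_def by blast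
  \<comment> \<open>The quotient property speaks of functions with values at all points of an open
    set, so T is replaced by \<open>t\<close>, its regular values on this domain.\<close>
  define Dm where "Dm = {R\<in>V. \<exists>c. regv R T c}"
  define t where "t R = (SOME c. regv R T c)" for R
  have t1: "regv R T (t R)" if "R \<in> Dm" for R
    using that unfolding Dm_def t_def by (auto intro: someI)
  have DmV: "Dm \<subseteq> V" by (auto simp: Dm_def)
  have fin_compl: "finite (V - Dm)"
  proof -
    have "{R\<in>V. \<not> (R \<in> V \<and> regv R T (T R))} \<supseteq> V - Dm" by (auto simp: Dm_def)
    then show ?thesis
      using rat_eventually_regv[OF regv_rat[OF P T0]] finite_subset unfolding eventually_gen_iff by blast
  qed
  have ev_Dm: "\<forall>\<^sub>F R in gen. R \<in> Dm"
  proof -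
    have "{R\<in>V. \<not> R \<in> Dm} = V - Dm" by blast
    then show ?thesis unfolding eventually_gen_iff using fin_compl by simp
  qed
  have Tt: "\<forall>\<^sub>F R in gen. T R = t R"
    using rat_eventually_regv[OF regv_rat[OF P T0]] ev_Dm
  proof eventually_elim
    case (elim R)
    then show ?case using regv_unique[of R T "T R" T "t R"] t1[of R] by simp
  qed
  have t2: "regv R t (t R)" if "R \<in> Dm" for R using regv_cong[OF t1[OF that] Tt] .
  \<comment> \<open>The largest G-stable subset of \<open>Dm\<close>; being a union of fibres, it is
    the preimage of an open set of the line.\<close>
  define V0 where "V0 = {R\<in>V. \<forall>\<sigma>\<in>G. \<sigma> R \<in> Dm}"
  have V0V: "V0 \<subseteq> V" by (auto simp: V0_def)
  have orbit_Dm: "\<sigma> P \<in> Dm" if "\<sigma> \<in> G" for \<sigma>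
  proof (cases "\<sigma> P = P")
    case True
    then show ?thesis using T0 P by (auto simp: Dm_def)
  next
    case False
    then have "\<sigma> P \<in> A" using that by (simp add: A_def)
    then show ?thesis using T(2) A(2) by (auto simp: Dm_def)
  qed
  then have PV0: "P \<in> V0" using P by (simp add: V0_def)
  have ev_V0: "\<forall>\<^sub>F R in gen. R \<in> V0"
  proof -
    have "\<forall>\<^sub>F R in gen. \<forall>\<sigma>\<in>G. \<sigma> R \<in> Dm"
      using G(2) eventually_aut[OF GA ev_Dm] by (subst eventually_ball_finite_distrib) auto
    then show ?thesis using eventually_gen_in by eventually_elim (simp add: V0_def)
  qed
  have open_V0: "zariski_openin V V0"
  proof -
    have "{R\<in>V. \<not> R \<in> V0} = V - V0" by blast
    then have "finite (V - V0)" using ev_V0 unfolding eventually_gen_iff by simp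
    then show ?thesis unfolding zariski_openin_iff using V0V by blast
  qed
  have V0_inv: "\<tau> R \<in> V0" if "\<tau> \<in> G" "R \<in> V0" for \<tau> R
  proof -
    have RV: "R \<in> V" using that(2) V0V by blast
    have "\<sigma> (\<tau> R) \<in> Dm" if "\<sigma> \<in> G" for \<sigma>
    proof -
      have "\<sigma> \<otimes>\<^bsub>Aut\<^esub> \<tau> \<in> G" using G(1) that \<open>\<tau> \<in> G\<close> by (rule subgroup.m_closed)
      then have "(\<sigma> \<otimes>\<^bsub>Aut\<^esub> \<tau>) R \<in> Dm" using \<open>R \<in> V0\<close> by (simp add: V0_def)
      then show ?thesis using aut_mult[OF GA[OF that] GA[OF \<open>\<tau> \<in> G\<close>] RV] by simp
    qed
    then show ?thesis using aut_in[OF GA[OF that(1)] RV] by (simp add: V0_def)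
  qed
  define N where "N R = (\<Prod>\<sigma>\<in>G. t (\<sigma> R))" for R
  have N: "regv R N (N R)" if R: "R \<in> V0" for R
    unfolding N_def
  proof (rule regv_prod)
    show RV: "R \<in> V" using R V0V by blast
    fix \<sigma> assume s: "\<sigma> \<in> G"
    then have "\<sigma> R \<in> Dm" using R by (simp add: V0_def)
    then have "regv (\<sigma> R) t (t (\<sigma> R))" by (rule t2)
    then show "regv R (\<lambda>R. t (\<sigma> R)) (t (\<sigma> R))" by (rule regv_aut[OF GA[OF s] RV])
  qed
  have N_inv: "N (\<tau> R) = N R" if "\<tau> \<in> G" "R \<in> V" for \<tau> R
    unfolding N_def by (rule invariant_product[OF G(1) that])
  obtain g where g: "\<And>R. R \<in> V \<Longrightarrow> g (\<pi> R) = N R"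
    by (rule quotient_lift[OF quot N_inv]) (assumption, assumption, rule that)
  define B where "B = \<pi> ` V0"
  have preB: "{R\<in>V. \<pi> R \<in> B} = V0"
  proof (intro equalityI subsetI)
    fix R assume "R \<in> {R\<in>V. \<pi> R \<in> B}"
    then obtain R' where R': "R \<in> V" "R' \<in> V0" "\<pi> R' = \<pi> R" by (auto simp: B_def)
    then obtain \<sigma> where "\<sigma> \<in> G" "R = \<sigma> R'" using quotient_fibre[OF quot _ R'(1), of R'] V0V by blast
    then show "R \<in> V0" using V0_inv R'(2) by simp
  qed (use V0V in \<open>auto simp: B_def\<close>)
  note open_iff = quotient_openin_iff[OF quot]
  note reg_iff = quotient_regular_iff[OF quot]
  have openB: "zariski_openin UNIV B" unfolding open_iff preB by (rule open_V0)
  have "regular_on V V0 (g \<circ> \<pi>)"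
    unfolding regular_on_iff[OF open_V0]
  proof
    fix R assume R: "R \<in> V0"
    have "\<forall>\<^sub>F R in gen. N R = (g \<circ> \<pi>) R" using eventually_gen_in by eventually_elim (simp add: g)
    moreover have "(g \<circ> \<pi>) R = N R" using g[of R] R V0V by auto
    ultimately show "regv R (g \<circ> \<pi>) ((g \<circ> \<pi>) R)" using regv_cong[OF N[OF R]] by (simp only:)
  qed
  then have "regular_on UNIV B g" unfolding reg_iff[OF openB] preB .
  moreover have yB: "\<pi> P \<in> B" using PV0 by (simp add: B_def)
  ultimately obtain W a b d where W: "zariski_openin UNIV W" "\<pi> P \<in> W" "homogeneous d a" "homogeneous d b"
    "\<And>z. z \<in> W \<Longrightarrow> eval_at b z \<noteq> 0 \<and> g z = eval_at a z / eval_at b z"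
    unfolding regular_on_def by blast
  have NP: "N P = 0"
  proof -
    have one: "\<one>\<^bsub>Aut\<^esub> \<in> G" using G(1) by (rule subgroup.one_closed)
    have "P \<in> Dm" using T0 P by (auto simp: Dm_def)
    then have "t P = 0" using regv_unique[OF P t1 T0] by simp
    then have "t (\<one>\<^bsub>Aut\<^esub> P) = 0" using aut_one[OF P] by simp
    then show ?thesis unfolding N_def using one G(2) by (subst prod_zero_iff) auto
  qed
  have "eval_at a (\<pi> P) = 0" using W(5)[OF W(2)] g[OF P] NP by auto
  then have "mpoly_eval a w = 0" using eval_at_abs_zero[OF w(1) W(3)] w(2) by simp
  \<comment> \<open>g vanishes at \<pi> P, so the linear form of \<open>w\<close> splits off its
    numerator and cancels the denominator of \<open>line_coord\<close>.\<close>
  then obtain a' where a': "homogeneous (d - 1) a'" "d = 0 \<Longrightarrow> a' = 0"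
    "\<And>v. mpoly_eval a v = (w $ 1 * v $ 2 - w $ 2 * v $ 1) * mpoly_eval a' v"
    using binary_form_divisible[OF w(1) W(3)] by blast
  have hom: "homogeneous d (a' * coord_form w)"
  proof (cases "d = 0")
    case True
    then show ?thesis using a'(2) by simp
  next
    case False
    have "homogeneous (d - 1 + 1) (a' * coord_form w)" by (rule homogeneous_mult[OF a'(1) homogeneous_coord_form])
    then show ?thesis using False by simp
  qed
  have bP: "eval_at b (\<pi> P) \<noteq> 0" using W(5)[OF W(2)] by blast
  have reg1: "regv P (\<lambda>R. eval_at (a' * coord_form w) (\<pi> R) / eval_at b (\<pi> R))
      (eval_at (a' * coord_form w) (\<pi> P) / eval_at b (\<pi> P))"
    by (rule regv_morphism_frac[OF mor k P hom W(4) bP])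
  have ev_W: "\<forall>\<^sub>F R in gen. \<pi> R \<in> W"
  proof -
    have "zariski_openin V {R\<in>V. \<pi> R \<in> W}" using W(1) unfolding open_iff .
    moreover have "P \<in> {R\<in>V. \<pi> R \<in> W}" using P W(2) by simp
    ultimately have "finite (V - {R\<in>V. \<pi> R \<in> W})" unfolding zariski_openin_iff by blast
    moreover have "V - {R\<in>V. \<pi> R \<in> W} = {R\<in>V. \<not> \<pi> R \<in> W}" by blast
    ultimately show ?thesis unfolding eventually_gen_iff by simp
  qed
  have ev_y: "\<forall>\<^sub>F R in gen. \<pi> R \<noteq> abs_proj w"
    using quotient_eventually_avoids[OF quot G(2) P] unfolding w(2) .
  have N\<xi>: "\<forall>\<^sub>F R in gen. eval_at (a' * coord_form w) (\<pi> R) / eval_at b (\<pi> R) = N R * line_coord w (\<pi> R)"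
    using ev_W ev_y eventually_gen_in
  proof eventually_elim
    case (elim R)
    have l0: "eval_at (line_form w) (\<pi> R) \<noteq> 0" using line_form_zero_iff[OF w(1)] elim(2) by simp
    have a: "eval_at a (\<pi> R) = eval_at (line_form w) (\<pi> R) * eval_at a' (\<pi> R)"
      by (simp add: eval_at_def[of a] eval_at_def[of a'] a'(3) eval_at_line_form)
    have "N R = eval_at a (\<pi> R) / eval_at b (\<pi> R)" using W(5)[OF elim(1)] g[OF elim(3)] by simp
    then show ?case unfolding a line_coord_def using l0 by simp
  qed
  obtain e where e: "regv P (\<lambda>R. N R * line_coord w (\<pi> R)) e" using regv_cong[OF reg1 N\<xi>] by blast
  \<comment> \<open>In the local ring at P, the factor of N belonging to \<sigma> divides T if
    \<sigma> fixes P, and divides 1 otherwise. The product of the cofactors turns N into a power of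
    T whose exponent is the order of the stabilizer.\<close>
  have "\<exists>\<alpha> c. regv P \<alpha> c \<and> (\<forall>\<^sub>F R in gen. \<alpha> R * t (\<sigma> R) = (if \<sigma> P = P then T R else 1))" if s: "\<sigma> \<in> G" for \<sigma>
  proof (cases "\<sigma> P = P")
    case True
    have si: "inv\<^bsub>Aut\<^esub> \<sigma> \<in> carrier Aut" using GA[OF s] by simp
    have iP: "(inv\<^bsub>Aut\<^esub> \<sigma>) P = P" using aut_inv(1)[OF GA[OF s] P] True by simp
    have "regv P (\<lambda>R. T ((inv\<^bsub>Aut\<^esub> \<sigma>) R)) 0" by (rule regv_aut[OF si P]) (simp add: iP T0)
    then obtain b c where b: "regv P b c" "\<forall>\<^sub>F R in gen. T ((inv\<^bsub>Aut\<^esub> \<sigma>) R) = b R * T R"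
      using T(1) unfolding unif_def by blast
    have 1: "regv P (\<lambda>R. b (\<sigma> R)) c" by (rule regv_aut[OF GA[OF s] P]) (simp add: True b(1))
    have 2: "\<forall>\<^sub>F R in gen. T ((inv\<^bsub>Aut\<^esub> \<sigma>) (\<sigma> R)) = b (\<sigma> R) * T (\<sigma> R)"
      by (rule eventually_aut[OF GA[OF s] b(2)])
    have 3: "\<forall>\<^sub>F R in gen. T (\<sigma> R) = t (\<sigma> R)" by (rule eventually_aut[OF GA[OF s] Tt])
    have "\<forall>\<^sub>F R in gen. b (\<sigma> R) * t (\<sigma> R) = (if \<sigma> P = P then T R else 1)"
      using 2 3 eventually_gen_in by eventually_elim (simp add: aut_inv[OF GA[OF s]] True)
    with 1 show ?thesis by blast
  next
    case False
    then have "\<sigma> P \<in> A" using s by (simp add: A_def)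
    then obtain c where c: "c \<noteq> 0" "regv (\<sigma> P) T c" using T(2) by blast
    have 1: "regv P (\<lambda>R. T (\<sigma> R)) c" by (rule regv_aut[OF GA[OF s] P c(2)])
    have nz: "\<forall>\<^sub>F R in gen. T (\<sigma> R) \<noteq> 0"
    proof -
      have "\<not> (\<forall>\<^sub>F R in gen. T (\<sigma> R) = 0)"
        using regv_unique[OF P 1 regv_const[of P 0]] c(1) by blast
      then show ?thesis using rat_zero_or_nonzero[OF regv_rat[OF P 1]] by blast
    qed
    have 3: "\<forall>\<^sub>F R in gen. T (\<sigma> R) = t (\<sigma> R)" by (rule eventually_aut[OF GA[OF s] Tt])
    have "\<forall>\<^sub>F R in gen. inverse (T (\<sigma> R)) * t (\<sigma> R) = (if \<sigma> P = P then T R else 1)"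
      using nz 3 by eventually_elim (simp add: False)
    with regv_inverse[OF P 1 c(1)] show ?thesis by blast
  qed
  then have "\<forall>\<sigma>\<in>G. \<exists>\<alpha>. \<exists>c. regv P \<alpha> c \<and> (\<forall>\<^sub>F R in gen. \<alpha> R * t (\<sigma> R) = (if \<sigma> P = P then T R else 1))" by blast
  from bchoice[OF this] obtain \<alpha> where "\<forall>\<sigma>\<in>G. \<exists>c. regv P (\<alpha> \<sigma>) c \<and> (\<forall>\<^sub>F R in gen. \<alpha> \<sigma> R * t (\<sigma> R) = (if \<sigma> P = P then T R else 1))"
    by blast
  from bchoice[OF this] obtain c where c: "\<And>\<sigma>. \<sigma> \<in> G \<Longrightarrow> regv P (\<alpha> \<sigma>) (c \<sigma>)"
    "\<And>\<sigma>. \<sigma> \<in> G \<Longrightarrow> \<forall>\<^sub>F R in gen. \<alpha> \<sigma> R * t (\<sigma> R) = (if \<sigma> P = P then T R else 1)" by blast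
  have all: "\<forall>\<^sub>F R in gen. \<forall>\<sigma>\<in>G. \<alpha> \<sigma> R * t (\<sigma> R) = (if \<sigma> P = P then T R else 1)"
    using G(2) c(2) by (subst eventually_ball_finite_distrib) auto
  have "\<forall>\<^sub>F R in gen. (\<Prod>\<sigma>\<in>G. \<alpha> \<sigma> R) * (N R * line_coord w (\<pi> R)) = T R ^ card {\<sigma>\<in>G. \<sigma> P = P} * line_coord w (\<pi> R)"
    using all
  proof eventually_elim
    case (elim R)
    have "(\<Prod>\<sigma>\<in>G. \<alpha> \<sigma> R) * N R = (\<Prod>\<sigma>\<in>G. \<alpha> \<sigma> R * t (\<sigma> R))" by (simp add: N_def prod.distrib)
    also have "\<dots> = (\<Prod>\<sigma>\<in>G. if \<sigma> P = P then T R else 1)" by (rule prod.cong) (use elim in auto)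
    also have "\<dots> = (\<Prod>\<sigma>\<in>{\<sigma>\<in>G. \<sigma> P = P}. T R)" by (rule prod.inter_filter[OF G(2), symmetric])
    also have "\<dots> = T R ^ card {\<sigma>\<in>G. \<sigma> P = P}" by simp
    finally show ?case by (simp add: mult.assoc[symmetric])
  qed
  from regv_cong[OF regv_mult[OF P regv_prod[OF P c(1)] e] this]
  show ?thesis unfolding pole_le_unif[OF P T(1)] by blast
qed

text \<open>The elements sending Q to P form a coset of the stabilizer of P, so the pole order found
  above is the coefficient of P in the orbit divisor.\<close>

lemma stabilizer_card:
  assumes G: "subgroup G Aut" and Q: "Q \<in> V" and \<rho>: "\<rho> \<in> G" "P = \<rho> Q"
  shows "card {\<sigma>\<in>G. \<sigma> P = P} = card {\<sigma>\<in>G. \<sigma> Q = P}"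
proof -
  have GA: "\<sigma> \<in> carrier Aut" if "\<sigma> \<in> G" for \<sigma> by (rule subgroup.mem_carrier[OF G that])
  have "bij_betw (\<lambda>\<sigma>. \<sigma> \<otimes>\<^bsub>Aut\<^esub> \<rho>) {\<sigma>\<in>G. \<sigma> P = P} {\<sigma>\<in>G. \<sigma> Q = P}"
  proof (rule bij_betw_byWitness[where f' = "\<lambda>\<sigma>. \<sigma> \<otimes>\<^bsub>Aut\<^esub> inv\<^bsub>Aut\<^esub> \<rho>"])
    show "\<forall>\<sigma>\<in>{\<sigma>\<in>G. \<sigma> P = P}. \<sigma> \<otimes>\<^bsub>Aut\<^esub> \<rho> \<otimes>\<^bsub>Aut\<^esub> inv\<^bsub>Aut\<^esub> \<rho> = \<sigma>"
      using GA \<rho>(1) by (auto simp: Aut.m_assoc)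
    show "\<forall>\<sigma>\<in>{\<sigma>\<in>G. \<sigma> Q = P}. \<sigma> \<otimes>\<^bsub>Aut\<^esub> inv\<^bsub>Aut\<^esub> \<rho> \<otimes>\<^bsub>Aut\<^esub> \<rho> = \<sigma>"
      using GA \<rho>(1) by (auto simp: Aut.m_assoc)
    show "(\<lambda>\<sigma>. \<sigma> \<otimes>\<^bsub>Aut\<^esub> \<rho>) ` {\<sigma>\<in>G. \<sigma> P = P} \<subseteq> {\<sigma>\<in>G. \<sigma> Q = P}"
      using GA \<rho> Q G by (auto simp: aut_mult intro: subgroup.m_closed)
    have ir: "inv\<^bsub>Aut\<^esub> \<rho> \<in> G" "(inv\<^bsub>Aut\<^esub> \<rho>) P = Q"
      using G \<rho> aut_inv(1)[OF GA[OF \<rho>(1)] Q] by (auto intro: subgroup.m_inv_closed)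
    have PV: "P \<in> V" using \<rho> aut_in GA Q by blast
    show "(\<lambda>\<sigma>. \<sigma> \<otimes>\<^bsub>Aut\<^esub> inv\<^bsub>Aut\<^esub> \<rho>) ` {\<sigma>\<in>G. \<sigma> Q = P} \<subseteq> {\<sigma>\<in>G. \<sigma> P = P}"
      using GA ir PV G by (auto simp: aut_mult intro: subgroup.m_closed)
  qed
  then show ?thesis by (rule bij_betw_same_card)
qed

text \<open>On the orbit of Q the poles are bounded by orders of stabilizers, and elsewhere the
  coordinate is regular. It lies in the function field over \<open>k\<close> because
  \<open>w\<close> and the quotient map are given over \<open>k\<close>.\<close>

lemma quotient_coordinate:
  fixes \<pi> :: "('a, 'n) proj \<Rightarrow> ('a, 2) proj"
  assumes G: "subgroup G Aut" "finite G" and quot: "is_quotient_by k V G UNIV \<pi>"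
    and Q: "Q \<in> V" and w: "w \<noteq> 0" "\<And>i. w $ i \<in> k" "\<pi> Q = abs_proj w"
  obtains f where "f \<in> function_field_over k V" "\<forall>\<^sub>F R in gen. fn f R = line_coord w (\<pi> R)"
    "\<And>P. P \<in> V \<Longrightarrow> pole_le P (card {\<sigma>\<in>G. \<sigma> Q = P}) (fn f)"
proof -
  have GA: "\<sigma> \<in> carrier Aut" if "\<sigma> \<in> G" for \<sigma> by (rule subgroup.mem_carrier[OF G(1) that])
  have mor: "is_morphism k V UNIV \<pi>" by (rule quotient_morphism[OF quot])
  \<comment> \<open>A point off the orbit of Q, where the denominator does not vanish; there the
    fraction on the line can be pulled back to a fraction of forms on \<open>V\<close>.\<close>
  have "\<not> V \<subseteq> (\<lambda>\<sigma>. \<sigma> Q) ` G" using infinite_V G(2) finite_subset by blast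
  then obtain P0 where P0: "P0 \<in> V" "P0 \<notin> (\<lambda>\<sigma>. \<sigma> Q) ` G" by blast
  then have "\<pi> P0 \<noteq> abs_proj w" using quotient_fibre[OF quot Q P0(1)] w(3) by auto
  then have l0P0: "eval_at (line_form w) (\<pi> P0) \<noteq> 0" using line_form_zero_iff[OF w(1)] by blast
  have cf_Var: "coeffs_in k (Var j :: ('a, 2) mpoly)" for j
    using k unfolding Var_def by (intro coeffs_in_single) (auto simp: subring_set_def)
  have cf0: "coeffs_in k (line_form w)"
    unfolding line_form_def by (intro coeffs_in_diff coeffs_in_mult coeffs_in_single cf_Var k w(2))
  have cf1: "coeffs_in k (coord_form w)" unfolding coord_form_def using cf_Var by simp
  obtain e g h where gh: "homogeneous e g" "homogeneous e h" "eval_at h P0 \<noteq> 0"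
    "coeffs_in k (coord_form w) \<Longrightarrow> coeffs_in k g" "coeffs_in k (line_form w) \<Longrightarrow> coeffs_in k h"
    "\<forall>\<^sub>F R in gen. eval_at (coord_form w) (\<pi> R) / eval_at (line_form w) (\<pi> R) = eval_at g R / eval_at h R"
    by (rule morphism_pullback_forms[OF mor k P0(1) homogeneous_coord_form homogeneous_line_form l0P0]) blast
  have ff: "(g, h) \<in> form_fractions V" unfolding form_fractions_iff using gh(1-3) P0(1) by blast
  have over: "cls g h \<in> function_field_over k V"
    unfolding function_field_over_def using cls_in_carrier[OF ff] in_cls[OF ff] gh(4)[OF cf1] gh(5)[OF cf0] by blast
  have fn: "\<forall>\<^sub>F R in gen. fn (cls g h) R = line_coord w (\<pi> R)"
    using fn_cls[OF ff] gh(6) by eventually_elim (simp add: line_coord_def)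
  have fn': "\<forall>\<^sub>F R in gen. line_coord w (\<pi> R) = fn (cls g h) R" using fn by eventually_elim simp
  have pole: "pole_le P (card {\<sigma>\<in>G. \<sigma> Q = P}) (fn (cls g h))" if P: "P \<in> V" for P
  proof (cases "\<pi> P = abs_proj w")
    case True
    then obtain \<rho> where \<rho>: "\<rho> \<in> G" "P = \<rho> Q" using quotient_fibre[OF quot Q P] w(3) by auto
    show ?thesis
      using pole_le_cong[OF quotient_pole[OF G quot P w(1) True] fn'] stabilizer_card[OF G(1) Q \<rho>] by simp
  next
    case False
    then have "eval_at (line_form w) (\<pi> P) \<noteq> 0" using line_form_zero_iff[OF w(1)] by blast
    from regv_morphism_frac[OF mor k P homogeneous_coord_form homogeneous_line_form this]
    have "regv P (\<lambda>R. line_coord w (\<pi> R)) (line_coord w (\<pi> P))" unfolding line_coord_def .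
    from pole_le_regv[OF P regv_cong[OF this fn']] show ?thesis .
  qed
  show ?thesis by (rule that[OF over fn pole])
qed

end

section \<open>Riemann--Roch spaces and their codes\<close>

context curve_over begin

lemma over_carrier: "f \<in> function_field_over k V \<Longrightarrow> f \<in> carrier FF"
  unfolding function_field_over_def by blast

lemma overE:
  assumes "f \<in> function_field_over k V"
  obtains g h where "(g, h) \<in> f" "(g, h) \<in> form_fractions V" "coeffs_in k g" "coeffs_in k h" "f = cls g h"
proof -
  obtain g h where gh: "(g, h) \<in> f" "coeffs_in k g" "coeffs_in k h"
    using assms unfolding function_field_over_def by auto
  show ?thesis
    using that[OF gh(1) carrier_memD(1)[OF over_carrier[OF assms] gh(1)] gh(2,3) carrier_memD(2)[OF over_carrier[OF assms] gh(1)]] .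
qed

lemma overI: "(g, h) \<in> form_fractions V \<Longrightarrow> coeffs_in k g \<Longrightarrow> coeffs_in k h \<Longrightarrow> cls g h \<in> function_field_over k V"
  unfolding function_field_over_def using cls_in_carrier in_cls by blast

lemma over_add:
  assumes f: "f \<in> function_field_over k V" and f': "f' \<in> function_field_over k V"
  shows "f \<oplus>\<^bsub>FF\<^esub> f' \<in> function_field_over k V"
proof -
  obtain g h where gh: "(g, h) \<in> f" "(g, h) \<in> form_fractions V" "coeffs_in k g" "coeffs_in k h" by (rule overE[OF f])
  obtain g' h' where gh': "(g', h') \<in> f'" "(g', h') \<in> form_fractions V" "coeffs_in k g'" "coeffs_in k h'" by (rule overE[OF f'])
  show ?thesis
    unfolding add_FF[OF over_carrier[OF f] over_carrier[OF f'] gh(1) gh'(1)]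
    using form_fractions_mult[OF gh(2) gh'(2)]
    by (intro overI coeffs_in_add coeffs_in_mult k gh gh') simp
qed

lemma over_mult:
  assumes f: "f \<in> function_field_over k V" and f': "f' \<in> function_field_over k V"
  shows "f \<otimes>\<^bsub>FF\<^esub> f' \<in> function_field_over k V"
proof -
  obtain g h where gh: "(g, h) \<in> f" "(g, h) \<in> form_fractions V" "coeffs_in k g" "coeffs_in k h" by (rule overE[OF f])
  obtain g' h' where gh': "(g', h') \<in> f'" "(g', h') \<in> form_fractions V" "coeffs_in k g'" "coeffs_in k h'" by (rule overE[OF f'])
  show ?thesis
    unfolding mult_FF[OF over_carrier[OF f] over_carrier[OF f'] gh(1) gh'(1)]
    using form_fractions_mult[OF gh(2) gh'(2)]
    by (intro overI coeffs_in_mult k gh gh') simp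
qed

lemma over_const: "c \<in> k \<Longrightarrow> cnst c \<in> function_field_over k V"
  unfolding cnst_def by (intro overI const_form_fraction coeffs_in_single coeffs_in_1 k)

lemma over_aut:
  assumes s: "\<sigma> \<in> carrier Aut" and f: "f \<in> function_field_over k V"
  obtains f' where "f' \<in> function_field_over k V" "\<forall>\<^sub>F R in gen. fn f' R = fn f (\<sigma> R)"
proof -
  obtain g h where gh: "(g, h) \<in> f" "(g, h) \<in> form_fractions V" "coeffs_in k g" "coeffs_in k h" by (rule overE[OF f])
  obtain d Q where d: "homogeneous d g" "homogeneous d h" "Q \<in> V" "eval_at h Q \<noteq> 0"
    using gh(2) unfolding form_fractions_iff by blast
  obtain P where P: "P \<in> V" "Q = \<sigma> P" using d(3) autD(4)[OF s] by blast
  have hP: "eval_at h (\<sigma> P) \<noteq> 0" using d(4) P(2) by simp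
  obtain e g' h' where gh': "homogeneous e g'" "homogeneous e h'" "eval_at h' P \<noteq> 0"
    "coeffs_in k g \<Longrightarrow> coeffs_in k g'" "coeffs_in k h \<Longrightarrow> coeffs_in k h'"
    "\<forall>\<^sub>F R in gen. eval_at g (\<sigma> R) / eval_at h (\<sigma> R) = eval_at g' R / eval_at h' R"
    by (rule morphism_pullback_forms[OF autD(2)[OF s] k P(1) d(1,2) hP]) blast
  have ff: "(g', h') \<in> form_fractions V" unfolding form_fractions_iff using gh'(1-3) P(1) by blast
  have "\<forall>\<^sub>F R in gen. fn (cls g' h') R = fn f (\<sigma> R)"
    using fn_cls[OF ff] gh'(6) eventually_aut[OF s fn_eq[OF over_carrier[OF f] gh(1)]]
    by eventually_elim simp
  then show ?thesis using that[OF overI[OF ff gh'(4)[OF gh(3)] gh'(5)[OF gh(4)]]] by blast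
qed

text \<open>The definition lists the zero function separately, since \<open>ord_at\<close> does not
  specify its order; with \<open>pole_le\<close> it needs no exception.\<close>

lemma riemann_roch_iff:
  assumes D: "\<And>P. Poly_Mapping.lookup D P \<ge> 0"
  shows "f \<in> riemann_roch_space k V D \<longleftrightarrow> f \<in> function_field_over k V \<and>
    (\<forall>P\<in>V. pole_le P (nat (Poly_Mapping.lookup D P)) (fn f))"
proof (cases "f = \<zero>\<^bsub>FF\<^esub>")
  case True
  have "\<zero>\<^bsub>FF\<^esub> \<in> function_field_over k V"
    unfolding zero_FF using k by (intro over_const) (auto simp: subring_set_def)
  moreover have "pole_le P n (fn \<zero>\<^bsub>FF\<^esub>)" if "P \<in> V" for P n
  proof -
    have "\<forall>\<^sub>F R in gen. 0 = fn \<zero>\<^bsub>FF\<^esub> R" using fn_zero by eventually_elim simp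
    from pole_le_regv[OF that regv_cong[OF regv_const this]] show ?thesis .
  qed
  ultimately show ?thesis using True unfolding riemann_roch_space_def by simp
next
  case False
  have "ord_at V P f + Poly_Mapping.lookup D P \<ge> 0 \<longleftrightarrow> pole_le P (nat (Poly_Mapping.lookup D P)) (fn f)"
    if "P \<in> V" "f \<in> function_field_over k V" for P
    using ord_at_ge_iff[OF that(1) smooth[OF that(1)] over_carrier[OF that(2)] False, of "nat (Poly_Mapping.lookup D P)"] D[of P]
    by simp
  then show ?thesis using False unfolding riemann_roch_space_def by auto
qed

end

text \<open>What the Frobenius argument has to supply appears here as assumptions: the points
  \<open>w1\<close>, \<open>w2\<close> with coordinates in \<open>k\<close> and the values in
  \<open>k\<close>. The code can then be studied over any algebraically closed field.\<close>

locale orbit_code = curve_over V k for V :: "('a::alg_closed_field, 'n::finite) proj set" and k :: "'a set" +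
  fixes G1 G2 :: "(('a, 'n) proj \<Rightarrow> ('a, 'n) proj) set" and Q Q' :: "('a, 'n) proj"
    and D :: "('a, 'n) proj \<Rightarrow>\<^sub>0 int" and \<pi>1 \<pi>2 :: "('a, 'n) proj \<Rightarrow> ('a, 2) proj" and w1 w2 :: "'a^2"
    and H S
  defines "H \<equiv> generate Aut (G1 \<union> G2)"
  defines "S \<equiv> {\<sigma> Q' | \<sigma>. \<sigma> \<in> H}"
  assumes G1: "subgroup G1 Aut" "finite G1" and G2: "subgroup G2 Aut" "finite G2"
    and points: "Q \<in> V" "Q' \<in> V"
    and quot1: "is_quotient_by k V G1 UNIV \<pi>1" and w1: "w1 \<noteq> 0" "\<And>i. w1 $ i \<in> k" "\<pi>1 Q = abs_proj w1"
    and quot2: "is_quotient_by k V G2 UNIV \<pi>2" and w2: "w2 \<noteq> 0" "\<And>i. w2 $ i \<in> k" "\<pi>2 Q = abs_proj w2"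
    and inter: "G1 \<inter> G2 = {\<one>\<^bsub>Aut\<^esub>}"
    and D1: "\<And>P. Poly_Mapping.lookup D P = int (card {\<sigma>\<in>G1. \<sigma> Q = P})"
    and D2: "\<And>P. Poly_Mapping.lookup D P = int (card {\<sigma>\<in>G2. \<sigma> Q = P})"
    and Q'D: "Poly_Mapping.lookup D Q' = 0"
    and card_S: "card S \<ge> card G1 + 1"
    and values_in: "\<And>f R c. f \<in> function_field_over k V \<Longrightarrow> R \<in> S \<Longrightarrow> regv R (fn f) c \<Longrightarrow> c \<in> k"
begin

abbreviation L where "L \<equiv> riemann_roch_space k V D"

lemma GA: "\<sigma> \<in> G1 \<union> G2 \<Longrightarrow> \<sigma> \<in> carrier Aut"
  using subgroup.subset[OF G1(1)] subgroup.subset[OF G2(1)] by auto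

lemma subgroup_H: "subgroup H Aut"
  unfolding H_def by (rule Aut.generate_is_subgroup) (use GA in blast)

lemma HA: "\<sigma> \<in> H \<Longrightarrow> \<sigma> \<in> carrier Aut"
  by (rule subgroup.mem_carrier[OF subgroup_H])

text \<open>Left translation by \<sigma> maps the elements sending Q to P onto those sending Q to
  \<sigma> P.\<close>

lemma orbit_count_invariant:
  assumes G: "subgroup G Aut" and s: "\<sigma> \<in> G" and P: "P \<in> V"
  shows "card {\<rho>\<in>G. \<rho> Q = \<sigma> P} = card {\<rho>\<in>G. \<rho> Q = P}"
proof -
  have A: "\<sigma> \<in> carrier Aut" if "\<sigma> \<in> G" for \<sigma> by (rule subgroup.mem_carrier[OF G that])
  have si: "inv\<^bsub>Aut\<^esub> \<sigma> \<in> G" using G s by (rule subgroup.m_inv_closed)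
  have "bij_betw (\<lambda>\<rho>. \<sigma> \<otimes>\<^bsub>Aut\<^esub> \<rho>) {\<rho>\<in>G. \<rho> Q = P} {\<rho>\<in>G. \<rho> Q = \<sigma> P}"
  proof (rule bij_betw_byWitness[where f' = "\<lambda>\<rho>. inv\<^bsub>Aut\<^esub> \<sigma> \<otimes>\<^bsub>Aut\<^esub> \<rho>"])
    show "\<forall>\<rho>\<in>{\<rho>\<in>G. \<rho> Q = P}. inv\<^bsub>Aut\<^esub> \<sigma> \<otimes>\<^bsub>Aut\<^esub> (\<sigma> \<otimes>\<^bsub>Aut\<^esub> \<rho>) = \<rho>"
      using A s by (auto simp: Aut.m_assoc[symmetric])
    show "\<forall>\<rho>\<in>{\<rho>\<in>G. \<rho> Q = \<sigma> P}. \<sigma> \<otimes>\<^bsub>Aut\<^esub> (inv\<^bsub>Aut\<^esub> \<sigma> \<otimes>\<^bsub>Aut\<^esub> \<rho>) = \<rho>"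
      using A s by (auto simp: Aut.m_assoc[symmetric])
    show "(\<lambda>\<rho>. \<sigma> \<otimes>\<^bsub>Aut\<^esub> \<rho>) ` {\<rho>\<in>G. \<rho> Q = P} \<subseteq> {\<rho>\<in>G. \<rho> Q = \<sigma> P}"
      using A s G points(1) by (auto simp: aut_mult intro: subgroup.m_closed)
    show "(\<lambda>\<rho>. inv\<^bsub>Aut\<^esub> \<sigma> \<otimes>\<^bsub>Aut\<^esub> \<rho>) ` {\<rho>\<in>G. \<rho> Q = \<sigma> P} \<subseteq> {\<rho>\<in>G. \<rho> Q = P}"
      using A si G points(1) aut_inv(1)[OF A[OF s] P] by (auto simp: aut_mult intro: subgroup.m_closed)
  qed
  then show ?thesis by (rule bij_betw_same_card[symmetric])
qed

text \<open>Each generator preserves D through the description of D as the orbit sum of its own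
  group.\<close>

lemma D_invariant:
  assumes s: "\<sigma> \<in> H" and P: "P \<in> V"
  shows "Poly_Mapping.lookup D (\<sigma> P) = Poly_Mapping.lookup D P"
proof -
  have gen: "Poly_Mapping.lookup D (h P) = Poly_Mapping.lookup D P" if h: "h \<in> G1 \<union> G2" and P: "P \<in> V" for h P
  proof (cases "h \<in> G1")
    case True
    show ?thesis unfolding D1 orbit_count_invariant[OF G1(1) True P] ..
  next
    case False
    then have "h \<in> G2" using h by blast
    show ?thesis unfolding D2 orbit_count_invariant[OF G2(1) \<open>h \<in> G2\<close> P] ..
  qed
  from s[unfolded H_def] P show ?thesis
  proof (induction arbitrary: P rule: generate.induct)
    case one
    then show ?case by (simp add: aut_one)
  next
    case (incl h)
    then show ?case by (rule gen)
  next
    case (inv h)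
    have hA: "h \<in> carrier Aut" by (rule GA[OF inv.hyps])
    have "(inv\<^bsub>Aut\<^esub> h) P \<in> V" by (rule aut_in[OF Aut.inv_closed[OF hA] inv.prems])
    from gen[OF inv.hyps this] show ?case unfolding aut_inv(2)[OF hA inv.prems] by simp
  next
    case (eng h1 h2)
    have A: "h1 \<in> carrier Aut" "h2 \<in> carrier Aut"
      by (rule HA[unfolded H_def, OF eng.hyps(1)], rule HA[unfolded H_def, OF eng.hyps(2)])
    show ?case unfolding aut_mult[OF A eng.prems]
      using eng.IH(1)[OF aut_in[OF A(2) eng.prems]] eng.IH(2)[OF eng.prems] by simp
  qed
qed

lemma D_nonneg: "Poly_Mapping.lookup D P \<ge> 0"
  by (simp add: D1)

section \<open>The vector space L(D) and its values on S\<close>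

lemmas L_iff = riemann_roch_iff[OF D_nonneg]

lemma L_carrier: "f \<in> L \<Longrightarrow> f \<in> carrier FF"
  using L_iff over_carrier by blast

lemma S_V: "R \<in> S \<Longrightarrow> R \<in> V"
  unfolding S_def using aut_in[OF HA points(2)] by blast

lemma S_aut: "\<sigma> \<in> H \<Longrightarrow> R \<in> S \<Longrightarrow> \<sigma> R \<in> S"
proof -
  assume s: "\<sigma> \<in> H" and "R \<in> S"
  then obtain \<tau> where t: "\<tau> \<in> H" "R = \<tau> Q'" unfolding S_def by blast
  have "\<sigma> R = (\<sigma> \<otimes>\<^bsub>Aut\<^esub> \<tau>) Q'" using aut_mult[OF HA[OF s] HA[OF t(1)] points(2)] t(2) by simp
  moreover have "\<sigma> \<otimes>\<^bsub>Aut\<^esub> \<tau> \<in> H" using subgroup_H s t(1) by (rule subgroup.m_closed)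
  ultimately show "\<sigma> R \<in> S" unfolding S_def by blast
qed

lemma finite_S: "finite S"
  using card_S by (metis One_nat_def add_is_0 card.infinite le_zero_eq nat.distinct(1))

lemma S_nonempty: "S \<noteq> {}"
  using card_S by auto

text \<open>D vanishes at Q' and is invariant, hence vanishes on the whole orbit S; no function in
  L(D) has a pole there.\<close>

lemma L_regv:
  assumes f: "f \<in> L" and R: "R \<in> S"
  shows "regv R (fn f) (ratfun_value f R)"
proof -
  have RV: "R \<in> V" by (rule S_V[OF R])
  obtain \<sigma> where s: "\<sigma> \<in> H" "R = \<sigma> Q'" using R unfolding S_def by blast
  have "Poly_Mapping.lookup D R = 0" using D_invariant[OF s(1) points(2)] s(2) Q'D by simp
  moreover have "pole_le R (nat (Poly_Mapping.lookup D R)) (fn f)" using f RV L_iff by blast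
  ultimately have "pole_le R 0 (fn f)" by simp
  then obtain c where c: "regv R (fn f) c" using pole_le_0[OF RV] by blast
  then show ?thesis using ratfun_value_eq[OF RV L_carrier[OF f] c] by simp
qed

lemma L_value: "f \<in> L \<Longrightarrow> R \<in> S \<Longrightarrow> regv R (fn f) c \<Longrightarrow> ratfun_value f R = c"
  using ratfun_value_eq[OF S_V L_carrier] by blast

lemma L_add:
  assumes f: "f \<in> L" and g: "g \<in> L"
  shows "f \<oplus>\<^bsub>FF\<^esub> g \<in> L"
    and "R \<in> S \<Longrightarrow> ratfun_value (f \<oplus>\<^bsub>FF\<^esub> g) R = ratfun_value f R + ratfun_value g R"
proof -
  have ev: "\<forall>\<^sub>F R in gen. fn f R + fn g R = fn (f \<oplus>\<^bsub>FF\<^esub> g) R"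
    using fn_add[OF L_carrier[OF f] L_carrier[OF g]] by eventually_elim simp
  have fg: "f \<in> function_field_over k V" "g \<in> function_field_over k V"
    "\<And>P. P \<in> V \<Longrightarrow> pole_le P (nat (Poly_Mapping.lookup D P)) (fn f)"
    "\<And>P. P \<in> V \<Longrightarrow> pole_le P (nat (Poly_Mapping.lookup D P)) (fn g)"
    using f g L_iff by blast+
  show 1: "f \<oplus>\<^bsub>FF\<^esub> g \<in> L"
    unfolding L_iff using over_add[OF fg(1,2)] pole_le_cong[OF pole_le_add[OF _ fg(3,4)] ev] by blast
  assume R: "R \<in> S"
  show "ratfun_value (f \<oplus>\<^bsub>FF\<^esub> g) R = ratfun_value f R + ratfun_value g R"
    by (rule L_value[OF 1 R regv_cong[OF regv_add[OF S_V[OF R] L_regv[OF f R] L_regv[OF g R]] ev]])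
qed

lemma L_scale:
  assumes f: "f \<in> L" and c: "c \<in> k"
  shows "cnst c \<otimes>\<^bsub>FF\<^esub> f \<in> L"
    and "R \<in> S \<Longrightarrow> ratfun_value (cnst c \<otimes>\<^bsub>FF\<^esub> f) R = c * ratfun_value f R"
proof -
  have ev: "\<forall>\<^sub>F R in gen. c * fn f R = fn (cnst c \<otimes>\<^bsub>FF\<^esub> f) R"
    using fn_mult[OF cnst_carrier[of c] L_carrier[OF f]] fn_cnst[of c] by eventually_elim simp
  have ff: "f \<in> function_field_over k V"
    "\<And>P. P \<in> V \<Longrightarrow> pole_le P (nat (Poly_Mapping.lookup D P)) (fn f)" using f L_iff by blast+
  show 1: "cnst c \<otimes>\<^bsub>FF\<^esub> f \<in> L"
    unfolding L_iff using over_mult[OF over_const[OF c] ff(1)] pole_le_cong[OF pole_le_cmult[OF _ ff(2)] ev] by blast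
  assume R: "R \<in> S"
  show "ratfun_value (cnst c \<otimes>\<^bsub>FF\<^esub> f) R = c * ratfun_value f R"
    by (rule L_value[OF 1 R regv_cong[OF regv_mult[OF S_V[OF R] regv_const L_regv[OF f R]] ev]])
qed

lemma L_const:
  assumes c: "c \<in> k"
  shows "cnst c \<in> L" and "R \<in> S \<Longrightarrow> ratfun_value (cnst c) R = c"
proof -
  have ev: "\<forall>\<^sub>F R in gen. c = fn (cnst c) R" using fn_cnst[of c] by eventually_elim simp
  have reg: "regv P (fn (cnst c)) c" for P by (rule regv_cong[OF regv_const ev])
  show 1: "cnst c \<in> L" unfolding L_iff using over_const[OF c] pole_le_regv[OF _ reg] by blast
  assume R: "R \<in> S"
  show "ratfun_value (cnst c) R = c" by (rule L_value[OF 1 R reg])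
qed

lemma L_aut:
  assumes s: "\<sigma> \<in> H" and f: "f \<in> L"
  obtains f' where "f' \<in> L" "\<forall>\<^sub>F R in gen. fn f' R = fn f (\<sigma> R)"
    "\<And>R. R \<in> S \<Longrightarrow> ratfun_value f' R = ratfun_value f (\<sigma> R)"
proof -
  have sA: "\<sigma> \<in> carrier Aut" by (rule HA[OF s])
  have ff: "f \<in> function_field_over k V"
    "\<And>P. P \<in> V \<Longrightarrow> pole_le P (nat (Poly_Mapping.lookup D P)) (fn f)" using f L_iff by blast+
  obtain f' where f': "f' \<in> function_field_over k V" "\<forall>\<^sub>F R in gen. fn f' R = fn f (\<sigma> R)"
    by (rule over_aut[OF sA ff(1)])
  have ev: "\<forall>\<^sub>F R in gen. fn f (\<sigma> R) = fn f' R" using f'(2) by eventually_elim simp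
  have "pole_le P (nat (Poly_Mapping.lookup D P)) (fn f')" if P: "P \<in> V" for P
  proof -
    have "pole_le (\<sigma> P) (nat (Poly_Mapping.lookup D P)) (fn f)"
      using ff(2)[OF aut_in[OF sA P]] D_invariant[OF s P] by simp
    from pole_le_cong[OF pole_le_aut[OF sA P this] ev] show ?thesis .
  qed
  then have f'L: "f' \<in> L" unfolding L_iff using f'(1) by blast
  have "ratfun_value f' R = ratfun_value f (\<sigma> R)" if R: "R \<in> S" for R
    by (rule L_value[OF f'L R regv_cong[OF regv_aut[OF sA S_V[OF R] L_regv[OF f S_aut[OF s R]]] ev]])
  with f'L f'(2) show ?thesis by (rule that)
qed

section \<open>Zeros, injectivity and minimum distance\<close>

lemma degree_D: "(\<Sum>P | nat (Poly_Mapping.lookup D P) \<noteq> 0. nat (Poly_Mapping.lookup D P)) = card G1"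
  and D_support: "finite {P. nat (Poly_Mapping.lookup D P) \<noteq> 0}" "{P. nat (Poly_Mapping.lookup D P) \<noteq> 0} \<subseteq> V"
proof -
  have supp: "{P. nat (Poly_Mapping.lookup D P) \<noteq> 0} = (\<lambda>\<sigma>. \<sigma> Q) ` G1"
    using G1(2) by (auto simp: D1 card_eq_0_iff)
  then show "finite {P. nat (Poly_Mapping.lookup D P) \<noteq> 0}" "{P. nat (Poly_Mapping.lookup D P) \<noteq> 0} \<subseteq> V"
    using G1(2) aut_in[OF GA points(1)] by auto
  have "(\<Sum>P\<in>(\<lambda>\<sigma>. \<sigma> Q) ` G1. nat (Poly_Mapping.lookup D P)) = (\<Sum>P\<in>(\<lambda>\<sigma>. \<sigma> Q) ` G1. \<Sum>\<sigma>\<in>{\<sigma>\<in>G1. \<sigma> Q = P}. 1)"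
    by (simp add: D1)
  also have "\<dots> = (\<Sum>\<sigma>\<in>G1. 1)"
    using sum.image_gen[OF G1(2), of "\<lambda>_. 1::nat" "\<lambda>\<sigma>. \<sigma> Q"] by simp
  finally show "(\<Sum>P | nat (Poly_Mapping.lookup D P) \<noteq> 0. nat (Poly_Mapping.lookup D P)) = card G1"
    unfolding supp by simp
qed

lemma zeros_le:
  assumes f: "f \<in> L" "f \<noteq> \<zero>\<^bsub>FF\<^esub>"
  shows "card {R\<in>S. ratfun_value f R = 0} \<le> card G1"
proof (rule zeros_le_degree[OF quotient_regular_constant[OF G1 quot1] D_support degree_D])
  show "rat (fn f)" by (rule fn_rat[OF L_carrier[OF f(1)]])
  show "pole_le P (nat (Poly_Mapping.lookup D P)) (fn f)" if "P \<in> V" for P using f(1) that L_iff by blast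
  show "\<not> (\<forall>\<^sub>F R in gen. fn f R = 0)" using fn_zero_iff[OF L_carrier[OF f(1)]] f(2) by blast
  show "finite {R\<in>S. ratfun_value f R = 0}" using finite_S by simp
  show "{R\<in>S. ratfun_value f R = 0} \<subseteq> V" using S_V by blast
  show "regv P (fn f) 0" if "P \<in> {R\<in>S. ratfun_value f R = 0}" for P
    using L_regv[OF f(1), of P] that by simp
qed

lemma minus_one: "- 1 \<in> k"
  using k by (simp add: subring_set_def)

text \<open>The difference vanishes on all of S, which has more points than the degree of D allows
  for a nonzero function.\<close>

lemma L_eqI:
  assumes f: "f \<in> L" and g: "g \<in> L" and eq: "\<And>R. R \<in> S \<Longrightarrow> ratfun_value f R = ratfun_value g R"
  shows "f = g"
proof -
  define h where "h = f \<oplus>\<^bsub>FF\<^esub> (cnst (- 1) \<otimes>\<^bsub>FF\<^esub> g)"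
  have g': "cnst (- 1) \<otimes>\<^bsub>FF\<^esub> g \<in> L" by (rule L_scale(1)[OF g minus_one])
  have h: "h \<in> L" unfolding h_def by (rule L_add(1)[OF f g'])
  have "ratfun_value h R = 0" if "R \<in> S" for R
    unfolding h_def L_add(2)[OF f g' that] L_scale(2)[OF g minus_one that] eq[OF that] by simp
  then have "{R\<in>S. ratfun_value h R = 0} = S" by blast
  then have h0: "h = \<zero>\<^bsub>FF\<^esub>" using zeros_le[OF h] card_S by fastforce
  show ?thesis
  proof (rule fn_inj[OF L_carrier[OF f] L_carrier[OF g]])
    have "\<forall>\<^sub>F R in gen. fn h R = 0" using h0 fn_zero by simp
    then show "\<forall>\<^sub>F R in gen. fn f R = fn g R"
      using fn_add[OF L_carrier[OF f] L_carrier[OF g'], folded h_def]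
        fn_mult[OF cnst_carrier[of "- 1"] L_carrier[OF g]] fn_cnst[of "- 1"]
      by eventually_elim simp
  qed
qed

lemma evaluation_inj: "inj_on (evaluation_map S) L"
proof (rule inj_onI)
  fix f g assume f: "f \<in> L" and g: "g \<in> L" and eq: "evaluation_map S f = evaluation_map S g"
  show "f = g"
  proof (rule L_eqI[OF f g])
    fix R assume "R \<in> S"
    then show "ratfun_value f R = ratfun_value g R"
      using fun_cong[OF eq, of R] by (simp add: evaluation_map_def)
  qed
qed

lemma linear_code_evaluation: "linear_code k S (evaluation_map S ` L)"
  unfolding linear_code_def
proof (intro conjI ballI)
  show "evaluation_map S ` L \<subseteq> S \<rightarrow>\<^sub>E k"
  proof
    fix c assume "c \<in> evaluation_map S ` L"
    then obtain f where f: "f \<in> L" "c = evaluation_map S f" by blast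
    have "f \<in> function_field_over k V" using f(1) L_iff by blast
    then have "ratfun_value f R \<in> k" if "R \<in> S" for R
      using values_in[OF _ that L_regv[OF f(1) that]] by blast
    then show "c \<in> S \<rightarrow>\<^sub>E k" unfolding f(2) evaluation_map_def by auto
  qed
  have zero: "0 \<in> k" using k by (simp add: subring_set_def)
  have "evaluation_map S (cnst 0) = (\<lambda>R\<in>S. 0)"
    unfolding evaluation_map_def by (rule restrict_ext) (rule L_const(2)[OF zero])
  then show "(\<lambda>R\<in>S. 0) \<in> evaluation_map S ` L" by (rule image_eqI[OF sym L_const(1)[OF zero]])
next
  fix c c' assume "c \<in> evaluation_map S ` L" "c' \<in> evaluation_map S ` L"
  then obtain f g where fg: "f \<in> L" "g \<in> L" "c = evaluation_map S f" "c' = evaluation_map S g" by blast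
  have "evaluation_map S (f \<oplus>\<^bsub>FF\<^esub> g) = (\<lambda>R\<in>S. c R + c' R)"
  proof
    fix R
    show "evaluation_map S (f \<oplus>\<^bsub>FF\<^esub> g) R = (\<lambda>R\<in>S. c R + c' R) R"
    proof (cases "R \<in> S")
      case True
      then show ?thesis using L_add(2)[OF fg(1,2) True]
        by (simp only: evaluation_map_def fg(3,4) restrict_apply' True)
    next
      case False
      then show ?thesis by (simp add: evaluation_map_def)
    qed
  qed
  then show "(\<lambda>R\<in>S. c R + c' R) \<in> evaluation_map S ` L" by (rule image_eqI[OF sym L_add(1)[OF fg(1,2)]])
next
  fix a c assume a: "a \<in> k" and "c \<in> evaluation_map S ` L"
  then obtain f where f: "f \<in> L" "c = evaluation_map S f" by blast
  have "evaluation_map S (cnst a \<otimes>\<^bsub>FF\<^esub> f) = (\<lambda>R\<in>S. a * c R)"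
    unfolding evaluation_map_def f(2) by (rule restrict_ext) (simp add: L_scale(2)[OF f(1) a])
  then show "(\<lambda>R\<in>S. a * c R) \<in> evaluation_map S ` L" by (rule image_eqI[OF sym L_scale(1)[OF f(1) a]])
qed

lemma min_distance_evaluation: "min_distance S (evaluation_map S ` L) \<ge> card S - card G1"
proof -
  let ?C = "evaluation_map S ` L"
  let ?P = "\<lambda>d. \<exists>c\<in>?C. c \<noteq> (\<lambda>R\<in>S. 0) \<and> d = card {R\<in>S. c R \<noteq> 0}"
  \<comment> \<open>The \<open>LEAST\<close> in \<open>min_distance\<close> says something only if a
    nonzero word exists; the constant function 1 provides one.\<close>
  have one: "1 \<in> k" using k by (simp add: subring_set_def)
  obtain R0 where R0: "R0 \<in> S" using S_nonempty by blast
  have "evaluation_map S (cnst 1) R0 = 1" using L_const(2)[OF one R0] R0 by (simp add: evaluation_map_def)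
  then have "evaluation_map S (cnst 1) \<noteq> (\<lambda>R\<in>S. 0)" using R0 by auto
  then have "?P (card {R\<in>S. evaluation_map S (cnst 1) R \<noteq> 0})" using L_const(1)[OF one] by blast
  then have "?P (LEAST d. ?P d)" by (rule LeastI[of ?P])
  then obtain c where c: "c \<in> ?C" "c \<noteq> (\<lambda>R\<in>S. 0)" "(LEAST d. ?P d) = card {R\<in>S. c R \<noteq> 0}" by blast
  obtain f where f: "f \<in> L" "c = evaluation_map S f" using c(1) by blast
  have zero: "0 \<in> k" using k by (simp add: subring_set_def)
  have "f \<noteq> \<zero>\<^bsub>FF\<^esub>"
  proof
    assume "f = \<zero>\<^bsub>FF\<^esub>"
    then have "c = (\<lambda>R\<in>S. 0)"
      unfolding f(2) zero_FF evaluation_map_def by (simp add: L_const(2)[OF zero] cong: restrict_cong)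
    then show False using c(2) by blast
  qed
  then have z: "card {R\<in>S. ratfun_value f R = 0} \<le> card G1" by (rule zeros_le[OF f(1)])
  have "{R\<in>S. c R \<noteq> 0} = S - {R\<in>S. ratfun_value f R = 0}"
    unfolding f(2) by (auto simp: evaluation_map_def)
  then have "card {R\<in>S. c R \<noteq> 0} = card S - card {R\<in>S. ratfun_value f R = 0}"
    using finite_S by (simp add: card_Diff_subset)
  then show ?thesis using z c(3) unfolding min_distance_def by simp
qed

section \<open>The action of \<open>H\<close> on the code\<close>

lemma restrict_bij: "\<sigma> \<in> H \<Longrightarrow> restrict \<sigma> S \<in> Bij S"
proof -
  assume s: "\<sigma> \<in> H"
  have si: "inv\<^bsub>Aut\<^esub> \<sigma> \<in> H" using subgroup_H s by (rule subgroup.m_inv_closed)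
  have "bij_betw \<sigma> S S"
    by (rule bij_betw_byWitness[where f' = "inv\<^bsub>Aut\<^esub> \<sigma>"])
      (use S_aut[OF s] S_aut[OF si] aut_inv[OF HA[OF s]] S_V in auto)
  then have "bij_betw (restrict \<sigma> S) S S" by (subst bij_betw_cong[where g = \<sigma>]) auto
  then show ?thesis by (simp add: Bij_def)
qed

lemma inv_restrict: "\<sigma> \<in> H \<Longrightarrow> R \<in> S \<Longrightarrow> inv_into S (restrict \<sigma> S) R = (inv\<^bsub>Aut\<^esub> \<sigma>) R"
proof -
  assume s: "\<sigma> \<in> H" and R: "R \<in> S"
  have si: "inv\<^bsub>Aut\<^esub> \<sigma> \<in> H" using subgroup_H s by (rule subgroup.m_inv_closed)
  have "inj_on (restrict \<sigma> S) S" using restrict_bij[OF s] by (simp add: Bij_def bij_betw_def)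
  then show ?thesis
    using S_aut[OF si R] aut_inv(2)[OF HA[OF s] S_V[OF R]] by (intro inv_into_f_eq) simp_all
qed

text \<open>\<open>permute_word\<close> moves the entry at R to \<sigma> R, so on functions \<sigma>
  acts by composition with its inverse.\<close>

lemma permute_evaluation:
  assumes s: "\<sigma> \<in> H" and f: "f \<in> L" and f': "f' \<in> L"
    and val: "\<And>R. R \<in> S \<Longrightarrow> ratfun_value f' R = ratfun_value f ((inv\<^bsub>Aut\<^esub> \<sigma>) R)"
  shows "permute_word S (restrict \<sigma> S) (evaluation_map S f) = evaluation_map S f'"
proof -
  have si: "inv\<^bsub>Aut\<^esub> \<sigma> \<in> H" using subgroup_H s by (rule subgroup.m_inv_closed)
  show ?thesis unfolding permute_word_def evaluation_map_def
    by (rule restrict_ext) (simp add: inv_restrict[OF s] S_aut[OF si] val)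
qed

lemma restrict_code_aut:
  assumes s: "\<sigma> \<in> H"
  shows "permute_word S (restrict \<sigma> S) ` (evaluation_map S ` L) = evaluation_map S ` L"
proof (intro equalityI subsetI)
  have si: "inv\<^bsub>Aut\<^esub> \<sigma> \<in> H" using subgroup_H s by (rule subgroup.m_inv_closed)
  {
    fix c assume "c \<in> permute_word S (restrict \<sigma> S) ` (evaluation_map S ` L)"
    then obtain f where f: "f \<in> L" "c = permute_word S (restrict \<sigma> S) (evaluation_map S f)" by blast
    obtain f' where f': "f' \<in> L" "\<And>R. R \<in> S \<Longrightarrow> ratfun_value f' R = ratfun_value f ((inv\<^bsub>Aut\<^esub> \<sigma>) R)"
      by (rule L_aut[OF si f(1)]) blast
    have "c = evaluation_map S f'"
      unfolding f(2) by (rule permute_evaluation[OF s f(1) f'(1)]) (rule f'(2))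
    then show "c \<in> evaluation_map S ` L" using f'(1) by blast
  next
    fix c assume "c \<in> evaluation_map S ` L"
    then obtain f where f: "f \<in> L" "c = evaluation_map S f" by blast
    obtain f' where f': "f' \<in> L" "\<And>R. R \<in> S \<Longrightarrow> ratfun_value f' R = ratfun_value f (\<sigma> R)"
      by (rule L_aut[OF s f(1)]) blast
    have val: "ratfun_value f R = ratfun_value f' ((inv\<^bsub>Aut\<^esub> \<sigma>) R)" if R: "R \<in> S" for R
      using f'(2)[OF S_aut[OF si R]] aut_inv(2)[OF HA[OF s] S_V[OF R]] by simp
    have "c = permute_word S (restrict \<sigma> S) (evaluation_map S f')"
      unfolding f(2) by (rule permute_evaluation[OF s f'(1) f(1), symmetric]) (rule val)
    then show "c \<in> permute_word S (restrict \<sigma> S) ` (evaluation_map S ` L)"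
      using f'(1) by blast
  }
qed

lemma restrict_hom:
  "(\<lambda>\<sigma>. restrict \<sigma> S) \<in> hom (Aut\<lparr>carrier := H\<rparr>) (code_aut_group S (evaluation_map S ` L))"
proof (rule homI)
  fix \<sigma> assume "\<sigma> \<in> carrier (Aut\<lparr>carrier := H\<rparr>)"
  then have s: "\<sigma> \<in> H" by simp
  show "restrict \<sigma> S \<in> carrier (code_aut_group S (evaluation_map S ` L))"
    using restrict_bij[OF s] restrict_code_aut[OF s] by (simp add: code_aut_group_def)
  fix \<tau> assume "\<tau> \<in> carrier (Aut\<lparr>carrier := H\<rparr>)"
  then have t: "\<tau> \<in> H" by simp
  have "restrict \<sigma> S \<otimes>\<^bsub>code_aut_group S (evaluation_map S ` L)\<^esub> restrict \<tau> S = compose S (restrict \<sigma> S) (restrict \<tau> S)"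
    using restrict_bij[OF s] restrict_bij[OF t] by (simp add: code_aut_group_def BijGroup_def)
  also have "\<dots> = restrict (\<sigma> \<otimes>\<^bsub>Aut\<^esub> \<tau>) S"
    unfolding compose_def by (rule restrict_ext) (simp add: S_aut[OF t] aut_mult[OF HA[OF s] HA[OF t] S_V])
  finally show "restrict (\<sigma> \<otimes>\<^bsub>Aut\<lparr>carrier := H\<rparr>\<^esub> \<tau>) S =
      restrict \<sigma> S \<otimes>\<^bsub>code_aut_group S (evaluation_map S ` L)\<^esub> restrict \<tau> S" by simp
qed

lemma coset_of_agreeing:
  fixes \<pi> :: "('a, 'n) proj \<Rightarrow> ('a, 2) proj"
  assumes s: "\<sigma> \<in> H" and t: "\<tau> \<in> H" and agree: "\<And>R. R \<in> S \<Longrightarrow> \<sigma> R = \<tau> R"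
    and G: "subgroup G Aut" "finite G" and quot: "is_quotient_by k V G UNIV \<pi>"
    and w: "w \<noteq> 0" "\<And>i. w $ i \<in> k" "\<pi> Q = abs_proj w"
    and DG: "\<And>P. Poly_Mapping.lookup D P = int (card {\<sigma>\<in>G. \<sigma> Q = P})"
  shows "\<sigma> \<otimes>\<^bsub>Aut\<^esub> inv\<^bsub>Aut\<^esub> \<tau> \<in> G"
proof -
  have sA: "\<sigma> \<in> carrier Aut" and tA: "\<tau> \<in> carrier Aut" using HA s t by blast+
  obtain f where f: "f \<in> function_field_over k V" "\<forall>\<^sub>F R in gen. fn f R = line_coord w (\<pi> R)"
    "\<And>P. P \<in> V \<Longrightarrow> pole_le P (card {\<sigma>\<in>G. \<sigma> Q = P}) (fn f)"
    by (rule quotient_coordinate[OF G quot points(1) w]) blast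
  have fL: "f \<in> L" unfolding L_iff using f(1,3) DG by simp
  obtain f1 where f1: "f1 \<in> L" "\<forall>\<^sub>F R in gen. fn f1 R = fn f (\<sigma> R)"
    "\<And>R. R \<in> S \<Longrightarrow> ratfun_value f1 R = ratfun_value f (\<sigma> R)" by (rule L_aut[OF s fL]) blast
  obtain f2 where f2: "f2 \<in> L" "\<forall>\<^sub>F R in gen. fn f2 R = fn f (\<tau> R)"
    "\<And>R. R \<in> S \<Longrightarrow> ratfun_value f2 R = ratfun_value f (\<tau> R)" by (rule L_aut[OF t fL]) blast
  have "f1 = f2" by (rule L_eqI[OF f1(1) f2(1)]) (simp add: f1(3) f2(3) agree)
  then have "\<forall>\<^sub>F R in gen. fn f2 R = fn f (\<sigma> R)" using f1(2) by (simp only:)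
  then have e: "\<forall>\<^sub>F R in gen. fn f (\<sigma> R) = fn f (\<tau> R)"
    using f2(2) by eventually_elim (simp only:)
  \<comment> \<open>The coordinate separates the fibres only away from its pole.\<close>
  have off: "\<forall>\<^sub>F R in gen. \<pi> R \<noteq> abs_proj w"
    using quotient_eventually_avoids[OF quot G(2) points(1)] unfolding w(3) .
  have "\<forall>\<^sub>F R in gen. \<exists>\<rho>\<in>G. \<sigma> R = \<rho> (\<tau> R)"
    using e eventually_aut[OF sA f(2)] eventually_aut[OF tA f(2)] eventually_aut[OF sA off] eventually_aut[OF tA off]
      eventually_gen_in
  proof eventually_elim
    case (elim R)
    have "line_coord w (\<pi> (\<sigma> R)) = line_coord w (\<pi> (\<tau> R))" using elim(1-3) by simp
    then have "\<pi> (\<tau> R) = \<pi> (\<sigma> R)"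
      using inj_onD[OF inj_line_coord[OF w(1)], of "\<pi> (\<sigma> R)" "\<pi> (\<tau> R)"] elim(4,5) by simp
    then show ?case using quotient_fibre[OF quot aut_in[OF tA elim(6)] aut_in[OF sA elim(6)]] by blast
  qed
  then have fin: "finite {R\<in>V. \<not> (\<exists>\<rho>\<in>G. \<sigma> R = \<rho> (\<tau> R))}" unfolding eventually_gen_iff .
  have "\<exists>\<rho>\<in>G. infinite {R\<in>V. \<sigma> R = \<rho> (\<tau> R)}"
  proof (rule ccontr)
    assume "\<not> ?thesis"
    then have "finite (\<Union>\<rho>\<in>G. {R\<in>V. \<sigma> R = \<rho> (\<tau> R)})" using G(2) by blast
    moreover have "V \<subseteq> {R\<in>V. \<not> (\<exists>\<rho>\<in>G. \<sigma> R = \<rho> (\<tau> R))} \<union> (\<Union>\<rho>\<in>G. {R\<in>V. \<sigma> R = \<rho> (\<tau> R)})" by blast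
    ultimately show False using infinite_V finite_subset[OF _ finite_UnI[OF fin]] by blast
  qed
  then obtain \<rho> where \<rho>: "\<rho> \<in> G" "infinite {R\<in>V. \<sigma> R = \<rho> (\<tau> R)}" by blast
  have \<rho>A: "\<rho> \<in> carrier Aut" using G(1) \<rho>(1) by (rule subgroup.mem_carrier)
  have "{R\<in>V. \<sigma> R = (\<rho> \<otimes>\<^bsub>Aut\<^esub> \<tau>) R} = {R\<in>V. \<sigma> R = \<rho> (\<tau> R)}"
    using aut_mult[OF \<rho>A tA] by auto
  then have "\<sigma> = \<rho> \<otimes>\<^bsub>Aut\<^esub> \<tau>"
    using aut_eq_if_agree[OF sA Aut.m_closed[OF \<rho>A tA]] \<rho>(2) by simp
  then have "\<sigma> \<otimes>\<^bsub>Aut\<^esub> inv\<^bsub>Aut\<^esub> \<tau> = \<rho>" using \<rho>A tA by (simp add: Aut.m_assoc)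
  then show ?thesis using \<rho>(1) by simp
qed

lemma restrict_inj: "inj_on (\<lambda>\<sigma>. restrict \<sigma> S) H"
proof (rule inj_onI)
  fix \<sigma> \<tau> assume s: "\<sigma> \<in> H" and t: "\<tau> \<in> H" and eq: "restrict \<sigma> S = restrict \<tau> S"
  have agree: "\<sigma> R = \<tau> R" if "R \<in> S" for R using fun_cong[OF eq, of R] that by simp
  have "\<sigma> \<otimes>\<^bsub>Aut\<^esub> inv\<^bsub>Aut\<^esub> \<tau> \<in> G1" by (rule coset_of_agreeing[OF s t agree G1 quot1 w1 D1])
  moreover have "\<sigma> \<otimes>\<^bsub>Aut\<^esub> inv\<^bsub>Aut\<^esub> \<tau> \<in> G2" by (rule coset_of_agreeing[OF s t agree G2 quot2 w2 D2])
  ultimately have "\<sigma> \<otimes>\<^bsub>Aut\<^esub> inv\<^bsub>Aut\<^esub> \<tau> = \<one>\<^bsub>Aut\<^esub>" using inter by blast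
  then have "\<sigma> = inv\<^bsub>Aut\<^esub> (inv\<^bsub>Aut\<^esub> \<tau>)"
    using Aut.inv_equality[of \<sigma> "inv\<^bsub>Aut\<^esub> \<tau>"] HA[OF s] HA[OF t] by simp
  then show "\<sigma> = \<tau>" using HA[OF t] by simp
qed

end

section \<open>The Frobenius automorphism\<close>

text \<open>Multiplication by x permutes the nonzero elements and leaves their product unchanged, so
  x^(q-1) = 1.\<close>

lemma finite_field_power_card:
  fixes x :: "'k::{field,finite}"
  shows "x ^ CARD('k) = x"
proof (cases "x = 0")
  case True
  then show ?thesis by simp
next
  case False
  let ?U = "UNIV - {0 :: 'k}"
  have "bij_betw (\<lambda>y. x * y) ?U ?U"
    by (rule bij_betw_byWitness[where f' = "\<lambda>y. inverse x * y"]) (use False in auto)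
  then have "(\<Prod>y\<in>?U. x * y) = (\<Prod>y\<in>?U. y)" by (rule prod.reindex_bij_betw)
  then have "x ^ card ?U * (\<Prod>y\<in>?U. y) = 1 * (\<Prod>y\<in>?U. y)" by (simp add: prod.distrib)
  moreover have "(\<Prod>y\<in>?U. y) \<noteq> 0" by (simp add: prod_zero_iff)
  ultimately have "x ^ card ?U = 1" using mult_right_cancel by blast
  moreover have "CARD('k) = Suc (card ?U)"
    by (simp add: card_Diff_singleton card_gt_0_iff)
  ultimately show ?thesis by (simp only: power_Suc mult_1_right)
qed

abbreviation frob :: "'k::{field,finite} alg_closure \<Rightarrow> 'k alg_closure" where
  "frob x \<equiv> x ^ CARD('k)"

lemma card_Fq: "card (Fq :: 'k::{field,finite} alg_closure set) = CARD('k)"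
  by (simp add: card_image inj_to_ac)

lemma card_field_ge_2: "CARD('k::{field,finite}) \<ge> 2"
proof -
  have "card {0, 1 :: 'k} \<le> CARD('k)" by (rule card_mono) auto
  then show ?thesis by simp
qed

lemma frob_Fq: "x \<in> Fq \<Longrightarrow> frob x = x"
  by (auto simp flip: to_ac_power simp: finite_field_power_card)

lemma subring_set_Fq: "subring_set (Fq :: 'k::field alg_closure set)"
  unfolding subring_set_def by (auto simp flip: to_ac_0 to_ac_1 to_ac_add to_ac_mult to_ac_minus)

lemma poly_zero_if_Fq_roots:
  fixes p :: "'k::{field,finite} alg_closure poly"
  assumes "Polynomial.degree p < CARD('k)" "\<And>x. x \<in> Fq \<Longrightarrow> poly p x = 0"
  shows "p = 0"
proof (rule ccontr)
  assume "p \<noteq> 0"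
  then have "card {x. poly p x = 0} \<le> Polynomial.degree p" "finite {x. poly p x = 0}"
    by (rule card_poly_roots_bound, rule poly_roots_finite)
  moreover have "card (Fq :: 'k alg_closure set) \<le> card {x. poly p x = 0}"
    using assms(2) calculation(2) by (intro card_mono) auto
  ultimately show False using assms(1) by (simp add: card_Fq)
qed

text \<open>For \<open>y\<close> in \<open>Fq\<close> the polynomial \<open>(X + y)^q - X^q - y^q\<close> has degree less than \<open>q\<close> and vanishes
  on \<open>Fq\<close>, hence identically; exchanging the roles of \<open>X\<close> and \<open>y\<close> gives the general case.\<close>

lemma frob_add:
  fixes x y :: "'k::{field,finite} alg_closure"
  shows "frob (x + y) = frob x + frob y"
proof -
  let ?q = "CARD('k)"
  define p where "p y = [:y, 1:] ^ ?q - Polynomial.monom 1 ?q - [:frob y:]" for y :: "'k alg_closure"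
  have p: "poly (p y) x = frob (x + y) - frob x - frob y" for x y :: "'k alg_closure"
    by (simp add: p_def poly_monom poly_power add.commute)
  have deg: "Polynomial.degree (p y) < ?q" for y
  proof -
    have "Polynomial.degree (p y) \<le> ?q"
      unfolding p_def by (intro degree_diff_le degree_monom_le) (simp_all add: degree_linear_power)
    \<comment> \<open>The leading terms cancel, and the constant term does not reach degree q
      because q > 0.\<close>
    moreover have "Polynomial.coeff (p y) ?q = 0"
      using card_field_ge_2[where 'k = 'k]
      by (simp add: p_def coeff_linear_power coeff_pCons split: nat.splits)
    ultimately show ?thesis
      using eq_zero_or_degree_less[of "p y" ?q] card_field_ge_2[where 'k = 'k] by auto
  qed
  have "p y = 0" if y: "y \<in> Fq" for y :: "'k alg_closure"
  proof (rule poly_zero_if_Fq_roots[OF deg])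
    fix x :: "'k alg_closure" assume x: "x \<in> Fq"
    then have "x + y \<in> Fq" using y subring_set_Fq unfolding subring_set_def by blast
    then show "poly (p y) x = 0" using x y by (simp add: p frob_Fq)
  qed
  then have 1: "frob (x + y) = frob x + frob y" if "y \<in> Fq" for x y :: "'k alg_closure"
    using p[of y x] that by (simp add: diff_eq_eq add.commute)
  have "p x = 0"
  proof (rule poly_zero_if_Fq_roots[OF deg])
    fix y :: "'k alg_closure" assume "y \<in> Fq"
    from 1[OF this, of x] show "poly (p x) y = 0" by (simp add: p add.commute)
  qed
  then show ?thesis using p[of x y] by (simp add: diff_eq_eq add.commute)
qed

lemma frob_mult: "frob (x * y) = frob x * frob y"
  by (rule power_mult_distrib)

text \<open>X^q - X has at most q roots, and \<open>Fq\<close> already supplies q of them.\<close>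

lemma frob_fixed: "frob x = x \<Longrightarrow> x \<in> Fq"
proof -
  fix x :: "'k::{field,finite} alg_closure"
  assume x: "frob x = x"
  let ?q = "CARD('k)"
  define p :: "'k alg_closure poly" where "p = Polynomial.monom 1 ?q - [:0, 1:]"
  have "Polynomial.degree p \<le> ?q"
    unfolding p_def using card_field_ge_2[where 'k = 'k] by (intro degree_diff_le degree_monom_le) simp
  moreover have "Polynomial.coeff p ?q = 1"
    using card_field_ge_2[where 'k = 'k] by (auto simp: p_def coeff_pCons split: nat.splits)
  ultimately have p: "p \<noteq> 0" "Polynomial.degree p \<le> ?q" by auto
  have "card {x. poly p x = 0} \<le> ?q" "finite {x. poly p x = 0}"
    using card_poly_roots_bound[OF p(1)] p(2) poly_roots_finite[OF p(1)] by auto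
  moreover have "Fq \<subseteq> {x. poly p x = 0}"
  proof
    fix y :: "'k alg_closure" assume "y \<in> Fq"
    then show "y \<in> {x. poly p x = 0}" using frob_Fq[of y] by (simp add: p_def poly_monom)
  qed
  ultimately have "(Fq :: 'k alg_closure set) = {x. poly p x = 0}"
    by (intro card_seteq) (simp_all add: card_Fq)
  moreover have "poly p x = 0" using x by (simp add: p_def poly_monom)
  ultimately show "x \<in> Fq" by blast
qed

lemma frob_inj: "frob x = frob y \<Longrightarrow> x = y"
proof -
  fix x y :: "'k::{field,finite} alg_closure"
  assume "frob x = frob y"
  moreover have "frob (x - y + y) = frob (x - y) + frob y" by (rule frob_add)
  ultimately have "frob (x - y) = 0" by simp
  then show "x = y" using card_field_ge_2[where 'k = 'k] by simp
qed

lemma frob_surj: "\<exists>x. frob x = (y :: 'k::{field,finite} alg_closure)"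
proof -
  let ?p = "Polynomial.monom 1 CARD('k) - [:y:]"
  have "Polynomial.coeff ?p CARD('k) = 1"
    using card_field_ge_2[where 'k = 'k] by (auto simp: coeff_pCons split: nat.splits)
  then have "Polynomial.degree ?p \<ge> CARD('k)" by (intro le_degree) simp
  then have "Polynomial.degree ?p > 0" using card_field_ge_2[where 'k = 'k] by linarith
  then obtain x where "poly ?p x = 0" using alg_closed_imp_poly_has_root by blast
  then show ?thesis by (auto simp: poly_monom)
qed

lemma frob_galois: "(\<lambda>x :: 'k::{field,finite} alg_closure. frob x) \<in> galois_group Fq"
proof -
  have "inj (\<lambda>x :: 'k alg_closure. frob x)" by (rule injI) (rule frob_inj)
  moreover have "surj (\<lambda>x :: 'k alg_closure. frob x)"
    unfolding surj_def
  proof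
    fix y :: "'k alg_closure"
    obtain x where "frob x = y" using frob_surj by blast
    then show "\<exists>x. y = frob x" by (intro exI[of _ x]) (rule sym)
  qed
  ultimately have "bij (\<lambda>x :: 'k alg_closure. frob x)" by (rule bijI)
  then show ?thesis unfolding galois_group_def
    by (intro CollectI conjI allI ballI) (assumption | rule frob_add frob_mult frob_Fq)+
qed

section \<open>Frobenius on points\<close>

abbreviation frob_pt :: "('k::{field,finite} alg_closure, 'n::finite) proj \<Rightarrow> ('k alg_closure, 'n) proj" where
  "frob_pt \<equiv> galois_act (\<lambda>x. frob x)"

definition frob_vec :: "'k::{field,finite} alg_closure^'n \<Rightarrow> 'k alg_closure^'n" where
  "frob_vec v = (\<chi> i. frob (v $ i))"

lemma frob_vec_nonzero: "v \<noteq> 0 \<Longrightarrow> frob_vec v \<noteq> 0"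
  unfolding frob_vec_def by (auto simp: vec_eq_iff)

lemma frob_vec_scale: "frob_vec (c *s v) = frob c *s frob_vec v"
  by (simp add: frob_vec_def vec_eq_iff frob_mult)

lemma frob_pt_rep: "frob_pt P = abs_proj (frob_vec (rep_proj P))"
  by (simp add: galois_act_def frob_vec_def)

lemma frob_pt_abs:
  assumes "v \<noteq> 0"
  shows "frob_pt (abs_proj v) = abs_proj (frob_vec v)"
proof -
  obtain c where c: "c \<noteq> 0" "rep_proj (abs_proj v) = c *s v" by (rule rep_abs_proj[OF assms])
  have "frob_pt (abs_proj v) = abs_proj (frob c *s frob_vec v)"
    by (simp add: frob_pt_rep c(2) frob_vec_scale)
  moreover have "abs_proj (frob_vec v) = abs_proj (frob c *s frob_vec v)"
    using c(1) frob_vec_nonzero[OF assms] by (subst abs_proj_eq_iff) auto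
  ultimately show ?thesis by simp
qed

lemma mpoly_eval_frob: "mpoly_eval (map_coeffs (\<lambda>x. frob x) F) (frob_vec v) = frob (mpoly_eval F v)"
  unfolding frob_vec_def by (rule mpoly_eval_map_coeffs) (simp_all add: frob_add frob_mult)

lemma map_coeffs_Fq: "coeffs_in Fq F \<Longrightarrow> map_coeffs (\<lambda>x. frob x) F = F"
  by (rule map_coeffs_fixed[of Fq]) (rule frob_Fq)

lemma mpoly_eval_frob_Fq: "coeffs_in Fq F \<Longrightarrow> mpoly_eval F (frob_vec v) = frob (mpoly_eval F v)"
  using mpoly_eval_frob[of F v] by (simp add: map_coeffs_Fq)

lemma eval_at_frob_zero:
  assumes "homogeneous d F"
  shows "eval_at (map_coeffs (\<lambda>x. frob x) F) (frob_pt P) = 0 \<longleftrightarrow> eval_at F P = 0"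
  unfolding frob_pt_rep eval_at_abs_zero[OF frob_vec_nonzero[OF rep_proj_nonzero] homogeneous_map_coeffs[OF assms]]
    mpoly_eval_frob by (simp add: eval_at_def)

lemma eval_at_frob_ratio:
  assumes "homogeneous d F" "homogeneous d G"
  shows "eval_at (map_coeffs (\<lambda>x. frob x) F) (frob_pt P) / eval_at (map_coeffs (\<lambda>x. frob x) G) (frob_pt P)
    = frob (eval_at F P / eval_at G P)"
  unfolding frob_pt_rep
    eval_at_abs_ratio[OF frob_vec_nonzero[OF rep_proj_nonzero] homogeneous_map_coeffs[OF assms(1)] homogeneous_map_coeffs[OF assms(2)]]
    mpoly_eval_frob by (simp add: eval_at_def power_divide)

text \<open>The scalar between the two image vectors has a q-th root, and Frobenius is injective on
  coordinates.\<close>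

lemma frob_pt_inj: "inj frob_pt"
proof (rule injI)
  fix P P' :: "('k::{field,finite} alg_closure, 'n::finite) proj"
  assume eq: "frob_pt P = frob_pt P'"
  obtain c where c: "c \<noteq> 0" "frob_vec (rep_proj P') = c *s frob_vec (rep_proj P)"
    using eq unfolding frob_pt_rep
    using abs_proj_eq_iff[OF frob_vec_nonzero[OF rep_proj_nonzero] frob_vec_nonzero[OF rep_proj_nonzero], of P P'] by blast
  obtain b where b: "frob b = c" using frob_surj by blast
  have "frob (rep_proj P' $ i) = frob (b * rep_proj P $ i)" for i
    using c(2) b by (simp add: frob_vec_def vec_eq_iff power_mult_distrib)
  then have "rep_proj P' = b *s rep_proj P" unfolding vec_eq_iff using frob_inj by (simp, blast)
  moreover from this have "b \<noteq> 0" using rep_proj_nonzero[of P'] by auto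
  ultimately have "abs_proj (rep_proj P) = abs_proj (rep_proj P')"
    using abs_proj_eq_iff[OF rep_proj_nonzero[of P] rep_proj_nonzero[of P']] by blast
  then show "P = P'" by simp
qed

lemma frob_pt_rational: "P \<in> rational_points Fq V \<Longrightarrow> frob_pt P = P"
proof -
  assume "P \<in> rational_points Fq V"
  then obtain v where v: "v \<noteq> 0" "P = abs_proj v" "\<And>i. v $ i \<in> Fq" unfolding rational_points_def by blast
  have "frob_vec v = v" using frob_Fq[OF v(3)] by (simp add: frob_vec_def vec_eq_iff)
  then show ?thesis using frob_pt_abs[OF v(1)] v(2) by simp
qed

text \<open>Normalize one coordinate to 1. Frobenius keeps that coordinate, so the scalar between
  the vector and its image is 1 and every coordinate is fixed.\<close>

lemma frob_pt_fixed:
  fixes P :: "('k::{field,finite} alg_closure, 'n::finite) proj"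
  assumes "frob_pt P = P"
  obtains w where "w \<noteq> 0" "\<And>i. w $ i \<in> Fq" "P = abs_proj w"
proof -
  obtain i where i: "rep_proj P $ i \<noteq> 0" by (metis rep_proj_nonzero vec_eq_iff zero_index)
  define w where "w = (\<chi> j. rep_proj P $ j / rep_proj P $ i)"
  have P: "P = abs_proj w" unfolding w_def by (rule proj_eq_coord[OF i])
  have wi: "w $ i = 1" using i by (simp add: w_def)
  then have w0: "w \<noteq> 0" by auto
  have "abs_proj w = abs_proj (frob_vec w)" using assms frob_pt_abs[OF w0] P by simp
  then obtain c where c: "frob_vec w = c *s w"
    using abs_proj_eq_iff[OF w0 frob_vec_nonzero[OF w0]] by blast
  have "c = 1" using arg_cong[OF c, of "\<lambda>v. v $ i"] wi by (simp add: frob_vec_def)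
  then have "frob (w $ j) = w $ j" for j using arg_cong[OF c, of "\<lambda>v. v $ j"] by (simp add: frob_vec_def)
  then have "w $ j \<in> Fq" for j by (rule frob_fixed)
  then show ?thesis using that w0 P by blast
qed

text \<open>Forms over \<open>Fq\<close> that vanish at P vanish at its Frobenius image as well, and
  those vanishing on \<open>V\<close> generate its whole homogeneous ideal.\<close>

lemma frob_pt_in:
  fixes V :: "('k::{field,finite} alg_closure, 'n::finite) proj set"
  assumes closed: "zariski_closed V" and over: "defined_over Fq V" and P: "P \<in> V"
  shows "frob_pt P \<in> V"
proof -
  have sub: "gen_ideal.subspace {F. eval_at F (frob_pt P) = 0}"
    by (rule gen_ideal.subspaceI) simp_all
  have "{F \<in> vanishing_forms V. coeffs_in Fq F} \<subseteq> {F. eval_at F (frob_pt P) = 0}"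
  proof
    fix F assume "F \<in> {F \<in> vanishing_forms V. coeffs_in Fq F}"
    then obtain d where F: "homogeneous d F" "eval_at F P = 0" "coeffs_in Fq F"
      using P unfolding vanishing_forms_def by blast
    then show "F \<in> {F. eval_at F (frob_pt P) = 0}"
      using eval_at_frob_zero[OF F(1), of P] by (simp add: map_coeffs_Fq)
  qed
  then have "gen_ideal.span {F \<in> vanishing_forms V. coeffs_in Fq F} \<subseteq> {F. eval_at F (frob_pt P) = 0}"
    using sub by (rule gen_ideal.span_minimal)
  then have vanish: "eval_at F (frob_pt P) = 0" if "F \<in> vanishing_forms V" for F
    using over that unfolding defined_over_def by blast
  obtain T where T: "\<And>F. F \<in> T \<Longrightarrow> \<exists>d. homogeneous d F" "V = {P. \<forall>F\<in>T. eval_at F P = 0}"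
    using closed unfolding zariski_closed_def by blast
  have "F \<in> vanishing_forms V" if "F \<in> T" for F
    using T(1)[OF that] T(2) that unfolding vanishing_forms_def by blast
  then show ?thesis using vanish T(2) by blast
qed

lemma abs_proj_eq_minors:
  fixes v w :: "'a::field^'n::finite"
  assumes "v \<noteq> 0" "w \<noteq> 0" "\<And>i j. v $ i * w $ j = v $ j * w $ i"
  shows "abs_proj v = abs_proj w"
proof -
  obtain i where i: "v $ i \<noteq> 0" using assms(1) by (auto simp: vec_eq_iff)
  have "w = (w $ i / v $ i) *s v" using assms(3)[of i] i by (simp add: vec_eq_iff field_simps)
  moreover from this have "w $ i / v $ i \<noteq> 0" using assms(2) by (metis vector_smult_lzero)
  ultimately show ?thesis using abs_proj_eq_iff[OF assms(1,2)] by blast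
qed

lemma abs_proj_eqD:
  fixes v w :: "'a::field^'n::finite"
  assumes "v \<noteq> 0" "w \<noteq> 0" "abs_proj v = abs_proj w"
  shows "v $ i * w $ j = v $ j * w $ i"
proof -
  obtain c where "w = c *s v" using abs_proj_eq_iff[OF assms(1,2)] assms(3) by blast
  then show ?thesis by simp
qed

text \<open>The component forms have coefficients in \<open>Fq\<close>, but the neighbourhood on
  which they work need not be stable under Frobenius. Forms F that work near the image of P are
  therefore compared with forms F' that work near P: their minors vanish generically, hence at P, so
  F also computes \<phi> P once it is nonzero there.\<close>

lemma frob_pt_morphism:
  fixes V :: "('k::{field,finite} alg_closure, 'n::finite) proj set" and Y :: "('k alg_closure, 'm::finite) proj set"
  assumes irr: "zariski_irreducible V" and stable: "\<And>P. P \<in> V \<Longrightarrow> frob_pt P \<in> V"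
    and phi: "is_morphism Fq V Y \<phi>" and P: "P \<in> V"
  shows "\<phi> (frob_pt P) = frob_pt (\<phi> P)"
proof -
  interpret irreducible_variety V by unfold_locales (rule irr)
  obtain F d h e where F: "\<And>j. homogeneous d (F j)" "\<And>j. coeffs_in Fq (F j)" "homogeneous e h" "eval_at h (frob_pt P) \<noteq> 0"
    "\<And>R. R \<in> V \<Longrightarrow> eval_at h R \<noteq> 0 \<Longrightarrow> (\<chi> j. eval_at (F j) R) \<noteq> 0 \<and> \<phi> R = abs_proj (\<chi> j. eval_at (F j) R)"
    by (rule morphism_local[OF phi stable[OF P]]) blast
  obtain F' d' h' e' where F': "\<And>j. homogeneous d' (F' j)" "homogeneous e' h'" "eval_at h' P \<noteq> 0"
    "\<And>R. R \<in> V \<Longrightarrow> eval_at h' R \<noteq> 0 \<Longrightarrow> (\<chi> j. eval_at (F' j) R) \<noteq> 0 \<and> \<phi> R = abs_proj (\<chi> j. eval_at (F' j) R)"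
    by (rule morphism_local[OF phi P]) blast
  have minors: "eval_at (F i) P * eval_at (F' j) P = eval_at (F j) P * eval_at (F' i) P" for i j
  proof -
    have hom: "homogeneous (d + d') (F i * F' j - F j * F' i)"
      by (intro homogeneous_diff homogeneous_mult F(1) F'(1))
    have "\<forall>\<^sub>F R in gen. eval_at (F i * F' j - F j * F' i) R = 0"
      using eventually_gen_in eventually_form_nonzero[OF F(3) stable[OF P] F(4)] eventually_form_nonzero[OF F'(2) P F'(3)]
    proof eventually_elim
      case (elim R)
      have 1: "(\<chi> j. eval_at (F j) R) \<noteq> 0" "\<phi> R = abs_proj (\<chi> j. eval_at (F j) R)" using F(5)[OF elim(1,2)] by auto
      have 2: "(\<chi> j. eval_at (F' j) R) \<noteq> 0" "\<phi> R = abs_proj (\<chi> j. eval_at (F' j) R)" using F'(4)[OF elim(1,3)] by auto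
      have "abs_proj (\<chi> j. eval_at (F j) R) = abs_proj (\<chi> j. eval_at (F' j) R)" using 1(2) 2(2) by simp
      from abs_proj_eqD[OF 1(1) 2(1) this, of i j] show ?case by simp
    qed
    from form_zero_if_eventually[OF hom this P] show ?thesis by simp
  qed
  define v where "v = (\<chi> j. eval_at (F j) P)"
  define v' where "v' = (\<chi> j. eval_at (F' j) P)"
  have v': "v' \<noteq> 0" "\<phi> P = abs_proj v'" using F'(4)[OF P F'(3)] by (auto simp: v'_def)
  obtain c where c: "c \<noteq> 0" "\<And>d F. homogeneous d F \<Longrightarrow> eval_at F (abs_proj (frob_vec (rep_proj P))) = c ^ d * mpoly_eval F (frob_vec (rep_proj P))"
    by (rule eval_at_abs[OF frob_vec_nonzero[OF rep_proj_nonzero[of P]]]) blast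
  have "eval_at (F j) (frob_pt P) = c ^ d * frob (eval_at (F j) P)" for j
    unfolding frob_pt_rep c(2)[OF F(1)] mpoly_eval_frob_Fq[OF F(2)] by (simp only: eval_at_def)
  then have eq: "(\<chi> j. eval_at (F j) (frob_pt P)) = c ^ d *s frob_vec v"
    by (simp add: vec_eq_iff frob_vec_def v_def)
  have pF: "(\<chi> j. eval_at (F j) (frob_pt P)) \<noteq> 0" "\<phi> (frob_pt P) = abs_proj (\<chi> j. eval_at (F j) (frob_pt P))"
    using F(5)[OF stable[OF P] F(4)] by auto
  \<comment> \<open>Up to a scalar, the Frobenius image of v is the vector of F at the image of P,
    which is nonzero.\<close>
  have v0: "v \<noteq> 0"
  proof
    assume "v = 0"
    then have "frob_vec v = 0" by (simp add: frob_vec_def vec_eq_iff)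
    then show False using pF(1) eq by simp
  qed
  have "abs_proj v = \<phi> P"
    unfolding v'(2) by (rule abs_proj_eq_minors[OF v0 v'(1)]) (simp add: v_def v'_def minors)
  then have "frob_pt (\<phi> P) = abs_proj (frob_vec v)" using frob_pt_abs[OF v0] by metis
  also have "\<dots> = abs_proj (\<chi> j. eval_at (F j) (frob_pt P))"
    using abs_proj_eq_iff[OF frob_vec_nonzero[OF v0] pF(1)] eq c(1) by (metis power_not_zero)
  finally show ?thesis using pF(2) by simp
qed

text \<open>A fraction over \<open>Fq\<close> for f may have denominator 0 at R, while a fraction
  defined at R may have other coefficients. The conjugate of the latter represents f as well, since
  the two agree at infinitely many Frobenius images of points. At R, which Frobenius fixes, the
  conjugate fraction has the value \<open>frob c\<close>, so c is fixed by Frobenius.\<close>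

lemma value_at_rational_point:
  fixes V :: "('k::{field,finite} alg_closure, 'n::finite) proj set"
  assumes cv: "curve V" and stable: "\<And>P. P \<in> V \<Longrightarrow> frob_pt P \<in> V"
    and f: "f \<in> function_field_over Fq V" and R: "R \<in> V" "frob_pt R = R"
    and c: "irreducible_variety.regv V R (irreducible_variety.fn f) c"
  shows "c \<in> Fq"
proof -
  interpret curve V by (rule cv)
  obtain g h where gh: "f \<in> carrier FF" "(g, h) \<in> f" "coeffs_in Fq g" "coeffs_in Fq h"
    using f unfolding function_field_over_def by auto
  obtain d Q where dQ: "homogeneous d g" "homogeneous d h" "Q \<in> V" "eval_at h Q \<noteq> 0"
    using carrier_memD(1)[OF gh(1,2)] unfolding form_fractions_iff by blast
  obtain e g0 h0 where gh0: "homogeneous e g0" "homogeneous e h0" "eval_at h0 R \<noteq> 0" "c = eval_at g0 R / eval_at h0 R"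
    "\<forall>\<^sub>F R in gen. fn f R = eval_at g0 R / eval_at h0 R"
    using c unfolding regv_def by blast
  define G where "G = map_coeffs (\<lambda>x. frob x) g0"
  define H where "H = map_coeffs (\<lambda>x. frob x) h0"
  have GH: "homogeneous e G" "homogeneous e H" unfolding G_def H_def by (rule homogeneous_map_coeffs[OF gh0(1)], rule homogeneous_map_coeffs[OF gh0(2)])
  have "\<forall>\<^sub>F R in gen. eval_at (g * H - G * h) (frob_pt R) = 0"
    using gh0(5) fn_eq[OF gh(1,2)] eventually_form_nonzero[OF dQ(2,3,4)] eventually_form_nonzero[OF gh0(2) R(1) gh0(3)]
  proof eventually_elim
    case (elim R)
    have "eval_at h (frob_pt R) \<noteq> 0" using eval_at_frob_zero[OF dQ(2), of R] elim(3) map_coeffs_Fq[OF gh(4)] by simp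
    moreover have "eval_at H (frob_pt R) \<noteq> 0" using eval_at_frob_zero[OF gh0(2), of R] elim(4) unfolding H_def by simp
    moreover have "eval_at g (frob_pt R) / eval_at h (frob_pt R) = frob (eval_at g R / eval_at h R)"
      using eval_at_frob_ratio[OF dQ(1,2), of R] map_coeffs_Fq[OF gh(3)] map_coeffs_Fq[OF gh(4)] by simp
    moreover have "eval_at G (frob_pt R) / eval_at H (frob_pt R) = frob (eval_at g0 R / eval_at h0 R)"
      unfolding G_def H_def by (rule eval_at_frob_ratio[OF gh0(1,2)])
    ultimately have "eval_at g (frob_pt R) / eval_at h (frob_pt R) = eval_at G (frob_pt R) / eval_at H (frob_pt R)"
      using elim(1,2) by simp
    then show ?case using \<open>eval_at h (frob_pt R) \<noteq> 0\<close> \<open>eval_at H (frob_pt R) \<noteq> 0\<close> by (simp add: frac_eq_eq)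
  qed
  then have fin: "finite {R\<in>V. eval_at (g * H - G * h) (frob_pt R) \<noteq> 0}" unfolding eventually_gen_iff .
  have hom: "homogeneous (d + e) (g * H - G * h)"
    using homogeneous_mult[OF dQ(1) GH(2)] homogeneous_mult[OF GH(1) dQ(2)] by (auto simp: add.commute)
  have all: "eval_at (g * H - G * h) R = 0" if "R \<in> V" for R
  proof (rule ccontr)
    assume "eval_at (g * H - G * h) R \<noteq> 0"
    from finite_zeros[OF hom that this] have "finite {R\<in>V. eval_at (g * H - G * h) R = 0}" .
    moreover have "frob_pt ` {R\<in>V. eval_at (g * H - G * h) (frob_pt R) = 0} \<subseteq> {R\<in>V. eval_at (g * H - G * h) R = 0}"
      using stable by auto
    moreover have "inj_on frob_pt {R\<in>V. eval_at (g * H - G * h) (frob_pt R) = 0}"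
      using frob_pt_inj by (rule inj_on_subset) simp
    ultimately have "finite {R\<in>V. eval_at (g * H - G * h) (frob_pt R) = 0}"
      using finite_imageD finite_subset by blast
    then have "finite ({R\<in>V. eval_at (g * H - G * h) (frob_pt R) = 0} \<union> {R\<in>V. eval_at (g * H - G * h) (frob_pt R) \<noteq> 0})"
      using fin by blast
    moreover have "{R\<in>V. eval_at (g * H - G * h) (frob_pt R) = 0} \<union> {R\<in>V. eval_at (g * H - G * h) (frob_pt R) \<noteq> 0} = V"
      by blast
    ultimately show False using infinite_V by metis
  qed
  have HR: "eval_at H R \<noteq> 0" using eval_at_frob_zero[OF gh0(2), of R] gh0(3) R(2) unfolding H_def by simp
  have "\<forall>\<^sub>F R in gen. fn f R = eval_at G R / eval_at H R"
    using fn_eq[OF gh(1,2)] eventually_gen_in eventually_form_nonzero[OF dQ(2,3,4)] eventually_form_nonzero[OF GH(2) R(1) HR]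
  proof eventually_elim
    case (elim R)
    then show ?case using all[OF elim(2)] by (simp add: frac_eq_eq)
  qed
  from regvI[OF GH HR this refl] have "regv R (fn f) (eval_at G R / eval_at H R)" .
  moreover have "eval_at G R / eval_at H R = frob c"
    using eval_at_frob_ratio[OF gh0(1,2), of R] R(2) unfolding G_def H_def gh0(4) by simp
  ultimately have r: "regv R (fn f) (frob c)" by simp
  have "frob c = c" by (rule regv_unique[OF R(1) r c]) simp
  then show ?thesis by (rule frob_fixed)
qed

lemma lookup_sum_frag_of:
  assumes "finite G" "(\<Sum>\<sigma>\<in>G. frag_of (\<sigma> Q)) = D"
  shows "Poly_Mapping.lookup D P = int (card {\<sigma>\<in>G. \<sigma> Q = P})"
proof -
  have "Poly_Mapping.lookup D P = (\<Sum>\<sigma>\<in>G. if \<sigma> Q = P then 1 else 0)"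
    unfolding assms(2)[symmetric] lookup_sum by (rule sum.cong) auto
  also have "\<dots> = int (card {\<sigma>\<in>G. \<sigma> Q = P})" using assms(1) by (simp add: sum.If_cases Int_def)
  finally show ?thesis .
qed

lemma rational_quotient_point:
  fixes V :: "('k::{field,finite} alg_closure, 'n::finite) proj set"
    and \<pi> :: "('k alg_closure, 'n) proj \<Rightarrow> ('k alg_closure, 2) proj"
  assumes irr: "zariski_irreducible V" and stable: "\<And>P. P \<in> V \<Longrightarrow> frob_pt P \<in> V"
    and quot: "is_quotient_by Fq V G UNIV \<pi>" and Q: "Q \<in> V" and fin: "finite G"
    and DG: "(\<Sum>\<sigma>\<in>G. frag_of (\<sigma> Q)) = D" and one: "\<one>\<^bsub>aut_group Fq V\<^esub> \<in> G" and over: "divisor_defined_over Fq D"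
  obtains w where "w \<noteq> 0" "\<And>i. w $ i \<in> Fq" "\<pi> Q = abs_proj w"
proof -
  note lookup = lookup_sum_frag_of[OF fin DG]
  have "\<one>\<^bsub>aut_group Fq V\<^esub> \<in> {\<sigma>\<in>G. \<sigma> Q = Q}" using one Q by (simp add: aut_group_one)
  \<comment> \<open>The identity puts Q into the support of D; its Frobenius image has the same
    coefficient and so lies in the orbit too.\<close>
  then have "card {\<sigma>\<in>G. \<sigma> Q = Q} \<noteq> 0" using fin by (auto simp: card_eq_0_iff)
  moreover have "Poly_Mapping.lookup D (frob_pt Q) = Poly_Mapping.lookup D Q"
    using over frob_galois unfolding divisor_defined_over_def by blast
  then have "card {\<sigma>\<in>G. \<sigma> Q = frob_pt Q} = card {\<sigma>\<in>G. \<sigma> Q = Q}"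
    unfolding lookup of_nat_eq_iff .
  ultimately have "{\<sigma>\<in>G. \<sigma> Q = frob_pt Q} \<noteq> {}" by (metis card.empty)
  then obtain \<sigma> where s: "\<sigma> \<in> G" "frob_pt Q = \<sigma> Q" by auto
  have "\<pi> Q = \<pi> (frob_pt Q)" using quotient_fibre[OF quot Q stable[OF Q]] s by blast
  also have "\<dots> = frob_pt (\<pi> Q)" by (rule frob_pt_morphism[OF irr stable quotient_morphism[OF quot] Q])
  finally have "frob_pt (\<pi> Q) = \<pi> Q" by simp
  then show ?thesis by (rule frob_pt_fixed) (rule that)
qed

section \<open>The code of two quotients\<close>

theorem theorem1:
  fixes V :: "('k::{field,finite} alg_closure, 'n::finite) proj set"
    and G1 G2 :: "(('k alg_closure, 'n) proj \<Rightarrow> ('k alg_closure, 'n) proj) set"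
    and Q Q' :: "('k alg_closure, 'n) proj"
    and D :: "('k alg_closure, 'n) proj \<Rightarrow>\<^sub>0 int"
  defines "H \<equiv> generate (aut_group Fq V) (G1 \<union> G2)"
  defines "S \<equiv> {\<sigma> Q' | \<sigma>. \<sigma> \<in> H}"
  defines "C \<equiv> evaluation_map S ` riemann_roch_space Fq V D"
  assumes curve: "smooth_projective_curve Fq V"
    and G1: "subgroup G1 (aut_group Fq V)" "finite G1"
    and G2: "subgroup G2 (aut_group Fq V)" "finite G2"
    and distinct: "G1 \<noteq> G2"
    and same_order: "card G1 = card G2"
    and points: "Q \<in> V" "Q' \<in> V"
    and a: "quotient_iso_P1 Fq V G1" "quotient_iso_P1 Fq V G2"
    and b: "G1 \<inter> G2 = {\<one>\<^bsub>aut_group Fq V\<^esub>}"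
    and c: "(\<Sum>\<sigma>\<in>G1. frag_of (\<sigma> Q)) = D" "(\<Sum>\<tau>\<in>G2. frag_of (\<tau> Q)) = D"
      "divisor_defined_over Fq D"
    and d: "Q' \<in> rational_points Fq V" "Q' \<notin> Poly_Mapping.keys D"
      "card S \<ge> card G1 + 1"
  shows "(linear_code Fq S C \<and>
          inj_on (evaluation_map S) (riemann_roch_space Fq V D) \<and>
          min_distance S C \<ge> card S - card G1) \<and>
         (\<exists>h. h \<in> hom ((aut_group Fq V)\<lparr>carrier := H\<rparr>) (code_aut_group S C) \<and> inj_on h H)"
proof -
  have cv: "zariski_closed V" "zariski_irreducible V" "dimension_one V" "\<And>P. P \<in> V \<Longrightarrow> smooth_curve_at V P" "defined_over Fq V"
    using curve unfolding smooth_projective_curve_def by auto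
  have stable: "frob_pt P \<in> V" if "P \<in> V" for P by (rule frob_pt_in[OF cv(1,5) that])
  interpret curve_over V Fq
    by unfold_locales (use cv subring_set_Fq in auto)
  obtain \<pi>1 :: "('k alg_closure, 'n) proj \<Rightarrow> ('k alg_closure, 2) proj" where q1: "is_quotient_by Fq V G1 UNIV \<pi>1"
    using a(1) unfolding quotient_iso_P1_def by blast
  obtain \<pi>2 :: "('k alg_closure, 'n) proj \<Rightarrow> ('k alg_closure, 2) proj" where q2: "is_quotient_by Fq V G2 UNIV \<pi>2"
    using a(2) unfolding quotient_iso_P1_def by blast
  obtain w1 where w1: "w1 \<noteq> 0" "\<And>i. w1 $ i \<in> Fq" "\<pi>1 Q = abs_proj w1"
    by (rule rational_quotient_point[OF cv(2) stable q1 points(1) G1(2) c(1) subgroup.one_closed[OF G1(1)] c(3)]) (assumption, rule that)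
  obtain w2 where w2: "w2 \<noteq> 0" "\<And>i. w2 $ i \<in> Fq" "\<pi>2 Q = abs_proj w2"
    by (rule rational_quotient_point[OF cv(2) stable q2 points(1) G2(2) c(2) subgroup.one_closed[OF G2(1)] c(3)]) (assumption, rule that)
  have Q'D: "Poly_Mapping.lookup D Q' = 0" using d(2) by (simp add: in_keys_iff)
  have HA: "\<sigma> \<in> carrier Aut" if "\<sigma> \<in> H" for \<sigma>
  proof -
    have "subgroup H Aut" unfolding H_def
      by (rule Aut.generate_is_subgroup) (use subgroup.subset[OF G1(1)] subgroup.subset[OF G2(1)] in blast)
    then show ?thesis using that by (rule subgroup.mem_carrier)
  qed
  \<comment> \<open>Automorphisms over \<open>Fq\<close> commute with Frobenius and Q' is rational,
    so Frobenius fixes every point of S.\<close>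
  have value_in: "e \<in> Fq" if f: "f \<in> function_field_over Fq V" and R: "R \<in> S" and e: "regv R (fn f) e" for f R e
  proof -
    obtain \<sigma> where s: "\<sigma> \<in> H" "R = \<sigma> Q'" using R unfolding S_def by blast
    have "frob_pt R = \<sigma> (frob_pt Q')"
      unfolding s(2) by (rule frob_pt_morphism[OF cv(2) stable autD(2)[OF HA[OF s(1)]] points(2), symmetric])
    then have "frob_pt R = R" using frob_pt_rational[OF d(1)] s(2) by simp
    then show ?thesis
      using value_at_rational_point[OF curve_axioms stable f _ _ e] aut_in[OF HA[OF s(1)] points(2)] s(2) by blast
  qed
  interpret orbit_code V Fq G1 G2 Q Q' D \<pi>1 \<pi>2 w1 w2 H S
    by (intro_locales, rule orbit_code_axioms.intro)
      (fact H_def S_def G1 G2 points q1 w1 q2 w2 b lookup_sum_frag_of[OF G1(2) c(1)]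
        lookup_sum_frag_of[OF G2(2) c(2)] Q'D d(3)[unfolded S_def H_def] value_in[unfolded S_def H_def])+
  show ?thesis
    unfolding C_def
    by (intro conjI exI[of _ "\<lambda>\<sigma>. restrict \<sigma> S"])
      (fact linear_code_evaluation evaluation_inj min_distance_evaluation restrict_hom restrict_inj)+
qed

end
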